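(* The Chow polytope of any homogeneous positively hyperbolic variety is a generalized permutohedron.
   Context: Let $K=\mathbb{C}\{\!\{t\}\!\}$ (Puiseux series) or $\mathbb{C}$. For a projective variety $X\subset\mathbb{P}^{n-1}$ of dimension $d-1$ (equivalently a homogeneous variety, i.e. an affine cone, in $K^n$ of dimension $d$), the set of $(n-d-1)$-dimensional projective linear subspaces of $\mathbb{P}^{n-1}$ meeting $X$ is a hypersurface in the Grassmannian $\mathrm{Gr}(n-d,n)$; a defining polynomial in the Plücker coordinates $p_I$, $I\in\binom{[n]}{n-d}$, is the Chow form of $X$. The Chow polytope of $X$ is the image of the Newton polytope of the Chow form under the linear map $\mathbb{R}^{\binom{[n]}{n-d}}\to\mathbb{R}^n$, $e_I\mapsto\sum_{i\in I}e_i$ (this is well defined). A generalized permutohedron is a polytope all of whose edges are parallel to vectors $e_i-e_j$. Positive hyperbolicity: writing $\operatorname{Im}(x)$ for the coordinatewise imaginary part (for Puiseux series, $z=a+ib$ with $a,b$ real Puiseux series and $\operatorname{Im} z=b$, real Puiseux series ordered by the sign of the leading coefficient), and $\mathrm{Gr}_+(c,n)$ for the set of $c$-dimensional real subspaces that are row spaces of $c\times n$ matrices with all maximal minors positive, an equidimensional variety $X\subset K^n$ of codimension $c\le n-1$ is positively hyperbolic if $\operatorname{Im}(x)\notin L\setminus\{0\}$ for all $x\in X$, $L\in\mathrm{Gr}_+(c,n)$. *)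

theory Defs
  imports
    "HOL-Analysis.Polytope"
    "HOL-Analysis.Finite_Function_Topology"
    "HOL-Computational_Algebra.Formal_Laurent_Series"
    "Jordan_Normal_Form.DL_Rank_Submatrix"
begin

section \<open>Puiseux series\<close>

text \<open>
  A Puiseux series is a formal sum of terms \<open>a\<^sub>q t\<^sup>q\<close> over rational exponents \<open>q\<close> with a common
  denominator \<open>N\<close>, bounded below.
\<close>

definition puiseux_denom :: "nat \<Rightarrow> (rat \<Rightarrow> 'a::zero) \<Rightarrow> bool" where
  "puiseux_denom N f \<longleftrightarrow> N > 0 \<and>
     (\<exists>m::int. \<forall>q. f q \<noteq> 0 \<longrightarrow> (\<exists>k\<ge>m. q = of_int k / of_nat N))"

typedef (overloaded) 'a puiseux = "{f :: rat \<Rightarrow> 'a::zero. \<exists>N. puiseux_denom N f}"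
  morphisms puiseux_coeff Abs_puiseux
  by (rule exI[of _ "\<lambda>_. 0"]) (auto simp: puiseux_denom_def)

setup_lifting type_definition_puiseux

lemma puiseux_eqI: "(\<And>q. puiseux_coeff x q = puiseux_coeff y q) \<Longrightarrow> x = y"
  by (simp add: puiseux_coeff_inject[symmetric] fun_eq_iff)

text \<open>The Puiseux series with exponents in \<open>(1/N)\<int>\<close> are the Laurent series in \<open>t\<^bsup>1/N\<^esup>\<close>.\<close>

lift_definition puiseux_of_fls :: "nat \<Rightarrow> 'a::zero fls \<Rightarrow> 'a puiseux" is
  "\<lambda>N f q. if N > 0 \<and> q * of_nat N \<in> \<int> then fls_nth f \<lfloor>q * of_nat N\<rfloor> else 0"
proof -
  fix N :: nat and f :: "'a fls"
  show "\<exists>M. puiseux_denom M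
          (\<lambda>q. if N > 0 \<and> q * of_nat N \<in> \<int> then fls_nth f \<lfloor>q * of_nat N\<rfloor> else 0)"
  proof (cases "N > 0")
    case True
    have "\<exists>k\<ge>fls_subdegree f. q = of_int k / of_nat N"
      if nz: "(if N > 0 \<and> q * of_nat N \<in> \<int> then fls_nth f \<lfloor>q * of_nat N\<rfloor> else 0) \<noteq> 0"
      for q :: rat
    proof -
      from nz have "q * of_nat N \<in> \<int>" and f: "fls_nth f \<lfloor>q * of_nat N\<rfloor> \<noteq> 0"
        by (auto split: if_splits)
      then obtain k where k: "q * of_nat N = of_int k" by (auto elim: Ints_cases)
      with f have "fls_nth f k \<noteq> 0" by simp
      then have "k \<ge> fls_subdegree f" using fls_eq0_below_subdegree not_less by blast
      moreover have "q = of_int k / of_nat N" using k True by (simp add: field_simps)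
      ultimately show ?thesis by blast
    qed
    with True have "puiseux_denom N
          (\<lambda>q. if N > 0 \<and> q * of_nat N \<in> \<int> then fls_nth f \<lfloor>q * of_nat N\<rfloor> else 0)"
      unfolding puiseux_denom_def by blast
    then show ?thesis by blast
  qed (auto simp: puiseux_denom_def intro: exI[of _ 1])
qed

lemma coeff_of_fls_int:
  "N > 0 \<Longrightarrow> puiseux_coeff (puiseux_of_fls N f) (of_int k / of_nat N) = fls_nth f k"
  by transfer simp

lemma coeff_of_fls_nz:
  assumes "puiseux_coeff (puiseux_of_fls N f) q \<noteq> 0"
  obtains k where "N > 0" "q = of_int k / of_nat N" "fls_nth f k \<noteq> 0"
proof -
  from assms have N: "N > 0" and "q * of_nat N \<in> \<int>"
    and f: "fls_nth f \<lfloor>q * of_nat N\<rfloor> \<noteq> 0"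
    by (transfer, auto split: if_splits)+
  then obtain k where k: "q * of_nat N = of_int k" by (auto elim: Ints_cases)
  show thesis by (rule that[of k]) (use N k f in \<open>auto simp: field_simps\<close>)
qed

lemma coeff_of_fls_not_int:
  assumes "\<And>k. q \<noteq> of_int k / of_nat N"
  shows "puiseux_coeff (puiseux_of_fls N f) q = 0"
  using assms coeff_of_fls_nz[of N f q] by metis

lemma puiseux_of_fls_eqI:
  assumes "N > 0"
    and "\<And>k. puiseux_coeff x (of_int k / of_nat N) = fls_nth f k"
    and "\<And>q. (\<And>k. q \<noteq> of_int k / of_nat N) \<Longrightarrow> puiseux_coeff x q = 0"
  shows "x = puiseux_of_fls N f"
proof (rule puiseux_eqI)
  fix q
  show "puiseux_coeff x q = puiseux_coeff (puiseux_of_fls N f) q"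
  proof (cases "\<exists>k. q = of_int k / of_nat N")
    case True
    then show ?thesis using assms(1,2) coeff_of_fls_int by metis
  next
    case False
    then show ?thesis using assms(3) coeff_of_fls_not_int by metis
  qed
qed

lemma puiseux_of_fls_inj:
  assumes "N > 0" "puiseux_of_fls N f = puiseux_of_fls N g" shows "f = g"
  by (rule fls_eqI) (metis assms coeff_of_fls_int)

lemma puiseux_denom_imp_fls:
  assumes "puiseux_denom N (puiseux_coeff x)"
  obtains f where "x = puiseux_of_fls N f"
proof -
  from assms obtain m where N: "N > 0"
    and m: "\<And>q. puiseux_coeff x q \<noteq> 0 \<Longrightarrow> \<exists>k\<ge>m. q = of_int k / of_nat N"
    unfolding puiseux_denom_def by blast
  define f where "f = Abs_fls (\<lambda>k. puiseux_coeff x (of_int k / of_nat N))"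
  have nth: "fls_nth f k = puiseux_coeff x (of_int k / of_nat N)" for k
    unfolding f_def
  proof (rule nth_Abs_fls_lower_bound)
    show "\<forall>k<m. puiseux_coeff x (of_int k / of_nat N) = 0"
    proof (intro allI impI, rule ccontr)
      fix k assume "k < m" and "puiseux_coeff x (of_int k / of_nat N) \<noteq> 0"
      with m obtain k' where "k' \<ge> m" "(of_int k / of_nat N :: rat) = of_int k' / of_nat N" by blast
      with N \<open>k < m\<close> show False by simp
    qed
  qed
  show thesis
    by (rule that[of f], rule puiseux_of_fls_eqI) (use N nth m in auto)
qed

lemma puiseux_denom_mult:
  assumes "puiseux_denom N f" "M > 0" shows "puiseux_denom (N * M) f"
proof -
  from assms obtain m where N: "N > 0"
    and m: "\<And>q. f q \<noteq> 0 \<Longrightarrow> \<exists>k\<ge>m. q = of_int k / of_nat N"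
    unfolding puiseux_denom_def by blast
  have "\<exists>k\<ge>m * int M. q = of_int k / of_nat (N * M)" if q: "f q \<noteq> 0" for q
  proof -
    from m[OF q] obtain k where "k \<ge> m" "q = of_int k / of_nat N" by blast
    then show ?thesis using N assms(2)
      by (intro exI[of _ "k * int M"]) (auto simp: mult_right_mono)
  qed
  then show ?thesis using N assms(2) unfolding puiseux_denom_def by auto
qed

lemma puiseux_denom_ex: "\<exists>N. puiseux_denom N (puiseux_coeff x)"
  using puiseux_coeff[of x] by simp

lemma puiseux_cases3:
  obtains N f g h where "N > 0" "x = puiseux_of_fls N f" "y = puiseux_of_fls N g"
    "z = puiseux_of_fls N h"
proof -
  obtain A where A: "puiseux_denom A (puiseux_coeff x)" using puiseux_denom_ex by blast
  obtain B where B: "puiseux_denom B (puiseux_coeff y)" using puiseux_denom_ex by blast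
  obtain C where C: "puiseux_denom C (puiseux_coeff z)" using puiseux_denom_ex by blast
  have p: "A > 0" "B > 0" "C > 0" using A B C unfolding puiseux_denom_def by auto
  have "puiseux_denom (A * B * C) (puiseux_coeff x)"
    by (intro puiseux_denom_mult A p)
  moreover have "puiseux_denom (B * A * C) (puiseux_coeff y)"
    by (intro puiseux_denom_mult B p)
  moreover have "puiseux_denom (C * A * B) (puiseux_coeff z)"
    by (intro puiseux_denom_mult C p)
  ultimately have "puiseux_denom (A * B * C) (puiseux_coeff x)"
    "puiseux_denom (A * B * C) (puiseux_coeff y)" "puiseux_denom (A * B * C) (puiseux_coeff z)"
    by (simp_all add: ac_simps)
  then show thesis using p that[of "A * B * C"]
    by (elim puiseux_denom_imp_fls) simp
qed

instantiation puiseux :: (field) comm_ring_1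
begin

lift_definition zero_puiseux :: "'a puiseux" is "\<lambda>_. 0"
  by (auto simp: puiseux_denom_def intro: exI[of _ 1])

lift_definition one_puiseux :: "'a puiseux" is "\<lambda>q. if q = 0 then 1 else 0"
  by (rule exI[of _ 1]) (auto simp: puiseux_denom_def intro!: exI[of _ 0])

lift_definition uminus_puiseux :: "'a puiseux \<Rightarrow> 'a puiseux" is "\<lambda>f q. - f q"
  by (simp add: puiseux_denom_def)

lift_definition plus_puiseux :: "'a puiseux \<Rightarrow> 'a puiseux \<Rightarrow> 'a puiseux" is
  "\<lambda>f g q. f q + g q"
proof -
  fix f g :: "rat \<Rightarrow> 'a"
  assume "\<exists>N. puiseux_denom N f" "\<exists>N. puiseux_denom N g"
  then obtain N M where N: "puiseux_denom N f" and M: "puiseux_denom M g" by blast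
  then have pos: "N > 0" "M > 0" unfolding puiseux_denom_def by auto
  from puiseux_denom_mult[OF N pos(2)] obtain a where
    a: "\<And>q. f q \<noteq> 0 \<Longrightarrow> \<exists>k\<ge>a. q = of_int k / of_nat (N * M)"
    unfolding puiseux_denom_def by blast
  from puiseux_denom_mult[OF M pos(1)] obtain b where
    b: "\<And>q. g q \<noteq> 0 \<Longrightarrow> \<exists>k\<ge>b. q = of_int k / of_nat (N * M)"
    unfolding puiseux_denom_def mult.commute[of M N] by blast
  have "\<exists>k\<ge>min a b. q = of_int k / of_nat (N * M)" if "f q + g q \<noteq> 0" for q
  proof -
    have "f q \<noteq> 0 \<or> g q \<noteq> 0" using that by auto
    then show ?thesis using a b by (metis min.coboundedI1 min.coboundedI2)
  qed
  then show "\<exists>N. puiseux_denom N (\<lambda>q. f q + g q)"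
    using pos unfolding puiseux_denom_def by (intro exI[of _ "N * M"]) auto
qed

definition minus_puiseux :: "'a puiseux \<Rightarrow> 'a puiseux \<Rightarrow> 'a puiseux" where
  "minus_puiseux x y = x + - y"

text \<open>The index set of the Cauchy product below is always finite.\<close>

lift_definition times_puiseux :: "'a puiseux \<Rightarrow> 'a puiseux \<Rightarrow> 'a puiseux" is
  "\<lambda>f g q. \<Sum>r | f r \<noteq> 0 \<and> g (q - r) \<noteq> 0. f r * g (q - r)"
proof -
  fix f g :: "rat \<Rightarrow> 'a"
  assume "\<exists>N. puiseux_denom N f" "\<exists>N. puiseux_denom N g"
  then obtain N M where N: "puiseux_denom N f" and M: "puiseux_denom M g" by blast
  then have pos: "N > 0" "M > 0" unfolding puiseux_denom_def by auto
  from puiseux_denom_mult[OF N pos(2)] obtain a where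
    a: "\<And>q. f q \<noteq> 0 \<Longrightarrow> \<exists>k\<ge>a. q = of_int k / of_nat (N * M)"
    unfolding puiseux_denom_def by blast
  from puiseux_denom_mult[OF M pos(1)] obtain b where
    b: "\<And>q. g q \<noteq> 0 \<Longrightarrow> \<exists>k\<ge>b. q = of_int k / of_nat (N * M)"
    unfolding puiseux_denom_def mult.commute[of M N] by blast
  have "\<exists>k\<ge>a + b. q = of_int k / of_nat (N * M)"
    if "(\<Sum>r | f r \<noteq> 0 \<and> g (q - r) \<noteq> 0. f r * g (q - r)) \<noteq> 0" for q
  proof -
    from that obtain r where "r \<in> {r. f r \<noteq> 0 \<and> g (q - r) \<noteq> 0}"
      by (rule sum.not_neutral_contains_not_neutral)
    then have "f r \<noteq> 0" "g (q - r) \<noteq> 0" by auto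
    with a b obtain k l where "k \<ge> a" "l \<ge> b"
      "r = of_int k / of_nat (N * M)" "q - r = of_int l / of_nat (N * M)" by blast
    then show ?thesis
      by (intro exI[of _ "k + l"]) (auto simp: add_divide_distrib)
  qed
  then show "\<exists>N. puiseux_denom N (\<lambda>q. \<Sum>r | f r \<noteq> 0 \<and> g (q - r) \<noteq> 0. f r * g (q - r))"
    using pos unfolding puiseux_denom_def by (intro exI[of _ "N * M"]) auto
qed

lemma puiseux_of_fls_0: "puiseux_of_fls N 0 = 0"
  by transfer (auto simp: fun_eq_iff)

lemma puiseux_of_fls_1: "N > 0 \<Longrightarrow> puiseux_of_fls N 1 = 1"
proof -
  assume N: "N > 0"
  show ?thesis
  proof (rule puiseux_of_fls_eqI[OF N, symmetric])
    fix q :: rat assume "\<And>k. q \<noteq> of_int k / of_nat N"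
    from this[of 0] show "puiseux_coeff (1 :: 'a puiseux) q = 0"
      by (simp add: one_puiseux.rep_eq)
  qed (use N in \<open>auto simp: one_puiseux.rep_eq\<close>)
qed

lemma puiseux_of_fls_add:
  "puiseux_of_fls N (f + g) = puiseux_of_fls N f + puiseux_of_fls N g"
  by transfer (auto simp: fun_eq_iff)

lemma puiseux_of_fls_uminus: "puiseux_of_fls N (- f) = - puiseux_of_fls N f"
  by transfer (auto simp: fun_eq_iff)

lemma puiseux_of_fls_minus:
  "puiseux_of_fls N (f - g) = puiseux_of_fls N f - puiseux_of_fls N g"
  by (simp add: minus_puiseux_def puiseux_of_fls_add[symmetric] puiseux_of_fls_uminus[symmetric])

lemma puiseux_of_fls_mult:
  assumes N: "N > 0"
  shows "puiseux_of_fls N (f * g) = puiseux_of_fls N f * puiseux_of_fls N g"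
proof (rule puiseux_of_fls_eqI[OF N, symmetric])
  fix k :: int
  let ?F = "puiseux_coeff (puiseux_of_fls N f)" and ?G = "puiseux_coeff (puiseux_of_fls N g)"
  let ?e = "\<lambda>i::int. of_int i / of_nat N :: rat"
  let ?I = "{i \<in> {fls_subdegree f..k - fls_subdegree g}. fls_nth f i \<noteq> 0 \<and> fls_nth g (k - i) \<noteq> 0}"
  have diff: "?e k - ?e i = ?e (k - i)" for i by (simp add: diff_divide_distrib)
  have "{r. ?F r \<noteq> 0 \<and> ?G (?e k - r) \<noteq> 0} = ?e ` ?I" (is "?L = _")
  proof (intro equalityI subsetI)
    fix r assume "r \<in> ?L"
    then have r: "?F r \<noteq> 0" "?G (?e k - r) \<noteq> 0" by auto
    from coeff_of_fls_nz[OF r(1)] obtain i where i: "r = ?e i" "fls_nth f i \<noteq> 0" by metis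
    have "fls_nth g (k - i) \<noteq> 0"
      using r(2) unfolding i(1) diff coeff_of_fls_int[OF N] .
    moreover from this have "k - i \<ge> fls_subdegree g" "i \<ge> fls_subdegree f"
      using i(2) fls_eq0_below_subdegree not_less by blast+
    ultimately show "r \<in> ?e ` ?I" using i by auto
  next
    fix r assume "r \<in> ?e ` ?I"
    then obtain i where i: "r = ?e i" "i \<in> ?I" by blast
    have "?F r \<noteq> 0" using i(2) unfolding i(1) coeff_of_fls_int[OF N] by blast
    moreover have "?G (?e k - r) \<noteq> 0" using i(2) unfolding i(1) diff coeff_of_fls_int[OF N] by blast
    ultimately show "r \<in> ?L" by blast
  qed
  moreover have "inj_on ?e ?I" using N by (auto simp: inj_on_def)
  ultimately have "puiseux_coeff (puiseux_of_fls N f * puiseux_of_fls N g) (?e k)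
      = (\<Sum>i\<in>?I. ?F (?e i) * ?G (?e k - ?e i))"
    by (simp only: times_puiseux.rep_eq sum.reindex o_def)
  also have "\<dots> = (\<Sum>i\<in>?I. fls_nth f i * fls_nth g (k - i))"
    by (simp only: diff coeff_of_fls_int[OF N])
  also have "\<dots> = (\<Sum>i\<in>{fls_subdegree f..k - fls_subdegree g}. fls_nth f i * fls_nth g (k - i))"
    by (rule sum.mono_neutral_left) auto
  also have "\<dots> = fls_nth (f * g) k" by (simp add: fls_times_nth(2))
  finally show "puiseux_coeff (puiseux_of_fls N f * puiseux_of_fls N g) (?e k) = fls_nth (f * g) k" .
next
  fix q :: rat assume q: "\<And>k. q \<noteq> of_int k / of_nat N"
  let ?F = "puiseux_coeff (puiseux_of_fls N f)" and ?G = "puiseux_coeff (puiseux_of_fls N g)"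
  have "{r. ?F r \<noteq> 0 \<and> ?G (q - r) \<noteq> 0} = {}"
  proof safe
    fix r assume r: "?F r \<noteq> 0" "?G (q - r) \<noteq> 0"
    from coeff_of_fls_nz[OF r(1)] coeff_of_fls_nz[OF r(2)] obtain i j :: int where
      "r = of_int i / of_nat N" "q - r = of_int j / of_nat N" by metis
    then have "q = of_int (i + j) / of_nat N" by (simp add: add_divide_distrib)
    with q show "r \<in> {}" by blast
  qed
  then show "puiseux_coeff (puiseux_of_fls N f * puiseux_of_fls N g) q = 0"
    by (simp add: times_puiseux.rep_eq)
qed

instance
proof
  fix x y z :: "'a puiseux"
  obtain N f g h where N: "N > 0" and eq: "x = puiseux_of_fls N f" "y = puiseux_of_fls N g"
    "z = puiseux_of_fls N h" using puiseux_cases3 by metis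
  note hom = puiseux_of_fls_mult[OF N, symmetric] puiseux_of_fls_1[OF N, symmetric]
    puiseux_of_fls_add[symmetric] puiseux_of_fls_0[of N, symmetric]
    puiseux_of_fls_uminus[symmetric] puiseux_of_fls_minus[symmetric]
  show "x * y * z = x * (y * z)" unfolding eq hom by (simp add: mult.assoc)
  show "x * y = y * x" unfolding eq hom by (simp add: mult.commute)
  show "1 * x = x" unfolding eq hom by simp
  show "(x + y) * z = x * z + y * z" unfolding eq hom by (simp add: distrib_right)
  show "x + y + z = x + (y + z)" unfolding eq hom by (simp add: add.assoc)
  show "x + y = y + x" unfolding eq hom by (simp add: add.commute)
  show "0 + x = x" unfolding eq hom by simp
  show "- x + x = 0" unfolding eq hom by simp
  show "x - y = x + - y" by (rule minus_puiseux_def)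
  show "(0 :: 'a puiseux) \<noteq> 1"
  proof
    assume "(0 :: 'a puiseux) = 1"
    then have "puiseux_coeff (0 :: 'a puiseux) 0 = puiseux_coeff (1 :: 'a puiseux) 0" by (rule arg_cong)
    then show False by (simp add: one_puiseux.rep_eq zero_puiseux.rep_eq)
  qed
qed

end

instantiation puiseux :: (field) field
begin

definition inverse_puiseux :: "'a puiseux \<Rightarrow> 'a puiseux" where
  "inverse_puiseux x = (if x = 0 then 0 else THE y. x * y = 1)"

definition divide_puiseux :: "'a puiseux \<Rightarrow> 'a puiseux \<Rightarrow> 'a puiseux" where
  "divide_puiseux x y = x * inverse y"

instance
proof
  fix x y :: "'a puiseux"
  show "inverse x * x = 1" if "x \<noteq> 0"
  proof -
    obtain N f where N: "N > 0" and x: "x = puiseux_of_fls N f"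
      using puiseux_cases3[of x x x] by metis
    with that have "f \<noteq> 0" using puiseux_of_fls_0 by metis
    then have inv: "x * puiseux_of_fls N (inverse f) = 1"
      by (simp add: x puiseux_of_fls_mult[OF N, symmetric] puiseux_of_fls_1[OF N])
    have "(THE y. x * y = 1) = puiseux_of_fls N (inverse f)"
    proof (rule the_equality)
      show "x * puiseux_of_fls N (inverse f) = 1" by (rule inv)
      fix y assume "x * y = 1"
      have "y = y * (x * puiseux_of_fls N (inverse f))" using inv by simp
      also have "\<dots> = (x * y) * puiseux_of_fls N (inverse f)" by (simp only: ac_simps)
      finally show "y = puiseux_of_fls N (inverse f)" using \<open>x * y = 1\<close> by simp
    qed
    then show ?thesis using that inv by (simp add: inverse_puiseux_def mult.commute)
  qed
  show "x div y = x * inverse y" by (rule divide_puiseux_def)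
  show "inverse (0 :: 'a puiseux) = 0" by (simp add: inverse_puiseux_def)
qed

end

text \<open>A nonzero series is positive when its leading (lowest-exponent) coefficient is.\<close>

definition puiseux_pos :: "'a::{zero,ord} puiseux \<Rightarrow> bool" where
  "puiseux_pos x \<longleftrightarrow> (\<exists>q. puiseux_coeff x q > 0 \<and> (\<forall>r<q. puiseux_coeff x r = 0))"

lemma puiseux_pos_of_fls:
  fixes f :: "'a::linordered_field fls"
  assumes N: "N > 0"
  shows "puiseux_pos (puiseux_of_fls N f) \<longleftrightarrow> fls_nth f (fls_subdegree f) > 0"
proof
  let ?x = "puiseux_of_fls N f"
  assume "puiseux_pos ?x"
  then obtain q where q: "puiseux_coeff ?x q > 0" "\<And>r. r < q \<Longrightarrow> puiseux_coeff ?x r = 0"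
    unfolding puiseux_pos_def by blast
  then have "puiseux_coeff ?x q \<noteq> 0" by simp
  from coeff_of_fls_nz[OF this] obtain k where k: "q = of_int k / of_nat N" by metis
  have kpos: "fls_nth f k > 0" using q(1) coeff_of_fls_int[OF N, of f k] k by simp
  have "fls_nth f i = 0" if "i < k" for i
    using q(2)[of "of_int i / of_nat N"] that N coeff_of_fls_int[OF N, of f i]
    by (simp add: k divide_strict_right_mono)
  then have "fls_subdegree f = k" using kpos by (intro fls_subdegree_eqI) auto
  with kpos show "fls_nth f (fls_subdegree f) > 0" by simp
next
  let ?x = "puiseux_of_fls N f" and ?q = "of_int (fls_subdegree f) / of_nat N :: rat"
  assume "fls_nth f (fls_subdegree f) > 0"
  then have "puiseux_coeff ?x ?q > 0" by (simp add: coeff_of_fls_int[OF N])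
  moreover have "puiseux_coeff ?x r = 0" if "r < ?q" for r
  proof (rule ccontr)
    assume "puiseux_coeff ?x r \<noteq> 0"
    from coeff_of_fls_nz[OF this] obtain k where "r = of_int k / of_nat N" "fls_nth f k \<noteq> 0"
      by metis
    with that N have "k < fls_subdegree f" by (simp add: divide_less_cancel)
    with \<open>fls_nth f k \<noteq> 0\<close> show False by simp
  qed
  ultimately show "puiseux_pos ?x" unfolding puiseux_pos_def by blast
qed

lemma puiseux_pos_add:
  fixes x y :: "'a::linordered_field puiseux"
  assumes "puiseux_pos x" "puiseux_pos y" shows "puiseux_pos (x + y)"
proof -
  from assms obtain p q where
    p: "puiseux_coeff x p > 0" "\<And>r. r < p \<Longrightarrow> puiseux_coeff x r = 0" and
    q: "puiseux_coeff y q > 0" "\<And>r. r < q \<Longrightarrow> puiseux_coeff y r = 0"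
    unfolding puiseux_pos_def by blast
  consider "p < q" | "p = q" | "q < p" by linarith
  then have "puiseux_coeff (x + y) (min p q) > 0"
    by cases (use p q in \<open>auto simp: plus_puiseux.rep_eq min_def\<close>)
  moreover have "\<forall>r<min p q. puiseux_coeff (x + y) r = 0"
    using p q by (simp add: plus_puiseux.rep_eq)
  ultimately show ?thesis unfolding puiseux_pos_def by blast
qed

lemma puiseux_pos_mult:
  fixes x y :: "'a::linordered_field puiseux"
  assumes "puiseux_pos x" "puiseux_pos y" shows "puiseux_pos (x * y)"
proof -
  obtain N f g where N: "N > 0" and eq: "x = puiseux_of_fls N f" "y = puiseux_of_fls N g"
    by (rule puiseux_cases3[of x y y])
  have f: "fls_nth f (fls_subdegree f) > 0" and g: "fls_nth g (fls_subdegree g) > 0"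
    using assms unfolding eq puiseux_pos_of_fls[OF N] by auto
  then have "f \<noteq> 0" "g \<noteq> 0" by auto
  then have sub: "fls_subdegree (f * g) = fls_subdegree f + fls_subdegree g"
    by (rule fls_subdegree_mult)
  have "fls_nth (f * g) (fls_subdegree (f * g)) > 0"
    unfolding sub using f g by (simp add: fls_times_base)
  then show ?thesis unfolding eq puiseux_of_fls_mult[OF N, symmetric] puiseux_pos_of_fls[OF N] .
qed

lemma puiseux_pos_cases:
  fixes x :: "'a::linordered_field puiseux"
  shows "x = 0 \<or> puiseux_pos x \<or> puiseux_pos (- x)"
proof -
  obtain N f where N: "N > 0" and x: "x = puiseux_of_fls N f"
    using puiseux_cases3[of x x x] by metis
  show ?thesis
  proof (cases "f = 0")
    case True
    then show ?thesis by (simp add: x puiseux_of_fls_0)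
  next
    case False
    then have "fls_nth f (fls_subdegree f) \<noteq> 0" by simp
    then have "fls_nth f (fls_subdegree f) > 0 \<or> fls_nth (- f) (fls_subdegree (- f)) > 0"
      by auto
    then show ?thesis
      unfolding x puiseux_of_fls_uminus[symmetric] puiseux_pos_of_fls[OF N] by blast
  qed
qed

lemma puiseux_pos_0: "\<not> puiseux_pos (0 :: 'a::linordered_field puiseux)"
  by (simp add: puiseux_pos_def zero_puiseux.rep_eq)

lemma puiseux_pos_uminus:
  fixes x :: "'a::linordered_field puiseux"
  assumes "puiseux_pos x" shows "\<not> puiseux_pos (- x)"
  using puiseux_pos_add[OF assms, of "- x"] puiseux_pos_0 by auto

instantiation puiseux :: (linordered_field) linordered_field
begin

definition less_puiseux :: "'a puiseux \<Rightarrow> 'a puiseux \<Rightarrow> bool" where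
  "less_puiseux x y \<longleftrightarrow> puiseux_pos (y - x)"

definition less_eq_puiseux :: "'a puiseux \<Rightarrow> 'a puiseux \<Rightarrow> bool" where
  "less_eq_puiseux x y \<longleftrightarrow> x = y \<or> puiseux_pos (y - x)"

definition abs_puiseux :: "'a puiseux \<Rightarrow> 'a puiseux" where
  "abs_puiseux x = (if x < 0 then - x else x)"

definition sgn_puiseux :: "'a puiseux \<Rightarrow> 'a puiseux" where
  "sgn_puiseux x = (if x = 0 then 0 else if 0 < x then 1 else - 1)"

instance
proof
  fix x y z :: "'a puiseux"
  show "(x < y) = (x \<le> y \<and> \<not> y \<le> x)"
    unfolding less_puiseux_def less_eq_puiseux_def
    using puiseux_pos_uminus[of "y - x"] puiseux_pos_0 by auto
  show "x \<le> x" by (simp add: less_eq_puiseux_def)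
  show "x \<le> z" if "x \<le> y" "y \<le> z"
    using that puiseux_pos_add[of "y - x" "z - y"] unfolding less_eq_puiseux_def by auto
  show "x = y" if "x \<le> y" "y \<le> x"
    using that puiseux_pos_uminus[of "y - x"] unfolding less_eq_puiseux_def by auto
  show "x \<le> y \<or> y \<le> x"
    using puiseux_pos_cases[of "y - x"] unfolding less_eq_puiseux_def by auto
  show "z + x \<le> z + y" if "x \<le> y"
    using that unfolding less_eq_puiseux_def by auto
  show "z * x < z * y" if "x < y" "0 < z"
    using that puiseux_pos_mult[of z "y - x"] unfolding less_puiseux_def
    by (simp add: right_diff_distrib)
  show "\<bar>x\<bar> = (if x < 0 then - x else x)" by (rule abs_puiseux_def)
  show "sgn x = (if x = 0 then 0 else if 0 < x then 1 else - 1)" by (rule sgn_puiseux_def)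
qed

end

text \<open>For \<open>z = a + ib\<close> with real Puiseux series \<open>a\<close> and \<open>b\<close>, this is \<open>b\<close>.\<close>

lift_definition puiseux_Im :: "complex puiseux \<Rightarrow> real puiseux" is "\<lambda>f q. Im (f q)"
proof -
  fix f :: "rat \<Rightarrow> complex"
  assume "\<exists>N. puiseux_denom N f"
  then obtain N m where "N > 0" "\<And>q. f q \<noteq> 0 \<Longrightarrow> \<exists>k\<ge>m. q = of_int k / of_nat N"
    unfolding puiseux_denom_def by blast
  moreover have "f q \<noteq> 0" if "Im (f q) \<noteq> 0" for q using that by auto
  ultimately show "\<exists>N. puiseux_denom N (\<lambda>q. Im (f q))"
    unfolding puiseux_denom_def by blast
qed


section \<open>Polynomials, affine varieties and dimension\<close>

text \<open>Monomials are finitely supported exponent vectors on a set of variables of type \<open>'v\<close>.\<close>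

type_synonym ('v, 'k) mpoly = "('v \<Rightarrow>\<^sub>0 nat) \<Rightarrow>\<^sub>0 'k"

definition polys_in :: "'v set \<Rightarrow> ('v, 'k::zero) mpoly set" where
  "polys_in V = {F. \<forall>\<alpha>\<in>Poly_Mapping.keys F. Poly_Mapping.keys \<alpha> \<subseteq> V}"

definition poly_eval :: "('v \<Rightarrow> 'k) \<Rightarrow> ('v, 'k::comm_ring_1) mpoly \<Rightarrow> 'k" where
  "poly_eval v F = (\<Sum>\<alpha>\<in>Poly_Mapping.keys F. Poly_Mapping.lookup F \<alpha> *
     (\<Prod>i\<in>Poly_Mapping.keys \<alpha>. v i ^ Poly_Mapping.lookup \<alpha> i))"

definition homogeneous_poly :: "('v, 'k::zero) mpoly \<Rightarrow> bool" where
  "homogeneous_poly F \<longleftrightarrow> (\<exists>k. \<forall>\<alpha>\<in>Poly_Mapping.keys F.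
     (\<Sum>i\<in>Poly_Mapping.keys \<alpha>. Poly_Mapping.lookup \<alpha> i) = k)"

definition zero_locus :: "nat \<Rightarrow> (nat, 'k::comm_ring_1) mpoly set \<Rightarrow> 'k vec set" where
  "zero_locus n S = {x \<in> carrier_vec n. \<forall>f\<in>S. poly_eval (vec_index x) f = 0}"

definition affine_variety :: "nat \<Rightarrow> 'k::comm_ring_1 vec set \<Rightarrow> bool" where
  "affine_variety n X \<longleftrightarrow> (\<exists>S \<subseteq> polys_in {..<n}. X = zero_locus n S)"

definition homogeneous_variety :: "nat \<Rightarrow> 'k::comm_ring_1 vec set \<Rightarrow> bool" where
  "homogeneous_variety n X \<longleftrightarrow>
     (\<exists>S \<subseteq> polys_in {..<n}. (\<forall>f\<in>S. homogeneous_poly f) \<and> X = zero_locus n S)"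

definition irreducible_variety :: "nat \<Rightarrow> 'k::comm_ring_1 vec set \<Rightarrow> bool" where
  "irreducible_variety n Z \<longleftrightarrow> affine_variety n Z \<and> Z \<noteq> {} \<and>
     (\<forall>A B. affine_variety n A \<and> affine_variety n B \<and> Z = A \<union> B \<longrightarrow> Z = A \<or> Z = B)"

definition irreducible_component :: "nat \<Rightarrow> 'k::comm_ring_1 vec set \<Rightarrow> 'k vec set \<Rightarrow> bool" where
  "irreducible_component n X Z \<longleftrightarrow> irreducible_variety n Z \<and> Z \<subseteq> X \<and>
     (\<forall>W. irreducible_variety n W \<and> Z \<subseteq> W \<and> W \<subseteq> X \<longrightarrow> W = Z)"

definition irreducible_chain :: "nat \<Rightarrow> 'k::comm_ring_1 vec set \<Rightarrow> nat \<Rightarrow> bool" where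
  "irreducible_chain n Z d \<longleftrightarrow> (\<exists>W :: nat \<Rightarrow> 'k vec set.
     (\<forall>i\<le>d. irreducible_variety n (W i) \<and> W i \<subseteq> Z) \<and> (\<forall>i<d. W i \<subset> W (Suc i)))"

text \<open>
  The Krull dimension of the affine set \<open>Z\<close>; for a cone it is one more than the projective dimension.
\<close>

definition has_dimension :: "nat \<Rightarrow> 'k::comm_ring_1 vec set \<Rightarrow> nat \<Rightarrow> bool" where
  "has_dimension n Z d \<longleftrightarrow> irreducible_chain n Z d \<and> \<not> irreducible_chain n Z (Suc d)"

definition equidimensional :: "nat \<Rightarrow> nat \<Rightarrow> 'k::comm_ring_1 vec set \<Rightarrow> bool" where
  "equidimensional n d X \<longleftrightarrow> affine_variety n X \<and> X \<noteq> {} \<and>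
     (\<forall>Z. irreducible_component n X Z \<longrightarrow> has_dimension n Z d)"


section \<open>Grassmannians and positive hyperbolicity\<close>

definition plucker_indices :: "nat \<Rightarrow> nat \<Rightarrow> nat set set" where
  "plucker_indices c n = {I. I \<subseteq> {..<n} \<and> card I = c}"

text \<open>Only used at \<open>I \<in> plucker_indices c n\<close> for a \<open>c \<times> n\<close> matrix, where it is a maximal minor.\<close>

definition plucker_coord :: "'k::comm_ring_1 mat \<Rightarrow> nat set \<Rightarrow> 'k" where
  "plucker_coord A I = Determinant.det (submatrix A UNIV I)"

definition full_rank_mats :: "nat \<Rightarrow> nat \<Rightarrow> 'k::field mat set" where
  "full_rank_mats c n = {A \<in> carrier_mat c n. vec_space.rank c A = c}"

definition grassmannian :: "nat \<Rightarrow> nat \<Rightarrow> 'k::field vec set set" where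
  "grassmannian c n = vec_space.row_space n ` full_rank_mats c n"

definition positive_grassmannian :: "nat \<Rightarrow> nat \<Rightarrow> 'r::linordered_field vec set set" where
  "positive_grassmannian c n = vec_space.row_space n `
     {A \<in> carrier_mat c n. \<forall>I\<in>plucker_indices c n. plucker_coord A I > 0}"

text \<open>
  The parameter \<open>im\<close> is the imaginary part \<open>K \<rightarrow> R\<close> to the ordered field \<open>R\<close> of real elements of
  \<open>K\<close>, so that linear subspaces in the positive Grassmannian are over \<open>R\<close>.
\<close>

definition positively_hyperbolic ::
  "('k::field \<Rightarrow> 'r::linordered_field) \<Rightarrow> nat \<Rightarrow> nat \<Rightarrow> 'k vec set \<Rightarrow> bool" where
  "positively_hyperbolic im n c X \<longleftrightarrow> c < n \<and> equidimensional n (n - c) X \<and>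
     (\<forall>x\<in>X. \<forall>L\<in>positive_grassmannian c n. map_vec im x \<notin> L - {0\<^sub>v n})"


section \<open>Chow forms and Chow polytopes\<close>

definition meeting_subspaces :: "nat \<Rightarrow> nat \<Rightarrow> 'k::field vec set \<Rightarrow> 'k vec set set" where
  "meeting_subspaces n c X = {L \<in> grassmannian c n. \<exists>x\<in>L \<inter> X. x \<noteq> 0\<^sub>v n}"

definition vanishes_on ::
  "nat \<Rightarrow> nat \<Rightarrow> 'k::field vec set set \<Rightarrow> (nat set, 'k) mpoly \<Rightarrow> bool" where
  "vanishes_on n c Y G \<longleftrightarrow> (\<forall>A\<in>full_rank_mats c n.
     vec_space.row_space n A \<in> Y \<longrightarrow> poly_eval (plucker_coord A) G = 0)"

text \<open>
  A defining polynomial of the hypersurface of \<open>c\<close>-dimensional subspaces meeting \<open>X\<close>, where \<open>c\<close> is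
  the codimension of \<open>X\<close>: its class generates the vanishing ideal of that hypersurface in the
  coordinate ring of the Grassmannian, which is the ring of polynomials in the Pluecker coordinates
  modulo those that vanish on the Grassmannian.
\<close>

definition is_chow_form :: "nat \<Rightarrow> nat \<Rightarrow> 'k::field vec set \<Rightarrow> (nat set, 'k) mpoly \<Rightarrow> bool" where
  "is_chow_form n c X F \<longleftrightarrow> F \<in> polys_in (plucker_indices c n) \<and> homogeneous_poly F \<and>
     (\<forall>G\<in>polys_in (plucker_indices c n).
        vanishes_on n c (meeting_subspaces n c X) G \<longleftrightarrow>
        (\<exists>H\<in>polys_in (plucker_indices c n). vanishes_on n c (grassmannian c n) (G - F * H)))"

definition real_exponent :: "('v \<Rightarrow>\<^sub>0 nat) \<Rightarrow> ('v \<Rightarrow>\<^sub>0 real)" where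
  "real_exponent \<alpha> = Poly_Mapping.map real \<alpha>"

definition newton_polytope :: "('v, 'k::zero) mpoly \<Rightarrow> ('v \<Rightarrow>\<^sub>0 real) set" where
  "newton_polytope F = convex hull (real_exponent ` Poly_Mapping.keys F)"

text \<open>The linear map with \<open>e\<^sub>I \<mapsto> \<Sum>i\<in>I. e\<^sub>i\<close>\<close>

definition weight_map :: "(nat set \<Rightarrow>\<^sub>0 real) \<Rightarrow> (nat \<Rightarrow>\<^sub>0 real)" where
  "weight_map v = (\<Sum>I\<in>Poly_Mapping.keys v. Poly_Mapping.lookup v I *\<^sub>R
     (\<Sum>i\<in>I. Poly_Mapping.single i 1))"

definition weight_component ::
  "(nat \<Rightarrow>\<^sub>0 real) \<Rightarrow> (nat set, 'k::comm_monoid_add) mpoly \<Rightarrow> (nat set, 'k) mpoly" where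
  "weight_component w F =
     (\<Sum>\<alpha> | \<alpha> \<in> Poly_Mapping.keys F \<and> weight_map (real_exponent \<alpha>) = w.
        Poly_Mapping.single \<alpha> (Poly_Mapping.lookup F \<alpha>))"

text \<open>
  A Chow form is only determined modulo Pluecker relations. These are homogeneous for the grading
  by weight, so the set of weights whose component is nonzero in the coordinate ring of the
  Grassmannian depends only on \<open>X\<close>. Adding to \<open>F\<close> a relation of a further weight would however
  enlarge the image of the Newton polytope. The Chow polytope is therefore read off from a
  representative none of whose nonzero weight components is a Pluecker relation.
\<close>

definition weight_reduced :: "nat \<Rightarrow> nat \<Rightarrow> (nat set, 'k::field) mpoly \<Rightarrow> bool" where
  "weight_reduced n c F \<longleftrightarrow> (\<forall>w. weight_component w F \<noteq> 0 \<longrightarrow>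
     \<not> vanishes_on n c (grassmannian c n) (weight_component w F))"

definition is_chow_polytope ::
  "nat \<Rightarrow> nat \<Rightarrow> 'k::field vec set \<Rightarrow> (nat \<Rightarrow>\<^sub>0 real) set \<Rightarrow> bool" where
  "is_chow_polytope n c X P \<longleftrightarrow> (\<exists>F. is_chow_form n c X F \<and> weight_reduced n c F \<and>
     P = weight_map ` newton_polytope F)"

text \<open>
  \<open>\<real>\<^sup>n\<close> is the space of finitely supported functions with support in \<open>{..<n}\<close>. An edge of a polytope
  is a face that is a nondegenerate segment.
\<close>

definition generalized_permutohedron :: "nat \<Rightarrow> (nat \<Rightarrow>\<^sub>0 real) set \<Rightarrow> bool" where
  "generalized_permutohedron n P \<longleftrightarrow> polytope P \<and> (\<forall>v\<in>P. Poly_Mapping.keys v \<subseteq> {..<n}) \<and>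
     (\<forall>a b. a \<noteq> b \<and> closed_segment a b face_of P \<longrightarrow>
        (\<exists>i<n. \<exists>j<n. \<exists>t. b - a = t *\<^sub>R (Poly_Mapping.single i 1 - Poly_Mapping.single j 1)))"

end

theory Submission
  imports
    Defs
    "HOL-Computational_Algebra.Fundamental_Theorem_Algebra"
    "HOL-Computational_Algebra.Field_as_Ring"
    "Jordan_Normal_Form.Char_Poly"
    "HOL-Analysis.Complex_Transcendental"
begin

text \<open>
  Multiplying the columns of a matrix \<open>A\<close> with positive maximal minors by \<open>z\<^sub>1, \<dots>, z\<^sub>n\<close> turns the
  Chow form into a polynomial in \<open>z\<close> whose Newton polytope has, for generic \<open>A\<close>, a given edge of the
  Chow polytope as an edge. If the primitive direction \<open>v\<close> of that edge has \<open>\<Sum>\<bar>v\<^sub>i\<bar> > 2\<close>, the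
  initial form of the edge vanishes at a point whose coordinates all have positive imaginary part:
  the arguments available to the Laurent monomial \<open>z\<^sup>v\<close> then cover the circle. This zero deforms to
  zeros of the polynomial along a curve with tropical direction \<open>w\<close>, hence to points of the variety
  \<open>X\<close> in the row spaces of the scaled matrices. A limit of the coefficient vectors of these points
  is supported on \<open>n - c + 1\<close> columns, since by algebraic dependence of any \<open>n - c + 1\<close> coordinates
  on \<open>X\<close> and genericity of \<open>w\<close> no smaller support is possible; it is therefore real up to a factor,
  so the imaginary parts of the points have the signs of a vector in the row space of \<open>A\<close>. Such a
  sign vector also occurs in a positive subspace with those exact imaginary parts, contradicting
  positive hyperbolicity. Edges with \<open>\<Sum>\<bar>v\<^sub>i\<bar> = 2\<close> are parallel to \<open>e\<^sub>i - e\<^sub>j\<close>, as \<open>\<Sum>v\<^sub>i = 0\<close>.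
\<close>

text \<open>The weight \<open>w\<close> cannot be fully generic: its product with the edge direction
  \<open>v\<close> is forced by the two terms of the edge that have to tie. A polynomial relating n
  - c + 1 coordinates on \<open>X\<close> can therefore still have several lowest terms, but only
  with exponents that differ by multiples of \<open>v\<close>. A relation in which some variable
  from the support of \<open>v\<close> is missing escapes this; it has a single lowest term, and
  such a term cannot vanish in the limit. This bounds the support of the limit from above by n - c +
  1. The bound from below comes from \<open>A\<close>, whose maximal minors are all nonzero. A
  combination of the rows with this support is unique up to a factor, and \<open>A\<close> is taken
  rational so that the limit is a multiple of a rational vector. Rationality also gives
  \<open>A\<close> a meaning in \<open>K\<close>, in its real subfield and in the residue field at
  once. Of \<open>K\<close> itself the algebraic part uses only that it is algebraically closed,
  uncountable and of characteristic 0.\<close>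

abbreviation lookup :: "('a \<Rightarrow>\<^sub>0 'b::zero) \<Rightarrow> 'a \<Rightarrow> 'b" where
  "lookup \<equiv> Poly_Mapping.lookup"
abbreviation keys :: "('a \<Rightarrow>\<^sub>0 'b::zero) \<Rightarrow> 'a set" where
  "keys \<equiv> Poly_Mapping.keys"
abbreviation single :: "'a \<Rightarrow> 'b::zero \<Rightarrow> 'a \<Rightarrow>\<^sub>0 'b" where
  "single \<equiv> Poly_Mapping.single"

section \<open>Multivariate polynomials\<close>

definition monom_eval :: "('v \<Rightarrow> 'k::comm_ring_1) \<Rightarrow> ('v \<Rightarrow>\<^sub>0 nat) \<Rightarrow> 'k" where
  "monom_eval v \<alpha> = (\<Prod>i\<in>keys \<alpha>. v i ^ lookup \<alpha> i)"

definition mconst :: "'k::zero \<Rightarrow> ('v, 'k) mpoly" where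
  "mconst c = single 0 c"

definition mvar :: "'v \<Rightarrow> ('v, 'k::zero_neq_one) mpoly" where
  "mvar i = single (single i 1) 1"

lemma monom_eval_superset:
  "finite A \<Longrightarrow> keys \<alpha> \<subseteq> A \<Longrightarrow> monom_eval v \<alpha> = (\<Prod>i\<in>A. v i ^ lookup \<alpha> i)"
  unfolding monom_eval_def by (rule prod.mono_neutral_left) (auto simp: in_keys_iff)

lemma monom_eval_0 [simp]: "monom_eval v 0 = 1"
  by (simp add: monom_eval_def)

lemma monom_eval_single [simp]: "monom_eval v (single i k) = v i ^ k"
  by (cases "k = 0") (simp_all add: monom_eval_def)

lemma monom_eval_add: "monom_eval v (\<alpha> + \<beta>) = monom_eval v \<alpha> * monom_eval v \<beta>"
proof -
  let ?A = "keys \<alpha> \<union> keys \<beta>"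
  have "monom_eval v (\<alpha> + \<beta>) = (\<Prod>i\<in>?A. v i ^ lookup (\<alpha> + \<beta>) i)"
    by (rule monom_eval_superset) (auto simp: Poly_Mapping.keys_add)
  also have "\<dots> = (\<Prod>i\<in>?A. v i ^ lookup \<alpha> i) * (\<Prod>i\<in>?A. v i ^ lookup \<beta> i)"
    by (simp add: lookup_add power_add prod.distrib)
  also have "\<dots> = monom_eval v \<alpha> * monom_eval v \<beta>"
    by (simp add: monom_eval_superset[of ?A])
  finally show ?thesis .
qed

lemma monom_eval_cong: "(\<And>i. i \<in> keys \<alpha> \<Longrightarrow> v i = v' i) \<Longrightarrow> monom_eval v \<alpha> = monom_eval v' \<alpha>"
  unfolding monom_eval_def by (rule prod.cong) auto

lemma monom_eval_scale:
  "monom_eval (\<lambda>i. s * v i) \<alpha> = s ^ (\<Sum>i\<in>keys \<alpha>. lookup \<alpha> i) * monom_eval v \<alpha>"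
  by (simp add: monom_eval_def power_mult_distrib prod.distrib power_sum)

lemma poly_eval_alt: "poly_eval v F = (\<Sum>\<alpha>\<in>keys F. lookup F \<alpha> * monom_eval v \<alpha>)"
  by (simp add: poly_eval_def monom_eval_def)

lemma poly_eval_superset:
  "finite A \<Longrightarrow> keys F \<subseteq> A \<Longrightarrow> poly_eval v F = (\<Sum>\<alpha>\<in>A. lookup F \<alpha> * monom_eval v \<alpha>)"
  unfolding poly_eval_alt by (rule sum.mono_neutral_left) (auto simp: in_keys_iff)

lemma poly_eval_0 [simp]: "poly_eval v 0 = 0"
  by (simp add: poly_eval_alt)

lemma poly_eval_single: "poly_eval v (single \<alpha> c) = c * monom_eval v \<alpha>"
  by (cases "c = 0") (simp_all add: poly_eval_alt)

lemma poly_eval_mconst [simp]: "poly_eval v (mconst c) = c"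
  by (simp add: mconst_def poly_eval_single)

lemma poly_eval_mvar [simp]: "poly_eval v (mvar i) = v i"
  by (simp add: mvar_def poly_eval_single)

lemma poly_eval_add [simp]: "poly_eval v (F + G) = poly_eval v F + poly_eval v G"
proof -
  let ?A = "keys F \<union> keys G"
  have "poly_eval v (F + G) = (\<Sum>\<alpha>\<in>?A. lookup (F + G) \<alpha> * monom_eval v \<alpha>)"
    by (rule poly_eval_superset) (auto simp: Poly_Mapping.keys_add)
  also have "\<dots> = poly_eval v F + poly_eval v G"
    by (simp add: lookup_add distrib_right sum.distrib poly_eval_superset[of ?A])
  finally show ?thesis .
qed

lemma poly_eval_sum [simp]: "poly_eval v (sum f A) = (\<Sum>a\<in>A. poly_eval v (f a))"
  by (induction A rule: infinite_finite_induct) auto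

lemma poly_mapping_expand: "F = (\<Sum>\<alpha>\<in>keys F. single \<alpha> (lookup F \<alpha>))"
proof (rule poly_mapping_eqI)
  fix k
  have "lookup (\<Sum>\<alpha>\<in>keys F. single \<alpha> (lookup F \<alpha>)) k
      = (\<Sum>\<alpha>\<in>keys F. if \<alpha> = k then lookup F k else 0)"
    unfolding lookup_sum by (rule sum.cong) (auto simp: lookup_single when_def)
  also have "\<dots> = lookup F k" by (auto simp: in_keys_iff)
  finally show "lookup F k = lookup (\<Sum>\<alpha>\<in>keys F. single \<alpha> (lookup F \<alpha>)) k" ..
qed

lemma poly_eval_mult [simp]: "poly_eval v (F * G) = poly_eval v F * poly_eval v G"
proof -
  have "F * G = (\<Sum>\<alpha>\<in>keys F. \<Sum>\<beta>\<in>keys G. single (\<alpha> + \<beta>) (lookup F \<alpha> * lookup G \<beta>))"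
    by (subst poly_mapping_expand[of F], subst poly_mapping_expand[of G])
      (simp add: sum_product mult_single)
  then have "poly_eval v (F * G) = (\<Sum>\<alpha>\<in>keys F. \<Sum>\<beta>\<in>keys G.
      (lookup F \<alpha> * monom_eval v \<alpha>) * (lookup G \<beta> * monom_eval v \<beta>))"
    by (simp add: poly_eval_single monom_eval_add ac_simps)
  also have "\<dots> = poly_eval v F * poly_eval v G"
    by (simp only: poly_eval_alt sum_product)
  finally show ?thesis .
qed

lemma mconst_1: "mconst 1 = 1" by (simp add: mconst_def)
lemma mconst_0 [simp]: "mconst 0 = 0" by (simp add: mconst_def)
lemma mconst_add: "mconst (a + b) = mconst a + mconst b" by (simp add: mconst_def single_add)
lemma mconst_mult: "mconst (a * b) = mconst a * mconst b" by (simp add: mconst_def mult_single)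
lemma poly_eval_1 [simp]: "poly_eval v 1 = 1"
  by (metis mconst_1 poly_eval_mconst)

lemma poly_eval_uminus [simp]: "poly_eval v (- F) = - poly_eval v F"
proof -
  have "poly_eval v F + poly_eval v (- F) = 0" by (simp flip: poly_eval_add)
  then show ?thesis by (simp add: minus_unique)
qed

lemma poly_eval_diff [simp]: "poly_eval v (F - G) = poly_eval v F - poly_eval v G"
  unfolding diff_conv_add_uminus by (simp del: add_uminus_conv_diff)

lemma poly_eval_prod [simp]: "poly_eval v (prod f A) = (\<Prod>a\<in>A. poly_eval v (f a))"
  by (induction A rule: infinite_finite_induct) auto

interpretation poly_eval_hom: comm_ring_hom "poly_eval v" for v :: "'v \<Rightarrow> 'k::comm_ring_1"
  by unfold_locales auto

lemma poly_eval_cong: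
  assumes "F \<in> polys_in V" "\<And>i. i \<in> V \<Longrightarrow> v i = v' i"
  shows "poly_eval v F = poly_eval v' F"
  unfolding poly_eval_alt
proof (rule sum.cong)
  fix \<alpha> assume "\<alpha> \<in> keys F"
  with assms(1) have "keys \<alpha> \<subseteq> V" by (auto simp: polys_in_def)
  with assms(2) have "monom_eval v \<alpha> = monom_eval v' \<alpha>" by (intro monom_eval_cong) auto
  then show "lookup F \<alpha> * monom_eval v \<alpha> = lookup F \<alpha> * monom_eval v' \<alpha>" by simp
qed simp

lemma polys_in_0 [simp]: "0 \<in> polys_in V"
  and polys_in_mconst [simp]: "mconst c \<in> polys_in V"
  and polys_in_1 [simp]: "(1 :: ('v, 'k::comm_ring_1) mpoly) \<in> polys_in V"
  by (auto simp: polys_in_def mconst_def keys_single)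

lemma polys_in_mvar [simp]: "i \<in> V \<Longrightarrow> mvar i \<in> polys_in V"
  by (auto simp: polys_in_def mvar_def keys_single)

lemma polys_in_add [simp]: "F \<in> polys_in V \<Longrightarrow> G \<in> polys_in V \<Longrightarrow> F + G \<in> polys_in V"
  using Poly_Mapping.keys_add[of F G] by (fastforce simp: polys_in_def)

lemma polys_in_mult [simp]:
  assumes "F \<in> polys_in V" "G \<in> polys_in V" shows "F * G \<in> polys_in V"
  unfolding polys_in_def
proof (intro CollectI ballI)
  fix \<alpha> assume "\<alpha> \<in> keys (F * G)"
  then obtain a b where ab: "\<alpha> = a + b" "a \<in> keys F" "b \<in> keys G"
    using keys_mult[of F G] by auto
  then show "keys \<alpha> \<subseteq> V"
    using assms Poly_Mapping.keys_add[of a b] unfolding polys_in_def by blast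
qed

lemma polys_in_uminus [simp]:
  fixes F :: "('v, 'k::comm_ring_1) mpoly"
  shows "F \<in> polys_in V \<Longrightarrow> - F \<in> polys_in V"
  by (auto simp: polys_in_def in_keys_iff)

lemma polys_in_diff [simp]:
  fixes F G :: "('v, 'k::comm_ring_1) mpoly"
  shows "F \<in> polys_in V \<Longrightarrow> G \<in> polys_in V \<Longrightarrow> F - G \<in> polys_in V"
  unfolding diff_conv_add_uminus by (intro polys_in_add polys_in_uminus)

lemma polys_in_sum: "(\<And>a. a \<in> A \<Longrightarrow> f a \<in> polys_in V) \<Longrightarrow> sum f A \<in> polys_in V"
  by (induction A rule: infinite_finite_induct) auto

lemma polys_in_prod:
  fixes f :: "_ \<Rightarrow> ('v, 'k::comm_ring_1) mpoly"
  shows "(\<And>a. a \<in> A \<Longrightarrow> f a \<in> polys_in V) \<Longrightarrow> prod f A \<in> polys_in V"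
  by (induction A rule: infinite_finite_induct) auto

lemma polys_in_power:
  fixes F :: "('v, 'k::comm_ring_1) mpoly"
  shows "F \<in> polys_in V \<Longrightarrow> F ^ k \<in> polys_in V"
  by (induction k) auto

lemma polys_in_mono: "V \<subseteq> W \<Longrightarrow> F \<in> polys_in V \<Longrightarrow> F \<in> polys_in W"
  by (auto simp: polys_in_def)

text \<open>Polynomial dependence is tested on lines only. The functions in question are built from
  minors of a matrix with variable entries; the property passes through sums, products and
  determinants, and it reduces nonvanishing to the finiteness of the roots of a univariate
  polynomial.\<close>

definition line_polynomial :: "(('i \<Rightarrow> 'k) \<Rightarrow> 'k::comm_ring_1) \<Rightarrow> bool" where
  "line_polynomial f \<longleftrightarrow> (\<forall>x y. \<exists>p. \<forall>t. f (\<lambda>i. x i + t * y i) = poly p t)"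

lemma line_polynomial_const: "line_polynomial (\<lambda>_. c)"
  unfolding line_polynomial_def by (intro allI exI[of _ "[:c:]"]) simp

lemma line_polynomial_coord: "line_polynomial (\<lambda>x. x i)"
  unfolding line_polynomial_def
proof (intro allI)
  fix x y :: "'a \<Rightarrow> 'b"
  show "\<exists>p. \<forall>t. x i + t * y i = poly p t" by (intro exI[of _ "[:x i, y i:]"]) simp
qed

lemma line_polynomial_add:
  assumes "line_polynomial f" "line_polynomial g" shows "line_polynomial (\<lambda>x. f x + g x)"
  unfolding line_polynomial_def
proof (intro allI)
  fix x y
  from assms obtain p q where "\<forall>t. f (\<lambda>i. x i + t * y i) = poly p t"
    "\<forall>t. g (\<lambda>i. x i + t * y i) = poly q t" unfolding line_polynomial_def by meson
  then show "\<exists>p. \<forall>t. f (\<lambda>i. x i + t * y i) + g (\<lambda>i. x i + t * y i) = poly p t"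
    by (intro exI[of _ "p + q"]) simp
qed

lemma line_polynomial_mult:
  assumes "line_polynomial f" "line_polynomial g" shows "line_polynomial (\<lambda>x. f x * g x)"
  unfolding line_polynomial_def
proof (intro allI)
  fix x y
  from assms obtain p q where "\<forall>t. f (\<lambda>i. x i + t * y i) = poly p t"
    "\<forall>t. g (\<lambda>i. x i + t * y i) = poly q t" unfolding line_polynomial_def by meson
  then show "\<exists>p. \<forall>t. f (\<lambda>i. x i + t * y i) * g (\<lambda>i. x i + t * y i) = poly p t"
    by (intro exI[of _ "p * q"]) simp
qed

lemma line_polynomial_sum:
  "(\<And>a. a \<in> A \<Longrightarrow> line_polynomial (f a)) \<Longrightarrow> line_polynomial (\<lambda>x. \<Sum>a\<in>A. f a x)"
  by (induction A rule: infinite_finite_induct) (auto intro: line_polynomial_const line_polynomial_add)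

lemma line_polynomial_prod:
  "(\<And>a. a \<in> A \<Longrightarrow> line_polynomial (f a)) \<Longrightarrow> line_polynomial (\<lambda>x. \<Prod>a\<in>A. f a x)"
  by (induction A rule: infinite_finite_induct) (auto intro: line_polynomial_const line_polynomial_mult)

lemma line_polynomial_power: "line_polynomial f \<Longrightarrow> line_polynomial (\<lambda>x. f x ^ k)"
  by (induction k) (auto intro: line_polynomial_const line_polynomial_mult)

lemma line_polynomial_poly_eval:
  "(\<And>i. line_polynomial (\<lambda>x. g x i)) \<Longrightarrow> line_polynomial (\<lambda>x. poly_eval (g x) F)"
  unfolding poly_eval_def
  by (intro line_polynomial_sum line_polynomial_mult line_polynomial_const line_polynomial_prod
      line_polynomial_power) auto

text \<open>On the line through the two points both functions restrict to nonzero univariate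
  polynomials, whose product has only finitely many roots.\<close>

lemma line_polynomial_common_nonzero:
  fixes f g :: "('i \<Rightarrow> 'k::field_char_0) \<Rightarrow> 'k"
  assumes "line_polynomial f" "line_polynomial g" "f x \<noteq> 0" "g y \<noteq> 0"
  obtains z where "f z \<noteq> 0" "g z \<noteq> 0"
proof -
  obtain p q where p: "\<And>t. f (\<lambda>i. x i + t * (y i - x i)) = poly p t"
    and q: "\<And>t. g (\<lambda>i. x i + t * (y i - x i)) = poly q t"
    using assms(1,2) unfolding line_polynomial_def by meson
  have "poly p 0 \<noteq> 0" "poly q 1 \<noteq> 0" using p[of 0] q[of 1] assms(3,4) by auto
  then have "p * q \<noteq> 0" by auto
  then have "finite {t. poly (p * q) t = 0}" by (rule poly_roots_finite)
  then obtain t where "poly (p * q) t \<noteq> 0"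
    using infinite_UNIV_char_0[where 'a='k] by (metis (mono_tags) ex_new_if_finite mem_Collect_eq)
  with p q that show thesis by (metis mult_eq_0_iff poly_mult)
qed

lemma poly_mapping_update_inj:
  assumes "Poly_Mapping.update i 0 \<alpha> = Poly_Mapping.update i 0 \<beta>" "lookup \<alpha> i = lookup \<beta> i"
  shows "\<alpha> = \<beta>"
proof (rule poly_mapping_eqI)
  fix j
  show "lookup \<alpha> j = lookup \<beta> j"
    using assms(2) arg_cong[OF assms(1), of "\<lambda>x. lookup x j"] by (cases "j = i") (auto simp: lookup_update)
qed

text \<open>Induction on the variables: some coefficient with respect to the new variable is a
  nonzero polynomial in the others, and once it is made nonzero, the new variable only has to avoid
  finitely many roots.\<close>

lemma nonvanishing_point_aux:
  fixes F :: "('v, 'k::field_char_0) mpoly"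
  assumes "finite V" "F \<in> polys_in V" "F \<noteq> 0"
  shows "\<exists>v. poly_eval v F \<noteq> 0"
  using assms
proof (induction V arbitrary: F rule: finite_induct)
  case empty
  then have "keys F = {0}"
    by (auto simp: polys_in_def) (metis keys_eq_empty empty_iff subsetI subset_antisym ex_in_conv)
  then show ?case by (intro exI[of _ "\<lambda>_. 0"]) (auto simp: poly_eval_alt in_keys_iff)
next
  case (insert i V)
  \<comment> \<open>\<open>red k\<close> is the coefficient of the \<open>k\<close>-th power of the
    variable \<open>i\<close>.\<close>
  define red where "red k = (\<Sum>\<alpha> | \<alpha> \<in> keys F \<and> lookup \<alpha> i = k.
    single (Poly_Mapping.update i 0 \<alpha>) (lookup F \<alpha>))" for k
  obtain \<alpha>0 where \<alpha>0: "\<alpha>0 \<in> keys F" using insert.prems(2) keys_eq_empty by blast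
  define k0 where "k0 = lookup \<alpha>0 i"
  have fin: "finite {\<alpha> \<in> keys F. lookup \<alpha> i = k}" for k by simp
  have "lookup (red k0) (Poly_Mapping.update i 0 \<alpha>0)
      = (\<Sum>\<alpha> | \<alpha> \<in> keys F \<and> lookup \<alpha> i = k0. if \<alpha> = \<alpha>0 then lookup F \<alpha>0 else 0)"
    unfolding red_def lookup_sum
    by (rule sum.cong) (auto simp: lookup_single when_def k0_def dest: poly_mapping_update_inj)
  also have "\<dots> = lookup F \<alpha>0" using \<alpha>0 by (simp add: k0_def)
  finally have "red k0 \<noteq> 0" using \<alpha>0 by (metis in_keys_iff lookup_zero)
  moreover have "red k \<in> polys_in V" for k
    unfolding red_def
  proof (rule polys_in_sum)
    fix \<alpha> assume "\<alpha> \<in> {\<alpha> \<in> keys F. lookup \<alpha> i = k}"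
    then have "keys \<alpha> \<subseteq> insert i V" using insert.prems(1) by (auto simp: polys_in_def)
    then show "single (Poly_Mapping.update i 0 \<alpha>) (lookup F \<alpha>) \<in> polys_in V"
      by (auto simp: polys_in_def keys_single keys_update)
  qed
  ultimately obtain v where v: "poly_eval v (red k0) \<noteq> 0" using insert.IH by blast
  define p where "p = (\<Sum>\<alpha>\<in>keys F. Polynomial.monom
      (lookup F \<alpha> * monom_eval v (Poly_Mapping.update i 0 \<alpha>)) (lookup \<alpha> i))"
  have "coeff p k0 = (\<Sum>\<alpha>\<in>keys F. if lookup \<alpha> i = k0
      then lookup F \<alpha> * monom_eval v (Poly_Mapping.update i 0 \<alpha>) else 0)"
    unfolding p_def coeff_sum by (rule sum.cong) auto
  also have "\<dots> = poly_eval v (red k0)"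
    unfolding red_def poly_eval_sum poly_eval_single by (rule sum.inter_filter[symmetric]) simp
  finally have "p \<noteq> 0" using v by auto
  then have "finite {t. poly p t = 0}" by (rule poly_roots_finite)
  then obtain t where t: "poly p t \<noteq> 0"
    using infinite_UNIV_char_0[where 'a='k] by (metis (mono_tags) ex_new_if_finite mem_Collect_eq)
  have mon: "monom_eval (v(i := t)) \<alpha> = t ^ lookup \<alpha> i * monom_eval v (Poly_Mapping.update i 0 \<alpha>)"
    for \<alpha> :: "'v \<Rightarrow>\<^sub>0 nat"
  proof -
    have "monom_eval (v(i := t)) \<alpha> = (\<Prod>j\<in>insert i (keys \<alpha> - {i}). (v(i := t)) j ^ lookup \<alpha> j)"
      by (rule monom_eval_superset) auto
    also have "\<dots> = t ^ lookup \<alpha> i * (\<Prod>j\<in>keys \<alpha> - {i}. v j ^ lookup \<alpha> j)"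
      by (subst prod.insert) (auto intro!: prod.cong)
    also have "(\<Prod>j\<in>keys \<alpha> - {i}. v j ^ lookup \<alpha> j) = monom_eval v (Poly_Mapping.update i 0 \<alpha>)"
      unfolding monom_eval_def by (rule prod.cong) (auto simp: keys_update lookup_update)
    finally show ?thesis .
  qed
  have "poly_eval (v(i := t)) F = poly p t"
    unfolding p_def poly_eval_alt poly_sum mon by (rule sum.cong) (auto simp: poly_monom)
  with t show ?case by metis
qed

lemma polys_in_vars: "F \<in> polys_in (\<Union>\<alpha>\<in>keys F. keys \<alpha>)"
  by (auto simp: polys_in_def)

lemma nonvanishing_point:
  fixes F :: "('v, 'k::field_char_0) mpoly"
  assumes "F \<noteq> 0" obtains v where "poly_eval v F \<noteq> 0"
  using nonvanishing_point_aux[OF _ polys_in_vars assms] by auto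

section \<open>Ideals over an uncountable field\<close>

text \<open>Gaussian elimination: an equation with a nonzero entry \<open>M a0 e\<close> eliminates
  the unknown \<open>a0\<close>, which leaves one equation and one unknown fewer.\<close>

lemma linear_dependence:
  fixes M :: "'a \<Rightarrow> 'e \<Rightarrow> 'k::field"
  assumes "finite E" "finite A" "card E < card A"
  shows "\<exists>l. (\<exists>a\<in>A. l a \<noteq> 0) \<and> (\<forall>e\<in>E. (\<Sum>a\<in>A. l a * M a e) = 0)"
  using assms
proof (induction E arbitrary: A M rule: finite_induct)
  case empty
  then show ?case by (intro exI[of _ "\<lambda>_. 1"]) (auto simp: card_gt_0_iff)
next
  case (insert e E)
  show ?case
  proof (cases "\<exists>a0\<in>A. M a0 e \<noteq> 0")
    case False
    moreover obtain l where "\<exists>a\<in>A. l a \<noteq> 0" "\<forall>e\<in>E. (\<Sum>a\<in>A. l a * M a e) = 0"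
      using insert.IH[of A M] insert.hyps insert.prems by auto
    ultimately show ?thesis by (intro exI[of _ l]) auto
  next
    case True
    then obtain a0 where a0: "a0 \<in> A" "M a0 e \<noteq> 0" by blast
    define M' where "M' a e' = M a e' - M a e / M a0 e * M a0 e'" for a e'
    have "card E < card (A - {a0})" using insert a0 by (simp add: card_Diff_singleton)
    then obtain l where l: "\<exists>a\<in>A - {a0}. l a \<noteq> 0"
      "\<forall>e'\<in>E. (\<Sum>a\<in>A - {a0}. l a * M' a e') = 0"
      using insert.IH[of "A - {a0}" M'] insert.prems by auto
    define l' where "l' = l(a0 := - (\<Sum>a\<in>A - {a0}. l a * M a e) / M a0 e)"
    have split: "(\<Sum>a\<in>A. l' a * M a e')
        = - (\<Sum>a\<in>A - {a0}. l a * M a e) / M a0 e * M a0 e' + (\<Sum>a\<in>A - {a0}. l a * M a e')" for e'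
      unfolding l'_def using a0 insert.prems(1) by (subst sum.remove[of _ a0]) auto
    have "(\<Sum>a\<in>A. l' a * M a e') = (\<Sum>a\<in>A - {a0}. l a * M' a e')" for e'
      unfolding split M'_def
      by (simp add: right_diff_distrib sum_subtractf sum_distrib_right sum_distrib_left
          sum_divide_distrib mult.assoc)
    moreover have "(\<Sum>a\<in>A. l' a * M a e) = 0" unfolding split using a0 by simp
    moreover have "\<exists>a\<in>A. l' a \<noteq> 0" using l(1) by (auto simp: l'_def)
    ultimately show ?thesis using l(2) by (intro exI[of _ l']) auto
  qed
qed

lemma countable_poly_mapping: "countable (UNIV :: ('v::countable \<Rightarrow>\<^sub>0 'b::{countable, zero}) set)"
proof -
  let ?g = "\<lambda>\<alpha> :: 'v \<Rightarrow>\<^sub>0 'b. (\<lambda>i. (i, lookup \<alpha> i)) ` keys \<alpha>"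
  have "inj ?g"
  proof (rule injI, rule poly_mapping_eqI)
    fix \<alpha> \<beta> :: "'v \<Rightarrow>\<^sub>0 'b" and k
    assume eq: "?g \<alpha> = ?g \<beta>"
    have "(k, x) \<in> ?g \<gamma> \<longleftrightarrow> x \<noteq> 0 \<and> lookup \<gamma> k = x" for \<gamma> :: "'v \<Rightarrow>\<^sub>0 'b" and x
      by (auto simp: in_keys_iff)
    then show "lookup \<alpha> k = lookup \<beta> k" using eq by metis
  qed
  moreover have "countable (range ?g)"
    by (rule countable_subset[OF _ countable_Collect_finite]) auto
  ultimately show ?thesis using countable_image_inj_on by blast
qed

text \<open>There are only countably many pairs of a finite support and a label, so infinitely many
  \<open>a\<close> share one pair. Among these, more polynomials than the common support has
  monomials are linearly dependent. In the Nullstellensatz the label \<open>\<kappa>\<close> makes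
  all denominators of a relation equal.\<close>

lemma uncountable_relation:
  fixes u :: "'k::field \<Rightarrow> ('v::countable, 'k) mpoly" and \<kappa> :: "'k \<Rightarrow> nat"
  assumes "uncountable (UNIV :: 'k set)"
  obtains A l where "finite A" "A \<noteq> {}" "\<And>a. a \<in> A \<Longrightarrow> l a \<noteq> 0"
    "\<And>a b. a \<in> A \<Longrightarrow> b \<in> A \<Longrightarrow> \<kappa> a = \<kappa> b" "(\<Sum>a\<in>A. mconst (l a) * u a) = 0"
proof -
  let ?h = "\<lambda>a. (keys (u a), \<kappa> a)"
  let ?C = "Collect finite \<times> UNIV :: (('v \<Rightarrow>\<^sub>0 nat) set \<times> nat) set"
  have "countable {E :: ('v \<Rightarrow>\<^sub>0 nat) set. finite E}"
    using countable_Collect_finite_subset[OF countable_poly_mapping] by simp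
  then have C: "countable ?C" by (intro countable_SIGMA) auto
  have "\<exists>c\<in>?C. infinite (?h -` {c})"
  proof (rule ccontr)
    assume "\<not> ?thesis"
    then have "countable (\<Union>c\<in>?C. ?h -` {c})"
      using C by (intro countable_UN) (auto intro: countable_finite)
    moreover have "(\<Union>c\<in>?C. ?h -` {c}) = UNIV" by auto
    ultimately show False using assms by simp
  qed
  then obtain E k where E: "finite E" and inf: "infinite (?h -` {(E, k)})" by auto
  obtain B where B: "B \<subseteq> ?h -` {(E, k)}" "finite B" "card B = Suc (card E)"
    using infinite_arbitrarily_large[OF inf] by metis
  obtain l where l: "\<exists>a\<in>B. l a \<noteq> 0" "\<forall>e\<in>E. (\<Sum>a\<in>B. l a * lookup (u a) e) = 0"
    using linear_dependence[of E B "\<lambda>a. lookup (u a)"] E B by auto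
  define A where "A = {a\<in>B. l a \<noteq> 0}"
  have key: "lookup (mconst (c :: 'k) * f) e = c * lookup f e" for c and f :: "('v, 'k) mpoly" and e
    unfolding mconst_def mult_map_scale_conv_mult[symmetric] by transfer (simp add: when_def)
  have "(\<Sum>a\<in>A. mconst (l a) * u a) = (\<Sum>a\<in>B. mconst (l a) * u a)"
    unfolding A_def by (rule sum.mono_neutral_left) (use B in auto)
  also have "\<dots> = 0"
  proof (rule poly_mapping_eqI)
    fix e
    show "lookup (\<Sum>a\<in>B. mconst (l a) * u a) e = lookup 0 e"
    proof (cases "e \<in> E")
      case True
      then show ?thesis using l(2) by (simp add: lookup_sum key)
    next
      case False
      then have "lookup (u a) e = 0" if "a \<in> B" for a
        using that B(1) by (auto simp: in_keys_iff)
      then show ?thesis by (simp add: lookup_sum key)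
    qed
  qed
  finally show thesis
    by (intro that[of A l]) (use B l(1) in \<open>auto simp: A_def\<close>)
qed

section \<open>Ideals that are maximal among those avoiding a given set\<close>

definition ideal_in :: "'a::comm_ring_1 set \<Rightarrow> 'a set \<Rightarrow> bool" where
  "ideal_in R I \<longleftrightarrow> I \<subseteq> R \<and> 0 \<in> I \<and> (\<forall>x\<in>I. \<forall>y\<in>I. x + y \<in> I) \<and> (\<forall>r\<in>R. \<forall>x\<in>I. r * x \<in> I)"

definition prime_in :: "'a::comm_ring_1 set \<Rightarrow> 'a set \<Rightarrow> bool" where
  "prime_in R P \<longleftrightarrow> ideal_in R P \<and> 1 \<notin> P \<and> (\<forall>f\<in>R. \<forall>g\<in>R. f * g \<in> P \<longrightarrow> f \<in> P \<or> g \<in> P)"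

text \<open>For multiplicative \<open>S\<close> such a \<open>P\<close> corresponds to a maximal
  ideal of the localization at \<open>S\<close>, without the localization being constructed.
  \<open>S\<close> will consist of the powers of a polynomial, or of the nonzero polynomials in a
  subset of the variables.\<close>

definition maximal_avoiding :: "'a::comm_ring_1 set \<Rightarrow> 'a set \<Rightarrow> 'a set \<Rightarrow> bool" where
  "maximal_avoiding R S P \<longleftrightarrow> ideal_in R P \<and> P \<inter> S = {} \<and>
     (\<forall>Q. ideal_in R Q \<and> P \<subseteq> Q \<and> Q \<inter> S = {} \<longrightarrow> Q = P)"

lemma ideal_in_sum: "ideal_in R I \<Longrightarrow> (\<And>a. a \<in> A \<Longrightarrow> f a \<in> I) \<Longrightarrow> sum f A \<in> I"
  by (induction A rule: infinite_finite_induct) (auto simp: ideal_in_def)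

lemma ex_maximal_avoiding:
  assumes "ideal_in R I" "I \<inter> S = {}"
  obtains P where "maximal_avoiding R S P" "I \<subseteq> P"
proof -
  let ?A = "{Q. ideal_in R Q \<and> I \<subseteq> Q \<and> Q \<inter> S = {}}"
  have "\<exists>M\<in>?A. \<forall>Q\<in>?A. M \<subseteq> Q \<longrightarrow> Q = M"
  proof (rule subset_Zorn_nonempty)
    show "?A \<noteq> {}" using assms by auto
    fix C assume C: "C \<noteq> {}" "subset.chain ?A C"
    then have sub: "\<And>Q. Q \<in> C \<Longrightarrow> Q \<in> ?A" and tot: "\<And>Q Q'. Q \<in> C \<Longrightarrow> Q' \<in> C \<Longrightarrow> Q \<subseteq> Q' \<or> Q' \<subseteq> Q"
      unfolding subset.chain_def by blast+
    have "x + y \<in> \<Union>C" if xy: "x \<in> \<Union>C" "y \<in> \<Union>C" for x y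
    proof -
      obtain Q Q' where Q: "Q \<in> C" "x \<in> Q" "Q' \<in> C" "y \<in> Q'" using xy by blast
      then obtain Q'' where "Q'' \<in> C" "x \<in> Q''" "y \<in> Q''" using tot[of Q Q'] by blast
      then show ?thesis using sub[of Q''] by (auto simp: ideal_in_def)
    qed
    moreover have "r * x \<in> \<Union>C" if "r \<in> R" "x \<in> \<Union>C" for r x
      using that sub by (fastforce simp: ideal_in_def)
    moreover have "\<Union>C \<subseteq> R" "0 \<in> \<Union>C" using sub C(1) by (fastforce simp: ideal_in_def)+
    ultimately have "ideal_in R (\<Union>C)" unfolding ideal_in_def by blast
    then show "\<Union>C \<in> ?A" using sub C(1) by blast
  qed
  then obtain M where M: "M \<in> ?A" "\<forall>Q\<in>?A. M \<subseteq> Q \<longrightarrow> Q = M" by blast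
  show thesis
    by (rule that[of M]) (use M in \<open>auto simp: maximal_avoiding_def\<close>)
qed

text \<open>By maximality the ideal generated by \<open>P\<close> and \<open>f\<close> meets
  \<open>S\<close>. Up to the denominator \<open>s\<close>, \<open>u\<close> is an inverse of
  \<open>f\<close> modulo \<open>P\<close>.\<close>

lemma maximal_avoiding_meets:
  fixes P :: "('v, 'k::comm_ring_1) mpoly set"
  assumes max: "maximal_avoiding (polys_in V) S P" and f: "f \<in> polys_in V" "f \<notin> P"
  obtains s u p where "s \<in> S" "u \<in> polys_in V" "p \<in> P" "s = u * f + p"
proof -
  have id: "ideal_in (polys_in V) P" using max by (simp add: maximal_avoiding_def)
  let ?Q = "{u * f + p | u p. u \<in> polys_in V \<and> p \<in> P}"
  have P: "P \<subseteq> polys_in V" "0 \<in> P" "\<And>x y. x \<in> P \<Longrightarrow> y \<in> P \<Longrightarrow> x + y \<in> P"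
    "\<And>r x. r \<in> polys_in V \<Longrightarrow> x \<in> P \<Longrightarrow> r * x \<in> P"
    using id by (simp_all add: ideal_in_def)
  have QI: "x \<in> ?Q" if "x = u * f + p" "u \<in> polys_in V" "p \<in> P" for x u p
    using that by blast
  have "ideal_in (polys_in V) ?Q"
    unfolding ideal_in_def
  proof (intro conjI ballI)
    show "?Q \<subseteq> polys_in V" using P(1) f by auto
    show "0 \<in> ?Q" by (rule QI[of _ 0 0]) (use P(2) in auto)
    fix x y assume "x \<in> ?Q" "y \<in> ?Q"
    then obtain u p u' p' where *: "x = u * f + p" "y = u' * f + p'" "u \<in> polys_in V" "u' \<in> polys_in V"
      "p \<in> P" "p' \<in> P" by blast
    show "x + y \<in> ?Q"
      by (rule QI[of _ "u + u'" "p + p'"]) (use * P(3) in \<open>simp_all add: algebra_simps\<close>)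
  next
    fix r x :: "('v, 'k) mpoly" assume r: "r \<in> polys_in V" and "x \<in> ?Q"
    then obtain u p where *: "x = u * f + p" "u \<in> polys_in V" "p \<in> P" by blast
    show "r * x \<in> ?Q"
      by (rule QI[of _ "r * u" "r * p"]) (use *(2) P(4)[OF r *(3)] r in \<open>simp_all add: *(1) distrib_left mult.assoc\<close>)
  qed
  moreover have "P \<subseteq> ?Q"
  proof
    fix x assume "x \<in> P" then show "x \<in> ?Q" by (intro QI[of _ 0 x]) auto
  qed
  moreover have "f \<in> ?Q" by (rule QI[of _ 1 0]) (use P(2) in auto)
  ultimately have "?Q \<inter> S \<noteq> {}" using max f(2) unfolding maximal_avoiding_def by blast
  then show thesis using that by blast
qed

text \<open>Two elements outside \<open>P\<close> generate together with \<open>P\<close> ideals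
  that meet \<open>S\<close>, say in \<open>s\<close> and \<open>t\<close>. If the product of the
  two elements were in \<open>P\<close>, so would be \<open>s * t\<close>, which belongs to
  \<open>S\<close>.\<close>

lemma maximal_avoiding_prime:
  assumes P: "maximal_avoiding (polys_in V) S P" and "1 \<in> S"
    and mult: "\<And>s t. s \<in> S \<Longrightarrow> t \<in> S \<Longrightarrow> s * t \<in> S"
  shows "prime_in (polys_in V) P"
  unfolding prime_in_def
proof (intro conjI ballI impI)
  show id: "ideal_in (polys_in V) P" using P by (simp add: maximal_avoiding_def)
  show "1 \<notin> P" using P assms(2) by (auto simp: maximal_avoiding_def)
  fix f g assume fg: "f \<in> polys_in V" "g \<in> polys_in V" "f * g \<in> P"
  show "f \<in> P \<or> g \<in> P"
  proof (rule ccontr)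
    assume "\<not> ?thesis"
    then obtain s u p t u' p' where s: "s \<in> S" "u \<in> polys_in V" "p \<in> P" "s = u * f + p"
      and t: "t \<in> S" "u' \<in> polys_in V" "p' \<in> P" "t = u' * g + p'"
      using maximal_avoiding_meets[OF P fg(1)] maximal_avoiding_meets[OF P fg(2)] by metis
    have *: "s * t = (u * u') * (f * g) + (u * f + p) * p' + (u' * g) * p"
      unfolding s t by (simp add: algebra_simps)
    have "p \<in> polys_in V" using id s(3) by (auto simp: ideal_in_def)
    then have "u * f + p \<in> polys_in V" "u * u' \<in> polys_in V" "u' * g \<in> polys_in V" using fg s(2) t(2) by auto
    then have "s * t \<in> P" unfolding * using id fg(3) s(3) t(3) unfolding ideal_in_def by blast
    then show False using mult[OF s(1) t(1)] P by (auto simp: maximal_avoiding_def)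
  qed
qed

lemma ideal_in_diff:
  assumes "ideal_in (polys_in V) P" "f \<in> P" "g \<in> P" shows "f - g \<in> P"
proof -
  have "(-1) * g \<in> P" using assms unfolding ideal_in_def by (metis polys_in_1 polys_in_uminus)
  then show ?thesis using assms unfolding ideal_in_def by (metis diff_conv_add_uminus mult_minus1)
qed

text \<open>
  The inverses of \<open>x - a\<close> modulo \<open>P\<close>, up to the factors \<open>s a\<close>, are linearly dependent since a
  polynomial ring has countable dimension while there are uncountably many \<open>a\<close>.
\<close>

lemma avoiding_relation:
  fixes P S :: "('v::countable, 'k::field) mpoly set" and \<kappa> :: "('v, 'k) mpoly \<Rightarrow> nat"
  assumes unc: "uncountable (UNIV :: 'k set)"
    and P: "maximal_avoiding (polys_in V) S P" "S \<subseteq> polys_in V" and j: "j \<in> V"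
    and notin: "\<And>a. mvar j - mconst a \<notin> P"
  obtains A l s where "finite A" "A \<noteq> {}" "\<And>a. a \<in> A \<Longrightarrow> l a \<noteq> 0" "\<And>a. s a \<in> S"
    "\<And>a b. a \<in> A \<Longrightarrow> b \<in> A \<Longrightarrow> \<kappa> (s a) = \<kappa> (s b)"
    "(\<Sum>a\<in>A. mconst (l a) * s a * (\<Prod>b\<in>A - {a}. mvar j - mconst b)) \<in> P"
proof -
  have id: "ideal_in (polys_in V) P" using P by (simp add: maximal_avoiding_def)
  have xin: "mvar j - mconst a \<in> polys_in V" for a :: 'k using j by simp
  have "\<forall>a. \<exists>s u p. s \<in> S \<and> u \<in> polys_in V \<and> p \<in> P \<and> s = u * (mvar j - mconst a) + p"
    using maximal_avoiding_meets[OF P(1) xin notin] by metis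
  then obtain s u p where s: "\<And>a. s a \<in> S" and u: "\<And>a. u a \<in> polys_in V" and p: "\<And>a. p a \<in> P"
    and eq: "\<And>a. s a = u a * (mvar j - mconst a) + p a" by metis
  obtain A l where A: "finite A" "A \<noteq> {}" "\<And>a. a \<in> A \<Longrightarrow> l a \<noteq> 0"
    "\<And>a b. a \<in> A \<Longrightarrow> b \<in> A \<Longrightarrow> \<kappa> (s a) = \<kappa> (s b)" "(\<Sum>a\<in>A. mconst (l a) * u a) = 0"
    by (rule uncountable_relation[OF unc, of "\<lambda>a. \<kappa> (s a)" u]) (rule that)
  let ?R = "\<lambda>a. \<Prod>b\<in>A - {a}. mvar j - mconst b :: ('v, 'k) mpoly"
  have Rin: "?R a \<in> polys_in V" for a using xin by (intro polys_in_prod) auto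
  \<comment> \<open>Modulo \<open>P\<close>, \<open>s a\<close> is
    \<open>u a * (mvar j - mconst a)\<close>, so each summand becomes
    \<open>mconst (l a) * u a\<close> times the product of all the linear forms.\<close>
  have "(\<Sum>a\<in>A. mconst (l a) * s a * ?R a)
      = (\<Sum>a\<in>A. (mconst (l a) * u a) * (\<Prod>b\<in>A. mvar j - mconst b)) + (\<Sum>a\<in>A. (mconst (l a) * ?R a) * p a)"
    unfolding sum.distrib[symmetric]
  proof (rule sum.cong)
    fix a assume "a \<in> A"
    then have pr: "(\<Prod>b\<in>A. mvar j - mconst b) = (mvar j - mconst a) * ?R a"
      using A(1) by (simp only: prod.remove)
    show "mconst (l a) * s a * ?R a = mconst (l a) * u a * (\<Prod>b\<in>A. mvar j - mconst b)
        + mconst (l a) * ?R a * p a"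
      by (simp only: eq pr distrib_left distrib_right ac_simps)
  qed simp
  also have "\<dots> = (\<Sum>a\<in>A. (mconst (l a) * ?R a) * p a)"
    using A(5) by (simp add: sum_distrib_right[symmetric])
  also have "\<dots> \<in> P"
    using id Rin p by (intro ideal_in_sum[OF id]) (auto simp: ideal_in_def)
  finally have rel: "(\<Sum>a\<in>A. mconst (l a) * s a * ?R a) \<in> P" .
  show thesis by (rule that[OF A(1,2,3) s A(4) rel])
qed

lemma mvar_power: "mvar i ^ k = (single (single i k) 1 :: ('v, 'k::comm_ring_1) mpoly)"
  by (induction k) (simp_all add: mvar_def mult_single single_add[symmetric])

lemma mpoly_induct [consumes 1, case_names mconst mvar add mult]:
  fixes F :: "('v, 'k::comm_ring_1) mpoly"
  assumes F: "F \<in> polys_in V" and c: "\<And>c. Q (mconst c)" and v: "\<And>i. i \<in> V \<Longrightarrow> Q (mvar i)"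
    and a: "\<And>f g. f \<in> polys_in V \<Longrightarrow> g \<in> polys_in V \<Longrightarrow> Q f \<Longrightarrow> Q g \<Longrightarrow> Q (f + g)"
    and m: "\<And>f g. f \<in> polys_in V \<Longrightarrow> g \<in> polys_in V \<Longrightarrow> Q f \<Longrightarrow> Q g \<Longrightarrow> Q (f * g)"
  shows "Q F"
proof -
  have one: "Q 1" using c[of 1] by (simp add: mconst_1)
  have zero: "Q 0" using c[of 0] by simp
  have pow: "Q (mvar i ^ k)" if "i \<in> V" for i k
  proof (induction k)
    case (Suc k)
    show ?case unfolding power_Suc by (rule m) (use that Suc in \<open>auto intro: polys_in_power v\<close>)
  qed (simp add: one)
  have pr: "Q (\<Prod>i\<in>A. mvar i ^ k i)" if "finite A" "A \<subseteq> V" for A and k :: "'v \<Rightarrow> nat"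
    using that
  proof (induction A rule: finite_induct)
    case (insert i A)
    then show ?case
      by (subst prod.insert) (auto intro!: m pow polys_in_power polys_in_prod)
  qed (simp add: one)
  have exp: "(\<Prod>i\<in>A. mvar i ^ k i) = (single (\<Sum>i\<in>A. single i (k i)) 1 :: ('v, 'k) mpoly)"
    if "finite A" for A and k :: "'v \<Rightarrow> nat"
    using that by (induction A rule: finite_induct) (simp_all add: mvar_power mult_single)
  have mon: "Q (single \<alpha> d)" if "keys \<alpha> \<subseteq> V" for \<alpha> :: "'v \<Rightarrow>\<^sub>0 nat" and d
  proof -
    have "single \<alpha> d = mconst d * (\<Prod>i\<in>keys \<alpha>. mvar i ^ lookup \<alpha> i)"
      by (simp add: exp poly_mapping_expand[symmetric] mconst_def mult_single)
    also have "Q \<dots>"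
      using that by (intro m c pr polys_in_prod polys_in_power) auto
    finally show ?thesis .
  qed
  have "Q (\<Sum>\<alpha>\<in>A. single \<alpha> (lookup F \<alpha>))" if "finite A" "A \<subseteq> keys F" for A
    using that
  proof (induction A rule: finite_induct)
    case (insert x A)
    have *: "single \<alpha> (lookup F \<alpha>) \<in> polys_in V" if "\<alpha> \<in> insert x A" for \<alpha>
      using that F insert.prems by (auto simp: polys_in_def keys_single)
    show ?case
      using insert F * by (subst sum.insert) (auto intro!: a mon polys_in_sum simp: polys_in_def)
  qed (simp add: zero)
  from this[of "keys F"] show ?thesis by (simp flip: poly_mapping_expand)
qed

text \<open>Over an algebraically closed field \<open>q\<close> splits into linear factors, and the
  prime \<open>P\<close> contains one of them because it contains no nonzero constant.\<close>

lemma prime_contains_linear: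
  fixes P :: "('v, 'k::alg_closed_field) mpoly set"
  assumes P: "prime_in (polys_in V) P" and j: "j \<in> V" and "q \<noteq> 0"
    and "poly (map_poly mconst q) (mvar j) \<in> P"
  shows "\<exists>b. mvar j - mconst b \<in> P"
proof -
  interpret mc: comm_ring_hom "mconst :: 'k \<Rightarrow> ('v, 'k) mpoly"
    by unfold_locales (auto simp: mconst_1 mconst_add mconst_mult)
  interpret mp: map_poly_comm_ring_hom "mconst :: 'k \<Rightarrow> ('v, 'k) mpoly" ..
  have id: "ideal_in (polys_in V) P" and one: "1 \<notin> P" using P by (auto simp: prime_in_def)
  have pin: "poly (map_poly mconst q) (mvar j) \<in> polys_in V" for q :: "'k poly"
    using j by (induction q) (auto simp: map_poly_pCons)
  show ?thesis using assms(3,4)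
  proof (induction "degree q" arbitrary: q)
    case 0
    then obtain c where c: "q = [:c:]" "c \<noteq> 0" by (metis degree_eq_zeroE pCons_0_0)
    then have "mconst c \<in> P" using 0 by (simp add: map_poly_pCons)
    then have "mconst (1 / c) * mconst c \<in> P" using id by (auto simp: ideal_in_def)
    then show ?case using one c by (simp flip: mconst_mult add: mconst_1)
  next
    case (Suc d)
    then obtain b where "poly q b = 0" using alg_closed_imp_poly_has_root[of q] by auto
    then obtain q' where q': "q = [:- b, 1:] * q'" by (metis dvdE poly_eq_0_iff_dvd)
    have "poly (map_poly mconst q) (mvar j) = (mvar j - mconst b) * poly (map_poly mconst q') (mvar j)"
      unfolding q' mp.hom_mult poly_mult by (simp add: map_poly_pCons mc.hom_uminus mconst_1)
    moreover have "mvar j - mconst b \<in> polys_in V" using j by simp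
    ultimately consider "mvar j - mconst b \<in> P" | "poly (map_poly mconst q') (mvar j) \<in> P"
      using Suc.prems(2) P pin[of q'] unfolding prime_in_def by metis
    then show ?case
    proof cases
      case 2
      have "q' \<noteq> 0" using Suc.prems(1) q' by auto
      then have "degree q = Suc (degree q')" unfolding q' by (subst degree_mult_eq) auto
      then show ?thesis using Suc.hyps(1)[of q'] Suc.hyps(2) 2 \<open>q' \<noteq> 0\<close> by auto
    qed blast
  qed
qed

text \<open>An ideal \<open>P\<close> that is maximal among those avoiding the powers of
  \<open>f\<close> is the ideal of a point. If no \<open>mvar j - mconst b\<close> were in
  \<open>P\<close>, the inverses of these forms would satisfy a linear relation with one common
  denominator, a power of \<open>f\<close>, and clearing denominators would put a nonzero univariate
  polynomial in \<open>mvar j\<close> into \<open>P\<close>.\<close>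

theorem strong_nullstellensatz:
  fixes I :: "('v::countable, 'k::alg_closed_field) mpoly set"
  assumes unc: "uncountable (UNIV :: 'k set)" and I: "ideal_in (polys_in V) I"
    and f: "f \<in> polys_in V" "\<And>k. f ^ k \<notin> I"
  obtains x where "\<And>p. p \<in> I \<Longrightarrow> poly_eval x p = 0" "poly_eval x f \<noteq> 0"
proof -
  let ?S = "range (\<lambda>k. f ^ k)"
  obtain P where P: "maximal_avoiding (polys_in V) ?S P" "I \<subseteq> P"
    using ex_maximal_avoiding[OF I, of ?S] f by blast
  have "1 \<in> ?S" by (metis power_0 rangeI)
  moreover have "s * t \<in> ?S" if "s \<in> ?S" "t \<in> ?S" for s t
    using that by (auto simp flip: power_add)
  ultimately have pr: "prime_in (polys_in V) P" by (rule maximal_avoiding_prime[OF P(1)])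
  then have id: "ideal_in (polys_in V) P" and one: "1 \<notin> P" by (auto simp: prime_in_def)
  have fk: "f ^ k \<notin> P" for k using P(1) by (auto simp: maximal_avoiding_def)
  have Ssub: "?S \<subseteq> polys_in V" using f by (auto intro: polys_in_power)
  have "\<exists>b. mvar j - mconst b \<in> P" if j: "j \<in> V" for j
  proof (rule ccontr)
    assume "\<not> ?thesis"
    then have no: "\<And>a. mvar j - mconst a \<notin> P" by blast
    define \<kappa> where "\<kappa> s = (SOME k. s = f ^ k)" for s
    have \<kappa>: "s = f ^ \<kappa> s" if "s \<in> ?S" for s
      unfolding \<kappa>_def by (rule someI_ex) (use that in blast)
    obtain A l s where A: "finite A" "A \<noteq> {}" "\<And>a. a \<in> A \<Longrightarrow> l a \<noteq> 0" "\<And>a. s a \<in> ?S"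
      "\<And>a b. a \<in> A \<Longrightarrow> b \<in> A \<Longrightarrow> \<kappa> (s a) = \<kappa> (s b)"
      "(\<Sum>a\<in>A. mconst (l a) * s a * (\<Prod>b\<in>A - {a}. mvar j - mconst b)) \<in> P"
      by (rule avoiding_relation[OF unc P(1) Ssub j no, of \<kappa>]) (rule that)
    obtain a0 where a0: "a0 \<in> A" using A(2) by blast
    \<comment> \<open>The numerator of the sum of the partial fractions
      \<open>l a / (x - a)\<close>. Its value at \<open>a0\<close> comes from a single summand, so
      it is nonzero.\<close>
    define q where "q = (\<Sum>a\<in>A. Polynomial.smult (l a) (\<Prod>b\<in>A - {a}. [:- b, 1:]))"
    have "poly q a0 = l a0 * (\<Prod>b\<in>A - {a0}. a0 - b)"
    proof -
      have "poly q a0 = (\<Sum>a\<in>A. l a * (\<Prod>b\<in>A - {a}. a0 - b))"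
        by (simp add: q_def poly_sum poly_prod)
      also have "\<dots> = (\<Sum>a\<in>{a0}. l a * (\<Prod>b\<in>A - {a}. a0 - b))"
        by (rule sum.mono_neutral_right) (use A(1) a0 in \<open>auto simp: prod_zero_iff\<close>)
      finally show ?thesis by simp
    qed
    then have "q \<noteq> 0" using A(1,3) a0 by (auto simp: prod_zero_iff)
    interpret mc: comm_ring_hom "mconst :: 'k \<Rightarrow> ('v, 'k) mpoly"
      by unfold_locales (auto simp: mconst_1 mconst_add mconst_mult)
    interpret mp: map_poly_comm_ring_hom "mconst :: 'k \<Rightarrow> ('v, 'k) mpoly" ..
    have "poly (map_poly mconst q) (mvar j) = (\<Sum>a\<in>A. mconst (l a) * (\<Prod>b\<in>A - {a}. mvar j - mconst b))"
      unfolding q_def mp.hom_sum poly_sum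
    proof (rule sum.cong)
      fix a
      have c: "map_poly mconst [:c:] = [:mconst c :: ('v, 'k) mpoly:]" for c :: 'k
        by (cases "c = 0") (simp_all add: map_poly_pCons)
      have "Polynomial.smult (l a) r = [:l a:] * r" for r by simp
      then have "poly (map_poly mconst (Polynomial.smult (l a) (\<Prod>b\<in>A - {a}. [:- b, 1:]))) (mvar j)
         = poly (map_poly mconst [:l a:]) (mvar j) * (\<Prod>b\<in>A - {a}. poly (map_poly mconst [:- b, 1:]) (mvar j))"
        by (simp only: mp.hom_mult mp.hom_prod poly_mult poly_prod)
      then show "poly (map_poly mconst (Polynomial.smult (l a) (\<Prod>b\<in>A - {a}. [:- b, 1:]))) (mvar j)
         = mconst (l a) * (\<Prod>b\<in>A - {a}. mvar j - mconst b)"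
        by (simp add: c map_poly_pCons mc.hom_uminus mconst_1)
    qed simp
    also have "f ^ \<kappa> (s a0) * \<dots> = (\<Sum>a\<in>A. mconst (l a) * s a * (\<Prod>b\<in>A - {a}. mvar j - mconst b))"
      unfolding sum_distrib_left
    proof (rule sum.cong)
      fix a assume "a \<in> A"
      then have "s a = f ^ \<kappa> (s a0)" using \<kappa>[OF A(4)[of a]] A(5)[OF \<open>a \<in> A\<close> a0] by simp
      then show "f ^ \<kappa> (s a0) * (mconst (l a) * (\<Prod>b\<in>A - {a}. mvar j - mconst b))
        = mconst (l a) * s a * (\<Prod>b\<in>A - {a}. mvar j - mconst b)" by (simp add: ac_simps)
    qed simp
    finally have prodP: "f ^ \<kappa> (s a0) * poly (map_poly mconst q) (mvar j) \<in> P" using A(6) by simp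
    have "poly (map_poly mconst q) (mvar j) \<in> polys_in V" for q :: "'k poly"
      using j by (induction q) (auto simp: map_poly_pCons)
    then have "poly (map_poly mconst q) (mvar j) \<in> P"
      using prodP pr fk polys_in_power[OF f(1)] unfolding prime_in_def by metis
    then show False using prime_contains_linear[OF pr j \<open>q \<noteq> 0\<close>] no by blast
  qed
  then obtain x where x: "\<And>j. j \<in> V \<Longrightarrow> mvar j - mconst (x j) \<in> P" by metis
  \<comment> \<open>Modulo \<open>P\<close> every polynomial equals its value at \<open>x\<close>,
    so membership in \<open>P\<close> means vanishing at \<open>x\<close>.\<close>
  have cong: "g - mconst (poly_eval x g) \<in> P" if "g \<in> polys_in V" for g
    using that
  proof (induction g rule: mpoly_induct)
    case (mconst c)
    then show ?case using id by (simp add: ideal_in_def)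
  next
    case (mvar i)
    then show ?case using x by simp
  next
    case (add f g)
    have "f + g - mconst (poly_eval x (f + g)) = (f - mconst (poly_eval x f)) + (g - mconst (poly_eval x g))"
      by (simp add: mconst_add)
    then show ?case using id add unfolding ideal_in_def by metis
  next
    case (mult f g)
    have "f * g - mconst (poly_eval x (f * g))
        = f * (g - mconst (poly_eval x g)) + mconst (poly_eval x g) * (f - mconst (poly_eval x f))"
      by (simp add: mconst_mult algebra_simps)
    then show ?case using id mult polys_in_mconst unfolding ideal_in_def by metis
  qed
  have const: "c = 0" if "mconst c \<in> P" for c
  proof (rule ccontr)
    assume "c \<noteq> 0"
    have "mconst (1 / c) * mconst c \<in> P" using id that by (auto simp: ideal_in_def)
    then show False using one \<open>c \<noteq> 0\<close> by (simp flip: mconst_mult add: mconst_1)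
  qed
  show thesis
  proof (rule that[of x])
    fix p assume "p \<in> I"
    then have p: "p \<in> P" "p \<in> polys_in V" using P(2) I by (auto simp: ideal_in_def)
    have "p - (p - mconst (poly_eval x p)) \<in> P" by (rule ideal_in_diff[OF id p(1) cong[OF p(2)]])
    then show "poly_eval x p = 0" using const by simp
  next
    show "poly_eval x f \<noteq> 0"
      using cong[OF f(1)] fk[of 1] by auto
  qed
qed

lemma polys_in_nonzero_prime:
  fixes P :: "(nat, 'k::field) mpoly set"
  assumes "maximal_avoiding (polys_in V) (polys_in W - {0}) P"
  shows "prime_in (polys_in V) P"
  by (rule maximal_avoiding_prime[OF assms]) auto

text \<open>
  If every \<open>x\<^sub>j - a\<close> is a unit modulo \<open>P\<close> after localization, clearing denominators in a linear
  relation between their inverses is an algebraic relation for \<open>x\<^sub>j\<close>.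
\<close>

lemma maximal_avoiding_algebraic:
  fixes P :: "(nat, 'k::field_char_0) mpoly set"
  assumes unc: "uncountable (UNIV :: 'k set)"
    and P: "maximal_avoiding (polys_in V) (polys_in W - {0}) P" and W: "W \<subseteq> V" and j: "j \<in> V" "j \<notin> W"
  shows "\<exists>g\<in>P. g \<noteq> 0 \<and> g \<in> polys_in (insert j W)"
proof (cases "\<exists>a. mvar j - mconst a \<in> P")
  case True
  then obtain a where a: "mvar j - mconst a \<in> P" by blast
  have "poly_eval (\<lambda>_. a + 1) (mvar j - mconst a) \<noteq> 0" by simp
  then have "mvar j - mconst a \<noteq> 0" by (metis poly_eval_0)
  with a show ?thesis by (intro bexI[of _ "mvar j - mconst a"]) auto
next
  case False
  have sub: "polys_in W - {0} \<subseteq> polys_in V" using polys_in_mono[OF W] by blast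
  have notin: "\<And>a. mvar j - mconst a \<notin> P" using False by blast
  obtain A l s where A: "finite A" "A \<noteq> {}" "\<And>a. a \<in> A \<Longrightarrow> l a \<noteq> 0" "\<And>a. s a \<in> polys_in W - {0}"
      "\<And>a b. a \<in> A \<Longrightarrow> b \<in> A \<Longrightarrow> (0::nat) = 0"
      "(\<Sum>a\<in>A. mconst (l a) * s a * (\<Prod>b\<in>A - {a}. mvar j - mconst b)) \<in> P"
    by (rule avoiding_relation[OF unc P sub j(1) notin, of "\<lambda>_. 0"]) (rule that)
  let ?g = "\<Sum>a\<in>A. mconst (l a) * s a * (\<Prod>b\<in>A - {a}. mvar j - mconst b)"
  obtain a0 where a0: "a0 \<in> A" using A(2) by blast
  obtain v where v: "poly_eval v (s a0) \<noteq> 0" using nonvanishing_point[of "s a0"] A(4) by blast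
  \<comment> \<open>Setting \<open>mvar j\<close> to \<open>a0\<close> leaves only the summand of
    \<open>a0\<close>, and does not affect the factor \<open>s a0\<close>, which is free of
    \<open>mvar j\<close>.\<close>
  have seval: "poly_eval (v(j := a0)) (s a) = poly_eval v (s a)" for a
    by (rule poly_eval_cong[of _ W]) (use A(4) j(2) in auto)
  have "poly_eval (v(j := a0)) ?g = (\<Sum>a\<in>A. l a * poly_eval v (s a) * (\<Prod>b\<in>A - {a}. a0 - b))"
    by (simp add: seval)
  also have "\<dots> = (\<Sum>a\<in>{a0}. l a * poly_eval v (s a) * (\<Prod>b\<in>A - {a}. a0 - b))"
    by (rule sum.mono_neutral_right) (use A(1) a0 in \<open>auto simp: prod_zero_iff\<close>)
  also have "\<dots> \<noteq> 0" using v A(1,3) a0 by (auto simp: prod_zero_iff)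
  finally have "?g \<noteq> 0" by (metis poly_eval_0)
  moreover have "?g \<in> polys_in (insert j W)"
    using A(4) polys_in_mono[of W "insert j W"]
    by (intro polys_in_sum polys_in_mult polys_in_prod polys_in_diff) auto
  ultimately show ?thesis using A(6) by blast
qed

section \<open>Dimension\<close>

text \<open>Each variable that is dropped gives a strict inclusion: \<open>P'\<close> avoids only
  the nonzero polynomials in the smaller set \<open>J\<close> and by maximality contains a nonzero
  polynomial in \<open>insert j J\<close>, whereas \<open>P\<close> contains none. This bounds the
  dimension from below by the number of algebraically independent coordinates.\<close>

lemma prime_chain:
  fixes P :: "(nat, 'k::field_char_0) mpoly set"
  assumes unc: "uncountable (UNIV :: 'k set)"
    and "prime_in (polys_in V) P" "P \<inter> (polys_in J - {0}) = {}" "finite J" "J \<subseteq> V"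
  shows "\<exists>Q. (\<forall>i\<le>card J. prime_in (polys_in V) (Q i) \<and> P \<subseteq> Q i) \<and> (\<forall>i<card J. Q i \<subset> Q (Suc i))"
  using assms(4,2,3,5)
proof (induction J arbitrary: P rule: finite_induct)
  case empty
  then show ?case by (intro exI[of _ "\<lambda>_. P"]) auto
next
  case (insert j J)
  have id: "ideal_in (polys_in V) P" using insert.prems by (simp add: prime_in_def)
  have "P \<inter> (polys_in J - {0}) = {}"
    using insert.prems(2) polys_in_mono[of J "insert j J"] by blast
  then obtain P' where P': "maximal_avoiding (polys_in V) (polys_in J - {0}) P'" "P \<subseteq> P'"
    using ex_maximal_avoiding[OF id] by blast
  have "\<exists>g\<in>P'. g \<noteq> 0 \<and> g \<in> polys_in (insert j J)"
    by (rule maximal_avoiding_algebraic[OF unc P'(1)]) (use insert in auto)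
  then have "P \<noteq> P'" using insert.prems(2) by blast
  have "P' \<inter> (polys_in J - {0}) = {}" using P'(1) by (simp add: maximal_avoiding_def)
  then obtain Q where Q: "\<forall>i\<le>card J. prime_in (polys_in V) (Q i) \<and> P' \<subseteq> Q i"
    "\<forall>i<card J. Q i \<subset> Q (Suc i)"
    using insert.IH[OF polys_in_nonzero_prime[OF P'(1)]] insert.prems by auto
  show ?case
  proof (intro exI[of _ "\<lambda>i. if i = 0 then P else Q (i - 1)"] conjI allI impI)
    fix i assume "i \<le> card (insert j J)"
    then have i: "i - 1 \<le> card J" using insert.hyps by simp
    show "prime_in (polys_in V) (if i = 0 then P else Q (i - 1))"
      "P \<subseteq> (if i = 0 then P else Q (i - 1))"
      using insert.prems(1) Q(1)[rule_format, OF i] P'(2) by auto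
  next
    fix i assume "i < card (insert j J)"
    then have i: "i \<le> card J" using insert by simp
    show "(if i = 0 then P else Q (i - 1)) \<subset> (if Suc i = 0 then P else Q (Suc i - 1))"
    proof (cases i)
      case 0
      then show ?thesis using Q(1) P'(2) \<open>P \<noteq> P'\<close> by auto
    next
      case (Suc k)
      then show ?thesis using Q(2) i by auto
    qed
  qed
qed

section \<open>Zariski closures and irreducible components\<close>

definition vanishing_ideal :: "nat \<Rightarrow> 'k::comm_ring_1 vec set \<Rightarrow> (nat, 'k) mpoly set" where
  "vanishing_ideal n X = {f \<in> polys_in {..<n}. \<forall>x\<in>X. poly_eval (vec_index x) f = 0}"

lemma ideal_vanishing_ideal: "ideal_in (polys_in {..<n}) (vanishing_ideal n X)"
  by (auto simp: ideal_in_def vanishing_ideal_def)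

lemma affine_varietyI: "S \<subseteq> polys_in {..<n} \<Longrightarrow> affine_variety n (zero_locus n S)"
  by (auto simp: affine_variety_def)

lemma closure_affine: "affine_variety n (zero_locus n (vanishing_ideal n Y))"
  by (rule affine_varietyI) (auto simp: vanishing_ideal_def)

lemma closure_upper: "Y \<subseteq> carrier_vec n \<Longrightarrow> Y \<subseteq> zero_locus n (vanishing_ideal n Y)"
  by (auto simp: zero_locus_def vanishing_ideal_def)

lemma closure_least:
  assumes "affine_variety n Z" "Y \<subseteq> Z" shows "zero_locus n (vanishing_ideal n Y) \<subseteq> Z"
proof -
  obtain S where S: "S \<subseteq> polys_in {..<n}" "Z = zero_locus n S"
    using assms(1) by (auto simp: affine_variety_def)
  then have "S \<subseteq> vanishing_ideal n Y" using assms(2) by (auto simp: zero_locus_def vanishing_ideal_def)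
  then show ?thesis unfolding S(2) by (auto simp: zero_locus_def)
qed

lemma affine_Int: "affine_variety n A \<Longrightarrow> affine_variety n B \<Longrightarrow> affine_variety n (A \<inter> B)"
  unfolding affine_variety_def
proof (elim exE conjE)
  fix S T assume "S \<subseteq> polys_in {..<n}" "A = zero_locus n S" "T \<subseteq> polys_in {..<n}" "B = zero_locus n T"
  then show "\<exists>S\<subseteq>polys_in {..<n}. A \<inter> B = zero_locus n S"
    by (intro exI[of _ "S \<union> T"]) (auto simp: zero_locus_def)
qed

lemma affine_carrier: "affine_variety n A \<Longrightarrow> A \<subseteq> carrier_vec n"
  by (auto simp: affine_variety_def zero_locus_def)

lemma irreducible_subset_Un:
  assumes "irreducible_variety n W" "affine_variety n A" "affine_variety n B" "W \<subseteq> A \<union> B"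
  shows "W \<subseteq> A \<or> W \<subseteq> B"
proof -
  have "W = (W \<inter> A) \<union> (W \<inter> B)" using assms(4) by blast
  moreover have "affine_variety n (W \<inter> A)" "affine_variety n (W \<inter> B)"
    using assms(1-3) by (auto simp: irreducible_variety_def intro: affine_Int)
  ultimately have "W = W \<inter> A \<or> W = W \<inter> B" using assms(1) unfolding irreducible_variety_def by blast
  then show ?thesis by blast
qed

text \<open>Zorn's lemma, with the Zariski closure
  \<open>zero_locus n (vanishing_ideal n (\<Union>C))\<close> as upper bound of a chain
  \<open>C\<close>. It is irreducible: if closed sets \<open>A\<close> and \<open>B\<close> cover
  it, each member of \<open>C\<close> lies in one of them, and as \<open>C\<close> is totally
  ordered, one of the two contains all members.\<close>

lemma ex_irreducible_component:
  assumes X: "affine_variety n X" and W: "irreducible_variety n W" "W \<subseteq> X"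
  obtains Z where "irreducible_component n X Z" "W \<subseteq> Z"
proof -
  let ?A = "{Z. irreducible_variety n Z \<and> W \<subseteq> Z \<and> Z \<subseteq> X}"
  have "\<exists>M\<in>?A. \<forall>Z\<in>?A. M \<subseteq> Z \<longrightarrow> Z = M"
  proof (rule subset_Zorn)
    fix C assume C: "subset.chain ?A C"
    then have sub: "\<And>Q. Q \<in> C \<Longrightarrow> Q \<in> ?A" and tot: "\<And>Q Q'. Q \<in> C \<Longrightarrow> Q' \<in> C \<Longrightarrow> Q \<subseteq> Q' \<or> Q' \<subseteq> Q"
      unfolding subset.chain_def by blast+
    show "\<exists>U\<in>?A. \<forall>Q\<in>C. Q \<subseteq> U"
    proof (cases "C = {}")
      case True
      then show ?thesis using W by blast
    next
      case False
      let ?U = "zero_locus n (vanishing_ideal n (\<Union>C))"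
      have "\<Union>C \<subseteq> X" using sub by blast
      then have up: "\<Union>C \<subseteq> ?U" using affine_carrier[OF X] by (intro closure_upper) blast
      have irr: "?U = A \<or> ?U = B" if AB: "affine_variety n A" "affine_variety n B" "?U = A \<union> B" for A B
      proof -
        have *: "Q \<subseteq> A \<or> Q \<subseteq> B" if "Q \<in> C" for Q
          using irreducible_subset_Un[OF _ AB(1,2), of Q] sub[OF that] that up AB(3) by blast
        have "\<Union>C \<subseteq> A \<or> \<Union>C \<subseteq> B"
        proof (rule ccontr)
          assume "\<not> ?thesis"
          then obtain Q Q' where "Q \<in> C" "Q' \<in> C" "\<not> Q \<subseteq> A" "\<not> Q' \<subseteq> B" by blast
          then show False using * tot[of Q Q'] by blast
        qed
        then have "?U \<subseteq> A \<or> ?U \<subseteq> B" using closure_least AB(1,2) by blast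
        then show ?thesis using AB(3) by blast
      qed
      obtain Q where "Q \<in> C" using False by blast
      then have "W \<subseteq> ?U" using sub[of Q] up by blast
      moreover have "W \<noteq> {}" using W(1) by (simp add: irreducible_variety_def)
      ultimately have "?U \<noteq> {}" by blast
      then have "irreducible_variety n ?U"
        unfolding irreducible_variety_def using irr closure_affine[of n "\<Union>C"] by metis
      moreover have "?U \<subseteq> X" using closure_least[OF X \<open>\<Union>C \<subseteq> X\<close>] .
      ultimately show ?thesis using \<open>W \<subseteq> ?U\<close> up by (intro bexI[of _ ?U]) auto
    qed
  qed
  then obtain M where "M \<in> ?A" "\<forall>Z\<in>?A. M \<subseteq> Z \<longrightarrow> Z = M" by blast
  then show thesis using that[of M] unfolding irreducible_component_def by blast
qed

text \<open>By primality no power of \<open>f\<close> lies in \<open>P\<close>, which is what the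
  Nullstellensatz asks for.\<close>

lemma prime_point:
  fixes P :: "(nat, 'k::alg_closed_field) mpoly set"
  assumes unc: "uncountable (UNIV :: 'k set)" and P: "prime_in (polys_in {..<n}) P"
    and f: "f \<in> polys_in {..<n}" "f \<notin> P"
  obtains x where "x \<in> zero_locus n P" "poly_eval (vec_index x) f \<noteq> 0"
proof -
  have id: "ideal_in (polys_in {..<n}) P" using P by (simp add: prime_in_def)
  have "f ^ k \<notin> P" for k
    using P f polys_in_power[OF f(1)] by (induction k) (auto simp: prime_in_def)
  then obtain x where x: "\<And>p. p \<in> P \<Longrightarrow> poly_eval x p = 0" "poly_eval x f \<noteq> 0"
    using strong_nullstellensatz[OF unc id f(1)] by metis
  have "poly_eval (vec_index (vec n x)) p = poly_eval x p" if "p \<in> polys_in {..<n}" for p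
    by (rule poly_eval_cong[OF that]) auto
  moreover have "P \<subseteq> polys_in {..<n}" using id by (simp add: ideal_in_def)
  ultimately have "vec n x \<in> zero_locus n P" "poly_eval (vec_index (vec n x)) f \<noteq> 0"
    using x f(1) by (auto simp: zero_locus_def)
  then show thesis by (rule that)
qed

lemma prime_irreducible:
  fixes P :: "(nat, 'k::alg_closed_field) mpoly set"
  assumes unc: "uncountable (UNIV :: 'k set)" and P: "prime_in (polys_in {..<n}) P"
  shows "irreducible_variety n (zero_locus n P)"
  unfolding irreducible_variety_def
proof (intro conjI allI impI)
  have "P \<subseteq> polys_in {..<n}" using P by (simp add: prime_in_def ideal_in_def)
  then show "affine_variety n (zero_locus n P)" by (rule affine_varietyI)
  have "1 \<notin> P" using P by (simp add: prime_in_def)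
  then show "zero_locus n P \<noteq> {}" using prime_point[OF unc P, of 1] by auto
  fix A B assume AB: "affine_variety n A \<and> affine_variety n B \<and> zero_locus n P = A \<union> B"
  then obtain S T where S: "S \<subseteq> polys_in {..<n}" "A = zero_locus n S"
    and T: "T \<subseteq> polys_in {..<n}" "B = zero_locus n T" unfolding affine_variety_def by blast
  show "zero_locus n P = A \<or> zero_locus n P = B"
  proof (rule ccontr)
    assume "\<not> ?thesis"
    then obtain x y where "x \<in> zero_locus n P" "x \<notin> A" "y \<in> zero_locus n P" "y \<notin> B" using AB by blast
    then obtain f g where fg: "f \<in> S" "poly_eval (vec_index x) f \<noteq> 0" "g \<in> T" "poly_eval (vec_index y) g \<noteq> 0"
      unfolding S T zero_locus_def by blast
    then have "f \<notin> P" "g \<notin> P"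
      using \<open>x \<in> zero_locus n P\<close> \<open>y \<in> zero_locus n P\<close> by (auto simp: zero_locus_def)
    moreover have "f \<in> polys_in {..<n}" "g \<in> polys_in {..<n}" using fg S(1) T(1) by blast+
    ultimately have "f * g \<notin> P" "f * g \<in> polys_in {..<n}" using P unfolding prime_in_def by auto
    then obtain z where "z \<in> zero_locus n P" "poly_eval (vec_index z) (f * g) \<noteq> 0"
      using prime_point[OF unc P] by metis
    then show False using AB fg unfolding S T by (auto simp: zero_locus_def)
  qed
qed

text \<open>If the coordinates in \<open>J\<close> were independent on \<open>X\<close>, the
  vanishing ideal would lie under a chain of d + 2 primes. Their zero loci form a chain of d + 2
  irreducible sets inside one component of \<open>X\<close>, against its dimension.\<close>

lemma coordinates_dependent:
  fixes X :: "'k::{alg_closed_field, field_char_0} vec set"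
  assumes unc: "uncountable (UNIV :: 'k set)" and X: "equidimensional n d X"
    and J: "J \<subseteq> {..<n}" "card J = Suc d"
  shows "\<exists>g\<in>polys_in J. g \<noteq> 0 \<and> (\<forall>x\<in>X. poly_eval (vec_index x) g = 0)"
proof (rule ccontr)
  assume no: "\<not> ?thesis"
  let ?R = "polys_in {..<n} :: (nat, 'k) mpoly set"
  have fin: "finite J" using J(1) finite_subset by blast
  have aff: "affine_variety n X" using X by (simp add: equidimensional_def)
  have "vanishing_ideal n X \<inter> (polys_in J - {0}) = {}" using no by (auto simp: vanishing_ideal_def)
  then obtain P where P: "maximal_avoiding ?R (polys_in J - {0}) P" "vanishing_ideal n X \<subseteq> P"
    using ex_maximal_avoiding[OF ideal_vanishing_ideal] by metis
  have "P \<inter> (polys_in J - {0}) = {}" using P(1) by (simp add: maximal_avoiding_def)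
  from prime_chain[OF unc polys_in_nonzero_prime[OF P(1)] this fin J(1)]
  obtain Q where Q: "\<And>i. i \<le> Suc d \<Longrightarrow> prime_in ?R (Q i)" "\<And>i. i \<le> Suc d \<Longrightarrow> P \<subseteq> Q i"
    "\<And>i. i < Suc d \<Longrightarrow> Q i \<subset> Q (Suc i)" unfolding J(2) by metis
  \<comment> \<open>Strictness survives the passage to zero loci by the Nullstellensatz.\<close>
  have strict: "zero_locus n (Q (Suc i)) \<subset> zero_locus n (Q i)" if i: "i < Suc d" for i
  proof -
    obtain f where f: "f \<in> Q (Suc i)" "f \<notin> Q i" using Q(3)[OF i] by blast
    then have "f \<in> ?R" using Q(1)[of "Suc i"] i by (auto simp: prime_in_def ideal_in_def)
    then obtain x where "x \<in> zero_locus n (Q i)" "poly_eval (vec_index x) f \<noteq> 0"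
      using prime_point[OF unc Q(1)[of i] _ f(2)] i by auto
    moreover from this f(1) have "x \<notin> zero_locus n (Q (Suc i))" by (auto simp: zero_locus_def)
    moreover have "zero_locus n (Q (Suc i)) \<subseteq> zero_locus n (Q i)"
      using Q(3)[OF i] by (auto simp: zero_locus_def)
    ultimately show ?thesis by blast
  qed
  let ?W = "zero_locus n P"
  have W: "irreducible_variety n ?W" by (rule prime_irreducible[OF unc polys_in_nonzero_prime[OF P(1)]])
  have "?W \<subseteq> zero_locus n (vanishing_ideal n X)" using P(2) by (auto simp: zero_locus_def)
  also have "\<dots> \<subseteq> X" by (rule closure_least[OF aff]) simp
  finally obtain Z where Z: "irreducible_component n X Z" "?W \<subseteq> Z"
    using ex_irreducible_component[OF aff W] by blast
  have "irreducible_chain n Z (Suc d)"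
    unfolding irreducible_chain_def
  proof (intro exI[of _ "\<lambda>i. zero_locus n (Q (Suc d - i))"] conjI allI impI)
    fix i assume "i \<le> Suc d"
    show "irreducible_variety n (zero_locus n (Q (Suc d - i)))"
      by (rule prime_irreducible[OF unc Q(1)]) simp
    have "zero_locus n (Q (Suc d - i)) \<subseteq> ?W"
      using Q(2)[of "Suc d - i"] by (auto simp: zero_locus_def)
    then show "zero_locus n (Q (Suc d - i)) \<subseteq> Z" using Z(2) by blast
  next
    fix i assume i: "i < Suc d"
    then have eq: "Suc d - i = Suc (Suc d - Suc i)" by simp
    show "zero_locus n (Q (Suc d - i)) \<subset> zero_locus n (Q (Suc d - Suc i))"
      unfolding eq by (rule strict) simp
  qed
  moreover have "has_dimension n Z d" using X Z(1) by (simp add: equidimensional_def)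
  ultimately show False by (simp add: has_dimension_def)
qed

section \<open>Maximal minors\<close>

text \<open>The column sequence \<open>s\<close> may be unsorted or have repetitions, as happens
  when Cramer's rule replaces one column by another.\<close>

definition col_det :: "nat \<Rightarrow> 'k::comm_ring_1 mat \<Rightarrow> (nat \<Rightarrow> nat) \<Rightarrow> 'k" where
  "col_det c A s = Determinant.det (mat c c (\<lambda>(r, k). A $$ (r, s k)))"

lemma row_comb_index:
  assumes "A \<in> carrier_mat c n" "y \<in> carrier_vec c" "j < n"
  shows "(A\<^sup>T *\<^sub>v y) $ j = (\<Sum>r<c. A $$ (r, j) * y $ r)"
  using assms by (auto simp: scalar_prod_def atLeast0LessThan intro!: sum.cong)

lemma row_space_char:
  fixes A :: "'k::field mat"
  assumes "A \<in> carrier_mat c n"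
  shows "vec_space.row_space n A = {A\<^sup>T *\<^sub>v y | y. y \<in> carrier_vec c}"
proof -
  interpret vec_space "TYPE('k)" n .
  show ?thesis unfolding row_space_eq[OF assms] using assms by auto
qed

lemma plucker_indices_pick:
  assumes "I \<in> plucker_indices c n"
  shows "\<And>k. k < c \<Longrightarrow> pick I k \<in> I" "\<And>k. k < c \<Longrightarrow> pick I k < n" "inj_on (pick I) {..<c}"
    "pick I ` {..<c} = I"
proof -
  have I: "I \<subseteq> {..<n}" "card I = c" "finite I"
    using assms finite_subset[of I "{..<n}"] by (auto simp: plucker_indices_def)
  show 1: "\<And>k. k < c \<Longrightarrow> pick I k \<in> I" using I(2) pick_in_set_le by blast
  then show "\<And>k. k < c \<Longrightarrow> pick I k < n" using I(1) by blast
  show 2: "inj_on (pick I) {..<c}"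
  proof (rule inj_onI)
    fix x y assume "x \<in> {..<c}" "y \<in> {..<c}" "pick I x = pick I y"
    then show "x = y" using card_pick_le I(2) by (metis lessThan_iff)
  qed
  show "pick I ` {..<c} = I"
    by (rule card_subset_eq[OF I(3)]) (use 1 2 I(2) in \<open>auto simp: card_image\<close>)
qed

lemma plucker_coord_eq_col_det:
  assumes A: "A \<in> carrier_mat c n" and I: "I \<in> plucker_indices c n"
  shows "plucker_coord A I = col_det c A (pick I)"
proof -
  have "{j. j < n \<and> j \<in> I} = I" "card I = c" using I by (auto simp: plucker_indices_def)
  then have "submatrix A UNIV I = mat c c (\<lambda>(r, k). A $$ (r, pick I k))"
    using A by (intro eq_matI) (auto simp: submatrix_def pick_UNIV)
  then show ?thesis by (simp add: plucker_coord_def col_det_def)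
qed

lemma col_det_permute:
  fixes A :: "'k::comm_ring_1 mat"
  assumes p: "p permutes {0..<c}"
  shows "col_det c A (s \<circ> p) = signof p * col_det c A s"
proof -
  let ?B = "mat c c (\<lambda>(r, k). A $$ (r, s k))"
  have pc: "p k < c" if "k < c" for k using p that permutes_in_image[OF p] by auto
  have "col_det c A (s \<circ> p) = Determinant.det ((mat c c (\<lambda>(r, k). A $$ (r, (s \<circ> p) k)))\<^sup>T)"
    unfolding col_det_def by (rule det_transpose[symmetric]) auto
  also have "(mat c c (\<lambda>(r, k). A $$ (r, (s \<circ> p) k)))\<^sup>T = mat c c (\<lambda>(i, j). ?B\<^sup>T $$ (p i, j))"
    using pc by (intro eq_matI) auto
  also have "Determinant.det \<dots> = signof p * Determinant.det (?B\<^sup>T)"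
    by (rule det_permute_rows[OF _ p]) auto
  also have "Determinant.det (?B\<^sup>T) = col_det c A s" unfolding col_det_def by (rule det_transpose) auto
  finally show ?thesis .
qed

lemma col_det_cong: "(\<And>k. k < c \<Longrightarrow> s k = s' k) \<Longrightarrow> col_det c A s = col_det c A s'"
  unfolding col_det_def by (intro arg_cong[of _ _ Determinant.det] eq_matI) auto

text \<open>With repeated columns the determinant is 0. Otherwise it is, up to the sign of the
  sorting permutation, the Pluecker coordinate of the set of columns.\<close>

lemma col_det_plucker_poly:
  assumes s: "\<And>k. k < c \<Longrightarrow> s k < n"
  obtains q :: "(nat set, 'k::comm_ring_1) mpoly" where "q \<in> polys_in (plucker_indices c n)"
    "\<And>A. A \<in> carrier_mat c n \<Longrightarrow> poly_eval (plucker_coord A) q = col_det c A s"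
proof (cases "inj_on s {..<c}")
  case False
  then obtain i j where ij: "i < c" "j < c" "i \<noteq> j" "s i = s j" by (auto simp: inj_on_def)
  have "col_det c A s = 0" if "A \<in> carrier_mat c n" for A :: "'k mat"
    unfolding col_det_def
    by (rule det_identical_columns[of _ c i j]) (use ij in \<open>auto intro!: eq_vecI\<close>)
  then show thesis using that[of 0] by simp
next
  case True
  let ?I = "s ` {..<c}"
  have I: "?I \<in> plucker_indices c n" using s True by (auto simp: plucker_indices_def card_image)
  note pk = plucker_indices_pick[OF I]
  define p where "p k = (if k < c then the_inv_into {..<c} (pick ?I) (s k) else k)" for k
  have "bij_betw p {..<c} {..<c}"
  proof -
    have "bij_betw (the_inv_into {..<c} (pick ?I)) ?I {..<c}"
      using pk(3,4) by (intro bij_betw_the_inv_into) (simp add: bij_betw_def)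
    moreover have "bij_betw s {..<c} ?I" using True by (simp add: bij_betw_def)
    ultimately have "bij_betw (the_inv_into {..<c} (pick ?I) \<circ> s) {..<c} {..<c}" by (rule bij_betw_trans[rotated])
    then show ?thesis by (rule bij_betw_cong[THEN iffD1, rotated]) (simp add: p_def)
  qed
  then have perm: "p permutes {0..<c}"
    unfolding atLeast0LessThan by (rule bij_imp_permutes) (simp add: p_def)
  have sp: "s k = pick ?I (p k)" if "k < c" for k
    unfolding p_def using that pk(3,4) by (auto intro!: f_the_inv_into_f[symmetric])
  let ?q = "mconst (signof p) * mvar ?I :: (nat set, 'k) mpoly"
  show thesis
  proof (rule that[of ?q])
    show "?q \<in> polys_in (plucker_indices c n)" using I by simp
    fix A :: "'k mat" assume A: "A \<in> carrier_mat c n"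
    have "col_det c A s = col_det c A (pick ?I \<circ> p)" using sp by (intro col_det_cong) auto
    also have "\<dots> = signof p * plucker_coord A ?I"
      unfolding col_det_permute[OF perm] plucker_coord_eq_col_det[OF A I] ..
    finally show "poly_eval (plucker_coord A) ?q = col_det c A s" by simp
  qed
qed

text \<open>The selected columns form an invertible square matrix, so the entries of a row
  combination at these columns can be prescribed and determine the combination.\<close>

lemma col_det_solve:
  fixes A :: "'k::field mat"
  assumes A: "A \<in> carrier_mat c n" and s: "\<And>k. k < c \<Longrightarrow> s k < n" and nz: "col_det c A s \<noteq> 0"
  shows "\<exists>y\<in>carrier_vec c. \<forall>k<c. (A\<^sup>T *\<^sub>v y) $ s k = t k"
    and "\<And>y. y \<in> carrier_vec c \<Longrightarrow> (\<And>k. k < c \<Longrightarrow> (A\<^sup>T *\<^sub>v y) $ s k = 0) \<Longrightarrow> y = 0\<^sub>v c"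
proof -
  let ?B = "(mat c c (\<lambda>(r, k). A $$ (r, s k)))\<^sup>T"
  let ?d = "Determinant.det ?B"
  have B: "?B \<in> carrier_mat c c" by simp
  have d: "?d \<noteq> 0" using nz unfolding col_det_def by (subst det_transpose[of _ c]) auto
  have idx: "(A\<^sup>T *\<^sub>v y) $ s k = (?B *\<^sub>v y) $ k" if "y \<in> carrier_vec c" "k < c" for y k
    unfolding row_comb_index[OF A that(1) s[OF that(2)]]
    using that by (auto simp: scalar_prod_def atLeast0LessThan intro!: sum.cong)
  let ?y = "(1 / ?d) \<cdot>\<^sub>v (adj_mat ?B *\<^sub>v vec c t)"
  have adj: "adj_mat ?B \<in> carrier_mat c c" by (rule adj_mat(1)[OF B])
  have "?B *\<^sub>v ?y = (1 / ?d) \<cdot>\<^sub>v (?B *\<^sub>v (adj_mat ?B *\<^sub>v vec c t))"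
    by (rule mult_mat_vec[OF B]) (use adj in auto)
  also have "?B *\<^sub>v (adj_mat ?B *\<^sub>v vec c t) = (?B * adj_mat ?B) *\<^sub>v vec c t"
    by (rule assoc_mult_mat_vec[symmetric, OF B adj]) simp
  also have "\<dots> = (?d \<cdot>\<^sub>m 1\<^sub>m c) *\<^sub>v vec c t" by (simp only: adj_mat(2)[OF B])
  also have "\<dots> = ?d \<cdot>\<^sub>v vec c t"
  proof (rule eq_vecI)
    fix i assume "i < dim_vec (?d \<cdot>\<^sub>v vec c t)"
    then have i: "i < c" by simp
    have "(\<Sum>k = 0..<c. ?d * (if k = i then 1 else 0) * t k) = (\<Sum>k = 0..<c. if k = i then ?d * t k else 0)"
      by (rule sum.cong) auto
    then show "((?d \<cdot>\<^sub>m 1\<^sub>m c) *\<^sub>v vec c t) $ i = (?d \<cdot>\<^sub>v vec c t) $ i"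
      using i by (simp add: scalar_prod_def)
  qed simp
  finally have "?B *\<^sub>v ?y = vec c t" using d by (simp add: smult_smult_assoc)
  then have "\<forall>k<c. (A\<^sup>T *\<^sub>v ?y) $ s k = t k" using idx[of ?y] adj by simp
  then show "\<exists>y\<in>carrier_vec c. \<forall>k<c. (A\<^sup>T *\<^sub>v y) $ s k = t k"
    using adj by (intro bexI[of _ ?y]) auto
  fix y assume y: "y \<in> carrier_vec c" "\<And>k. k < c \<Longrightarrow> (A\<^sup>T *\<^sub>v y) $ s k = 0"
  then have "?B *\<^sub>v y = 0\<^sub>v c" using idx[OF y(1)] by (intro eq_vecI) auto
  then show "y = 0\<^sub>v c" using d det_0_iff_vec_prod_zero_field[OF B] y(1) by blast
qed

text \<open>Cramer's rule for expressing column \<open>j\<close> through the columns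
  \<open>s\<close>: the determinants with one column replaced are expanded along it, and a matrix
  times its adjugate is scalar.\<close>

lemma col_det_cramer:
  fixes A :: "'k::comm_ring_1 mat"
  assumes r: "r < c"
  shows "col_det c A s * A $$ (r, j) = (\<Sum>k<c. A $$ (r, s k) * col_det c A (s(k := j)))"
proof -
  let ?B = "mat c c (\<lambda>(r, k). A $$ (r, s k))"
  let ?C = "\<lambda>k. mat c c (\<lambda>(r, l). A $$ (r, (s(k := j)) l))"
  have B: "?B \<in> carrier_mat c c" by simp
  have exp: "col_det c A (s(k := j)) = (\<Sum>i<c. A $$ (i, j) * cofactor ?B i k)" if k: "k < c" for k
  proof -
    have "mat_delete (?C k) i k = mat_delete ?B i k" for i
      by (rule eq_matI) (auto simp: mat_delete_def)
    then have "cofactor (?C k) i k = cofactor ?B i k" for i by (simp add: cofactor_def)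
    then show ?thesis
      unfolding col_det_def using k by (subst laplace_expansion_column[of _ c k]) auto
  qed
  have orth: "(\<Sum>k<c. ?B $$ (r, k) * cofactor ?B i k) = (if i = r then Determinant.det ?B else 0)"
    if i: "i < c" for i
  proof -
    have "(?B * adj_mat ?B) $$ (r, i) = (\<Sum>k<c. ?B $$ (r, k) * cofactor ?B i k)"
      using r i adj_mat(1)[OF B]
      by (auto simp: times_mat_def scalar_prod_def adj_mat_def atLeast0LessThan intro!: sum.cong)
    also have "?B * adj_mat ?B = Determinant.det ?B \<cdot>\<^sub>m 1\<^sub>m c" by (rule adj_mat(2)[OF B])
    finally show ?thesis using r i by auto
  qed
  have "(\<Sum>k<c. A $$ (r, s k) * col_det c A (s(k := j)))
      = (\<Sum>k<c. \<Sum>i<c. A $$ (i, j) * (?B $$ (r, k) * cofactor ?B i k))"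
    using r by (intro sum.cong) (auto simp: exp sum_distrib_left ac_simps)
  also have "\<dots> = (\<Sum>i<c. A $$ (i, j) * (\<Sum>k<c. ?B $$ (r, k) * cofactor ?B i k))"
    unfolding sum_distrib_left by (rule sum.swap)
  also have "\<dots> = (\<Sum>i<c. if i = r then A $$ (r, j) * Determinant.det ?B else 0)"
    by (rule sum.cong) (auto simp: orth)
  also have "\<dots> = col_det c A s * A $$ (r, j)" using r by (simp add: col_det_def mult.commute)
  finally show ?thesis ..
qed

text \<open>A nonzero maximal minor bounds the rank from below by \<open>c\<close>, the number of
  rows bounds it from above.\<close>

lemma full_rank_of_plucker:
  fixes A :: "'k::field mat"
  assumes A: "A \<in> carrier_mat c n" and I: "I \<in> plucker_indices c n" "plucker_coord A I \<noteq> 0"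
  shows "A \<in> full_rank_mats c n"
proof -
  interpret vec_space "TYPE('k)" c .
  have "{j. j < n \<and> j \<in> I} = I" "card I = c" using I(1) by (auto simp: plucker_indices_def)
  then have ge: "c \<le> rank A" using rank_gt_minor[OF A, of UNIV I] I(2) by (simp add: plucker_coord_def)
  obtain S where S: "maximal S (\<lambda>T. T \<subseteq> set (cols A) \<and> lin_indpt T)"
    using maximal_exists_superset[of "set (cols A)" "\<lambda>T. T \<subseteq> set (cols A) \<and> lin_indpt T" "{}"]
    by (auto simp: lin_dep_def)
  then have "S \<subseteq> set (cols A)" "lin_indpt S" unfolding maximal_def by blast+
  moreover have "set (cols A) \<subseteq> carrier_vec c" using cols_dim[of A] A by auto
  ultimately have "card S \<le> c" using li_le_dim(2)[OF fin_dim, of S] dim_is_n by simp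
  then have "rank A = c" using rank_card_indpt[OF A S] ge by simp
  then show ?thesis using A by (simp add: full_rank_mats_def)
qed

section \<open>Zeros of the Chow form\<close>

lemma lookup_mconst_mult: "lookup (mconst c * f) e = c * lookup f e"
  for c :: "'k::comm_ring_1"
  unfolding mconst_def mult_map_scale_conv_mult[symmetric] by transfer (simp add: when_def)

lemma homogeneous_variety_scale:
  assumes "homogeneous_variety n X" "x \<in> X" shows "a \<cdot>\<^sub>v x \<in> X"
proof -
  obtain S where S: "S \<subseteq> polys_in {..<n}" "\<forall>f\<in>S. homogeneous_poly f" "X = zero_locus n S"
    using assms(1) by (auto simp: homogeneous_variety_def)
  have x: "x \<in> carrier_vec n" using assms(2) by (simp add: S zero_locus_def)
  have "poly_eval (vec_index (a \<cdot>\<^sub>v x)) f = 0" if f: "f \<in> S" for f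
  proof -
    obtain k where k: "\<And>\<alpha>. \<alpha> \<in> keys f \<Longrightarrow> (\<Sum>i\<in>keys \<alpha>. lookup \<alpha> i) = k"
      using S(2) f by (auto simp: homogeneous_poly_def)
    have "poly_eval (vec_index (a \<cdot>\<^sub>v x)) f = poly_eval (\<lambda>i. a * x $ i) f"
      by (rule poly_eval_cong[of _ "{..<n}"]) (use f S(1) x in auto)
    also have "\<dots> = (\<Sum>\<alpha>\<in>keys f. a ^ k * (lookup f \<alpha> * monom_eval (vec_index x) \<alpha>))"
      unfolding poly_eval_alt by (rule sum.cong) (auto simp: monom_eval_scale k)
    also have "\<dots> = a ^ k * poly_eval (vec_index x) f" by (simp add: poly_eval_alt sum_distrib_left)
    also have "\<dots> = 0" using f assms(2) by (simp add: S zero_locus_def)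
    finally show ?thesis .
  qed
  then show ?thesis using x by (simp add: S(3) zero_locus_def)
qed

text \<open>On the line through 0 and \<open>x\<close> the value is a polynomial in
  \<open>s\<close>, and the sum is its coefficient at \<open>s ^ N\<close>.\<close>

lemma homogeneous_part_zero:
  fixes F :: "('v, 'k::field_char_0) mpoly"
  assumes "\<And>s. poly_eval (\<lambda>i. s * x i) F = 0"
  shows "(\<Sum>\<alpha> | \<alpha> \<in> keys F \<and> (\<Sum>i\<in>keys \<alpha>. lookup \<alpha> i) = N. lookup F \<alpha> * monom_eval x \<alpha>) = 0"
proof -
  define p where "p = (\<Sum>\<alpha>\<in>keys F. Polynomial.monom (lookup F \<alpha> * monom_eval x \<alpha>) (\<Sum>i\<in>keys \<alpha>. lookup \<alpha> i))"
  have "poly p s = 0" for s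
  proof -
    have "poly p s = poly_eval (\<lambda>i. s * x i) F"
      unfolding p_def poly_sum poly_eval_alt by (rule sum.cong) (auto simp: poly_monom monom_eval_scale)
    then show ?thesis using assms by simp
  qed
  then have "p = 0" using poly_all_0_iff_0 by blast
  then have "0 = coeff p N" by simp
  also have "\<dots> = (\<Sum>\<alpha>\<in>keys F. if (\<Sum>i\<in>keys \<alpha>. lookup \<alpha> i) = N then lookup F \<alpha> * monom_eval x \<alpha> else 0)"
    unfolding p_def coeff_sum by (rule sum.cong) auto
  finally show ?thesis by (simp add: sum.inter_filter)
qed

text \<open>This linear form says that the \<open>j\<close>-th entry of a vector depends on its
  entries at the columns \<open>s\<close> as it does in the row space of \<open>A\<close>. Its
  coefficients are Pluecker coordinates up to sign, or zero, so it remains meaningful when the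
  subspace varies.\<close>

definition cramer_form :: "nat \<Rightarrow> 'k::comm_ring_1 mat \<Rightarrow> (nat \<Rightarrow> nat) \<Rightarrow> nat \<Rightarrow> (nat, 'k) mpoly" where
  "cramer_form c A s j = mconst (col_det c A s) * mvar j
     - (\<Sum>k<c. mconst (col_det c A (s(k := j))) * mvar (s k))"

lemma cramer_form_zero:
  assumes A: "A \<in> carrier_mat c n" "y \<in> carrier_vec c" and s: "\<And>k. k < c \<Longrightarrow> s k < n" and j: "j < n"
  shows "poly_eval (vec_index (A\<^sup>T *\<^sub>v y)) (cramer_form c A s j) = 0"
proof -
  have "(\<Sum>k<c. col_det c A (s(k := j)) * (A\<^sup>T *\<^sub>v y) $ s k)
      = (\<Sum>k<c. \<Sum>r<c. y $ r * (A $$ (r, s k) * col_det c A (s(k := j))))"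
    by (rule sum.cong) (simp_all add: row_comb_index[OF A s] sum_distrib_left ac_simps)
  also have "\<dots> = (\<Sum>r<c. y $ r * (\<Sum>k<c. A $$ (r, s k) * col_det c A (s(k := j))))"
    unfolding sum_distrib_left by (rule sum.swap)
  also have "\<dots> = (\<Sum>r<c. y $ r * (col_det c A s * A $$ (r, j)))"
    by (rule sum.cong) (simp_all add: col_det_cramer)
  also have "\<dots> = col_det c A s * (A\<^sup>T *\<^sub>v y) $ j"
    by (simp add: row_comb_index[OF A j] sum_distrib_left ac_simps)
  finally show ?thesis by (simp add: cramer_form_def)
qed

text \<open>Some row combination agrees with \<open>x\<close> at the columns \<open>s\<close>, and
  the forms force its remaining entries to agree as well.\<close>

lemma cramer_form_row_space:
  fixes A :: "'k::field mat"
  assumes A: "A \<in> carrier_mat c n" and s: "\<And>k. k < c \<Longrightarrow> s k < n" and nz: "col_det c A s \<noteq> 0"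
    and x: "x \<in> carrier_vec n" "\<And>j. j < n \<Longrightarrow> poly_eval (vec_index x) (cramer_form c A s j) = 0"
  shows "\<exists>y\<in>carrier_vec c. A\<^sup>T *\<^sub>v y = x"
proof -
  obtain y where y: "y \<in> carrier_vec c" "\<And>k. k < c \<Longrightarrow> (A\<^sup>T *\<^sub>v y) $ s k = x $ s k"
    using col_det_solve(1)[OF A s nz, of "\<lambda>k. x $ s k"] by auto
  have "(A\<^sup>T *\<^sub>v y) $ j = x $ j" if j: "j < n" for j
  proof -
    have "col_det c A s * (A\<^sup>T *\<^sub>v y) $ j = (\<Sum>k<c. col_det c A (s(k := j)) * (A\<^sup>T *\<^sub>v y) $ s k)"
      using cramer_form_zero[OF A y(1) s j] by (simp add: cramer_form_def)
    also have "\<dots> = (\<Sum>k<c. col_det c A (s(k := j)) * x $ s k)" using y(2) by simp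
    also have "\<dots> = col_det c A s * x $ j" using x(2)[OF j] by (simp add: cramer_form_def)
    finally show ?thesis using nz by simp
  qed
  then have "A\<^sup>T *\<^sub>v y = x" using x(1) A by (intro eq_vecI) auto
  then show ?thesis using y(1) by blast
qed

lemma finite_monomials: "finite {\<beta> :: nat \<Rightarrow>\<^sub>0 nat. keys \<beta> \<subseteq> {..<n} \<and> (\<Sum>i\<in>keys \<beta>. lookup \<beta> i) = N}"
proof (rule finite_subset)
  show "{\<beta> :: nat \<Rightarrow>\<^sub>0 nat. keys \<beta> \<subseteq> {..<n} \<and> (\<Sum>i\<in>keys \<beta>. lookup \<beta> i) = N}
      \<subseteq> (\<lambda>g. \<Sum>i<n. single i (g i)) ` ({..<n} \<rightarrow>\<^sub>E {..N})"
  proof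
    fix \<beta> :: "nat \<Rightarrow>\<^sub>0 nat"
    assume "\<beta> \<in> {\<beta>. keys \<beta> \<subseteq> {..<n} \<and> (\<Sum>i\<in>keys \<beta>. lookup \<beta> i) = N}"
    then have b: "keys \<beta> \<subseteq> {..<n}" "(\<Sum>i\<in>keys \<beta>. lookup \<beta> i) = N" by auto
    have le: "lookup \<beta> i \<le> N" for i
      using b(2) member_le_sum[of i "keys \<beta>" "lookup \<beta>"] by (cases "i \<in> keys \<beta>") (auto simp: in_keys_iff)
    let ?g = "\<lambda>i. if i < n then lookup \<beta> i else undefined"
    have "\<beta> = (\<Sum>i\<in>keys \<beta>. single i (lookup \<beta> i))" by (rule poly_mapping_expand)
    also have "\<dots> = (\<Sum>i<n. single i (lookup \<beta> i))"
      by (rule sum.mono_neutral_left) (use b in \<open>auto simp: in_keys_iff\<close>)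
    also have "\<dots> = (\<Sum>i<n. single i (?g i))" by (rule sum.cong) auto
    finally show "\<beta> \<in> (\<lambda>g. \<Sum>i<n. single i (g i)) ` ({..<n} \<rightarrow>\<^sub>E {..N})"
      using le by (intro image_eqI[of _ _ ?g] PiE_I) auto
  qed
  show "finite ((\<lambda>g. \<Sum>i<n. single i (g i) :: nat \<Rightarrow>\<^sub>0 nat) ` ({..<n} \<rightarrow>\<^sub>E {..N}))"
    by (intro finite_imageI finite_PiE) auto
qed

lemma det_in_polys_in:
  fixes M :: "('v, 'k::comm_ring_1) mpoly mat"
  assumes M: "M \<in> carrier_mat b b" and "\<And>i j. i < b \<Longrightarrow> j < b \<Longrightarrow> M $$ (i, j) \<in> polys_in V"
  shows "Determinant.det M \<in> polys_in V"
proof -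
  have *: "signof p * (\<Prod>i = 0..<b. M $$ (i, p i)) \<in> polys_in V" if p: "p permutes {0..<b}" for p
  proof -
    have "signof p = (1 :: ('v, 'k) mpoly) \<or> signof p = (-1 :: ('v, 'k) mpoly)"
      by (auto simp: sign_def)
    moreover have "(\<Prod>i = 0..<b. M $$ (i, p i)) \<in> polys_in V"
      using assms(2) permutes_in_image[OF p] by (intro polys_in_prod) auto
    ultimately show ?thesis by auto
  qed
  show ?thesis unfolding det_def'[OF M] by (rule polys_in_sum) (use * in auto)
qed

text \<open>
  If the row space of \<open>A\<close> meets \<open>X\<close> only in zero, then every monomial of a large degree \<open>N\<close> is
  a combination of the vanishing ideal of \<open>X\<close> and the forms \<open>cramer_form\<close> of \<open>A\<close>. With the
  matrix as a variable, the coefficients of these combinations form a square matrix of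
  polynomials in the Pluecker coordinates that is the identity at \<open>A\<close> and singular at every
  subspace meeting \<open>X\<close>. Its determinant is therefore a multiple of the Chow form.
\<close>

lemma chow_form_zero_imp_meets:
  fixes X :: "'k::{alg_closed_field, field_char_0} vec set"
  assumes unc: "uncountable (UNIV :: 'k set)" and X: "homogeneous_variety n X"
    and F: "is_chow_form n c X F" and A: "A \<in> carrier_mat c n"
    and I0: "I0 \<in> plucker_indices c n" "plucker_coord A I0 \<noteq> 0"
    and zero: "poly_eval (plucker_coord A) F = 0"
  shows "\<exists>y\<in>carrier_vec c. A\<^sup>T *\<^sub>v y \<noteq> 0\<^sub>v n \<and> A\<^sup>T *\<^sub>v y \<in> X"
proof (rule ccontr)
  assume no: "\<not> ?thesis"
  let ?R = "polys_in {..<n} :: (nat, 'k) mpoly set"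
  let ?s = "pick I0"
  let ?V = "plucker_indices c n"
  obtain S where S: "S \<subseteq> ?R" "X = zero_locus n S" using X by (auto simp: homogeneous_variety_def)
  have s: "\<And>k. k < c \<Longrightarrow> ?s k < n" by (rule plucker_indices_pick(2)[OF I0(1)])
  have nz: "col_det c A ?s \<noteq> 0" using I0 plucker_coord_eq_col_det[OF A I0(1)] by simp
  \<comment> \<open>Up to radical, the ideal of the intersection of \<open>X\<close> with the row
    space of \<open>A\<close>.\<close>
  define I where "I = {h0 + (\<Sum>j<n. h j * cramer_form c A ?s j) | h0 h.
    h0 \<in> vanishing_ideal n X \<and> (\<forall>j<n. h j \<in> ?R)}"
  have cr: "cramer_form c B ?s j \<in> ?R" if "j < n" for B :: "'k mat" and j
    using that s by (auto simp: cramer_form_def intro!: polys_in_diff polys_in_sum)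
  have vid: "ideal_in ?R (vanishing_ideal n X)" by (rule ideal_vanishing_ideal)
  have II: "f \<in> I" if "f = h0 + (\<Sum>j<n. h j * cramer_form c A ?s j)" "h0 \<in> vanishing_ideal n X"
    "\<And>j. j < n \<Longrightarrow> h j \<in> ?R" for f h0 h using that unfolding I_def by blast
  have id: "ideal_in ?R I"
    unfolding ideal_in_def
  proof (intro conjI ballI)
    show "I \<subseteq> ?R" unfolding I_def using cr by (auto simp: vanishing_ideal_def intro!: polys_in_add polys_in_sum)
    show "0 \<in> I" by (rule II[of _ 0 "\<lambda>_. 0"]) (use vid in \<open>auto simp: ideal_in_def\<close>)
    fix f g assume "f \<in> I" "g \<in> I"
    then obtain h0 h k0 k where *: "f = h0 + (\<Sum>j<n. h j * cramer_form c A ?s j)"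
      "g = k0 + (\<Sum>j<n. k j * cramer_form c A ?s j)" "h0 \<in> vanishing_ideal n X" "k0 \<in> vanishing_ideal n X"
      "\<And>j. j < n \<Longrightarrow> h j \<in> ?R" "\<And>j. j < n \<Longrightarrow> k j \<in> ?R" unfolding I_def by blast
    show "f + g \<in> I"
    proof (rule II[of _ "h0 + k0" "\<lambda>j. h j + k j"])
      show "h0 + k0 \<in> vanishing_ideal n X" using vid *(3,4) unfolding ideal_in_def by blast
    qed (use * in \<open>auto simp: distrib_right sum.distrib\<close>)
  next
    fix r f assume r: "r \<in> ?R" and "f \<in> I"
    then obtain h0 h where *: "f = h0 + (\<Sum>j<n. h j * cramer_form c A ?s j)"
      "h0 \<in> vanishing_ideal n X" "\<And>j. j < n \<Longrightarrow> h j \<in> ?R" unfolding I_def by blast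
    show "r * f \<in> I"
    proof (rule II[of _ "r * h0" "\<lambda>j. r * h j"])
      show "r * h0 \<in> vanishing_ideal n X" using vid *(2) r unfolding ideal_in_def by blast
    qed (use * r in \<open>auto simp: distrib_left sum_distrib_left mult.assoc\<close>)
  qed
  have SI: "f \<in> I" if "f \<in> S" for f
    by (rule II[of _ f "\<lambda>_. 0"]) (use that S in \<open>auto simp: vanishing_ideal_def zero_locus_def\<close>)
  have CI: "cramer_form c A ?s j \<in> I" if j: "j < n" for j
  proof (rule II[of _ 0 "\<lambda>i. if i = j then 1 else 0"])
    show "cramer_form c A ?s j = 0 + (\<Sum>i<n. (if i = j then 1 else 0) * cramer_form c A ?s i)"
      using j by (simp add: if_distrib[of "\<lambda>x. x * _"] cong: if_cong)
  qed (use vid in \<open>auto simp: ideal_in_def\<close>)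
  \<comment> \<open>Otherwise the Nullstellensatz gives a common zero of \<open>I\<close> with
    nonzero \<open>i\<close>-th coordinate, which is a nonzero point of \<open>X\<close> in the row
    space.\<close>
  have "\<exists>m. mvar i ^ m \<in> I" if i: "i < n" for i
  proof (rule ccontr)
    assume "\<not> ?thesis"
    then have npow: "\<And>m. mvar i ^ m \<notin> I" by blast
    obtain x where x: "\<And>p. p \<in> I \<Longrightarrow> poly_eval x p = 0" "poly_eval x (mvar i) \<noteq> 0"
      using strong_nullstellensatz[OF unc id polys_in_mvar npow] i by (metis lessThan_iff)
    have ev: "poly_eval (vec_index (vec n x)) p = poly_eval x p" if "p \<in> ?R" for p
      by (rule poly_eval_cong[OF that]) auto
    have "vec n x \<in> X" unfolding S(2) zero_locus_def using SI x(1) ev S(1) by auto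
    moreover obtain y where y: "y \<in> carrier_vec c" "A\<^sup>T *\<^sub>v y = vec n x"
      using cramer_form_row_space[OF A s nz, of "vec n x"] CI x(1) ev[OF cr] by auto
    moreover have "vec n x $ i \<noteq> 0\<^sub>v n $ i" using x(2) i by simp
    then have "vec n x \<noteq> 0\<^sub>v n" by metis
    ultimately show False using no by metis
  qed
  then obtain m where m: "\<And>i. i < n \<Longrightarrow> mvar i ^ m i \<in> I" by metis
  \<comment> \<open>By the pigeonhole principle a monomial of this degree is divisible by some
    \<open>mvar i ^ m i\<close>. The successor also keeps \<open>N\<close> positive, which makes
    \<open>single i N\<close> a monomial of degree \<open>N\<close>.\<close>
  define N where "N = Suc (\<Sum>i<n. m i)"
  define B where "B = {\<beta> :: nat \<Rightarrow>\<^sub>0 nat. keys \<beta> \<subseteq> {..<n} \<and> (\<Sum>i\<in>keys \<beta>. lookup \<beta> i) = N}"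
  have finB: "finite B" unfolding B_def by (rule finite_monomials)
  have BI: "single \<beta> 1 \<in> I" if \<beta>: "\<beta> \<in> B" for \<beta>
  proof -
    have "(\<Sum>i<n. lookup \<beta> i) = (\<Sum>i\<in>keys \<beta>. lookup \<beta> i)"
      by (rule sum.mono_neutral_right) (use \<beta> in \<open>auto simp: B_def in_keys_iff\<close>)
    also have "\<dots> = N" using \<beta> by (simp add: B_def)
    finally have "(\<Sum>i<n. m i) < (\<Sum>i<n. lookup \<beta> i)" by (simp add: N_def)
    then obtain i where i: "i < n" "m i \<le> lookup \<beta> i"
      using sum_mono[of "{..<n}" "lookup \<beta>" m] by (metis lessThan_iff nat_le_linear not_less)
    have eq: "\<beta> = (\<beta> - single i (m i)) + single i (m i)"
      by (rule poly_mapping_eqI) (use i in \<open>auto simp: lookup_add lookup_minus lookup_single when_def\<close>)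
    have "single \<beta> 1 = single (\<beta> - single i (m i)) 1 * (mvar i ^ m i :: (nat, 'k) mpoly)"
      unfolding mvar_power mult_single by (simp flip: eq)
    moreover have "single (\<beta> - single i (m i)) 1 \<in> ?R"
      using \<beta> by (auto simp: polys_in_def B_def keys_single in_keys_iff lookup_minus subset_iff)
    ultimately show ?thesis using m[OF i(1)] id unfolding ideal_in_def by auto
  qed
  have "\<exists>p. fst p \<in> vanishing_ideal n X \<and> (\<forall>j<n. snd p j \<in> ?R) \<and>
      single \<beta> 1 = fst p + (\<Sum>j<n. snd p j * cramer_form c A ?s j)" if "\<beta> \<in> B" for \<beta>
  proof -
    obtain h0 h where "h0 \<in> vanishing_ideal n X \<and> (\<forall>j<n. h j \<in> ?R) \<and>
      single \<beta> 1 = h0 + (\<Sum>j<n. h j * cramer_form c A ?s j)"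
      using BI[OF \<open>\<beta> \<in> B\<close>] unfolding I_def by blast
    then show ?thesis by (intro exI[of _ "(h0, h)"]) simp
  qed
  then have "\<forall>\<beta>\<in>B. \<exists>p. fst p \<in> vanishing_ideal n X \<and> (\<forall>j<n. snd p j \<in> ?R) \<and>
      single \<beta> 1 = fst p + (\<Sum>j<n. snd p j * cramer_form c A ?s j)" by blast
  from bchoice[OF this] obtain p where p: "\<forall>\<beta>\<in>B. fst (p \<beta>) \<in> vanishing_ideal n X \<and>
      (\<forall>j<n. snd (p \<beta>) j \<in> ?R) \<and>
      single \<beta> 1 = fst (p \<beta>) + (\<Sum>j<n. snd (p \<beta>) j * cramer_form c A ?s j)" ..
  define h0 where "h0 \<beta> = fst (p \<beta>)" for \<beta>
  define h where "h \<beta> = snd (p \<beta>)" for \<beta>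
  have h: "\<And>\<beta>. \<beta> \<in> B \<Longrightarrow> h0 \<beta> \<in> vanishing_ideal n X"
    "\<And>\<beta> j. \<beta> \<in> B \<Longrightarrow> j < n \<Longrightarrow> h \<beta> j \<in> ?R"
    "\<And>\<beta>. \<beta> \<in> B \<Longrightarrow> single \<beta> 1 = h0 \<beta> + (\<Sum>j<n. h \<beta> j * cramer_form c A ?s j)"
    using p by (auto simp: h0_def h_def)
  \<comment> \<open>The multipliers found for \<open>A\<close> are kept while the matrix varies; the
    result still vanishes at every point of \<open>X\<close> in the row space of
    \<open>A'\<close>.\<close>
  define P where "P \<beta> A' = h0 \<beta> + (\<Sum>j<n. h \<beta> j * cramer_form c A' ?s j)" for \<beta> A'
  have "\<exists>q :: (nat set, 'k) mpoly. q \<in> polys_in ?V \<and> (\<forall>A\<in>carrier_mat c n. poly_eval (plucker_coord A) q = col_det c A t)"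
    if "\<And>k. k < c \<Longrightarrow> t k < n" for t
    using col_det_plucker_poly[of c t n] that by metis
  then obtain q :: "(nat \<Rightarrow> nat) \<Rightarrow> (nat set, 'k) mpoly" where
    q: "\<And>t. (\<And>k. k < c \<Longrightarrow> t k < n) \<Longrightarrow> q t \<in> polys_in ?V"
    "\<And>t A. (\<And>k. k < c \<Longrightarrow> t k < n) \<Longrightarrow> A \<in> carrier_mat c n \<Longrightarrow> poly_eval (plucker_coord A) (q t) = col_det c A t"
    by metis
  define cf where "cf \<beta> \<beta>' = mconst (lookup (h0 \<beta>) \<beta>') + (\<Sum>j<n. q ?s * mconst (lookup (h \<beta> j * mvar j) \<beta>')
     - (\<Sum>k<c. q (?s(k := j)) * mconst (lookup (h \<beta> j * mvar (?s k)) \<beta>')))" for \<beta> \<beta>'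
  have cf_in: "cf \<beta> \<beta>' \<in> polys_in ?V" for \<beta> \<beta>'
    unfolding cf_def using s
    by (intro polys_in_add polys_in_mconst polys_in_sum polys_in_diff polys_in_mult q(1)) auto
  have cf_eval: "poly_eval (plucker_coord A') (cf \<beta> \<beta>') = lookup (P \<beta> A') \<beta>'"
    if A': "A' \<in> carrier_mat c n" for A' \<beta> \<beta>'
  proof -
    have mm: "h \<beta> j * cramer_form c A' ?s j = mconst (col_det c A' ?s) * (h \<beta> j * mvar j)
      - (\<Sum>k<c. mconst (col_det c A' (?s(k := j))) * (h \<beta> j * mvar (?s k)))" for j
      by (simp add: cramer_form_def right_diff_distrib sum_distrib_left ac_simps)
    have q1: "poly_eval (plucker_coord A') (q ?s) = col_det c A' ?s" using q(2) s A' by blast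
    have q2: "poly_eval (plucker_coord A') (q (?s(k := j))) = col_det c A' (?s(k := j))" if "j < n" for j k
      using q(2)[of "?s(k := j)" A'] s A' that by auto
    show ?thesis
      unfolding P_def cf_def mm
      by (simp add: lookup_add lookup_sum lookup_minus lookup_mconst_mult q1 q2)
  qed
  obtain e where e: "bij_betw e {0..<card B} B" using ex_bij_betw_nat_finite[OF finB] by blast
  let ?b = "card B"
  define M where "M = mat ?b ?b (\<lambda>(i, j). cf (e i) (e j))"
  have eB: "e i \<in> B" if "i < ?b" for i using e that by (auto simp: bij_betw_def)
  define G where "G = Determinant.det M"
  have G_in: "G \<in> polys_in ?V"
    unfolding G_def by (rule det_in_polys_in[of _ ?b]) (use cf_in in \<open>auto simp: M_def\<close>)
  have G_eval: "poly_eval (plucker_coord A') G = Determinant.det (mat ?b ?b (\<lambda>(i, j). lookup (P (e i) A') (e j)))"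
    if "A' \<in> carrier_mat c n" for A'
  proof -
    have "map_mat (poly_eval (plucker_coord A')) M = mat ?b ?b (\<lambda>(i, j). lookup (P (e i) A') (e j))"
      by (rule eq_matI) (auto simp: M_def cf_eval[OF that])
    then show ?thesis unfolding G_def poly_eval_hom.hom_det[symmetric] by simp
  qed
  have "mat ?b ?b (\<lambda>(i, j). lookup (P (e i) A) (e j)) = 1\<^sub>m ?b"
  proof (rule eq_matI)
    fix i j assume ij: "i < dim_row (1\<^sub>m ?b :: 'k mat)" "j < dim_col (1\<^sub>m ?b :: 'k mat)"
    then have "P (e i) A = single (e i) 1" using h(3) eB by (simp add: P_def)
    moreover have "e i = e j \<longleftrightarrow> i = j" using e ij by (auto simp: bij_betw_def inj_on_def)
    ultimately show "mat ?b ?b (\<lambda>(i, j). lookup (P (e i) A) (e j)) $$ (i, j) = 1\<^sub>m ?b $$ (i, j)"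
      using ij by (auto simp: lookup_single when_def)
  qed auto
  then have GA: "poly_eval (plucker_coord A) G = 1" using G_eval[OF A] by simp
  have "vanishes_on n c (meeting_subspaces n c X) G"
    unfolding vanishes_on_def
  proof (intro ballI impI)
    fix A' :: "'k mat" assume A'f: "A' \<in> full_rank_mats c n"
      and "vec_space.row_space n A' \<in> meeting_subspaces n c X"
    then have A': "A' \<in> carrier_mat c n" by (simp add: full_rank_mats_def)
    obtain x where x: "x \<in> vec_space.row_space n A'" "x \<in> X" "x \<noteq> 0\<^sub>v n"
      using \<open>vec_space.row_space n A' \<in> _\<close> by (auto simp: meeting_subspaces_def)
    then obtain y where y: "y \<in> carrier_vec c" "x = A'\<^sup>T *\<^sub>v y" unfolding row_space_char[OF A'] by blast
    have xc: "x \<in> carrier_vec n" using x(2) by (simp add: S(2) zero_locus_def)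
    \<comment> \<open>The multiples of \<open>x\<close> are common zeros as well, so the part of
      degree \<open>N\<close> vanishes at \<open>x\<close> separately.\<close>
    have Pz: "poly_eval (\<lambda>i. a * x $ i) (P \<beta> A') = 0" if \<beta>: "\<beta> \<in> B" for a \<beta>
    proof -
      have Pin: "P \<beta> A' \<in> ?R"
        unfolding P_def using h(1,2)[OF \<beta>] cr by (auto simp: vanishing_ideal_def intro!: polys_in_add polys_in_sum)
      have "a \<cdot>\<^sub>v x = A'\<^sup>T *\<^sub>v (a \<cdot>\<^sub>v y)" unfolding y(2)
        by (rule mult_mat_vec[symmetric]) (use A' y(1) in auto)
      then have "poly_eval (vec_index (a \<cdot>\<^sub>v x)) (cramer_form c A' ?s j) = 0" if "j < n" for j
        using cramer_form_zero[OF A' _ s that, of "a \<cdot>\<^sub>v y"] y(1) by simp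
      moreover have "poly_eval (vec_index (a \<cdot>\<^sub>v x)) (h0 \<beta>) = 0"
        using h(1)[OF \<beta>] homogeneous_variety_scale[OF X x(2)] by (simp add: vanishing_ideal_def)
      ultimately have "poly_eval (vec_index (a \<cdot>\<^sub>v x)) (P \<beta> A') = 0" by (simp add: P_def)
      also have "poly_eval (vec_index (a \<cdot>\<^sub>v x)) (P \<beta> A') = poly_eval (\<lambda>i. a * x $ i) (P \<beta> A')"
        by (rule poly_eval_cong[OF Pin]) (use xc in auto)
      finally show ?thesis .
    qed
    have rel: "(\<Sum>\<beta>'\<in>B. lookup (P \<beta> A') \<beta>' * monom_eval (vec_index x) \<beta>') = 0" if \<beta>: "\<beta> \<in> B" for \<beta>
    proof -
      have Pin: "P \<beta> A' \<in> ?R"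
        unfolding P_def using h(1,2)[OF \<beta>] cr by (auto simp: vanishing_ideal_def intro!: polys_in_add polys_in_sum)
      have "(\<Sum>\<beta>'\<in>B. lookup (P \<beta> A') \<beta>' * monom_eval (vec_index x) \<beta>')
        = (\<Sum>\<alpha> | \<alpha> \<in> keys (P \<beta> A') \<and> (\<Sum>i\<in>keys \<alpha>. lookup \<alpha> i) = N. lookup (P \<beta> A') \<alpha> * monom_eval (vec_index x) \<alpha>)"
        by (rule sum.mono_neutral_right)
          (use finB Pin in \<open>auto simp: B_def polys_in_def in_keys_iff subset_iff\<close>)
      also have "\<dots> = 0" by (rule homogeneous_part_zero) (rule Pz[OF \<beta>])
      finally show ?thesis .
    qed
    \<comment> \<open>The values at \<open>x\<close> of the monomials of degree \<open>N\<close>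
      form a kernel vector. It is nonzero since it contains the \<open>N\<close>-th powers of the
      coordinates of \<open>x\<close>.\<close>
    define v where "v = vec ?b (\<lambda>j. monom_eval (vec_index x) (e j))"
    let ?M = "mat ?b ?b (\<lambda>(i, j). lookup (P (e i) A') (e j))"
    have "?M *\<^sub>v v = 0\<^sub>v ?b"
    proof (rule eq_vecI)
      fix i assume "i < dim_vec (0\<^sub>v ?b :: 'k vec)"
      then have i: "i < ?b" by simp
      have "(?M *\<^sub>v v) $ i = (\<Sum>j = 0..<?b. lookup (P (e i) A') (e j) * monom_eval (vec_index x) (e j))"
        using i by (simp add: scalar_prod_def v_def)
      also have "\<dots> = (\<Sum>\<beta>'\<in>B. lookup (P (e i) A') \<beta>' * monom_eval (vec_index x) \<beta>')"
        by (rule sum.reindex_bij_betw[OF e])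
      also have "\<dots> = 0" using rel eB[OF i] .
      finally show "(?M *\<^sub>v v) $ i = 0\<^sub>v ?b $ i" using i by simp
    qed simp
    moreover have "v \<noteq> 0\<^sub>v ?b"
    proof -
      obtain i where i: "i < n" "x $ i \<noteq> 0" using x(3) xc by (metis eq_vecI carrier_vecD index_zero_vec)
      have "single i N \<in> B" using i by (simp add: B_def N_def keys_single)
      then have "single i N \<in> e ` {0..<?b}" using e unfolding bij_betw_def by simp
      then obtain j where j: "j < ?b" "e j = single i N" by auto
      then have "v $ j = (x $ i) ^ N" by (simp add: v_def)
      then show ?thesis using i j by auto
    qed
    moreover have "v \<in> carrier_vec ?b" by (simp add: v_def)
    ultimately have "Determinant.det ?M = 0"
      by (subst det_0_iff_vec_prod_zero_field[of _ ?b]) auto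
    then show "poly_eval (plucker_coord A') G = 0" using G_eval[OF A'] by simp
  qed
  then obtain H where H: "vanishes_on n c (grassmannian c n) (G - F * H)"
    using F G_in unfolding is_chow_form_def by blast
  have "A \<in> full_rank_mats c n" by (rule full_rank_of_plucker[OF A I0])
  then have "poly_eval (plucker_coord A) (G - F * H) = 0"
    using H by (auto simp: vanishes_on_def grassmannian_def)
  then show False using GA zero by simp
qed

section \<open>Hensel's lemma and Puiseux series\<close>

text \<open>Bezout's identity gives some representation. Reducing the cofactor of \<open>h\<close>
  modulo \<open>g\<close> bounds the degree of \<open>u\<close>, and the degree of \<open>r\<close>
  then bounds that of \<open>w\<close>.\<close>

lemma coprime_split:
  fixes g h r :: "'a::field_gcd poly"
  assumes gh: "coprime g h" and dg: "degree g > 0" and dr: "degree r < degree g + degree h"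
  obtains u w where "r = g * w + u * h" "degree u < degree g" "w = 0 \<or> degree w < degree h"
proof -
  obtain s t where st: "s * g + t * h = 1"
    using bezout_coefficients_fst_snd[of g h] gh coprime_iff_gcd_eq_1 by metis
  define u where "u = (t * r) mod g"
  define w where "w = s * r + h * ((t * r) div g)"
  have tr: "t * r = g * ((t * r) div g) + u" unfolding u_def by simp
  have "r = (s * g + t * h) * r" using st by simp
  also have "\<dots> = g * (s * r) + h * (t * r)" by (simp add: algebra_simps)
  also have "\<dots> = g * (s * r) + h * (g * ((t * r) div g) + u)" using tr by simp
  also have "\<dots> = g * w + u * h" by (simp add: w_def algebra_simps)
  finally have eq: "r = g * w + u * h" .
  have du: "degree u < degree g"
    unfolding u_def using dg by (metis degree_0 degree_mod_less less_nat_zero_code neq0_conv)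
  have "w = 0 \<or> degree w < degree h"
  proof (rule ccontr)
    assume "\<not> ?thesis"
    then have w: "w \<noteq> 0" "degree h \<le> degree w" by auto
    have "degree (g * w) = degree g + degree w" using dg w by (subst degree_mult_eq) auto
    moreover have "g * w = r - u * h" using eq by simp
    moreover have "degree (u * h) < degree g + degree h"
      using degree_mult_le[of u h] du by linarith
    then have "degree (r - u * h) < degree g + degree h" using dr by (intro degree_diff_less) auto
    ultimately show False using w by simp
  qed
  with eq du show thesis by (rule that)
qed

text \<open>Comparing terms of order \<open>m > 0\<close> in the product asks for
  \<open>g0 * h m + g m * h0\<close> to be a known polynomial, which coprimality makes solvable. All
  corrections have degrees below those of \<open>g0\<close> and \<open>h0\<close>, so the leading
  terms stay fixed.\<close>

lemma hensel_sequence: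
  fixes p :: "nat \<Rightarrow> 'a::field_gcd poly"
  assumes p0: "p 0 = g0 * h0" and gh: "coprime g0 h0" and dg: "degree g0 > 0" and dh: "degree h0 > 0"
    and dp: "\<And>m. m > 0 \<Longrightarrow> degree (p m) < degree g0 + degree h0"
  obtains g h where "g 0 = g0" "h 0 = h0" "\<And>m. m > 0 \<Longrightarrow> degree (g m) < degree g0"
    "\<And>m. m > 0 \<Longrightarrow> degree (h m) < degree h0" "\<And>m. p m = (\<Sum>l\<le>m. g l * h (m - l))"
proof -
  \<comment> \<open>\<open>Q f m x\<close> says that the pair \<open>x\<close> is an admissible
    choice at order \<open>m\<close>, given the earlier pairs in \<open>f\<close>.\<close>
  define Q where "Q f m x \<longleftrightarrow> (if m = 0 then x = (g0, h0) else
    degree (fst x) < degree g0 \<and> degree (snd x) < degree h0 \<and>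
    p m = g0 * snd x + fst x * h0 + (\<Sum>l\<in>{1..<m}. fst (f l) * snd (f (m - l))))"
    for f :: "nat \<Rightarrow> 'a poly \<times> 'a poly" and m x
  have Qd: "degree (fst x) < degree g0" "degree (snd x) < degree h0" if "Q f m x" "m \<noteq> 0" for f m x
    using that by (simp_all only: Q_def if_False)
  have "\<exists>f. \<forall>m. Q f m (f m)"
  proof (rule dependent_wellorder_choice)
    fix m :: nat and f g x assume "\<And>k. k < m \<Longrightarrow> (f k :: 'a poly \<times> 'a poly) = g k"
    then have "(\<Sum>l\<in>{1..<m}. fst (f l) * snd (f (m - l))) = (\<Sum>l\<in>{1..<m}. fst (g l) * snd (g (m - l)))"
      by (intro sum.cong) auto
    then show "Q f m x = Q g m x" by (simp only: Q_def)
  next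
    fix m :: nat and f :: "nat \<Rightarrow> 'a poly \<times> 'a poly"
    assume IH: "\<And>k. k < m \<Longrightarrow> Q f k (f k)"
    show "\<exists>x. Q f m x"
    proof (cases "m = 0")
      case True
      then show ?thesis by (simp add: Q_def)
    next
      case False
      have trm: "degree (fst (f l) * snd (f (m - l))) < degree g0 + degree h0" if "l \<in> {1..<m}" for l
      proof -
        have "degree (fst (f l)) < degree g0" "degree (snd (f (m - l))) < degree h0"
          using Qd[OF IH[of l]] Qd[OF IH[of "m - l"]] that by simp_all
        then show ?thesis using degree_mult_le[of "fst (f l)" "snd (f (m - l))"] by linarith
      qed
      have "degree (\<Sum>l\<in>{1..<m}. fst (f l) * snd (f (m - l))) < degree g0 + degree h0"
        using trm dg by (intro degree_sum_less) auto
      then have dr: "degree (p m - (\<Sum>l\<in>{1..<m}. fst (f l) * snd (f (m - l)))) < degree g0 + degree h0"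
        using dp False by (intro degree_diff_less) auto
      obtain u w where uw: "p m - (\<Sum>l\<in>{1..<m}. fst (f l) * snd (f (m - l))) = g0 * w + u * h0"
        "degree u < degree g0" "w = 0 \<or> degree w < degree h0" 
        by (rule coprime_split[OF gh dg dr]) (rule that)
      then have "degree w < degree h0" using dh by auto
      then have "Q f m (u, w)" using uw False unfolding Q_def by (auto simp: diff_eq_eq)
      then show ?thesis ..
    qed
  qed
  then obtain f where f: "\<And>m. Q f m (f m)" by blast
  show thesis
  proof (rule that[of "fst \<circ> f" "snd \<circ> f"])
    show "(fst \<circ> f) 0 = g0" "(snd \<circ> f) 0 = h0" using f[of 0] by (auto simp: Q_def)
    fix m
    show "degree ((fst \<circ> f) m) < degree g0" "degree ((snd \<circ> f) m) < degree h0" if "m > 0"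
      using Qd[OF f[of m]] that by simp_all
    show "p m = (\<Sum>l\<le>m. (fst \<circ> f) l * (snd \<circ> f) (m - l))"
    proof (cases "m = 0")
      case True
      then show ?thesis using f[of 0] p0 by (simp add: Q_def)
    next
      case False
      have "{..m} = insert 0 (insert m {1..<m})" using False by auto
      then have "(\<Sum>l\<le>m. (fst \<circ> f) l * (snd \<circ> f) (m - l))
          = fst (f 0) * snd (f m) + (fst (f m) * snd (f 0) + (\<Sum>l\<in>{1..<m}. fst (f l) * snd (f (m - l))))"
        using False by simp
      then show ?thesis using f[of m] f[of 0] False by (simp add: Q_def)
    qed
  qed
qed

text \<open>The factors are assembled from their parts of each order. The two nonzero coefficients
  in the conclusion will show that both factors stay nonconstant over the field of Puiseux
  series.\<close>

lemma hensel_fps: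
  fixes P :: "'a::field_gcd fps poly"
  assumes lc: "lead_coeff P = 1" and fac: "map_poly (\<lambda>f. fps_nth f 0) P = g0 * h0" and gh: "coprime g0 h0"
    and dg: "degree g0 > 0" and dh: "degree h0 > 0"
  obtains G H where "P = G * H" "coeff G (degree g0) \<noteq> 0" "coeff H (degree h0) \<noteq> 0"
proof -
  define p where "p m = map_poly (\<lambda>f. fps_nth f m) P" for m
  have cp: "coeff (p m) j = fps_nth (coeff P j) m" for m j by (simp add: p_def coeff_map_poly)
  have "degree (p 0) = degree P"
  proof (rule antisym)
    show "degree (p 0) \<le> degree P" by (rule degree_le) (simp add: cp coeff_eq_0)
    show "degree P \<le> degree (p 0)" by (rule le_degree) (simp add: cp lc)
  qed
  moreover have "degree (p 0) = degree g0 + degree h0"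
    unfolding p_def fac using dg dh by (subst degree_mult_eq) auto
  ultimately have dP: "degree P = degree g0 + degree h0" by simp
  have dp: "degree (p m) < degree g0 + degree h0" if "m > 0" for m
  proof (rule degree_lessI)
    show "p m \<noteq> 0 \<or> degree g0 + degree h0 > 0" using dg by simp
    show "\<forall>k\<ge>degree g0 + degree h0. coeff (p m) k = 0"
    proof (intro allI impI)
      fix k assume "degree g0 + degree h0 \<le> k"
      then consider "k = degree P" | "degree P < k" using dP by linarith
      then show "coeff (p m) k = 0" by cases (use lc that in \<open>auto simp: cp coeff_eq_0\<close>)
    qed
  qed
  have p0: "p 0 = g0 * h0" by (simp add: p_def fac)
  obtain g h where g: "g 0 = g0" "h 0 = h0" "\<And>m. m > 0 \<Longrightarrow> degree (g m) < degree g0"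
    "\<And>m. m > 0 \<Longrightarrow> degree (h m) < degree h0" "\<And>m. p m = (\<Sum>l\<le>m. g l * h (m - l))"
  proof (rule hensel_sequence[of p g0 h0, OF p0 gh dg dh])
    show "\<And>m. 0 < m \<Longrightarrow> degree (p m) < degree g0 + degree h0" by (rule dp)
  qed (rule that)
  define lift where "lift d q = (\<Sum>j\<le>d. Polynomial.monom (Abs_fps (\<lambda>m. coeff (q m) j)) j)"
    for d and q :: "nat \<Rightarrow> 'a poly"
  have clift: "coeff (lift d q) j = Abs_fps (\<lambda>m. coeff (q m) j)" if "\<And>m. degree (q m) \<le> d" for d q j
  proof (cases "j \<le> d")
    case True
    then show ?thesis by (simp add: lift_def coeff_sum)
  next
    case False
    then have "coeff (q m) j = 0" for m using that[of m] by (intro coeff_eq_0) linarith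
    then show ?thesis using False by (simp add: lift_def coeff_sum fps_eq_iff)
  qed
  have dgm: "degree (g m) \<le> degree g0" for m using g(1) g(3)[of m] by (cases "m = 0") auto
  have dhm: "degree (h m) \<le> degree h0" for m using g(2) g(4)[of m] by (cases "m = 0") auto
  show thesis
  proof (rule that[of "lift (degree g0) g" "lift (degree h0) h"])
    show "P = lift (degree g0) g * lift (degree h0) h"
    proof (rule poly_eqI, rule fps_ext)
      fix j m
      have "fps_nth (coeff P j) m = coeff (p m) j" by (simp add: cp)
      also have "\<dots> = (\<Sum>l\<le>m. \<Sum>i\<le>j. coeff (g l) i * coeff (h (m - l)) (j - i))"
        by (simp add: g(5) coeff_sum coeff_mult)
      also have "\<dots> = (\<Sum>i\<le>j. \<Sum>l\<le>m. coeff (g l) i * coeff (h (m - l)) (j - i))" by (rule sum.swap)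
      also have "\<dots> = fps_nth (coeff (lift (degree g0) g * lift (degree h0) h) j) m"
        by (simp add: coeff_mult clift[OF dgm] clift[OF dhm] fps_sum_nth fps_mult_nth atLeast0AtMost)
      finally show "fps_nth (coeff P j) m = fps_nth (coeff (lift (degree g0) g * lift (degree h0) h) j) m" .
    qed
    have "fps_nth (coeff (lift (degree g0) g) (degree g0)) 0 \<noteq> 0"
      unfolding clift[OF dgm] using g(1) dg by auto
    then show "coeff (lift (degree g0) g) (degree g0) \<noteq> 0" by auto
    have "fps_nth (coeff (lift (degree h0) h) (degree h0)) 0 \<noteq> 0"
      unfolding clift[OF dhm] using g(2) dh by auto
    then show "coeff (lift (degree h0) h) (degree h0) \<noteq> 0" by auto
  qed
qed

section \<open>Valuation and residues of Puiseux series\<close>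

lemma puiseux_coeff_of_nat: "puiseux_coeff (of_nat k :: 'a::field puiseux) 0 = of_nat k"
  by (induction k) (simp_all add: zero_puiseux.rep_eq one_puiseux.rep_eq plus_puiseux.rep_eq)

instance puiseux :: (field_char_0) field_char_0
proof
  show "inj (of_nat :: nat \<Rightarrow> 'a puiseux)"
    by (rule injI) (metis puiseux_coeff_of_nat of_nat_eq_iff)
qed

lift_definition tpow :: "rat \<Rightarrow> 'a::zero_neq_one puiseux" is "\<lambda>e q. if q = e then 1 else 0"
proof -
  fix e :: rat
  obtain a b where e: "e = of_int a / of_int b" "b > 0" by (cases e) (auto simp: Fract_of_int_quotient)
  then have "puiseux_denom (nat b) (\<lambda>q. if q = e then 1 else (0 :: 'a))"
    unfolding puiseux_denom_def by (auto intro!: exI[of _ a])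
  then show "\<exists>N. puiseux_denom N (\<lambda>q. if q = e then 1 else (0 :: 'a))" ..
qed

lemma coeff_tpow_mult: "puiseux_coeff (tpow e * x) q = puiseux_coeff (x :: 'a::field puiseux) (q - e)"
proof -
  have "{r. puiseux_coeff (tpow e :: 'a puiseux) r \<noteq> 0 \<and> puiseux_coeff x (q - r) \<noteq> 0}
      = (if puiseux_coeff x (q - e) = 0 then {} else {e})"
    by (auto simp: tpow.rep_eq)
  then show ?thesis unfolding times_puiseux.rep_eq by (simp add: tpow.rep_eq)
qed

lemma tpow_0: "tpow 0 = (1 :: 'a::field puiseux)"
  by (rule puiseux_eqI) (simp add: tpow.rep_eq one_puiseux.rep_eq)

lemma tpow_add: "tpow (a + b) = (tpow a * tpow b :: 'a::field puiseux)"
  by (rule puiseux_eqI) (auto simp: coeff_tpow_mult tpow.rep_eq)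

lemma tpow_nonzero [simp]: "tpow e \<noteq> (0 :: 'a::field puiseux)"
proof
  assume "tpow e = (0 :: 'a puiseux)"
  then have "tpow 0 = (0 :: 'a puiseux)" using tpow_add[of e "- e", where 'a='a] by simp
  then show False by (simp add: tpow_0)
qed

lemma tpow_power: "tpow e ^ k = (tpow (of_nat k * e) :: 'a::field puiseux)"
  by (induction k) (simp_all add: tpow_0 tpow_add[symmetric] algebra_simps)

text \<open>Membership in the valuation ring, on which \<open>residue_coeff\<close> is the residue
  map.\<close>

definition integral :: "'a::zero puiseux \<Rightarrow> bool" where
  "integral x \<longleftrightarrow> (\<forall>q<0. puiseux_coeff x q = 0)"

abbreviation residue_coeff :: "'a::zero puiseux \<Rightarrow> 'a" where
  "residue_coeff x \<equiv> puiseux_coeff x 0"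

lemma integral_add: "integral x \<Longrightarrow> integral y \<Longrightarrow> integral (x + y :: 'a::field puiseux)"
  by (simp add: integral_def plus_puiseux.rep_eq)

lemma integral_uminus: "integral x \<Longrightarrow> integral (- x :: 'a::field puiseux)"
  by (simp add: integral_def uminus_puiseux.rep_eq)

lemma integral_1: "integral (1 :: 'a::field puiseux)"
  by (simp add: integral_def one_puiseux.rep_eq)

lemma integral_mult:
  fixes x y :: "'a::field puiseux"
  assumes "integral x" "integral y"
  shows "integral (x * y)" "residue_coeff (x * y) = residue_coeff x * residue_coeff y"
proof -
  have pos: "puiseux_coeff x r \<noteq> 0 \<Longrightarrow> r \<ge> 0" "puiseux_coeff y r \<noteq> 0 \<Longrightarrow> r \<ge> 0" for r
    using assms by (auto simp: integral_def not_less)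
  show "integral (x * y)"
    unfolding integral_def
  proof (intro allI impI)
    fix q :: rat assume "q < 0"
    then have "{r. puiseux_coeff x r \<noteq> 0 \<and> puiseux_coeff y (q - r) \<noteq> 0} = {}"
      using pos by fastforce
    then show "puiseux_coeff (x * y) q = 0" by (simp add: times_puiseux.rep_eq)
  qed
  have rz: "r = 0" if "puiseux_coeff x r \<noteq> 0" "puiseux_coeff y (0 - r) \<noteq> 0" for r
    using pos(1)[OF that(1)] pos(2)[OF that(2)] by simp
  have "{r. puiseux_coeff x r \<noteq> 0 \<and> puiseux_coeff y (0 - r) \<noteq> 0}
      = {r. r = 0 \<and> residue_coeff x \<noteq> 0 \<and> residue_coeff y \<noteq> 0}"
  proof (rule Collect_cong)
    fix r
    show "(puiseux_coeff x r \<noteq> 0 \<and> puiseux_coeff y (0 - r) \<noteq> 0)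
      = (r = 0 \<and> residue_coeff x \<noteq> 0 \<and> residue_coeff y \<noteq> 0)"
      by (cases "r = 0") (use rz[of r] in auto)
  qed
  also have "\<dots> = (if residue_coeff x = 0 \<or> residue_coeff y = 0 then {} else {0})" by auto
  finally show "residue_coeff (x * y) = residue_coeff x * residue_coeff y"
    by (auto simp: times_puiseux.rep_eq)
qed

lemma puiseux_val:
  fixes x :: "'a::field puiseux"
  assumes "x \<noteq> 0"
  obtains e u where "x = tpow e * u" "integral u" "residue_coeff u \<noteq> 0"
proof -
  obtain N f where N: "N > 0" and x: "x = puiseux_of_fls N f" using puiseux_cases3[of x x x] by metis
  have f: "f \<noteq> 0" using assms x puiseux_of_fls_0 by metis
  define e where "e = (of_int (fls_subdegree f) / of_nat N :: rat)"
  have c: "puiseux_coeff (tpow (- e) * x) q = puiseux_coeff x (q + e)" for q by (simp add: coeff_tpow_mult)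
  show thesis
  proof (rule that[of e "tpow (- e) * x"])
    show "x = tpow e * (tpow (- e) * x)"
      unfolding mult.assoc[symmetric] tpow_add[symmetric] by (simp add: tpow_0)
    show "integral (tpow (- e) * x)"
      unfolding integral_def c
    proof (intro allI impI, rule ccontr)
      fix q :: rat assume q: "q < 0" "puiseux_coeff x (q + e) \<noteq> 0"
      then obtain k where k: "q + e = of_int k / of_nat N" "fls_nth f k \<noteq> 0"
        using coeff_of_fls_nz[of N f "q + e"] x by metis
      then have "fls_subdegree f \<le> k" by (meson fls_eq0_below_subdegree not_less)
      then have "e \<le> of_int k / of_nat N" unfolding e_def using N by (simp add: divide_right_mono)
      then show False using q(1) k(1) by linarith
    qed
    show "residue_coeff (tpow (- e) * x) \<noteq> 0"
      using c[of 0] f coeff_of_fls_int[OF N, of f "fls_subdegree f"] x by (simp add: e_def)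
  qed
qed

lemma integral_inverse:
  fixes u :: "'a::field puiseux"
  assumes u: "integral u" "residue_coeff u \<noteq> 0"
  shows "integral (inverse u)" "residue_coeff (inverse u) = inverse (residue_coeff u)"
proof -
  have "u \<noteq> 0" using u(2) by (auto simp: zero_puiseux.rep_eq)
  then obtain e w where w: "inverse u = tpow e * w" "integral w" "residue_coeff w \<noteq> 0"
    using puiseux_val[of "inverse u"] by auto
  have one: "tpow e * (u * w) = 1" using w(1) \<open>u \<noteq> 0\<close> by (metis mult.left_commute right_inverse)
  have "puiseux_coeff (tpow e * (u * w)) e = residue_coeff (u * w)" by (simp add: coeff_tpow_mult)
  then have "puiseux_coeff (1 :: 'a puiseux) e \<noteq> 0"
    unfolding one using integral_mult[OF u(1) w(2)] u(2) w(3) by simp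
  then have "e = 0" by (simp add: one_puiseux.rep_eq split: if_splits)
  then show i: "integral (inverse u)" using w by (simp add: tpow_0)
  have "residue_coeff u * residue_coeff (inverse u) = 1"
    using integral_mult(2)[OF u(1) i] \<open>u \<noteq> 0\<close> by (simp add: one_puiseux.rep_eq)
  then show "residue_coeff (inverse u) = inverse (residue_coeff u)" by (metis inverse_unique)
qed

lemma puiseux_common_denom:
  assumes "finite S"
  shows "\<exists>N>0. \<forall>x\<in>S. \<exists>f. x = puiseux_of_fls N f"
proof -
  have "\<exists>N>0. \<forall>x\<in>S. puiseux_denom N (puiseux_coeff x)"
    using assms
  proof (induction S rule: finite_induct)
    case (insert x S)
    then obtain N where N: "N > 0" "\<And>x. x \<in> S \<Longrightarrow> puiseux_denom N (puiseux_coeff x)" by blast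
    obtain M where M: "puiseux_denom M (puiseux_coeff x)" using puiseux_denom_ex by blast
    then have "M > 0" by (simp add: puiseux_denom_def)
    then have "\<forall>y\<in>insert x S. puiseux_denom (M * N) (puiseux_coeff y)"
      using puiseux_denom_mult[OF M N(1)] puiseux_denom_mult[OF N(2) \<open>M > 0\<close>] by (auto simp: mult.commute)
    then show ?case using N(1) \<open>M > 0\<close> by (intro exI[of _ "M * N"]) auto
  qed auto
  then show ?thesis using puiseux_denom_imp_fls by metis
qed

definition fps_puiseux :: "nat \<Rightarrow> 'a::field fps \<Rightarrow> 'a puiseux" where
  "fps_puiseux N f = puiseux_of_fls N (fps_to_fls f)"

lemma fps_puiseux_hom: "N > 0 \<Longrightarrow> comm_ring_hom (fps_puiseux N :: 'a::field fps \<Rightarrow> 'a puiseux)"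
  by unfold_locales
    (simp_all add: fps_puiseux_def puiseux_of_fls_0 puiseux_of_fls_1 puiseux_of_fls_add
      puiseux_of_fls_mult fls_times_fps_to_fls)

lemma fps_puiseux_inj: "N > 0 \<Longrightarrow> fps_puiseux N f = fps_puiseux N g \<Longrightarrow> f = g"
  unfolding fps_puiseux_def by (metis puiseux_of_fls_inj fps_to_fls_eq_iff)

lemma fps_puiseux_residue: "N > 0 \<Longrightarrow> residue_coeff (fps_puiseux N f) = fps_nth f 0"
  using coeff_of_fls_int[of N "fps_to_fls f" 0] by (simp add: fps_puiseux_def)

lemma integral_eq_fps_puiseux:
  assumes N: "N > 0" and x: "integral x" "x = puiseux_of_fls N f"
  shows "x = fps_puiseux N (fls_regpart f)"
proof -
  have "fls_nth f k = 0" if "k < 0" for k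
    using x(1) that N unfolding integral_def x(2)
    by (metis coeff_of_fls_int divide_neg_pos of_int_less_0_iff of_nat_0_less_iff)
  then have "fps_to_fls (fls_regpart f) = f" by (intro fls_eqI) auto
  then show ?thesis by (simp add: fps_puiseux_def x(2))
qed

text \<open>If \<open>x\<close> were the only root, \<open>p\<close> would be a power of a linear
  factor with second coefficient \<open>- of_nat (degree p) * x\<close>. In characteristic 0 its
  vanishing forces x = 0, and then all lower coefficients of \<open>p\<close> are 0.\<close>

lemma distinct_roots:
  fixes p :: "'a::{alg_closed_field, field_char_0, field_gcd} poly"
  assumes n: "degree p > 1" and lc: "lead_coeff p = 1" and c: "coeff p (degree p - 1) = 0"
    and nz: "i < degree p" "coeff p i \<noteq> 0"
  shows "\<exists>x y. poly p x = 0 \<and> poly p y = 0 \<and> x \<noteq> y"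
proof (rule ccontr)
  assume no: "\<not> ?thesis"
  obtain x where x: "poly p x = 0" using alg_closed_imp_poly_has_root[of p] n by auto
  have uniq: "y = x" if "poly p y = 0" for y using no x that by blast
  have "p \<noteq> 0" using n by auto
  then obtain A where A: "size A = degree p" "p = Polynomial.smult (lead_coeff p) (\<Prod>x\<in>#A. [:- x, 1:])"
    using alg_closed_imp_factorization by blast
  have "y = x" if "y \<in># A" for y
  proof (rule uniq)
    have "[:- y, 1:] dvd (\<Prod>x\<in>#A. [:- x, 1:])" using that by (intro dvd_prod_mset) auto
    then have "[:- y, 1:] dvd p" using A(2) lc by simp
    then show "poly p y = 0" by (simp add: poly_eq_0_iff_dvd)
  qed
  then have "A = replicate_mset (degree p) x" using A(1) by (metis set_mset_subset_singletonD subsetI singletonI)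
  then have p: "p = [:- x, 1:] ^ degree p" using A(2) lc by (simp add: prod_mset_replicate_mset)
  have "coeff p (degree p - 1) = of_nat (degree p choose (degree p - 1)) * (- x) ^ (degree p - (degree p - 1))"
    by (subst p) (simp add: coeff_linear_poly_power)
  also have "\<dots> = - of_nat (degree p) * x" using n binomial_symmetric[of 1 "degree p"] by simp
  finally have "x = 0" using c n by auto
  then have "coeff p i = 0" using nz(1) by (subst p) (simp add: coeff_linear_poly_power)
  then show False using nz(2) by simp
qed

text \<open>With a common denominator \<open>N\<close> of the exponents, the coefficients are power
  series in the \<open>N\<close>-th root of t. The residue polynomial has two distinct roots, hence
  coprime nonconstant factors, which Hensel's lemma lifts.\<close>

lemma puiseux_reducible_integral:
  fixes p :: "'a::{alg_closed_field, field_char_0, field_gcd} puiseux poly"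
  assumes n: "degree p > 1" and lc: "lead_coeff p = 1" and c: "coeff p (degree p - 1) = 0"
    and int: "\<And>i. integral (coeff p i)" and nz: "i < degree p" "residue_coeff (coeff p i) \<noteq> 0"
  obtains G H where "p = G * H" "degree G > 0" "degree H > 0"
proof -
  obtain N where N: "N > 0" "\<And>j. j \<le> degree p \<Longrightarrow> \<exists>f. coeff p j = puiseux_of_fls N f"
    using puiseux_common_denom[of "coeff p ` {..degree p}"] by auto
  interpret \<phi>: comm_ring_hom "fps_puiseux N :: 'a fps \<Rightarrow> _" by (rule fps_puiseux_hom[OF N(1)])
  interpret mp: map_poly_comm_ring_hom "fps_puiseux N :: 'a fps \<Rightarrow> _" ..
  have "\<exists>f. coeff p j = fps_puiseux N f" for j
  proof (cases "j \<le> degree p")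
    case True
    then show ?thesis using N integral_eq_fps_puiseux[OF N(1) int] by metis
  next
    case False
    then show ?thesis by (intro exI[of _ 0]) (simp add: coeff_eq_0)
  qed
  then obtain f where f: "\<And>j. coeff p j = fps_puiseux N (f j)" by metis
  define P where "P = (\<Sum>j\<le>degree p. Polynomial.monom (f j) j)"
  have f0: "f j = 0" if "j > degree p" for j
    using f[of j] that fps_puiseux_inj[OF N(1), of "f j" 0] by (simp add: coeff_eq_0)
  have cP: "coeff P j = f j" for j by (auto simp: P_def coeff_sum f0 not_le)
  have pP: "p = map_poly (fps_puiseux N) P" by (rule poly_eqI) (simp add: coeff_map_poly cP f)
  have f1: "f (degree p) = 1" using f[of "degree p"] lc fps_puiseux_inj[OF N(1), of "f (degree p)" 1] by simp
  have dP: "degree P = degree p"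
  proof (rule antisym)
    show "degree P \<le> degree p" by (rule degree_le) (simp add: cP f0)
    show "degree p \<le> degree P" by (rule le_degree) (simp add: cP f1)
  qed
  define P0 where "P0 = map_poly (\<lambda>f. fps_nth f 0) P"
  have cP0: "coeff P0 j = residue_coeff (coeff p j)" for j
    by (simp add: P0_def coeff_map_poly cP f fps_puiseux_residue[OF N(1)])
  have r1: "residue_coeff (1 :: 'a puiseux) = 1" "residue_coeff (0 :: 'a puiseux) = 0"
    by (simp_all add: one_puiseux.rep_eq zero_puiseux.rep_eq)
  have dP0: "degree P0 = degree p"
  proof (rule antisym)
    show "degree P0 \<le> degree p" by (rule degree_le) (simp add: cP0 coeff_eq_0 r1)
    show "degree p \<le> degree P0" by (rule le_degree) (simp add: cP0 lc r1)
  qed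
  obtain x y where "poly P0 x = 0" "poly P0 y = 0" "x \<noteq> y"
    using distinct_roots[of P0 i] n lc c nz unfolding dP0 cP0 by (metis r1)
  then obtain g0 h0 where gh: "degree g0 > 0" "degree h0 > 0" "coprime g0 h0" "P0 = g0 * h0"
    using alg_closed_imp_poly_splits_coprime[of P0 x y] n dP0 by metis
  have "lead_coeff P = 1" by (simp add: cP dP f1)
  then obtain G H where GH: "P = G * H" "coeff G (degree g0) \<noteq> 0" "coeff H (degree h0) \<noteq> 0"
    using hensel_fps[OF _ gh(4)[unfolded P0_def] gh(3,1,2)] by metis
  have pos: "degree (map_poly (fps_puiseux N) Q) > 0" if "coeff Q d \<noteq> 0" "d > 0" for Q :: "'a fps poly" and d
  proof -
    have "coeff (map_poly (fps_puiseux N) Q) d = fps_puiseux N (coeff Q d)" by (simp add: coeff_map_poly)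
    then have "coeff (map_poly (fps_puiseux N) Q) d \<noteq> 0"
      using that(1) fps_puiseux_inj[OF N(1)] by (metis \<phi>.hom_zero)
    then show ?thesis using that(2) le_degree by (metis gr0I less_le_trans not_less0)
  qed
  show thesis
    by (rule that[of "map_poly (fps_puiseux N) G" "map_poly (fps_puiseux N) H"])
      (use pP GH pos gh in \<open>auto simp: mp.hom_mult\<close>)
qed

text \<open>
  The substitution \<open>x \<mapsto> t\<^sup>e x\<close> for the largest slope \<open>-e\<close> of the Newton polygon makes the
  coefficients integral, and the vanishing of the second coefficient excludes a multiple residue root.
\<close>

lemma puiseux_reducible:
  fixes p :: "'a::{alg_closed_field, field_char_0, field_gcd} puiseux poly"
  assumes n: "degree p > 1" and lc: "lead_coeff p = 1" and c: "coeff p (degree p - 1) = 0"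
    and c0: "coeff p 0 \<noteq> 0"
  shows "\<not> irreducible p"
proof -
  let ?n = "degree p"
  have "\<exists>e u. coeff p i \<noteq> 0 \<longrightarrow> coeff p i = tpow e * u \<and> integral u \<and> residue_coeff u \<noteq> 0" for i
    using puiseux_val[of "coeff p i"] by metis
  then obtain v u where vu: "\<And>i. coeff p i \<noteq> 0 \<Longrightarrow> coeff p i = tpow (v i) * u i"
    "\<And>i. coeff p i \<noteq> 0 \<Longrightarrow> integral (u i)" "\<And>i. coeff p i \<noteq> 0 \<Longrightarrow> residue_coeff (u i) \<noteq> 0" by metis
  \<comment> \<open>The slopes, up to sign, from the leading term of \<open>p\<close> to its other
    terms in the Newton polygon. The least one, \<open>e\<close>, is attained at \<open>i0\<close>,
    whose coefficient becomes a unit.\<close>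
  define E where "E = (\<lambda>i. v i / of_nat (?n - i)) ` {i. i < ?n \<and> coeff p i \<noteq> 0}"
  have E: "finite E" "E \<noteq> {}" using n c0 by (auto simp: E_def intro!: exI[of _ 0])
  define e where "e = Min E"
  obtain i0 where i0: "i0 < ?n" "coeff p i0 \<noteq> 0" "e = v i0 / of_nat (?n - i0)"
    using Min_in[OF E] by (auto simp: e_def E_def)
  have le: "of_nat (?n - i) * e \<le> v i" if "i < ?n" "coeff p i \<noteq> 0" for i
  proof -
    have "e \<le> v i / of_nat (?n - i)" unfolding e_def using E(1) that by (intro Min_le) (auto simp: E_def)
    then show ?thesis using that by (simp add: field_simps)
  qed
  define q where "q = Polynomial.smult (tpow (- (of_nat ?n * e))) (pcompose p [:0, tpow e:])"
  have cq: "coeff q i = tpow (of_nat i * e - of_nat ?n * e) * coeff p i" for i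
    unfolding q_def coeff_smult coeff_pcompose_linear tpow_power mult.assoc[symmetric] tpow_add[symmetric]
    by simp
  have dq: "degree q = ?n" unfolding q_def by (simp add: degree_pcompose)
  have cq': "coeff q i = tpow (v i - of_nat (?n - i) * e) * u i" if "coeff p i \<noteq> 0" "i < ?n" for i
  proof -
    have "coeff q i = tpow ((of_nat i * e - of_nat ?n * e) + v i) * u i"
      unfolding cq tpow_add mult.assoc vu(1)[OF that(1), symmetric] ..
    also have "(of_nat i * e - of_nat ?n * e) + v i = v i - of_nat (?n - i) * e"
      using that(2) by (simp add: of_nat_diff algebra_simps)
    finally show ?thesis .
  qed
  have int: "integral (coeff q i)" for i
  proof -
    consider "coeff p i = 0" | "i = ?n" | "coeff p i \<noteq> 0" "i < ?n" using le_degree[of p i] by fastforce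
    then show ?thesis
    proof cases
      case 1
      then show ?thesis by (simp add: cq integral_def zero_puiseux.rep_eq)
    next
      case 2
      then show ?thesis using lc by (simp add: cq tpow_0 integral_1)
    next
      case 3
      have "integral (tpow (v i - of_nat (?n - i) * e) :: 'a puiseux)"
        using le[OF 3(2,1)] by (auto simp: integral_def tpow.rep_eq)
      then show ?thesis unfolding cq'[OF 3] using vu(2)[OF 3(1)] by (rule integral_mult(1))
    qed
  qed
  have "v i0 - of_nat (?n - i0) * e = 0" using i0 by simp
  then have res: "residue_coeff (coeff q i0) \<noteq> 0"
    unfolding cq'[OF i0(2,1)] using vu(3)[OF i0(2)] by (simp add: tpow_0)
  obtain G H where GH: "q = G * H" "degree G > 0" "degree H > 0"
  proof (rule puiseux_reducible_integral[of q i0])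
    show "degree q > 1" "i0 < degree q" using n i0 by (simp_all add: dq)
    show "lead_coeff q = 1" using lc by (simp add: dq cq tpow_0)
    show "coeff q (degree q - 1) = 0" using c by (simp add: dq cq)
  qed (use int res in auto)
  \<comment> \<open>The inverse substitution, which carries factors of \<open>q\<close> to factors
    of \<open>p\<close>.\<close>
  let ?s = "[:0, tpow (- e):] :: 'a puiseux poly"
  have comp: "pcompose [:0, tpow e:] ?s = [:0, 1:]"
    by (simp add: pcompose_pCons tpow_add[symmetric] tpow_0)
  have one: "tpow (of_nat ?n * e) * tpow (- (of_nat ?n * e)) = (1 :: 'a puiseux)"
    unfolding tpow_add[symmetric] by (simp add: tpow_0)
  have one': "tpow e * tpow (- e) = (1 :: 'a puiseux)"
    unfolding tpow_add[symmetric] by (simp add: tpow_0)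
  have "p = Polynomial.smult (tpow (of_nat ?n * e)) (pcompose q ?s)"
    by (simp add: q_def pcompose_smult pcompose_assoc[symmetric] comp one one')
  also have "\<dots> = Polynomial.smult (tpow (of_nat ?n * e)) (pcompose G ?s) * pcompose H ?s"
    by (simp add: GH(1) pcompose_mult)
  finally show ?thesis
    by (rule reducible_polyI) (use GH in \<open>auto simp: degree_pcompose\<close>)
qed

instance puiseux :: ("{alg_closed_field, field_char_0, field_gcd}") alg_closed_field
  by (rule alg_closedI_reducible_coeff_deg_minus_one_eq_0) (rule puiseux_reducible)

section \<open>Limits in a valued field\<close>

text \<open>
  The complex numbers and the complex Puiseux series are treated at once. Over the complex numbers
  \<open>T e n\<close> is \<open>(n + 1) powr - e\<close> and \<open>tends\<close> is convergence; over the Puiseux series \<open>T e n\<close>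
  is \<open>t\<^sup>e\<close> and \<open>tends\<close> is convergence of the residues of integral elements.
\<close>

locale valued_limits =
  fixes tends :: "nat filter \<Rightarrow> (nat \<Rightarrow> 'k::{alg_closed_field, field_char_0}) \<Rightarrow> complex \<Rightarrow> bool"
    and T :: "rat \<Rightarrow> nat \<Rightarrow> 'k"
    and im :: "'k \<Rightarrow> 'r::linordered_field"
  assumes uncountable_field: "uncountable (UNIV :: 'k set)"
    and tends_mono: "F' \<le> F \<Longrightarrow> tends F f a \<Longrightarrow> tends F' f a"
    and tends_cong: "eventually (\<lambda>n. f n = g n) F \<Longrightarrow> tends F f a \<Longrightarrow> tends F g a"
    and tends_1: "tends F (\<lambda>_. 1) 1"
    and tends_add: "tends F f a \<Longrightarrow> tends F g b \<Longrightarrow> tends F (\<lambda>n. f n + g n) (a + b)"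
    and tends_mult: "tends F f a \<Longrightarrow> tends F g b \<Longrightarrow> tends F (\<lambda>n. f n * g n) (a * b)"
    and tends_uminus: "tends F f a \<Longrightarrow> tends F (\<lambda>n. - f n) (- a)"
    and tends_inverse: "tends F f a \<Longrightarrow> a \<noteq> 0 \<Longrightarrow> tends F (\<lambda>n. inverse (f n)) (inverse a)"
    and tends_nonzero: "tends F f a \<Longrightarrow> a \<noteq> 0 \<Longrightarrow> eventually (\<lambda>n. f n \<noteq> 0) F"
    and tends_unique: "F \<noteq> bot \<Longrightarrow> tends F f a \<Longrightarrow> tends F f b \<Longrightarrow> a = b"
    and tends_const: "\<exists>u. \<forall>F. tends F (\<lambda>_. u) a"
    and T_0: "T 0 n = 1"
    and T_add: "T (e + e') n = T e n * T e' n"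
    and T_tends: "e > 0 \<Longrightarrow> tends sequentially (T e) 0"
    and valuation: "u \<noteq> 0 \<Longrightarrow> \<exists>e a. a \<noteq> 0 \<and> tends sequentially (\<lambda>n. u * T (- e) n) a"
    and compactness: "F \<noteq> bot \<Longrightarrow> (\<And>n. \<exists>j<(m::nat). y n j \<noteq> 0) \<Longrightarrow>
      \<exists>F' s l. F' \<le> F \<and> F' \<noteq> bot \<and> (\<forall>n. s n \<noteq> 0) \<and>
        (\<forall>j<m. tends F' (\<lambda>n. s n * y n j) (l j)) \<and> (\<exists>j<m. l j \<noteq> 0)"
    and im_pos: "F \<le> sequentially \<Longrightarrow> tends F f a \<Longrightarrow> Im a > 0 \<Longrightarrow> eventually (\<lambda>n. im (T e n * f n) > 0) F"
    and im_uminus: "im (- x) = - im x"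
begin

lemma tends_0: "tends F (\<lambda>_. 0) 0"
  using tends_add[OF tends_1 tends_uminus[OF tends_1]] by simp

lemma tends_sum: "(\<And>a. a \<in> A \<Longrightarrow> tends F (f a) (l a)) \<Longrightarrow> tends F (\<lambda>n. \<Sum>a\<in>A. f a n) (\<Sum>a\<in>A. l a)"
  by (induction A rule: infinite_finite_induct) (auto intro: tends_0 tends_add)

lemma tends_prod: "(\<And>a. a \<in> A \<Longrightarrow> tends F (f a) (l a)) \<Longrightarrow> tends F (\<lambda>n. \<Prod>a\<in>A. f a n) (\<Prod>a\<in>A. l a)"
  by (induction A rule: infinite_finite_induct) (auto intro: tends_1 tends_mult)

lemma tends_power: "tends F f l \<Longrightarrow> tends F (\<lambda>n. f n ^ k) (l ^ k)"
  by (induction k) (auto intro: tends_1 tends_mult)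

lemma tends_of_nat: "tends F (\<lambda>_. of_nat k) (of_nat k)"
  by (induction k) (auto intro: tends_0 tends_1 tends_add)

lemma tends_of_int: "tends F (\<lambda>_. of_int k) (of_int k)"
  by (cases k) (auto intro: tends_of_nat tends_uminus tends_add tends_1 simp del: of_nat_Suc)

lemma tends_of_rat: "tends F (\<lambda>_. of_rat q) (of_rat q)"
proof -
  obtain a b where q: "q = of_int a / of_int b" "b > 0" by (cases q) (auto simp: Fract_of_int_quotient)
  have "tends F (\<lambda>_. of_int a * inverse (of_int b)) (of_int a * inverse (of_int b))"
    using q(2) by (intro tends_mult tends_of_int tends_inverse) auto
  then show ?thesis by (simp add: q(1) divide_inverse of_rat_mult of_rat_inverse)
qed

lemma T_inverse: "T e n * T (- e) n = 1"
  using T_add[of e "- e" n] T_0 by simp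

lemma T_nonzero [simp]: "T e n \<noteq> 0"
  using T_inverse[of e n] by auto

lemma T_power: "T e n ^ k = T (of_nat k * e) n"
  by (induction k) (simp_all add: T_0 T_add[symmetric] algebra_simps)

lemma T_sum: "finite A \<Longrightarrow> T (\<Sum>a\<in>A. f a) n = (\<Prod>a\<in>A. T (f a) n)"
  by (induction A rule: finite_induct) (simp_all add: T_0 T_add)

lemma T_limit: "F \<le> sequentially \<Longrightarrow> e \<ge> 0 \<Longrightarrow> tends F (T e) (if e = 0 then 1 else 0)"
  using tends_mono[OF _ T_tends] tends_1[of F] by (cases "e = 0") (auto simp: T_0[abs_def])

text \<open>After the substitution the term of \<open>\<alpha>\<close> has order
  \<open>\<nu> \<alpha>\<close> plus the weight of its exponent. Division by \<open>T m\<close>, for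
  a lower bound \<open>m\<close> of these orders, leaves in the limit exactly the terms of order
  \<open>m\<close>.\<close>

lemma tropical_limit:
  assumes F: "F \<le> sequentially" and fin: "finite Q" "finite I"
    and \<phi>: "\<And>\<alpha>. \<alpha> \<in> Q \<Longrightarrow> tends F (\<lambda>n. \<phi> \<alpha> * T (- \<nu> \<alpha>) n) (l \<alpha>)"
    and X: "\<And>i. i \<in> I \<Longrightarrow> tends F (X i) (x i)"
    and min: "\<And>\<alpha>. \<alpha> \<in> Q \<Longrightarrow> m \<le> \<nu> \<alpha> + (\<Sum>i\<in>I. of_nat (a \<alpha> i) * w i)"
  shows "tends F (\<lambda>n. T (- m) n * (\<Sum>\<alpha>\<in>Q. \<phi> \<alpha> * (\<Prod>i\<in>I. (T (w i) n * X i n) ^ a \<alpha> i)))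
    (\<Sum>\<alpha> | \<alpha> \<in> Q \<and> \<nu> \<alpha> + (\<Sum>i\<in>I. of_nat (a \<alpha> i) * w i) = m. l \<alpha> * (\<Prod>i\<in>I. x i ^ a \<alpha> i))"
proof -
  let ?d = "\<lambda>\<alpha>. \<nu> \<alpha> + (\<Sum>i\<in>I. of_nat (a \<alpha> i) * w i) - m"
  have eq: "T (- m) n * (\<Sum>\<alpha>\<in>Q. \<phi> \<alpha> * (\<Prod>i\<in>I. (T (w i) n * X i n) ^ a \<alpha> i))
      = (\<Sum>\<alpha>\<in>Q. (\<phi> \<alpha> * T (- \<nu> \<alpha>) n) * (T (?d \<alpha>) n * (\<Prod>i\<in>I. X i n ^ a \<alpha> i)))" for n
    unfolding sum_distrib_left
  proof (rule sum.cong)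
    fix \<alpha>
    have "T (- \<nu> \<alpha>) n * T (?d \<alpha>) n = T (- m + (\<Sum>i\<in>I. of_nat (a \<alpha> i) * w i)) n"
      unfolding T_add[symmetric] by (rule arg_cong[of _ _ "\<lambda>e. T e n"]) simp
    also have "\<dots> = T (- m) n * (\<Prod>i\<in>I. T (w i) n ^ a \<alpha> i)"
      by (simp only: T_add T_sum[OF fin(2)] T_power)
    finally show "T (- m) n * (\<phi> \<alpha> * (\<Prod>i\<in>I. (T (w i) n * X i n) ^ a \<alpha> i))
      = (\<phi> \<alpha> * T (- \<nu> \<alpha>) n) * (T (?d \<alpha>) n * (\<Prod>i\<in>I. X i n ^ a \<alpha> i))"
      by (simp add: power_mult_distrib prod.distrib ac_simps)
  qed simp
  have "tends F (\<lambda>n. \<Sum>\<alpha>\<in>Q. (\<phi> \<alpha> * T (- \<nu> \<alpha>) n) * (T (?d \<alpha>) n * (\<Prod>i\<in>I. X i n ^ a \<alpha> i)))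
    (\<Sum>\<alpha>\<in>Q. l \<alpha> * ((if ?d \<alpha> = 0 then 1 else 0) * (\<Prod>i\<in>I. x i ^ a \<alpha> i)))"
    using min by (intro tends_sum tends_mult \<phi> T_limit F tends_prod tends_power X) auto
  also have "(\<Sum>\<alpha>\<in>Q. l \<alpha> * ((if ?d \<alpha> = 0 then 1 else 0) * (\<Prod>i\<in>I. x i ^ a \<alpha> i)))
    = (\<Sum>\<alpha> | \<alpha> \<in> Q \<and> \<nu> \<alpha> + (\<Sum>i\<in>I. of_nat (a \<alpha> i) * w i) = m. l \<alpha> * (\<Prod>i\<in>I. x i ^ a \<alpha> i))"
    unfolding sum.inter_filter[OF fin(1)] by (rule sum.cong) auto
  finally show ?thesis unfolding eq .
qed

text \<open>Each pair is a point of the projective line. The points are normalized one after the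
  other, each time along a finer filter.\<close>

lemma compactness_family:
  assumes F: "F \<noteq> bot" and nz: "\<And>i n. i < (D::nat) \<Longrightarrow> \<alpha> i n \<noteq> 0 \<or> \<beta> i n \<noteq> 0"
  shows "\<exists>F' s a b. F' \<le> F \<and> F' \<noteq> bot \<and> (\<forall>i<D. (\<forall>n. s i n \<noteq> 0) \<and> tends F' (\<lambda>n. s i n * \<alpha> i n) (a i) \<and>
    tends F' (\<lambda>n. s i n * \<beta> i n) (b i) \<and> (a i \<noteq> 0 \<or> b i \<noteq> 0))"
  using nz
proof (induction D)
  case 0
  then show ?case using F by auto
next
  case (Suc D)
  have "\<exists>F' s a b. F' \<le> F \<and> F' \<noteq> bot \<and> (\<forall>i<D. (\<forall>n. s i n \<noteq> 0) \<and> tends F' (\<lambda>n. s i n * \<alpha> i n) (a i) \<and>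
    tends F' (\<lambda>n. s i n * \<beta> i n) (b i) \<and> (a i \<noteq> 0 \<or> b i \<noteq> 0))"
    by (rule Suc.IH) (use Suc.prems in auto)
  then obtain F1 s a b where 1: "F1 \<le> F" "F1 \<noteq> bot" "\<forall>i<D. (\<forall>n. s i n \<noteq> 0) \<and>
    tends F1 (\<lambda>n. s i n * \<alpha> i n) (a i) \<and> tends F1 (\<lambda>n. s i n * \<beta> i n) (b i) \<and> (a i \<noteq> 0 \<or> b i \<noteq> 0)"
    by (elim exE conjE) (rule that)
  define y where "y n j = (if j = 0 then \<alpha> D n else \<beta> D n)" for n and j :: nat
  have y: "\<exists>j<2. y n j \<noteq> 0" for n
  proof (cases "\<alpha> D n = 0")
    case True
    then show ?thesis using Suc.prems[of D n] by (intro exI[of _ 1]) (auto simp: y_def)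
  next
    case False
    then show ?thesis by (intro exI[of _ 0]) (auto simp: y_def)
  qed
  from compactness[of F1 2 y, OF 1(2) y]
  obtain F' t l where 2: "F' \<le> F1" "F' \<noteq> bot" "\<forall>n. t n \<noteq> 0"
    "\<forall>j<2. tends F' (\<lambda>n. t n * y n j) (l j)" "\<exists>j<2. l j \<noteq> 0"
    by (elim exE conjE) (rule that, assumption+, blast)
  have l: "tends F' (\<lambda>n. t n * \<alpha> D n) (l 0)" "tends F' (\<lambda>n. t n * \<beta> D n) (l 1)"
    using 2(4)[rule_format, of 0] 2(4)[rule_format, of 1] by (auto simp: y_def)
  have nz: "l 0 \<noteq> 0 \<or> l 1 \<noteq> 0" using 2(5) by (auto simp: less_2_cases_iff)
  have lim: "(\<forall>n. (s(D := t)) i n \<noteq> 0) \<and> tends F' (\<lambda>n. (s(D := t)) i n * \<alpha> i n) ((a(D := l 0)) i) \<and>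
    tends F' (\<lambda>n. (s(D := t)) i n * \<beta> i n) ((b(D := l 1)) i) \<and> ((a(D := l 0)) i \<noteq> 0 \<or> (b(D := l 1)) i \<noteq> 0)"
    if "i < Suc D" for i
  proof (cases "i = D")
    case True
    then show ?thesis using l nz 2(3) by simp
  next
    case False
    then show ?thesis using 1(3)[rule_format, of i] that tends_mono[OF 2(1)] by simp
  qed
  show ?case
    by (intro exI[of _ F'] exI[of _ "s(D := t)"] exI[of _ "a(D := l 0)"] exI[of _ "b(D := l 1)"]
        conjI[OF order_trans[OF 2(1) 1(1)]] conjI[OF 2(2)] allI impI lim)
qed

text \<open>Factors beyond the degree are constants 1, that is, roots at infinity. With a fixed
  number of factors limits can be taken even when the degree drops.\<close>

lemma poly_projective_factors:
  fixes q :: "'k poly"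
  assumes "degree q \<le> D"
  shows "\<exists>\<kappa> a b. (\<forall>i<D. a i \<noteq> 0 \<or> b i \<noteq> 0) \<and> q = Polynomial.smult \<kappa> (\<Prod>i<D. [:- b i, a i:])"
proof (cases "q = 0")
  case True
  then show ?thesis by (intro exI[of _ 0] exI[of _ "\<lambda>_. 1"]) auto
next
  case False
  then obtain A where A: "size A = degree q" "q = Polynomial.smult (lead_coeff q) (\<Prod>x\<in>#A. [:- x, 1:])"
    using alg_closed_imp_factorization by blast
  obtain xs where xs: "mset xs = A" using ex_mset by blast
  define a where "a i = (if i < length xs then 1 else 0 :: 'k)" for i
  define b where "b i = (if i < length xs then xs ! i else - 1)" for i
  have le: "length xs \<le> D" using assms A(1) xs by (metis size_mset)
  have "(\<Prod>i<D. [:- b i, a i:]) = (\<Prod>i<length xs. [:- b i, a i:])"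
    by (rule prod.mono_neutral_right) (use le in \<open>auto simp: a_def b_def one_pCons\<close>)
  also have "\<dots> = (\<Prod>i<length xs. [:- (xs ! i), 1:])" by (rule prod.cong) (auto simp: a_def b_def)
  also have "\<dots> = prod_list (map (\<lambda>x. [:- x, 1:]) xs)"
    by (simp add: prod.list_conv_set_nth atLeast0LessThan)
  also have "\<dots> = (\<Prod>x\<in>#A. [:- x, 1:])" unfolding xs[symmetric] by (metis mset_map prod_mset_prod_list)
  finally have "q = Polynomial.smult (lead_coeff q) (\<Prod>i<D. [:- b i, a i:])" using A(2) by simp
  moreover have "\<forall>i<D. a i \<noteq> 0 \<or> b i \<noteq> 0" by (simp add: a_def b_def)
  ultimately show ?thesis by blast
qed

definition poly_tends :: "nat filter \<Rightarrow> (nat \<Rightarrow> 'k poly) \<Rightarrow> complex poly \<Rightarrow> bool" where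
  "poly_tends F p q \<longleftrightarrow> (\<forall>k. tends F (\<lambda>n. coeff (p n) k) (coeff q k))"

lemma poly_tends_mult:
  "poly_tends F p q \<Longrightarrow> poly_tends F p' q' \<Longrightarrow> poly_tends F (\<lambda>n. p n * p' n) (q * q')"
  unfolding poly_tends_def coeff_mult by (auto intro!: tends_sum tends_mult)

lemma poly_tends_1: "poly_tends F (\<lambda>_. 1) 1"
  unfolding poly_tends_def
proof
  fix k
  show "tends F (\<lambda>n. coeff 1 k) (coeff 1 k)"
    using tends_1[of F] tends_0[of F] by (cases "k = 0") auto
qed

lemma poly_tends_prod:
  "(\<And>i. i < (D::nat) \<Longrightarrow> poly_tends F (p i) (q i)) \<Longrightarrow> poly_tends F (\<lambda>n. \<Prod>i<D. p i n) (\<Prod>i<D. q i)"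
proof (induction D)
  case (Suc D)
  then have "poly_tends F (\<lambda>n. (\<Prod>i<D. p i n) * p D n) ((\<Prod>i<D. q i) * q D)"
    by (intro poly_tends_mult) auto
  then show ?case by simp
qed (simp add: poly_tends_1)

lemma poly_tends_linear:
  assumes "tends F f a" "tends F g b" shows "poly_tends F (\<lambda>n. [:f n, g n:]) [:a, b:]"
  unfolding poly_tends_def
proof
  fix k
  consider "k = 0" | "k = 1" | j where "k = Suc (Suc j)" by (metis One_nat_def not0_implies_Suc)
  then show "tends F (\<lambda>n. coeff [:f n, g n:] k) (coeff [:a, b:] k)"
    by cases (use assms tends_0 in auto)
qed

text \<open>Continuity of roots. The roots of \<open>q n\<close>, as points of the projective line,
  converge along a finer filter, and the product of the limit factors is proportional to
  \<open>q'\<close>. So \<open>\<zeta>\<close> is the root of a limit factor and hence the limit of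
  the corresponding roots.\<close>

lemma root_limit:
  assumes F: "F \<noteq> bot" and q: "poly_tends F q q'" and deg: "\<And>n. degree (q n) \<le> D"
    and nz: "q' \<noteq> 0" and root: "poly q' \<zeta> = 0"
  obtains F' z where "F' \<le> F" "F' \<noteq> bot" "tends F' z \<zeta>" "eventually (\<lambda>n. poly (q n) (z n) = 0) F'"
proof -
  have "\<forall>n. \<exists>\<kappa> a b. (\<forall>i<D. a i \<noteq> 0 \<or> b i \<noteq> 0) \<and> q n = Polynomial.smult \<kappa> (\<Prod>i<D. [:- b i, a i:])"
    using poly_projective_factors[OF deg] by blast
  then obtain \<kappa> a b where ab: "\<And>n i. i < D \<Longrightarrow> a n i \<noteq> 0 \<or> b n i \<noteq> 0"
    "\<And>n. q n = Polynomial.smult (\<kappa> n) (\<Prod>i<D. [:- b n i, a n i:])" by metis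
  obtain F' s a' b' where F': "F' \<le> F" "F' \<noteq> bot" and s: "\<And>i. i < D \<Longrightarrow> (\<forall>n. s i n \<noteq> 0) \<and>
    tends F' (\<lambda>n. s i n * a n i) (a' i) \<and> tends F' (\<lambda>n. s i n * b n i) (b' i) \<and> (a' i \<noteq> 0 \<or> b' i \<noteq> 0)"
    using compactness_family[OF F, of D "\<lambda>i n. a n i" "\<lambda>i n. b n i"] ab(1) by blast
  define R where "R n = (\<Prod>i<D. [:- (s i n * b n i), s i n * a n i:])" for n
  define R' where "R' = (\<Prod>i<D. [:- b' i, a' i:])"
  have R: "poly_tends F' R R'"
    unfolding R_def R'_def using s by (intro poly_tends_prod poly_tends_linear tends_uminus) auto
  have "R' \<noteq> 0" unfolding R'_def using s by (auto simp: prod_zero_iff)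
  then obtain k where k: "coeff R' k \<noteq> 0" by (metis leading_coeff_0_iff)
  define \<gamma> where "\<gamma> n = \<kappa> n / (\<Prod>i<D. s i n)" for n
  have qR: "q n = Polynomial.smult (\<gamma> n) (R n)" for n
  proof -
    have "[:- (s i n * b n i), s i n * a n i:] = [:s i n:] * [:- b n i, a n i:]" for i by simp
    then have "R n = (\<Prod>i<D. [:s i n:]) * (\<Prod>i<D. [:- b n i, a n i:])" by (simp only: R_def prod.distrib)
    also have "(\<Prod>i<D. [:s i n:]) = [:\<Prod>i<D. s i n:]" by (induction D) (auto simp: one_pCons)
    finally have "Polynomial.smult (\<gamma> n) (R n) = Polynomial.smult (\<gamma> n * (\<Prod>i<D. s i n)) (\<Prod>i<D. [:- b n i, a n i:])"
      by simp
    moreover have "(\<Prod>i<D. s i n) \<noteq> 0" using s by (simp add: prod_zero_iff)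
    ultimately show ?thesis using ab(2)[of n] by (simp add: \<gamma>_def)
  qed
  have q': "tends F' (\<lambda>n. coeff (q n) j) (coeff q' j)" for j
    using q tends_mono[OF F'(1)] by (simp add: poly_tends_def)
  have R'': "tends F' (\<lambda>n. coeff (R n) j) (coeff R' j)" for j using R by (simp add: poly_tends_def)
  \<comment> \<open>At an index where the limit product has a nonzero coefficient, the scalars
    \<open>\<gamma> n\<close> can be read off as quotients and are seen to converge.\<close>
  define \<mu> where "\<mu> = coeff q' k * inverse (coeff R' k)"
  have "tends F' (\<lambda>n. coeff (q n) k * inverse (coeff (R n) k)) \<mu>"
    unfolding \<mu>_def by (intro tends_mult q' tends_inverse R'' k)
  then have \<gamma>: "tends F' \<gamma> \<mu>"
    by (rule tends_cong[rotated])
      (rule eventually_mono[OF tends_nonzero[OF R'' k]], simp add: qR)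
  have "coeff q' j = \<mu> * coeff R' j" for j
  proof -
    have "tends F' (\<lambda>n. coeff (q n) j) (\<mu> * coeff R' j)"
      unfolding qR coeff_smult by (intro tends_mult \<gamma> R'')
    then show ?thesis using tends_unique[OF F'(2) q'] by blast
  qed
  then have "q' = Polynomial.smult \<mu> R'" by (intro poly_eqI) simp
  then have "poly R' \<zeta> = 0" using nz root by auto
  then obtain i where i: "i < D" "- b' i + \<zeta> * a' i = 0"
    unfolding R'_def poly_prod by (auto simp: prod_zero_iff)
  have ai: "a' i \<noteq> 0" using s[OF i(1)] i(2) by auto
  define z where "z n = (s i n * b n i) * inverse (s i n * a n i)" for n
  have "tends F' z (b' i * inverse (a' i))"
    unfolding z_def using s[OF i(1)] ai by (intro tends_mult tends_inverse) auto
  also have "b' i * inverse (a' i) = \<zeta>" using i(2) ai by (simp add: field_simps)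
  finally have "tends F' z \<zeta>" .
  moreover have "eventually (\<lambda>n. s i n * a n i \<noteq> 0) F'" using s[OF i(1)] ai tends_nonzero by blast
  then have "eventually (\<lambda>n. poly (q n) (z n) = 0) F'"
  proof (rule eventually_mono)
    fix n assume nz: "s i n * a n i \<noteq> 0"
    have "\<exists>i\<in>{..<D}. poly [:- (s i n * b n i), s i n * a n i:] (z n) = 0"
      using i(1) nz by (intro bexI[of _ i]) (auto simp: z_def field_simps)
    then have "poly (R n) (z n) = 0" unfolding R_def poly_prod by (simp add: prod_zero_iff)
    then show "poly (q n) (z n) = 0" by (simp add: qR)
  qed
  ultimately show thesis using that F' by blast
qed

end

section \<open>Complex numbers: limits along finer filters\<close>

lemma bounded_refine:
  fixes f :: "nat \<Rightarrow> complex"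
  assumes F: "F \<noteq> bot" and b: "\<And>n. norm (f n) \<le> 1"
  obtains F' l where "F' \<le> F" "F' \<noteq> bot" "(f \<longlongrightarrow> l) F'"
proof -
  have "filtermap f F \<noteq> bot" using F by (simp add: filtermap_bot_iff)
  moreover have "eventually (\<lambda>x. x \<in> cball 0 1) (filtermap f F)" using b by (simp add: eventually_filtermap)
  ultimately obtain l where l: "inf (nhds l) (filtermap f F) \<noteq> bot"
    using compact_cball[of "0 :: complex" 1] unfolding compact_filter by blast
  \<comment> \<open>Intersecting with the preimage of the neighbourhoods of the cluster point
    \<open>l\<close> takes the place of choosing a subsequence.\<close>
  let ?F' = "inf F (filtercomap f (nhds l))"
  have "?F' \<noteq> bot"
  proof
    assume "?F' = bot"
    then have "eventually (\<lambda>_. False) ?F'" by simp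
    then obtain Q R where QR: "eventually Q F" "eventually R (filtercomap f (nhds l))" "\<And>n. Q n \<Longrightarrow> R n \<Longrightarrow> False"
      unfolding eventually_inf by blast
    obtain P where P: "eventually P (nhds l)" "\<And>n. P (f n) \<Longrightarrow> R n"
      using QR(2) unfolding eventually_filtercomap by blast
    have "eventually (\<lambda>y. \<not> P y) (filtermap f F)"
      unfolding eventually_filtermap by (rule eventually_mono[OF QR(1)]) (use P(2) QR(3) in blast)
    then have "eventually (\<lambda>_. False) (inf (nhds l) (filtermap f F))"
      unfolding eventually_inf using P(1) by (intro exI[of _ P] exI[of _ "\<lambda>y. \<not> P y"]) auto
    then show False using l by (simp add: trivial_limit_def[symmetric])
  qed
  moreover have "(f \<longlongrightarrow> l) ?F'"
    by (rule filterlim_mono[OF filterlim_filtercomap order.refl]) simp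
  ultimately show thesis using that[of ?F' l] by simp
qed

lemma bounded_refine_family:
  fixes z :: "nat \<Rightarrow> nat \<Rightarrow> complex"
  assumes F: "F \<noteq> bot" and b: "\<And>n j. j < m \<Longrightarrow> norm (z n j) \<le> 1"
  shows "\<exists>F' l. F' \<le> F \<and> F' \<noteq> bot \<and> (\<forall>j<m. ((\<lambda>n. z n j) \<longlongrightarrow> l j) F')"
  using b
proof (induction m)
  case 0
  then show ?case using F by auto
next
  case (Suc m)
  obtain F1 l where 1: "F1 \<le> F" "F1 \<noteq> bot" "\<forall>j<m. ((\<lambda>n. z n j) \<longlongrightarrow> l j) F1"
    using Suc.IH Suc.prems by (meson less_SucI)
  obtain F2 a where 2: "F2 \<le> F1" "F2 \<noteq> bot" "((\<lambda>n. z n m) \<longlongrightarrow> a) F2"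
    using bounded_refine[OF 1(2), of "\<lambda>n. z n m"] Suc.prems by blast
  have "((\<lambda>n. z n j) \<longlongrightarrow> (l(m := a)) j) F2" if "j < Suc m" for j
    using that 1(3) 2(3) tendsto_mono[OF 2(1)] by (cases "j = m") (auto simp: less_Suc_eq)
  then show ?case using 1(1) 2(1,2) by (meson order_trans)
qed

text \<open>Compactness of complex projective space: division by the sum of the absolute values
  keeps this sum equal to 1, also for the limit, which is therefore nonzero.\<close>

lemma complex_compactness:
  fixes y :: "nat \<Rightarrow> nat \<Rightarrow> complex"
  assumes F: "F \<noteq> bot" and nz: "\<And>n. \<exists>j<m. y n j \<noteq> 0"
  shows "\<exists>F' s l. F' \<le> F \<and> F' \<noteq> bot \<and> (\<forall>n. s n \<noteq> 0) \<and>
        (\<forall>j<m. ((\<lambda>n. s n * y n j) \<longlongrightarrow> l j) F') \<and> (\<exists>j<m. l j \<noteq> 0)"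
proof -
  define S where "S n = (\<Sum>j<m. norm (y n j))" for n
  have S: "S n > 0" for n
  proof -
    obtain j where "j < m" "y n j \<noteq> 0" using nz by blast
    then show ?thesis unfolding S_def by (intro sum_pos2[of _ j]) auto
  qed
  define s where "s n = complex_of_real (1 / S n)" for n
  have s: "s n \<noteq> 0" for n using S[of n] by (simp add: s_def)
  have ns: "norm (s n * y n j) = norm (y n j) / S n" for n j
    using S[of n] by (simp add: s_def norm_mult norm_divide)
  have "norm (s n * y n j) \<le> 1" if "j < m" for n j
  proof -
    have "norm (y n j) \<le> S n" unfolding S_def using that by (intro member_le_sum) auto
    then show ?thesis unfolding ns using S[of n] by simp
  qed
  then obtain F' l where F': "F' \<le> F" "F' \<noteq> bot" "\<forall>j<m. ((\<lambda>n. s n * y n j) \<longlongrightarrow> l j) F'"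
    using bounded_refine_family[OF F, of m "\<lambda>n j. s n * y n j"] by blast
  have "((\<lambda>n. \<Sum>j<m. norm (s n * y n j)) \<longlongrightarrow> (\<Sum>j<m. norm (l j))) F'"
    using F'(3) by (intro tendsto_sum tendsto_norm) auto
  moreover have "(\<Sum>j<m. norm (s n * y n j)) = 1" for n
    using S[of n] unfolding ns by (simp add: S_def sum_divide_distrib[symmetric])
  ultimately have "((\<lambda>n. 1) \<longlongrightarrow> (\<Sum>j<m. norm (l j))) F'" by simp
  then have "(\<Sum>j<m. norm (l j)) = 1" using F'(2) tendsto_unique[OF F'(2) _ tendsto_const] by metis
  then have "\<exists>j<m. l j \<noteq> 0" by (metis lessThan_iff norm_zero sum.neutral zero_neq_one)
  then show ?thesis using F' s by blast
qed

definition complex_T :: "rat \<Rightarrow> nat \<Rightarrow> complex" where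
  "complex_T e n = of_real (real (n + 1) powr (- of_rat e))"

interpretation complex_limits: valued_limits "\<lambda>F f a. (f \<longlongrightarrow> a) F" complex_T Im
proof
  show "uncountable (UNIV :: complex set)" by (rule uncountable_UNIV_complex)
  fix F F' :: "nat filter" and f g :: "nat \<Rightarrow> complex" and a b :: complex
  show "(f \<longlongrightarrow> a) F'" if "F' \<le> F" "(f \<longlongrightarrow> a) F" using that by (rule tendsto_mono)
  show "(g \<longlongrightarrow> a) F" if "eventually (\<lambda>n. f n = g n) F" "(f \<longlongrightarrow> a) F"
    using tendsto_cong[OF that(1), of a] that(2) by simp
  show "((\<lambda>_. 1) \<longlongrightarrow> 1) F" by simp
  show "((\<lambda>n. f n + g n) \<longlongrightarrow> a + b) F" if "(f \<longlongrightarrow> a) F" "(g \<longlongrightarrow> b) F" using that by (rule tendsto_add)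
  show "((\<lambda>n. f n * g n) \<longlongrightarrow> a * b) F" if "(f \<longlongrightarrow> a) F" "(g \<longlongrightarrow> b) F" using that by (rule tendsto_mult)
  show "((\<lambda>n. - f n) \<longlongrightarrow> - a) F" if "(f \<longlongrightarrow> a) F" using that by (rule tendsto_minus)
  show "((\<lambda>n. inverse (f n)) \<longlongrightarrow> inverse a) F" if "(f \<longlongrightarrow> a) F" "a \<noteq> 0" using that by (rule tendsto_inverse)
  show "eventually (\<lambda>n. f n \<noteq> 0) F" if "(f \<longlongrightarrow> a) F" "a \<noteq> 0" using that by (rule tendsto_imp_eventually_ne)
  show "a = b" if "F \<noteq> bot" "(f \<longlongrightarrow> a) F" "(f \<longlongrightarrow> b) F" using that tendsto_unique by blast
  show "\<exists>u. \<forall>F. ((\<lambda>_. u) \<longlongrightarrow> a) (F :: nat filter)" by (intro exI[of _ a]) simp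
  fix n :: nat and e e' :: rat
  show "complex_T 0 n = 1" by (simp add: complex_T_def)
  show "complex_T (e + e') n = complex_T e n * complex_T e' n"
    by (simp add: complex_T_def of_rat_add powr_add[symmetric] flip: of_real_mult)
  show "(complex_T e \<longlongrightarrow> 0) sequentially" if "e > 0"
  proof -
    have "(\<lambda>n. real (n + 1) powr - of_rat e) \<longlonglongrightarrow> 0"
    proof (rule tendsto_neg_powr)
      show "- real_of_rat e < 0" using that by simp
      show "filterlim (\<lambda>n. real (n + 1)) at_top sequentially"
        using filterlim_compose[OF filterlim_real_sequentially filterlim_add_const_nat_at_top[of 1]] by simp
    qed
    then have "(\<lambda>n. complex_of_real (real (n + 1) powr - of_rat e)) \<longlonglongrightarrow> of_real 0" by (rule tendsto_of_real)
    then show ?thesis by (simp add: complex_T_def[abs_def])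
  qed
  \<comment> \<open>The valuation of the complex numbers is trivial: a nonzero element has order 0
    and is its own leading coefficient.\<close>
  show "\<exists>e a. a \<noteq> 0 \<and> ((\<lambda>n. u * complex_T (- e) n) \<longlongrightarrow> a) sequentially" if "u \<noteq> 0" for u :: complex
    using that by (intro exI[of _ 0] exI[of _ u]) (simp add: complex_T_def)
  show "\<exists>F' s l. F' \<le> F \<and> F' \<noteq> bot \<and> (\<forall>n. s n \<noteq> 0) \<and>
        (\<forall>j<m. ((\<lambda>n. s n * y n j) \<longlongrightarrow> l j) F') \<and> (\<exists>j<m. l j \<noteq> 0)"
    if "F \<noteq> bot" "\<And>n. \<exists>j<m. y n j \<noteq> 0" for m and y :: "nat \<Rightarrow> nat \<Rightarrow> complex"
    using that by (rule complex_compactness)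
  show "eventually (\<lambda>n. Im (complex_T e n * f n) > 0) F"
    if "F \<le> sequentially" "(f \<longlongrightarrow> a) F" "Im a > 0"
  proof -
    have "((\<lambda>n. Im (f n)) \<longlongrightarrow> Im a) F" by (intro tendsto_intros that)
    then have "eventually (\<lambda>n. Im (f n) > 0) F" using that(3) by (rule order_tendstoD)
    then show ?thesis by (rule eventually_mono) (simp add: complex_T_def)
  qed
  show "Im (- x) = - Im x" for x by simp
qed

section \<open>Puiseux series: limits of residues\<close>

lift_definition puiseux_const :: "'a::zero \<Rightarrow> 'a puiseux" is "\<lambda>a q. if q = 0 then a else 0"
proof -
  fix a :: 'a
  have "puiseux_denom 1 (\<lambda>q. if q = 0 then a else 0)"
    unfolding puiseux_denom_def by (auto intro!: exI[of _ 0])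
  then show "\<exists>N. puiseux_denom N (\<lambda>q. if q = 0 then a else 0)" ..
qed

lemma integral_puiseux_const: "integral (puiseux_const a)" "residue_coeff (puiseux_const a) = a"
  by (simp_all add: integral_def puiseux_const.rep_eq)

definition puiseux_tends :: "nat filter \<Rightarrow> (nat \<Rightarrow> complex puiseux) \<Rightarrow> complex \<Rightarrow> bool" where
  "puiseux_tends F f a \<longleftrightarrow> eventually (\<lambda>n. integral (f n)) F \<and> ((\<lambda>n. residue_coeff (f n)) \<longlongrightarrow> a) F"

text \<open>Division by the power of t whose exponent is the least valuation of an entry makes all
  entries integral and at least one of them a unit.\<close>

lemma puiseux_normalize:
  fixes y :: "nat \<Rightarrow> 'a::field puiseux"
  assumes "\<exists>j<m. y j \<noteq> 0"
  shows "\<exists>s. s \<noteq> 0 \<and> (\<forall>j<m. integral (s * y j)) \<and> (\<exists>j<m. residue_coeff (s * y j) \<noteq> 0)"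
proof -
  have "\<exists>e u. y j \<noteq> 0 \<longrightarrow> y j = tpow e * u \<and> integral u \<and> residue_coeff u \<noteq> 0" for j
  proof (cases "y j = 0")
    case False
    then obtain e u where "y j = tpow e * u" "integral u" "residue_coeff u \<noteq> 0" by (rule puiseux_val)
    then show ?thesis by blast
  qed blast
  then obtain e u where eu': "\<forall>j. y j \<noteq> 0 \<longrightarrow> y j = tpow (e j) * u j \<and> integral (u j) \<and> residue_coeff (u j) \<noteq> 0"
    by metis
  then have eu: "\<And>j. y j \<noteq> 0 \<Longrightarrow> y j = tpow (e j) * u j"
    "\<And>j. y j \<noteq> 0 \<Longrightarrow> integral (u j)" "\<And>j. y j \<noteq> 0 \<Longrightarrow> residue_coeff (u j) \<noteq> 0" by blast+
  define E where "E = e ` {j. j < m \<and> y j \<noteq> 0}"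
  have E: "finite E" "E \<noteq> {}" using assms by (auto simp: E_def)
  obtain j0 where j0: "j0 < m" "y j0 \<noteq> 0" "e j0 = Min E" using Min_in[OF E] by (auto simp: E_def)
  have sy: "tpow (- Min E) * y j = tpow (e j - Min E) * u j" if "y j \<noteq> 0" for j
    by (subst eu(1)[OF that]) (simp add: mult.assoc[symmetric] tpow_add[symmetric])
  have "integral (tpow (- Min E) * y j)" if "j < m" for j
  proof (cases "y j = 0")
    case True
    then show ?thesis by (simp add: integral_def zero_puiseux.rep_eq)
  next
    case False
    then have "Min E \<le> e j" using that E by (intro Min_le) (auto simp: E_def)
    then have "integral (tpow (e j - Min E) :: 'a puiseux)" by (auto simp: integral_def tpow.rep_eq)
    then show ?thesis unfolding sy[OF False] using eu(2)[OF False] by (rule integral_mult(1))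
  qed
  moreover have "residue_coeff (tpow (- Min E) * y j0) \<noteq> 0"
    unfolding sy[OF j0(2)] using j0 eu(3) by (simp add: tpow_0)
  ultimately show ?thesis using j0(1) by (intro exI[of _ "tpow (- Min E)"]) auto
qed

lemma residue_inverse_eventually:
  assumes "puiseux_tends F f a" "a \<noteq> 0"
  shows "eventually (\<lambda>n. integral (f n) \<and> residue_coeff (f n) \<noteq> 0) F"
proof (rule eventually_conj)
  have t: "((\<lambda>n. residue_coeff (f n)) \<longlongrightarrow> a) F" and i: "eventually (\<lambda>n. integral (f n)) F"
    using assms(1) by (auto simp: puiseux_tends_def)
  show "eventually (\<lambda>n. integral (f n)) F" by (rule i)
  show "eventually (\<lambda>n. residue_coeff (f n) \<noteq> 0) F" by (rule tendsto_imp_eventually_ne[OF t assms(2)])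
qed

interpretation puiseux_limits: valued_limits puiseux_tends "\<lambda>e n. tpow e" puiseux_Im
proof
  have "inj (puiseux_const :: complex \<Rightarrow> complex puiseux)"
    by (rule injI) (metis integral_puiseux_const(2))
  then show "uncountable (UNIV :: complex puiseux set)"
    using uncountable_UNIV_complex countable_image_inj_on[of puiseux_const UNIV] countable_subset[of "range puiseux_const" UNIV]
    by blast
  fix F F' :: "nat filter" and f g :: "nat \<Rightarrow> complex puiseux" and a b :: complex
  show "puiseux_tends F' f a" if "F' \<le> F" "puiseux_tends F f a"
    using that by (auto simp: puiseux_tends_def intro: tendsto_mono filter_leD)
  show "puiseux_tends F g a" if "eventually (\<lambda>n. f n = g n) F" "puiseux_tends F f a"
    unfolding puiseux_tends_def
  proof
    show "eventually (\<lambda>n. integral (g n)) F"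
      using that(1) conjunct1[OF that(2)[unfolded puiseux_tends_def]] by (rule eventually_elim2) simp
    have "eventually (\<lambda>n. residue_coeff (f n) = residue_coeff (g n)) F"
      using that(1) by (rule eventually_mono) simp
    from tendsto_cong[OF this, of a] show "((\<lambda>n. residue_coeff (g n)) \<longlongrightarrow> a) F"
      using that(2) by (simp add: puiseux_tends_def)
  qed
  show "puiseux_tends F (\<lambda>_. 1) 1" by (simp add: puiseux_tends_def integral_1 one_puiseux.rep_eq)
  show "puiseux_tends F (\<lambda>n. f n + g n) (a + b)" if "puiseux_tends F f a" "puiseux_tends F g b"
    unfolding puiseux_tends_def
  proof
    have "eventually (\<lambda>n. integral (f n)) F" "eventually (\<lambda>n. integral (g n)) F"
      using that by (auto simp: puiseux_tends_def)
    then show "eventually (\<lambda>n. integral (f n + g n)) F" by (rule eventually_elim2) (rule integral_add)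
    show "((\<lambda>n. residue_coeff (f n + g n)) \<longlongrightarrow> a + b) F"
      using that by (auto simp: puiseux_tends_def plus_puiseux.rep_eq intro: tendsto_add)
  qed
  show "puiseux_tends F (\<lambda>n. f n * g n) (a * b)" if "puiseux_tends F f a" "puiseux_tends F g b"
    unfolding puiseux_tends_def
  proof
    have ev: "eventually (\<lambda>n. integral (f n) \<and> integral (g n)) F"
      using that unfolding puiseux_tends_def by (auto intro: eventually_conj)
    then show "eventually (\<lambda>n. integral (f n * g n)) F"
      by (rule eventually_mono) (auto intro: integral_mult)
    have e: "eventually (\<lambda>n. residue_coeff (f n) * residue_coeff (g n) = residue_coeff (f n * g n)) F"
      using ev by (rule eventually_mono) (auto simp: integral_mult)
    have "((\<lambda>n. residue_coeff (f n) * residue_coeff (g n)) \<longlongrightarrow> a * b) F"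
      using that unfolding puiseux_tends_def by (auto intro: tendsto_mult)
    then show "((\<lambda>n. residue_coeff (f n * g n)) \<longlongrightarrow> a * b) F" using tendsto_cong[OF e, of "a * b"] by simp
  qed
  show "puiseux_tends F (\<lambda>n. - f n) (- a)" if "puiseux_tends F f a"
    unfolding puiseux_tends_def
  proof
    have "eventually (\<lambda>n. integral (f n)) F" using that by (simp add: puiseux_tends_def)
    then show "eventually (\<lambda>n. integral (- f n)) F" by (rule eventually_mono) (rule integral_uminus)
    show "((\<lambda>n. residue_coeff (- f n)) \<longlongrightarrow> - a) F"
      using that by (auto simp: puiseux_tends_def uminus_puiseux.rep_eq intro: tendsto_minus)
  qed
  show "puiseux_tends F (\<lambda>n. inverse (f n)) (inverse a)" if "puiseux_tends F f a" "a \<noteq> 0"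
    unfolding puiseux_tends_def
  proof
    note ev = residue_inverse_eventually[OF that]
    show "eventually (\<lambda>n. integral (inverse (f n))) F"
      using ev by (rule eventually_mono) (auto intro: integral_inverse)
    have e: "eventually (\<lambda>n. inverse (residue_coeff (f n)) = residue_coeff (inverse (f n))) F"
      using ev by (rule eventually_mono) (auto simp: integral_inverse)
    have "((\<lambda>n. inverse (residue_coeff (f n))) \<longlongrightarrow> inverse a) F"
      using that unfolding puiseux_tends_def by (auto intro: tendsto_inverse)
    then show "((\<lambda>n. residue_coeff (inverse (f n))) \<longlongrightarrow> inverse a) F" using tendsto_cong[OF e, of "inverse a"] by simp
  qed
  show "eventually (\<lambda>n. f n \<noteq> 0) F" if "puiseux_tends F f a" "a \<noteq> 0"
    using residue_inverse_eventually[OF that] by (rule eventually_mono) (auto simp: zero_puiseux.rep_eq)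
  show "a = b" if "F \<noteq> bot" "puiseux_tends F f a" "puiseux_tends F f b"
    using that tendsto_unique unfolding puiseux_tends_def by blast
  show "\<exists>u. \<forall>F. puiseux_tends F (\<lambda>_. u) a"
    by (intro exI[of _ "puiseux_const a"]) (simp add: puiseux_tends_def integral_puiseux_const)
  fix n :: nat and e e' :: rat
  show "tpow 0 = (1 :: complex puiseux)" by (rule tpow_0)
  show "tpow (e + e') = (tpow e * tpow e' :: complex puiseux)" by (rule tpow_add)
  show "puiseux_tends sequentially (\<lambda>n. tpow e) 0" if "e > 0"
    using that by (simp add: puiseux_tends_def integral_def tpow.rep_eq)
  show "\<exists>e a. a \<noteq> 0 \<and> puiseux_tends sequentially (\<lambda>n. u * tpow (- e)) a" if "u \<noteq> 0" for u :: "complex puiseux"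
  proof -
    obtain e v where v: "u = tpow e * v" "integral v" "residue_coeff v \<noteq> 0" by (rule puiseux_val[OF \<open>u \<noteq> 0\<close>])
    have "u * tpow (- e) = (tpow e * tpow (- e)) * v" by (simp add: v(1))
    also have "\<dots> = v" by (simp add: tpow_add[symmetric] tpow_0)
    finally show ?thesis using v(2,3)
      by (intro exI[of _ e] exI[of _ "residue_coeff v"]) (simp add: puiseux_tends_def)
  qed
  show "\<exists>F' s l. F' \<le> F \<and> F' \<noteq> bot \<and> (\<forall>n. s n \<noteq> 0) \<and>
        (\<forall>j<m. puiseux_tends F' (\<lambda>n. s n * y n j) (l j)) \<and> (\<exists>j<m. l j \<noteq> 0)"
    if F: "F \<noteq> bot" and y: "\<And>n. \<exists>j<m. y n j \<noteq> 0" for m and y :: "nat \<Rightarrow> nat \<Rightarrow> complex puiseux"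
  proof -
    \<comment> \<open>Once the valuations are cleared, the residues form nonzero complex vectors, to
      which compactness of complex projective space applies; its scalars are lifted to constant
      series.\<close>
    have "\<forall>n. \<exists>s. s \<noteq> 0 \<and> (\<forall>j<m. integral (s * y n j)) \<and> (\<exists>j<m. residue_coeff (s * y n j) \<noteq> 0)"
      using puiseux_normalize[OF y] by blast
    then obtain s where s: "\<And>n. s n \<noteq> 0" "\<And>n j. j < m \<Longrightarrow> integral (s n * y n j)"
      "\<And>n. \<exists>j<m. residue_coeff (s n * y n j) \<noteq> 0" by metis
    obtain F' t l where t: "F' \<le> F" "F' \<noteq> bot" "\<forall>n. t n \<noteq> 0"
      "\<forall>j<m. ((\<lambda>n. t n * residue_coeff (s n * y n j)) \<longlongrightarrow> l j) F'" "\<exists>j<m. l j \<noteq> 0"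
      using complex_compactness[OF F, of m "\<lambda>n j. residue_coeff (s n * y n j)"] s(3) by blast
    have "puiseux_tends F' (\<lambda>n. puiseux_const (t n) * s n * y n j) (l j)" if "j < m" for j
      unfolding puiseux_tends_def mult.assoc
      using integral_mult[OF integral_puiseux_const(1) s(2)[OF that]] t(4) that
      by (simp add: integral_puiseux_const)
    moreover have "puiseux_const (t n) * s n \<noteq> 0" for n
    proof -
      have "puiseux_const (t n) \<noteq> 0"
        using t(3) integral_puiseux_const(2)[of "t n"] by (metis zero_puiseux.rep_eq)
      then show ?thesis using s(1) by simp
    qed
    ultimately show ?thesis using t by (intro exI[of _ F'] exI[of _ "\<lambda>n. puiseux_const (t n) * s n"] exI[of _ l]) auto
  qed
  show "eventually (\<lambda>n. puiseux_Im (tpow e * f n) > 0) F"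
    if "F \<le> sequentially" "puiseux_tends F f a" "Im a > 0"
  proof -
    have "((\<lambda>n. Im (residue_coeff (f n))) \<longlongrightarrow> Im a) F"
      using that(2) unfolding puiseux_tends_def by (auto intro: tendsto_Im)
    then have "eventually (\<lambda>n. Im (residue_coeff (f n)) > 0) F" using that(3) by (rule order_tendstoD)
    moreover have "eventually (\<lambda>n. integral (f n)) F" using that(2) by (simp add: puiseux_tends_def)
    ultimately show ?thesis
    proof (rule eventually_elim2)
      \<comment> \<open>The lowest exponent in the imaginary part is \<open>e\<close>, and its
        coefficient is the imaginary part of the residue.\<close>
      fix n assume n: "Im (residue_coeff (f n)) > 0" "integral (f n)"
      then show "puiseux_Im (tpow e * f n) > 0"
        unfolding less_puiseux_def puiseux_pos_def
        by (intro exI[of _ e]) (auto simp: puiseux_Im.rep_eq coeff_tpow_mult integral_def)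
    qed
  qed
  show "puiseux_Im (- x) = - puiseux_Im x" for x
    by (rule puiseux_eqI) (simp add: puiseux_Im.rep_eq uminus_puiseux.rep_eq)
qed

section \<open>Generic weights\<close>

definition dot :: "nat \<Rightarrow> (nat \<Rightarrow> 'a::comm_ring_1) \<Rightarrow> (nat \<Rightarrow> 'a) \<Rightarrow> 'a" where
  "dot n x y = (\<Sum>i<n. x i * y i)"

lemma dot_add: "dot n (\<lambda>i. x i + y i) z = dot n x z + dot n y z"
  "dot n z (\<lambda>i. x i + y i) = dot n z x + dot n z y"
  by (simp_all add: dot_def algebra_simps sum.distrib)

lemma dot_diff: "dot n (\<lambda>i. x i - y i) z = dot n x z - dot n y z"
  "dot n z (\<lambda>i. x i - y i) = dot n z x - dot n z y"
  by (simp_all add: dot_def algebra_simps sum_subtractf)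

lemma dot_scale: "dot n (\<lambda>i. c * x i) z = c * dot n x z" "dot n z (\<lambda>i. c * x i) = c * dot n z x"
  by (simp_all add: dot_def sum_distrib_left ac_simps)

lemma eventually_large:
  fixes x y :: rat
  shows "x > 0 \<Longrightarrow> eventually (\<lambda>M. M * x + y > 0) at_top"
    and "x \<noteq> 0 \<Longrightarrow> eventually (\<lambda>M. M * x + y \<noteq> 0) at_top"
proof -
  have pos: "eventually (\<lambda>M. M * x + y > 0) at_top" if "x > 0" for x y :: rat
    unfolding eventually_at_top_linorder
  proof (intro exI[of _ "(1 - y) / x"] allI impI)
    fix M assume "(1 - y) / x \<le> M"
    then have "1 - y \<le> M * x" using that by (simp add: divide_le_eq)
    then show "M * x + y > 0" by linarith
  qed
  then show "x > 0 \<Longrightarrow> eventually (\<lambda>M. M * x + y > 0) at_top" by blast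
  show "eventually (\<lambda>M. M * x + y \<noteq> 0) at_top" if "x \<noteq> 0"
  proof (cases "x > 0")
    case True
    show ?thesis by (rule eventually_mono[OF pos[OF True, of y]]) simp
  next
    case False
    then have "- x > 0" using that by simp
    show ?thesis by (rule eventually_mono[OF pos[OF \<open>- x > 0\<close>, of "- y"]]) auto
  qed
qed

text \<open>Gordan's theorem over the rationals, by induction on the vectors. If a functional
  \<open>w\<close> that is positive on the old vectors is negative on the new vector
  \<open>v b\<close>, the old vectors are moved along \<open>v b\<close> into the hyperplane
  orthogonal to \<open>w\<close>, and the induction hypothesis is applied to them there.\<close>

lemma gordan:
  fixes v :: "'a \<Rightarrow> nat \<Rightarrow> rat"
  assumes "finite I"
  shows "(\<exists>w. \<forall>a\<in>I. dot n w (v a) > 0) \<or>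
    (\<exists>l. (\<forall>a\<in>I. l a \<ge> 0) \<and> (\<exists>a\<in>I. l a > 0) \<and> (\<forall>i<n. (\<Sum>a\<in>I. l a * v a i) = 0))"
  using assms
proof (induction I arbitrary: v rule: finite_induct)
  case empty
  then show ?case by simp
next
  case (insert b I)
  let ?goal = "(\<exists>w. \<forall>a\<in>insert b I. dot n w (v a) > 0) \<or>
    (\<exists>l. (\<forall>a\<in>insert b I. l a \<ge> 0) \<and> (\<exists>a\<in>insert b I. l a > 0) \<and> (\<forall>i<n. (\<Sum>a\<in>insert b I. l a * v a i) = 0))"
  have ext: "(\<Sum>a\<in>insert b I. (l(b := x)) a * v a i) = x * v b i + (\<Sum>a\<in>I. l a * v a i)" for l x i
    using insert.hyps by (auto intro!: sum.cong)
  have dep: ?goal if "\<forall>a\<in>I. l a \<ge> 0" "x \<ge> 0" "(\<exists>a\<in>I. l a > 0) \<or> x > 0"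
    "\<forall>i<n. x * v b i + (\<Sum>a\<in>I. l a * v a i) = 0" for l x
  proof (rule disjI2, intro exI[of _ "l(b := x)"] conjI)
    show "\<forall>a\<in>insert b I. (l(b := x)) a \<ge> 0" using that(1,2) by auto
    show "\<exists>a\<in>insert b I. (l(b := x)) a > 0" using that(3) insert.hyps(2) by auto
    show "\<forall>i<n. (\<Sum>a\<in>insert b I. (l(b := x)) a * v a i) = 0" unfolding ext using that(4) .
  qed
  \<comment> \<open>A large multiple of \<open>W\<close> keeps the values on \<open>I\<close>
    positive, while \<open>w\<close> settles the sign at \<open>v b\<close>.\<close>
  have combine: ?goal if W: "\<forall>a\<in>I. dot n W (v a) > 0" "dot n W (v b) = 0" and w: "dot n w (v b) > 0" for W w
  proof -
    have "eventually (\<lambda>M. \<forall>a\<in>I. M * dot n W (v a) + dot n w (v a) > 0) at_top"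
      using insert.hyps(1) W(1) by (intro eventually_ball_finite ballI eventually_large) auto
    from eventually_happens'[OF trivial_limit_at_top_linorder this] obtain M where M: "\<forall>a\<in>I. M * dot n W (v a) + dot n w (v a) > 0"
      by blast
    then have "\<forall>a\<in>insert b I. dot n (\<lambda>i. M * W i + w i) (v a) > 0"
      using W(2) w by (simp add: dot_add dot_scale)
    then show ?goal by blast
  qed
  from insert.IH[of v] show ?case
  proof (elim disjE exE conjE)
    fix l assume l: "\<forall>a\<in>I. l a \<ge> 0" "\<exists>a\<in>I. l a > 0" "\<forall>i<n. (\<Sum>a\<in>I. l a * v a i) = 0"
    show ?case by (rule dep[of l 0]) (use l in auto)
  next
    fix w assume w: "\<forall>a\<in>I. dot n w (v a) > 0"
    consider "dot n w (v b) > 0" | "dot n w (v b) = 0" | "dot n w (v b) < 0" by linarith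
    then show ?case
    proof cases
      case 1
      then have "\<forall>a\<in>insert b I. dot n w (v a) > 0" using w by simp
      then show ?thesis by blast
    next
      case 2
      show ?thesis
      proof (cases "\<forall>i<n. v b i = 0")
        case True
        show ?thesis by (rule dep[of "\<lambda>_. 0" 1]) (use True in auto)
      next
        case False
        then obtain i where "i < n" "v b i \<noteq> 0" by blast
        then have "dot n (v b) (v b) > 0"
          unfolding dot_def by (intro sum_pos2[of _ i]) (auto simp: zero_less_mult_iff)
        then show ?thesis using combine[OF w 2] by blast
      qed
    next
      case 3
      define p where "p a = dot n w (v a) / - dot n w (v b)" for a
      have p: "p a > 0" if "a \<in> I" for a using w 3 that unfolding p_def by (intro divide_pos_pos) auto
      from insert.IH[of "\<lambda>a i. v a i + p a * v b i"] show ?thesis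
      proof (elim disjE exE conjE)
        fix l assume l: "\<forall>a\<in>I. l a \<ge> 0" "\<exists>a\<in>I. l a > 0" "\<forall>i<n. (\<Sum>a\<in>I. l a * (v a i + p a * v b i)) = 0"
        show ?thesis
        proof (rule dep[of l "\<Sum>a\<in>I. l a * p a"])
          show "(\<Sum>a\<in>I. l a * p a) \<ge> 0" using l(1) p by (intro sum_nonneg mult_nonneg_nonneg) (auto intro: less_imp_le)
          show "\<forall>i<n. (\<Sum>a\<in>I. l a * p a) * v b i + (\<Sum>a\<in>I. l a * v a i) = 0"
            using l(3) by (simp add: distrib_left sum.distrib sum_distrib_right mult.assoc add.commute)
        qed (use l in auto)
      next
        fix u assume u: "\<forall>a\<in>I. dot n u (\<lambda>i. v a i + p a * v b i) > 0"
        \<comment> \<open>A multiple of \<open>w\<close> is added so that the product with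
          \<open>v b\<close> vanishes; on the moved vectors, all orthogonal to \<open>w\<close>,
          nothing changes.\<close>
        define W where "W i = u i + (- dot n u (v b) / dot n w (v b)) * w i" for i
        have W0: "dot n W (v b) = 0" unfolding W_def dot_add dot_scale using 3 by simp
        have "dot n w (\<lambda>i. v a i + p a * v b i) = 0" for a
          unfolding dot_add dot_scale p_def using 3 by simp
        then have "dot n W (\<lambda>i. v a i + p a * v b i) = dot n u (\<lambda>i. v a i + p a * v b i)" for a
          unfolding W_def dot_add(1) dot_scale(1) by simp
        then have W: "\<forall>a\<in>I. dot n W (v a) > 0"
          using u W0 by (simp add: dot_add(2) dot_scale(2))
        have "dot n (\<lambda>i. - 1 * w i) (v b) > 0" unfolding dot_scale using 3 by simp
        then show ?thesis by (rule combine[OF W W0])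
      qed
    qed
  qed
qed

text \<open>A multiple of the point with parameter \<open>s\<close> on the moment curve is corrected
  in the coordinate \<open>i0\<close> to become orthogonal to \<open>v\<close>. Its products with
  the members of \<open>\<Delta>\<close> are nonzero polynomials in \<open>s\<close>, and some
  \<open>s\<close> avoids all their roots.\<close>

lemma ex_generic_orthogonal:
  fixes v :: "nat \<Rightarrow> rat" and \<Delta> :: "(nat \<Rightarrow> rat) set"
  assumes fin: "finite \<Delta>" and i0: "i0 < n"
    and \<Delta>: "\<And>\<delta>. \<delta> \<in> \<Delta> \<Longrightarrow> \<exists>k<n. v i0 * \<delta> k \<noteq> v k * \<delta> i0"
  obtains u where "dot n u v = 0" "\<And>\<delta>. \<delta> \<in> \<Delta> \<Longrightarrow> dot n u \<delta> \<noteq> 0"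
proof -
  define p where "p \<delta> = (\<Sum>k<n. Polynomial.monom (v i0 * \<delta> k - v k * \<delta> i0) k)" for \<delta>
  have "p \<delta> \<noteq> 0" if \<delta>: "\<delta> \<in> \<Delta>" for \<delta>
  proof -
    obtain k where k: "k < n" "v i0 * \<delta> k \<noteq> v k * \<delta> i0" using \<Delta>[OF \<delta>] by blast
    have "coeff (p \<delta>) k = v i0 * \<delta> k - v k * \<delta> i0" using k(1) by (simp add: p_def coeff_sum)
    then show ?thesis using k(2) by auto
  qed
  then have "(\<Prod>\<delta>\<in>\<Delta>. p \<delta>) \<noteq> 0" using fin by (simp add: prod_zero_iff)
  then have "finite {s. poly (\<Prod>\<delta>\<in>\<Delta>. p \<delta>) s = 0}" by (rule poly_roots_finite)
  then obtain s where "poly (\<Prod>\<delta>\<in>\<Delta>. p \<delta>) s \<noteq> 0"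
    using infinite_UNIV_char_0[where 'a=rat] by (metis (mono_tags) ex_new_if_finite mem_Collect_eq)
  then have s: "\<And>\<delta>. \<delta> \<in> \<Delta> \<Longrightarrow> poly (p \<delta>) s \<noteq> 0" using fin by (simp add: poly_prod prod_zero_iff)
  define u where "u i = v i0 * s ^ i - (if i = i0 then \<Sum>k<n. v k * s ^ k else 0)" for i
  have u: "dot n u \<delta> = (\<Sum>k<n. (v i0 * \<delta> k - v k * \<delta> i0) * s ^ k)" for \<delta>
  proof -
    have "dot n u \<delta> = (\<Sum>i<n. v i0 * s ^ i * \<delta> i) - (\<Sum>i<n. if i = i0 then (\<Sum>k<n. v k * s ^ k) * \<delta> i0 else 0)"
      unfolding dot_def sum_subtractf[symmetric] by (rule sum.cong) (auto simp: u_def algebra_simps)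
    also have "\<dots> = (\<Sum>i<n. v i0 * s ^ i * \<delta> i) - (\<Sum>k<n. v k * s ^ k) * \<delta> i0" using i0 by simp
    also have "\<dots> = (\<Sum>k<n. (v i0 * \<delta> k - v k * \<delta> i0) * s ^ k)"
      unfolding sum_distrib_right sum_subtractf[symmetric] by (rule sum.cong) (auto simp: algebra_simps)
    finally show ?thesis .
  qed
  show thesis
  proof (rule that[of u])
    show "dot n u v = 0" by (simp add: u)
    show "dot n u \<delta> \<noteq> 0" if "\<delta> \<in> \<Delta>" for \<delta>
      using s[OF that] by (simp add: u p_def poly_sum poly_monom)
  qed
qed

text \<open>Three scales are combined. The dominating \<open>w2\<close> makes the elements of
  \<open>S\<close> positive, \<open>u\<close> breaks the ties that \<open>w2\<close> leaves in
  \<open>R\<close>, and \<open>w1\<close>, on the smallest scale, alone contributes to the product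
  with \<open>v\<close>, because \<open>w2\<close> and \<open>u\<close> are orthogonal to
  \<open>v\<close>.\<close>

lemma ex_generic_weight:
  fixes v w1 w2 :: "nat \<Rightarrow> rat" and \<Delta> :: "(nat \<Rightarrow> rat) set" and S R :: "((nat \<Rightarrow> rat) \<times> rat) set"
  assumes fin: "finite S" "finite R" and i0: "i0 < n"
    and w2: "dot n w2 v = 0" "\<And>\<delta> x. (\<delta>, x) \<in> S \<Longrightarrow> dot n w2 \<delta> > 0"
    and R: "\<And>\<delta> x. (\<delta>, x) \<in> R \<Longrightarrow> \<exists>k<n. v i0 * \<delta> k \<noteq> v k * \<delta> i0"
  obtains w where "dot n w v = dot n w1 v" "\<And>\<delta> x. (\<delta>, x) \<in> S \<Longrightarrow> x + dot n w \<delta> > 0"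
    "\<And>\<delta> x. (\<delta>, x) \<in> R \<Longrightarrow> x + dot n w \<delta> \<noteq> 0"
proof -
  have R': "\<exists>k<n. v i0 * \<delta> k \<noteq> v k * \<delta> i0" if "\<delta> \<in> fst ` R" for \<delta>
    using that R by auto
  obtain u where u: "dot n u v = 0" "\<And>\<delta>. \<delta> \<in> fst ` R \<Longrightarrow> dot n u \<delta> \<noteq> 0"
    by (rule ex_generic_orthogonal[OF finite_imageI[OF fin(2)] i0 R']) (assumption, rule that)
  have "eventually (\<lambda>M. (\<forall>p\<in>S. M * dot n w2 (fst p) + dot n u (fst p) > 0) \<and>
      (\<forall>p\<in>R. M * dot n w2 (fst p) + dot n u (fst p) \<noteq> 0)) at_top"
  proof (intro eventually_conj eventually_ball_finite ballI fin)
    fix p assume "p \<in> S"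
    then show "eventually (\<lambda>M. M * dot n w2 (fst p) + dot n u (fst p) > 0) at_top"
      using w2(2) by (intro eventually_large) (metis prod.collapse)
  next
    fix p assume p: "p \<in> R"
    show "eventually (\<lambda>M. M * dot n w2 (fst p) + dot n u (fst p) \<noteq> 0) at_top"
    proof (cases "dot n w2 (fst p) = 0")
      case True
      then show ?thesis using u(2) p by simp
    next
      case False
      then show ?thesis by (rule eventually_large)
    qed
  qed
  from eventually_happens'[OF trivial_limit_at_top_linorder this] obtain M where M: "\<forall>p\<in>S. M * dot n w2 (fst p) + dot n u (fst p) > 0"
    "\<forall>p\<in>R. M * dot n w2 (fst p) + dot n u (fst p) \<noteq> 0"
    by blast
  define w3 where "w3 i = M * w2 i + u i" for i
  have w3: "dot n w3 x = M * dot n w2 x + dot n u x" for x unfolding w3_def dot_add dot_scale ..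
  have "eventually (\<lambda>M. (\<forall>p\<in>S. M * dot n w3 (fst p) + (snd p + dot n w1 (fst p)) > 0) \<and>
      (\<forall>p\<in>R. M * dot n w3 (fst p) + (snd p + dot n w1 (fst p)) \<noteq> 0)) at_top"
    using M unfolding w3[symmetric]
    by (intro eventually_conj eventually_ball_finite ballI fin eventually_large) auto
  from eventually_happens'[OF trivial_limit_at_top_linorder this] obtain N where N: "\<forall>p\<in>S. N * dot n w3 (fst p) + (snd p + dot n w1 (fst p)) > 0"
    "\<forall>p\<in>R. N * dot n w3 (fst p) + (snd p + dot n w1 (fst p)) \<noteq> 0"
    by blast
  define w where "w i = N * w3 i + w1 i" for i
  have w: "dot n w x = N * dot n w3 x + dot n w1 x" for x unfolding w_def dot_add dot_scale ..
  show thesis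
  proof (rule that[of w])
    show "dot n w v = dot n w1 v" using w2(1) u(1) by (simp add: w w3)
    show "x + dot n w \<delta> > 0" if "(\<delta>, x) \<in> S" for \<delta> x using N(1) that unfolding w by force
    show "x + dot n w \<delta> \<noteq> 0" if "(\<delta>, x) \<in> R" for \<delta> x using N(2) that unfolding w by force
  qed
qed

text \<open>
  On the product of the upper half planes, the argument of the Laurent monomial with exponent
  \<open>v\<close> ranges over an interval of length \<open>\<pi> \<Sum>\<bar>v\<^sub>i\<bar>\<close>, so the monomial takes all nonzero values as
  soon as this length exceeds \<open>2\<pi>\<close>.
\<close>

lemma ex_upper_half_plane_monomial:
  fixes v :: "nat \<Rightarrow> int"
  assumes v: "(\<Sum>i<n. v i) = 0" "(\<Sum>i<n. \<bar>v i\<bar>) > 2" and r: "r \<noteq> 0"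
  obtains z :: "nat \<Rightarrow> complex" where "\<And>i. Im (z i) > 0" "(\<Prod>i<n. z i powi v i) = r"
proof -
  define S where "S = real_of_int (\<Sum>i<n. \<bar>v i\<bar>)"
  have S: "S > 2" using v(2) unfolding S_def by linarith
  obtain i0 where i0: "i0 < n" "v i0 \<noteq> 0"
    using v(2) by (metis abs_zero lessThan_iff not_numeral_less_zero sum.neutral)
  define \<phi> where "\<phi> = Im (Ln r)"
  have \<phi>: "\<bar>\<phi>\<bar> \<le> pi" using mpi_less_Im_Ln[OF r] Im_Ln_le_pi[OF r] by (auto simp: \<phi>_def)
  \<comment> \<open>The deviations from the right angle follow the signs of \<open>v\<close> and add
    up to \<open>\<phi>\<close> in the argument of the monomial; the right angles cancel because
    \<open>v\<close> has sum 0.\<close>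
  define \<theta> where "\<theta> i = pi / 2 + \<phi> / S * sgn (real_of_int (v i))" for i
  have "\<bar>\<phi> / S * sgn (real_of_int (v i))\<bar> < pi / 2" for i
  proof -
    have "\<bar>\<phi> / S * sgn (real_of_int (v i))\<bar> \<le> \<bar>\<phi>\<bar> / S"
      using S by (auto simp: abs_mult sgn_if)
    also have "\<dots> \<le> pi / S" using \<phi> S by (intro divide_right_mono) auto
    also have "\<dots> < pi / 2" using S by (intro divide_strict_left_mono) auto
    finally show ?thesis .
  qed
  then have \<theta>: "0 < \<theta> i" "\<theta> i < pi" for i
    unfolding \<theta>_def by (smt (verit) field_sum_of_halves)+
  \<comment> \<open>Logarithms of the coordinates; the modulus of \<open>r\<close> is put into the
    coordinate \<open>i0\<close> alone.\<close>
  define w where "w i = Complex (if i = i0 then Re (Ln r) / real_of_int (v i0) else 0) (\<theta> i)" for i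
  have "(\<Sum>i<n. of_int (v i) * w i) = Ln r"
  proof (rule complex_eqI)
    have "Re (\<Sum>i<n. of_int (v i) * w i) = (\<Sum>i<n. if i = i0 then Re (Ln r) else 0)"
      unfolding Re_sum by (rule sum.cong) (use i0 in \<open>auto simp: w_def\<close>)
    then show "Re (\<Sum>i<n. of_int (v i) * w i) = Re (Ln r)" using i0 by simp
    have "Im (\<Sum>i<n. of_int (v i) * w i) = (\<Sum>i<n. real_of_int (v i) * (pi / 2) + \<phi> / S * real_of_int \<bar>v i\<bar>)"
      unfolding Im_sum by (rule sum.cong) (auto simp: w_def \<theta>_def sgn_if abs_if algebra_simps)
    also have "\<dots> = real_of_int (\<Sum>i<n. v i) * (pi / 2) + \<phi> / S * S"
      unfolding sum.distrib S_def by (simp add: sum_distrib_left sum_distrib_right)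
    also have "\<dots> = \<phi>" using S v(1) by simp
    finally show "Im (\<Sum>i<n. of_int (v i) * w i) = Im (Ln r)" by (simp add: \<phi>_def)
  qed
  moreover have "(\<Prod>i<n. exp (w i) powi v i) = exp (\<Sum>i<n. of_int (v i) * w i)"
    by (simp add: exp_sum exp_power_int)
  ultimately have "(\<Prod>i<n. exp (w i) powi v i) = r" using r by simp
  then show thesis
  proof (rule that[rotated])
    show "Im (exp (w i)) > 0" for i using \<theta>[of i] by (simp add: Im_exp w_def sin_gt_zero)
  qed
qed

section \<open>Leading terms and zeros along a direction normal to an edge\<close>

context valued_limits
begin

text \<open>The order is characterized by a limit, so that one definition serves both fields. Over
  the complex numbers the order of a nonzero element is 0.\<close>

definition val :: "'k \<Rightarrow> rat" where
  "val u = (SOME e. \<exists>a. a \<noteq> 0 \<and> tends sequentially (\<lambda>n. u * T (- e) n) a)"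

definition lead :: "'k \<Rightarrow> complex" where
  "lead u = (SOME a. a \<noteq> 0 \<and> tends sequentially (\<lambda>n. u * T (- val u) n) a)"

lemma val_lead:
  assumes "u \<noteq> 0"
  shows "lead u \<noteq> 0" "tends sequentially (\<lambda>n. u * T (- val u) n) (lead u)"
proof -
  have "\<exists>a. a \<noteq> 0 \<and> tends sequentially (\<lambda>n. u * T (- val u) n) a"
    unfolding val_def by (rule someI_ex) (rule valuation[OF assms])
  then have "lead u \<noteq> 0 \<and> tends sequentially (\<lambda>n. u * T (- val u) n) (lead u)"
    unfolding lead_def by (rule someI_ex)
  then show "lead u \<noteq> 0" "tends sequentially (\<lambda>n. u * T (- val u) n) (lead u)" by auto
qed

abbreviation exponent :: "(nat \<Rightarrow>\<^sub>0 nat) \<Rightarrow> nat \<Rightarrow> rat" where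
  "exponent \<alpha> \<equiv> \<lambda>i. of_nat (lookup \<alpha> i)"

lemma dot_exponent: "(\<Sum>i<n. of_nat (lookup \<alpha> i) * w i) = dot n w (exponent \<alpha>)"
  by (simp add: dot_def mult.commute)

text \<open>
  A weight in the normal cone of an edge can be chosen such that two terms of the edge have
  minimal order while the terms of the finitely many further polynomials in \<open>G\<close> have distinct
  orders unless their exponents differ by a multiple of \<open>v\<close>. The initial form of the edge has a zero
  in the product of upper half planes, which is then followed along \<open>T w\<close>.
\<close>

lemma edge_limit_point:
  fixes v :: "nat \<Rightarrow> int" and \<phi> :: "(nat \<Rightarrow>\<^sub>0 nat) \<Rightarrow> 'k" and G :: "(nat, 'k) mpoly set"
  assumes Q: "finite Q" "\<And>\<alpha>. \<alpha> \<in> Q \<Longrightarrow> \<phi> \<alpha> \<noteq> 0" "\<And>\<alpha>. \<alpha> \<in> Q \<Longrightarrow> keys \<alpha> \<subseteq> {..<n}"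
    and v: "(\<Sum>i<n. v i) = 0" "(\<Sum>i<n. \<bar>v i\<bar>) > 2"
    and E: "E \<subseteq> Q" "a \<in> E" "b \<in> E" "b \<noteq> a"
    and kk: "\<And>\<alpha> i. \<alpha> \<in> E \<Longrightarrow> i < n \<Longrightarrow> int (lookup \<alpha> i) = int (lookup a i) + int (kk \<alpha>) * v i"
    and w2: "dot n w2 (\<lambda>i. of_int (v i)) = 0"
      "\<And>\<alpha>. \<alpha> \<in> Q - E \<Longrightarrow> dot n w2 (\<lambda>i. exponent \<alpha> i - exponent a i) > 0"
    and G: "finite G"
  obtains F w Z z where "F \<le> sequentially" "F \<noteq> bot" "\<And>i. i < n \<Longrightarrow> tends F (Z i) (z i)"
    "\<And>i. i < n \<Longrightarrow> Im (z i) > 0"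
    "eventually (\<lambda>m. (\<Sum>\<alpha>\<in>Q. \<phi> \<alpha> * (\<Prod>i<n. (T (w i) m * Z i m) ^ lookup \<alpha> i)) = 0) F"
    "\<And>g \<beta> \<beta>' k l. g \<in> G \<Longrightarrow> \<beta> \<in> keys g \<Longrightarrow> \<beta>' \<in> keys g \<Longrightarrow>
      val (lookup g \<beta>) + dot n w (exponent \<beta>) = val (lookup g \<beta>') + dot n w (exponent \<beta>') \<Longrightarrow> k < n \<Longrightarrow> l < n \<Longrightarrow>
      of_int (v k) * (exponent \<beta> l - exponent \<beta>' l) = of_int (v l) * (exponent \<beta> k - exponent \<beta>' k)"
proof -
  define rv where "rv i = (of_int (v i) :: rat)" for i
  obtain i0 where i0: "i0 < n" "v i0 \<noteq> 0"
    using v(2) by (metis abs_zero lessThan_iff not_numeral_less_zero sum.neutral)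
  have finE: "finite E" using E(1) Q(1) finite_subset by blast
  have kinj: "\<alpha> = \<beta>" if "\<alpha> \<in> E" "\<beta> \<in> E" "kk \<alpha> = kk \<beta>" for \<alpha> \<beta>
  proof (rule poly_mapping_eqI)
    fix i
    show "lookup \<alpha> i = lookup \<beta> i"
    proof (cases "i < n")
      case True
      then show ?thesis using kk[OF that(1), of i] kk[OF that(2), of i] that(3) by simp
    next
      case False
      then have "i \<notin> keys \<alpha>" "i \<notin> keys \<beta>" using Q(3) E(1) that by blast+
      then show ?thesis by (simp add: in_keys_iff)
    qed
  qed
  have ka: "kk a = 0" using kk[OF E(2) i0(1)] i0(2) by simp
  have kb: "kk b > 0" using kinj[OF E(3,2)] E(4) ka by auto
  have exE: "exponent \<alpha> i = exponent a i + of_nat (kk \<alpha>) * rv i" if "\<alpha> \<in> E" "i < n" for \<alpha> i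
  proof -
    have "(of_int (int (lookup \<alpha> i)) :: rat) = of_int (int (lookup a i) + int (kk \<alpha>) * v i)"
      using kk[OF that] by simp
    then show ?thesis by (simp add: rv_def)
  qed
  \<comment> \<open>The value of the product of the weight with \<open>v\<close> at which the terms
    of \<open>a\<close> and \<open>\<alpha>\<close> have the same order.\<close>
  define s where "s \<alpha> = (val (\<phi> a) - val (\<phi> \<alpha>)) / of_nat (kk \<alpha>)" for \<alpha>
  define P where "P = {\<alpha> \<in> E. kk \<alpha> > 0}"
  have P: "finite (s ` P)" "s ` P \<noteq> {}" using finE E(3) kb by (auto simp: P_def)
  \<comment> \<open>At the largest of these values \<open>a\<close> has minimal order on the edge
    and ties with \<open>a1\<close>, so the initial form has at least two terms.\<close>
  define \<mu> where "\<mu> = Max (s ` P)"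
  obtain a1 where a1: "a1 \<in> E" "kk a1 > 0" "s a1 = \<mu>" using Max_in[OF P] by (auto simp: P_def \<mu>_def)
  have ge: "val (\<phi> a) \<le> val (\<phi> \<alpha>) + of_nat (kk \<alpha>) * \<mu>" if "\<alpha> \<in> E" for \<alpha>
  proof (cases "kk \<alpha> = 0")
    case True
    then have "\<alpha> = a" using kinj[OF that E(2)] ka by simp
    then show ?thesis using True by simp
  next
    case False
    then have "s \<alpha> \<le> \<mu>" unfolding \<mu>_def using P(1) that by (intro Max_ge) (auto simp: P_def)
    then show ?thesis using False by (simp add: s_def field_simps)
  qed
  have eq1: "val (\<phi> a1) + of_nat (kk a1) * \<mu> = val (\<phi> a)"
    unfolding a1(3)[symmetric] s_def using a1(2) by simp
  define w1 where "w1 i = (if i = i0 then \<mu> / rv i0 else 0)" for i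
  have rv0: "rv i0 \<noteq> 0" using i0(2) by (simp add: rv_def)
  have w1: "dot n w1 rv = \<mu>"
  proof -
    have "dot n w1 rv = (\<Sum>i<n. if i = i0 then \<mu> else 0)"
      unfolding dot_def by (rule sum.cong) (use rv0 in \<open>auto simp: w1_def\<close>)
    then show ?thesis using i0(1) by simp
  qed
  \<comment> \<open>\<open>S\<close> encodes that terms off the edge have larger order than
    \<open>a\<close>. \<open>R\<close> encodes that two terms of a polynomial in \<open>G\<close>
    have different orders unless their exponents differ by a multiple of \<open>v\<close>.\<close>
  define S where "S = (\<lambda>\<alpha>. (\<lambda>i. exponent \<alpha> i - exponent a i, val (\<phi> \<alpha>) - val (\<phi> a))) ` (Q - E)"
  define df where "df \<beta> \<beta>' = (\<lambda>i. exponent \<beta> i - exponent \<beta>' i)" for \<beta> \<beta>'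
  define R where "R = (\<Union>g\<in>G. (\<lambda>(\<beta>, \<beta>'). (df \<beta> \<beta>', val (lookup g \<beta>) - val (lookup g \<beta>'))) `
    {(\<beta>, \<beta>') \<in> keys g \<times> keys g. \<exists>k<n. rv i0 * df \<beta> \<beta>' k \<noteq> rv k * df \<beta> \<beta>' i0})"
  have finR: "finite R" unfolding R_def
    by (intro finite_UN_I G finite_imageI finite_subset[OF _ finite_cartesian_product[OF finite_keys finite_keys]]) auto
  have finS: "finite S" using Q(1) by (simp add: S_def)
  have R: "\<exists>k<n. rv i0 * \<delta> k \<noteq> rv k * \<delta> i0" if "(\<delta>, x) \<in> R" for \<delta> x using that by (auto simp: R_def)
  have S: "dot n w2 \<delta> > 0" if "(\<delta>, x) \<in> S" for \<delta> x using that w2(2) by (auto simp: S_def)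
  have w2': "dot n w2 rv = 0" using w2(1) by (simp add: rv_def[abs_def])
  obtain w where w: "dot n w rv = dot n w1 rv" "\<And>\<delta> x. (\<delta>, x) \<in> S \<Longrightarrow> x + dot n w \<delta> > 0"
    "\<And>\<delta> x. (\<delta>, x) \<in> R \<Longrightarrow> x + dot n w \<delta> \<noteq> 0"
    by (rule ex_generic_weight[OF finS finR i0(1) w2' S R]) (assumption, assumption, rule that)
  define m where "m = val (\<phi> a) + dot n w (exponent a)"
  have dE: "dot n w (exponent \<alpha>) = dot n w (exponent a) + of_nat (kk \<alpha>) * \<mu>" if "\<alpha> \<in> E" for \<alpha>
  proof -
    have "dot n w (exponent \<alpha>) = dot n w (\<lambda>i. exponent a i + of_nat (kk \<alpha>) * rv i)"
      unfolding dot_def by (rule sum.cong) (simp_all add: exE[OF that])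
    then show ?thesis by (simp add: dot_add dot_scale w(1) w1)
  qed
  have strict: "m < val (\<phi> \<alpha>) + dot n w (exponent \<alpha>)" if "\<alpha> \<in> Q" "\<alpha> \<notin> E" for \<alpha>
  proof -
    have "(\<lambda>i. exponent \<alpha> i - exponent a i, val (\<phi> \<alpha>) - val (\<phi> a)) \<in> S" using that by (simp add: S_def)
    from w(2)[OF this] show ?thesis by (simp add: dot_diff m_def)
  qed
  have mle: "m \<le> val (\<phi> \<alpha>) + dot n w (exponent \<alpha>)" if "\<alpha> \<in> Q" for \<alpha>
    using strict[OF that] ge[of \<alpha>] dE[of \<alpha>] by (cases "\<alpha> \<in> E") (auto simp: m_def)
  define E0 where "E0 = {\<alpha> \<in> E. val (\<phi> \<alpha>) + of_nat (kk \<alpha>) * \<mu> = val (\<phi> a)}"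
  have tie: "\<alpha> \<in> Q \<and> val (\<phi> \<alpha>) + dot n w (exponent \<alpha>) = m \<longleftrightarrow> \<alpha> \<in> E0" for \<alpha>
  proof (cases "\<alpha> \<in> E")
    case True
    then show ?thesis using dE E(1) by (auto simp: E0_def m_def)
  next
    case False
    then show ?thesis using strict[of \<alpha>] by (auto simp: E0_def)
  qed
  have aE0: "a \<in> E0" using E(2) ka by (simp add: E0_def)
  have a1E0: "a1 \<in> E0" using a1(1) eq1 by (simp add: E0_def)
  have finE0: "finite E0" using finE by (simp add: E0_def)
  have leadE: "lead (\<phi> \<alpha>) \<noteq> 0" if "\<alpha> \<in> Q" for \<alpha> using val_lead(1)[OF Q(2)[OF that]] .
  have E0Q: "E0 \<subseteq> Q" using E(1) by (auto simp: E0_def)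
  \<comment> \<open>The initial form divided by the monomial of \<open>a\<close>, as a polynomial in
    the value of the Laurent monomial with exponent \<open>v\<close>. Its nonzero constant term
    comes from \<open>a\<close> and its positive degree from \<open>a1\<close>, so it has a nonzero
    root.\<close>
  define ep where "ep = (\<Sum>\<alpha>\<in>E0. Polynomial.monom (lead (\<phi> \<alpha>)) (kk \<alpha>))"
  have cep: "coeff ep (kk \<beta>) = lead (\<phi> \<beta>)" if "\<beta> \<in> E0" for \<beta>
  proof -
    have "coeff ep (kk \<beta>) = (\<Sum>\<alpha>\<in>E0. if \<alpha> = \<beta> then lead (\<phi> \<beta>) else 0)"
      unfolding ep_def coeff_sum by (rule sum.cong) (use that kinj in \<open>auto simp: E0_def\<close>)
    then show ?thesis using that finE0 by simp
  qed
  have "degree ep \<noteq> 0" using cep[OF a1E0] leadE a1E0 E0Q a1(2) by (metis coeff_eq_0 neq0_conv subsetD)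
  then obtain r where r: "poly ep r = 0" using alg_closed_imp_poly_has_root by blast
  have "r \<noteq> 0" using r cep[OF aE0] leadE aE0 E0Q ka by (metis poly_0_coeff_0 subsetD)
  then obtain z where z: "\<And>i. Im (z i) > 0" "(\<Prod>i<n. z i powi v i) = r"
    using ex_upper_half_plane_monomial[OF v] by metis
  have znz: "z i \<noteq> 0" for i using z(1)[of i] by auto
  have monE: "(\<Prod>i<n. z i ^ lookup \<alpha> i) = (\<Prod>i<n. z i ^ lookup a i) * r ^ kk \<alpha>" if "\<alpha> \<in> E" for \<alpha>
  proof -
    have "z i ^ lookup \<alpha> i = z i ^ lookup a i * (z i powi v i) ^ kk \<alpha>" if "i < n" for i
    proof -
      have "z i ^ lookup \<alpha> i = z i powi (int (lookup a i) + int (kk \<alpha>) * v i)"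
        using kk[OF \<open>\<alpha> \<in> E\<close> that] by (metis power_int_of_nat)
      also have "\<dots> = z i powi int (lookup a i) * (z i powi v i) powi int (kk \<alpha>)"
        using znz by (simp add: power_int_add mult.commute[of "int (kk \<alpha>)"] power_int_mult)
      finally show ?thesis by simp
    qed
    then show ?thesis unfolding z(2)[symmetric] by (simp add: prod.distrib prod_power_distrib)
  qed
  have zero: "(\<Sum>\<alpha>\<in>E0. lead (\<phi> \<alpha>) * (\<Prod>i<n. z i ^ lookup \<alpha> i)) = 0"
  proof -
    have "(\<Sum>\<alpha>\<in>E0. lead (\<phi> \<alpha>) * (\<Prod>i<n. z i ^ lookup \<alpha> i))
      = (\<Sum>\<alpha>\<in>E0. (\<Prod>i<n. z i ^ lookup a i) * (lead (\<phi> \<alpha>) * r ^ kk \<alpha>))"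
      by (rule sum.cong) (simp_all add: monE E0_def)
    also have "\<dots> = (\<Prod>i<n. z i ^ lookup a i) * poly ep r"
      by (simp add: ep_def poly_sum poly_monom sum_distrib_left)
    finally show ?thesis using r by simp
  qed
  have "\<exists>u. \<forall>F. tends F (\<lambda>_. u) (z i)" for i by (rule tends_const)
  then obtain u where u: "\<And>i F. tends F (\<lambda>_. u i) (z i)" by metis
  \<comment> \<open>Only the coordinate \<open>i0\<close> is left free, to be found as a root; the
    others are frozen at constants with the right limits.\<close>
  define X where "X i = (if i = i0 then (\<lambda>_. 1) else (\<lambda>_ :: nat. u i))" for i
  define x where "x i = (if i = i0 then 1 else z i)" for i
  have X: "tends F (X i) (x i)" for F i by (simp add: X_def x_def tends_1 u)
  define q where "q j = (\<Sum>\<alpha>\<in>Q. Polynomial.monom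
    (T (- m) j * (\<phi> \<alpha> * (\<Prod>i<n. (T (w i) j * X i j) ^ lookup \<alpha> i))) (lookup \<alpha> i0))" for j
  define q' where "q' = (\<Sum>\<alpha>\<in>E0. Polynomial.monom (lead (\<phi> \<alpha>) * (\<Prod>i<n. x i ^ lookup \<alpha> i)) (lookup \<alpha> i0))"
  have pt: "poly_tends sequentially q q'"
    unfolding poly_tends_def
  proof
    fix k
    let ?Q = "{\<alpha> \<in> Q. lookup \<alpha> i0 = k}"
    have "tends sequentially (\<lambda>j. T (- m) j * (\<Sum>\<alpha>\<in>?Q. \<phi> \<alpha> * (\<Prod>i<n. (T (w i) j * X i j) ^ lookup \<alpha> i)))
      (\<Sum>\<alpha> | \<alpha> \<in> ?Q \<and> val (\<phi> \<alpha>) + (\<Sum>i<n. of_nat (lookup \<alpha> i) * w i) = m. lead (\<phi> \<alpha>) * (\<Prod>i<n. x i ^ lookup \<alpha> i))"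
      by (rule tropical_limit) (use Q(1,2) X mle in \<open>auto simp: dot_exponent val_lead(2)\<close>)
    moreover have "coeff (q j) k = T (- m) j * (\<Sum>\<alpha>\<in>?Q. \<phi> \<alpha> * (\<Prod>i<n. (T (w i) j * X i j) ^ lookup \<alpha> i))" for j
    proof -
      have "coeff (q j) k = (\<Sum>\<alpha>\<in>Q. if lookup \<alpha> i0 = k
          then T (- m) j * (\<phi> \<alpha> * (\<Prod>i<n. (T (w i) j * X i j) ^ lookup \<alpha> i)) else 0)"
        unfolding q_def coeff_sum by (rule sum.cong) auto
      then show ?thesis using Q(1) by (simp add: sum.inter_filter[symmetric] sum_distrib_left)
    qed
    moreover have "coeff q' k = (\<Sum>\<alpha> | \<alpha> \<in> ?Q \<and> val (\<phi> \<alpha>) + (\<Sum>i<n. of_nat (lookup \<alpha> i) * w i) = m. lead (\<phi> \<alpha>) * (\<Prod>i<n. x i ^ lookup \<alpha> i))"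
    proof -
      have "coeff q' k = (\<Sum>\<alpha>\<in>E0. if lookup \<alpha> i0 = k then lead (\<phi> \<alpha>) * (\<Prod>i<n. x i ^ lookup \<alpha> i) else 0)"
        unfolding q'_def coeff_sum by (rule sum.cong) auto
      also have "\<dots> = (\<Sum>\<alpha> | \<alpha> \<in> E0 \<and> lookup \<alpha> i0 = k. lead (\<phi> \<alpha>) * (\<Prod>i<n. x i ^ lookup \<alpha> i))"
        using finE0 by (simp add: sum.inter_filter[symmetric])
      also have "{\<alpha>. \<alpha> \<in> E0 \<and> lookup \<alpha> i0 = k} = {\<alpha>. \<alpha> \<in> ?Q \<and> val (\<phi> \<alpha>) + (\<Sum>i<n. of_nat (lookup \<alpha> i) * w i) = m}"
        unfolding dot_exponent using tie by blast
      finally show ?thesis .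
    qed
    ultimately show "tends sequentially (\<lambda>j. coeff (q j) k) (coeff q' k)" by simp
  qed
  \<comment> \<open>Exponents on the edge are distinct in the coordinate \<open>i0\<close>, because
    \<open>v i0\<close> is nonzero, so no cancellation occurs in this coefficient.\<close>
  have "coeff q' (lookup a i0) = (\<Sum>\<alpha>\<in>E0. if \<alpha> = a then lead (\<phi> a) * (\<Prod>i<n. x i ^ lookup a i) else 0)"
    unfolding q'_def coeff_sum
  proof (rule sum.cong)
    fix \<alpha> assume "\<alpha> \<in> E0"
    then have "\<alpha> \<in> E" by (simp add: E0_def)
    then have "\<alpha> = a" if "lookup \<alpha> i0 = lookup a i0"
      using that kk[of \<alpha> i0] i0 ka kinj[of \<alpha> a] E(2) by auto
    then show "coeff (Polynomial.monom (lead (\<phi> \<alpha>) * (\<Prod>i<n. x i ^ lookup \<alpha> i)) (lookup \<alpha> i0)) (lookup a i0)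
      = (if \<alpha> = a then lead (\<phi> a) * (\<Prod>i<n. x i ^ lookup a i) else 0)" by auto
  qed simp
  also have "\<dots> = lead (\<phi> a) * (\<Prod>i<n. x i ^ lookup a i)" using aE0 finE0 by simp
  also have "\<dots> \<noteq> 0" using leadE aE0 E0Q znz by (auto simp: x_def prod_zero_iff)
  finally have q'nz: "q' \<noteq> 0" by auto
  have split: "(\<Prod>i<n. y i ^ lookup \<alpha> i) = (\<Prod>i<n. y' i ^ lookup \<alpha> i) * t ^ lookup \<alpha> i0"
    if "\<And>i. y i = (if i = i0 then y' i * t else y' i)" for y y' :: "nat \<Rightarrow> 'f::comm_ring_1" and t \<alpha>
  proof -
    have "(\<Prod>i<n. y i ^ lookup \<alpha> i) = (\<Prod>i<n. y' i ^ lookup \<alpha> i * (if i = i0 then t ^ lookup \<alpha> i0 else 1))"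
      by (rule prod.cong) (auto simp: that power_mult_distrib)
    also have "\<dots> = (\<Prod>i<n. y' i ^ lookup \<alpha> i) * (\<Prod>i<n. if i = i0 then t ^ lookup \<alpha> i0 else 1)"
      by (rule prod.distrib)
    finally show ?thesis using i0(1) by simp
  qed
  have "poly q' (z i0) = (\<Sum>\<alpha>\<in>E0. lead (\<phi> \<alpha>) * (\<Prod>i<n. z i ^ lookup \<alpha> i))"
    unfolding q'_def poly_sum
  proof (rule sum.cong)
    fix \<alpha>
    have "(\<Prod>i<n. z i ^ lookup \<alpha> i) = (\<Prod>i<n. x i ^ lookup \<alpha> i) * z i0 ^ lookup \<alpha> i0"
      by (rule split) (simp add: x_def)
    then show "poly (Polynomial.monom (lead (\<phi> \<alpha>) * (\<Prod>i<n. x i ^ lookup \<alpha> i)) (lookup \<alpha> i0)) (z i0)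
      = lead (\<phi> \<alpha>) * (\<Prod>i<n. z i ^ lookup \<alpha> i)" by (simp add: poly_monom)
  qed simp
  then have q'root: "poly q' (z i0) = 0" using zero by simp
  have deg: "degree (q j) \<le> (\<Sum>\<alpha>\<in>Q. lookup \<alpha> i0)" for j
    unfolding q_def
  proof (rule degree_sum_le)
    fix \<alpha> assume "\<alpha> \<in> Q"
    then have "lookup \<alpha> i0 \<le> (\<Sum>\<alpha>\<in>Q. lookup \<alpha> i0)" using Q(1) by (intro member_le_sum) auto
    then show "degree (Polynomial.monom (T (- m) j * (\<phi> \<alpha> * (\<Prod>i<n. (T (w i) j * X i j) ^ lookup \<alpha> i))) (lookup \<alpha> i0))
      \<le> (\<Sum>\<alpha>\<in>Q. lookup \<alpha> i0)" using degree_monom_le order_trans by blast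
  qed (rule Q(1))
  obtain F \<zeta> where F: "F \<le> sequentially" "F \<noteq> bot" "tends F \<zeta> (z i0)" "eventually (\<lambda>j. poly (q j) (\<zeta> j) = 0) F"
    by (rule root_limit[OF trivial_limit_sequentially pt deg q'nz q'root]) (rule that)
  define Z where "Z i = (if i = i0 then \<zeta> else (\<lambda>_. u i))" for i
  show thesis
  proof (rule that[of F Z z w])
    show "F \<le> sequentially" "F \<noteq> bot" by (rule F)+
    show "tends F (Z i) (z i)" for i using F(3) u by (simp add: Z_def)
    show "Im (z i) > 0" for i by (rule z(1))
    have "poly (q j) (\<zeta> j) = T (- m) j * (\<Sum>\<alpha>\<in>Q. \<phi> \<alpha> * (\<Prod>i<n. (T (w i) j * Z i j) ^ lookup \<alpha> i))" for j
      unfolding q_def poly_sum sum_distrib_left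
    proof (rule sum.cong)
      fix \<alpha>
      have "(\<Prod>i<n. (T (w i) j * Z i j) ^ lookup \<alpha> i) = (\<Prod>i<n. (T (w i) j * X i j) ^ lookup \<alpha> i) * \<zeta> j ^ lookup \<alpha> i0"
        by (rule split) (simp add: X_def Z_def)
      then show "poly (Polynomial.monom (T (- m) j * (\<phi> \<alpha> * (\<Prod>i<n. (T (w i) j * X i j) ^ lookup \<alpha> i))) (lookup \<alpha> i0)) (\<zeta> j)
        = T (- m) j * (\<phi> \<alpha> * (\<Prod>i<n. (T (w i) j * Z i j) ^ lookup \<alpha> i))" by (simp add: poly_monom mult.assoc)
    qed simp
    then show "eventually (\<lambda>j. (\<Sum>\<alpha>\<in>Q. \<phi> \<alpha> * (\<Prod>i<n. (T (w i) j * Z i j) ^ lookup \<alpha> i)) = 0) F"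
      using F(4) by simp
    fix g \<beta> \<beta>' k l
    assume g: "g \<in> G" "\<beta> \<in> keys g" "\<beta>' \<in> keys g" and kl: "k < n" "l < n"
      and eq: "val (lookup g \<beta>) + dot n w (exponent \<beta>) = val (lookup g \<beta>') + dot n w (exponent \<beta>')"
    have notR: "(df \<beta> \<beta>', val (lookup g \<beta>) - val (lookup g \<beta>')) \<notin> R"
      using w(3)[of "df \<beta> \<beta>'" "val (lookup g \<beta>) - val (lookup g \<beta>')"] eq
      unfolding df_def dot_diff by auto
    have par: "rv i0 * df \<beta> \<beta>' j = rv j * df \<beta> \<beta>' i0" if "j < n" for j
    proof (rule ccontr)
      assume "\<not> ?thesis"
      then have "(df \<beta> \<beta>', val (lookup g \<beta>) - val (lookup g \<beta>')) \<in> R"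
        unfolding R_def using g(2,3) that
        by (intro UN_I[OF g(1)] image_eqI[of _ _ "(\<beta>, \<beta>')"]) auto
      then show False using notR by contradiction
    qed
    have "rv i0 * (rv k * df \<beta> \<beta>' l) = rv k * (rv i0 * df \<beta> \<beta>' l)" by (rule mult.left_commute)
    also have "\<dots> = rv l * (rv i0 * df \<beta> \<beta>' k)" unfolding par[OF kl(1)] par[OF kl(2)] by (rule mult.left_commute)
    also have "\<dots> = rv i0 * (rv l * df \<beta> \<beta>' k)" by (rule mult.left_commute)
    finally have "rv i0 * (rv k * df \<beta> \<beta>' l) = rv i0 * (rv l * df \<beta> \<beta>' k)" .
    then show "of_int (v k) * (exponent \<beta> l - exponent \<beta>' l) = of_int (v l) * (exponent \<beta> k - exponent \<beta>' k)"
      using rv0 by (simp add: rv_def df_def)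
  qed
qed

end

section \<open>Positive matrices\<close>

text \<open>The torus action on matrices which, through row spaces, is that on the
  Grassmannian.\<close>

definition scale_cols :: "'k::comm_ring_1 mat \<Rightarrow> (nat \<Rightarrow> 'k) \<Rightarrow> 'k mat" where
  "scale_cols A z = mat (dim_row A) (dim_col A) (\<lambda>(r, j). A $$ (r, j) * z j)"

lemma scale_cols_carrier: "A \<in> carrier_mat c n \<Longrightarrow> scale_cols A z \<in> carrier_mat c n"
  by (auto simp: scale_cols_def)

lemma scale_cols_row_comb:
  assumes A: "A \<in> carrier_mat c n" and y: "y \<in> carrier_vec c" and j: "j < n"
  shows "((scale_cols A z)\<^sup>T *\<^sub>v y) $ j = (A\<^sup>T *\<^sub>v y) $ j * z j"
  unfolding row_comb_index[OF scale_cols_carrier[OF A] y j] row_comb_index[OF A y j] sum_distrib_right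
  by (rule sum.cong) (use A j in \<open>auto simp: scale_cols_def ac_simps\<close>)

lemma plucker_scale_cols:
  assumes A: "A \<in> carrier_mat c n" and I: "I \<in> plucker_indices c n"
  shows "plucker_coord (scale_cols A z) I = plucker_coord A I * (\<Prod>i\<in>I. z i)"
proof -
  note pk = plucker_indices_pick[OF I]
  let ?s = "pick I"
  let ?M = "mat c c (\<lambda>(r, k). A $$ (r, ?s k) * z (?s k))" and ?N = "mat c c (\<lambda>(r, k). A $$ (r, ?s k))"
  have eq: "col_det c (scale_cols A z) ?s = Determinant.det ?M"
    unfolding col_det_def using A pk(2)
    by (intro arg_cong[of _ _ Determinant.det] eq_matI) (auto simp: scale_cols_def)
  have perm: "(\<Prod>i = 0..<c. ?M $$ (i, p i)) = (\<Prod>i = 0..<c. ?N $$ (i, p i)) * (\<Prod>k<c. z (?s k))"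
    if p: "p permutes {0..<c}" for p
  proof -
    have pc: "p i < c" if "i < c" for i using p that permutes_in_image[OF p] by auto
    have "(\<Prod>i = 0..<c. ?M $$ (i, p i)) = (\<Prod>i = 0..<c. ?N $$ (i, p i)) * (\<Prod>i = 0..<c. z (?s (p i)))"
      unfolding prod.distrib[symmetric] by (rule prod.cong) (use pc in auto)
    also have "(\<Prod>i = 0..<c. z (?s (p i))) = (\<Prod>k = 0..<c. z (?s k))"
      using prod.permute[OF p, of "\<lambda>k. z (?s k)"] by (simp add: o_def)
    finally show ?thesis by (simp add: atLeast0LessThan)
  qed
  have "Determinant.det ?M = (\<Sum>p | p permutes {0..<c}. signof p * (\<Prod>i = 0..<c. ?M $$ (i, p i)))"
    by (rule det_def') auto
  also have "\<dots> = (\<Sum>p | p permutes {0..<c}. signof p * (\<Prod>i = 0..<c. ?N $$ (i, p i)) * (\<Prod>k<c. z (?s k)))"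
    by (rule sum.cong) (simp_all only: mem_Collect_eq perm mult.assoc)
  also have "\<dots> = Determinant.det ?N * (\<Prod>k<c. z (?s k))"
    unfolding sum_distrib_right[symmetric] by (subst det_def'[of ?N c]) auto
  also have "(\<Prod>k<c. z (?s k)) = (\<Prod>i\<in>?s ` {..<c}. z i)"
    using prod.reindex[OF pk(3), of z] by simp
  finally show ?thesis
    unfolding plucker_coord_eq_col_det[OF scale_cols_carrier[OF A] I] plucker_coord_eq_col_det[OF A I] eq
    by (simp add: col_det_def pk(4))
qed

lemma plucker_of_rat:
  assumes A: "A \<in> carrier_mat c n" and I: "I \<in> plucker_indices c n"
  shows "plucker_coord (map_mat of_rat A) I = (of_rat (plucker_coord A I) :: 'k::field_char_0)"
proof -
  interpret comm_ring_hom "of_rat :: rat \<Rightarrow> 'k" by unfold_locales (auto simp: of_rat_add of_rat_mult)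
  have "map_mat of_rat A \<in> carrier_mat c n" using A by simp
  moreover have "mat c c (\<lambda>(r, k). map_mat of_rat A $$ (r, pick I k))
      = (map_mat of_rat (mat c c (\<lambda>(r, k). A $$ (r, pick I k))) :: 'k mat)"
    using A plucker_indices_pick(2)[OF I] by (intro eq_matI) auto
  ultimately show ?thesis
    by (simp add: plucker_coord_eq_col_det[OF A I] plucker_coord_eq_col_det[of _ c n, OF _ I] col_det_def)
qed

lemma row_comb_of_rat:
  assumes A: "A \<in> carrier_mat c n" and y: "y \<in> carrier_vec c" and j: "j < n"
  shows "((map_mat of_rat A)\<^sup>T *\<^sub>v map_vec of_rat y) $ j = (of_rat ((A\<^sup>T *\<^sub>v y) $ j) :: 'k::field_char_0)"
proof -
  have A': "map_mat of_rat A \<in> carrier_mat c n" "map_vec of_rat y \<in> carrier_vec c" using A y by auto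
  show ?thesis
    unfolding row_comb_index[OF A' j] row_comb_index[OF A y j] of_rat_sum
    using A y j by (intro sum.cong) (auto simp: of_rat_mult)
qed

lemma plucker_solve:
  fixes A :: "'k::field mat"
  assumes A: "A \<in> carrier_mat c n" and I: "I \<in> plucker_indices c n" and nz: "plucker_coord A I \<noteq> 0"
  shows "\<exists>y\<in>carrier_vec c. \<forall>i\<in>I. (A\<^sup>T *\<^sub>v y) $ i = t i"
    and "\<And>y. y \<in> carrier_vec c \<Longrightarrow> (\<And>i. i \<in> I \<Longrightarrow> (A\<^sup>T *\<^sub>v y) $ i = 0) \<Longrightarrow> y = 0\<^sub>v c"
proof -
  note pk = plucker_indices_pick[OF I]
  have nz': "col_det c A (pick I) \<noteq> 0" using nz plucker_coord_eq_col_det[OF A I] by simp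
  obtain y where "y \<in> carrier_vec c" "\<forall>k<c. (A\<^sup>T *\<^sub>v y) $ pick I k = t (pick I k)"
    using col_det_solve(1)[OF A pk(2) nz', of "\<lambda>k. t (pick I k)"] by blast
  moreover from this have "(A\<^sup>T *\<^sub>v y) $ i = t i" if "i \<in> I" for i
    using that pk(4) by (metis imageE lessThan_iff)
  ultimately show "\<exists>y\<in>carrier_vec c. \<forall>i\<in>I. (A\<^sup>T *\<^sub>v y) $ i = t i" by blast
  fix y assume "y \<in> carrier_vec c" "\<And>i. i \<in> I \<Longrightarrow> (A\<^sup>T *\<^sub>v y) $ i = 0"
  then show "y = 0\<^sub>v c" using col_det_solve(2)[OF A pk(2) nz'] pk(1) by blast
qed

text \<open>An explicit bound on \<open>\<delta>\<close> works in every ordered field, in particular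
  in the non-Archimedean field of real Puiseux series.\<close>

lemma ex_small_perturbation:
  fixes x y :: "'a \<Rightarrow> 'r::linordered_field"
  assumes "finite J" "\<And>j. j \<in> J \<Longrightarrow> x j \<noteq> 0"
  obtains \<delta> where "\<delta> > 0" "\<And>j. j \<in> J \<Longrightarrow> x j * (x j + \<delta> * y j) > 0"
proof -
  have "\<exists>d>0. \<forall>\<delta>. 0 < \<delta> \<and> \<delta> \<le> d \<longrightarrow> (\<forall>j\<in>J. x j * (x j + \<delta> * y j) > 0)"
    using assms
  proof (induction J rule: finite_induct)
    case empty
    then show ?case by (intro exI[of _ 1]) auto
  next
    case (insert b J)
    then obtain d where d: "d > 0" "\<forall>\<delta>. 0 < \<delta> \<and> \<delta> \<le> d \<longrightarrow> (\<forall>j\<in>J. x j * (x j + \<delta> * y j) > 0)" by auto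
    define e where "e = \<bar>x b\<bar> / (1 + \<bar>y b\<bar>)"
    have xb: "x b \<noteq> 0" using insert.prems by simp
    have pos: "1 + \<bar>y b\<bar> > 0" by (simp add: add_pos_nonneg)
    have e: "e > 0" unfolding e_def using xb pos by (intro divide_pos_pos) auto
    have "x b * (x b + \<delta> * y b) > 0" if \<delta>: "0 < \<delta>" "\<delta> \<le> e" for \<delta>
    proof -
      have "\<bar>\<delta> * y b\<bar> \<le> e * \<bar>y b\<bar>" using \<delta> by (simp add: abs_mult mult_right_mono)
      also have "\<dots> < e * (1 + \<bar>y b\<bar>)" using e by simp
      also have "\<dots> = \<bar>x b\<bar>" using pos by (simp add: e_def)
      finally have *: "\<bar>\<delta> * y b\<bar> < \<bar>x b\<bar>" .
      show ?thesis
      proof (cases "x b > 0")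
        case True
        then show ?thesis using * by (intro mult_pos_pos) (auto simp: abs_less_iff)
      next
        case False
        then show ?thesis using * xb by (intro mult_neg_neg) (auto simp: abs_less_iff)
      qed
    qed
    then show ?case using d e by (intro exI[of _ "min d e"]) auto
  qed
  then obtain d where "d > 0" "\<forall>\<delta>. 0 < \<delta> \<and> \<delta> \<le> d \<longrightarrow> (\<forall>j\<in>J. x j * (x j + \<delta> * y j) > 0)" by blast
  then show thesis using that[of d] by auto
qed

text \<open>
  Perturbing \<open>y\<close> in the direction of a vector whose combination agrees with \<open>U\<close> on \<open>K\<close> makes the
  signs of the row combination equal to those of \<open>U\<close>; the rest is a positive scaling of columns.
\<close>

lemma sign_pattern_in_positive_subspace:
  fixes A :: "rat mat" and U :: "'r::linordered_field vec"
  assumes A: "A \<in> carrier_mat c n" and pos: "\<And>I. I \<in> plucker_indices c n \<Longrightarrow> plucker_coord A I > 0"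
    and I: "I \<in> plucker_indices c n" "K \<subseteq> I"
    and y: "y \<in> carrier_vec c" "\<And>k. k \<in> K \<Longrightarrow> (A\<^sup>T *\<^sub>v y) $ k = 0"
    and U: "U \<in> carrier_vec n"
    and sgn: "\<And>j. j < n \<Longrightarrow> j \<notin> K \<Longrightarrow> (A\<^sup>T *\<^sub>v y) $ j \<noteq> 0"
      "\<And>j. j < n \<Longrightarrow> j \<notin> K \<Longrightarrow> of_rat ((A\<^sup>T *\<^sub>v y) $ j) * U $ j > 0"
  shows "\<exists>L\<in>positive_grassmannian c n. U \<in> L"
proof -
  define B where "B = (map_mat of_rat A :: 'r mat)"
  have B: "B \<in> carrier_mat c n" using A by (simp add: B_def)
  have Bpos: "plucker_coord B I > 0" if "I \<in> plucker_indices c n" for I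
    unfolding B_def plucker_of_rat[OF A that] using pos[OF that] by simp
  define y1 where "y1 = (map_vec of_rat y :: 'r vec)"
  have y1: "y1 \<in> carrier_vec c" using y(1) by (simp add: y1_def)
  have By1: "(B\<^sup>T *\<^sub>v y1) $ j = of_rat ((A\<^sup>T *\<^sub>v y) $ j)" if "j < n" for j
    unfolding B_def y1_def by (rule row_comb_of_rat[OF A y(1) that])
  \<comment> \<open>\<open>y2\<close> realizes \<open>U\<close> on \<open>I\<close>, and so on
    \<open>K\<close>, where \<open>y1\<close> contributes 0.\<close>
  obtain y2 where y2: "y2 \<in> carrier_vec c" "\<And>i. i \<in> I \<Longrightarrow> (B\<^sup>T *\<^sub>v y2) $ i = U $ i"
    using plucker_solve(1)[OF B I(1), of "\<lambda>i. U $ i"] Bpos[OF I(1)] by auto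
  have Kn: "K \<subseteq> {..<n}" using I by (auto simp: plucker_indices_def)
  obtain \<delta> where \<delta>: "\<delta> > 0" "\<And>j. j \<in> {..<n} - K \<Longrightarrow>
      (B\<^sup>T *\<^sub>v y1) $ j * ((B\<^sup>T *\<^sub>v y1) $ j + \<delta> * (B\<^sup>T *\<^sub>v y2) $ j) > 0"
    using ex_small_perturbation[of "{..<n} - K" "\<lambda>j. (B\<^sup>T *\<^sub>v y1) $ j" "\<lambda>j. (B\<^sup>T *\<^sub>v y2) $ j"] sgn(1) By1
    by auto
  define y' where "y' = y1 + \<delta> \<cdot>\<^sub>v y2"
  have y': "y' \<in> carrier_vec c" using y1 y2 by (simp add: y'_def)
  define e where "e j = (B\<^sup>T *\<^sub>v y1) $ j + \<delta> * (B\<^sup>T *\<^sub>v y2) $ j" for j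
  have ey': "(B\<^sup>T *\<^sub>v y') $ j = e j" if "j < n" for j
    unfolding row_comb_index[OF B y' that] e_def row_comb_index[OF B y1 that] row_comb_index[OF B y2(1) that]
      sum_distrib_left sum.distrib[symmetric]
    by (rule sum.cong) (use y1 y2(1) in \<open>auto simp: y'_def algebra_simps\<close>)
  \<comment> \<open>On \<open>K\<close> the combination is \<open>\<delta>\<close> times
    \<open>U\<close>, whatever the sign of \<open>U\<close> there; elsewhere it has the sign of
    \<open>U\<close>. So the scaling factors are positive.\<close>
  define s where "s j = (if j \<in> K then 1 / \<delta> else U $ j / e j)" for j
  have eK: "e k = \<delta> * U $ k" if "k \<in> K" for k
  proof -
    have "k < n" "k \<in> I" using that Kn I(2) by auto
    then show ?thesis using that by (simp add: e_def By1 y(2) y2(2))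
  qed
  have eJ: "e j \<noteq> 0 \<and> U $ j / e j > 0" if "j < n" "j \<notin> K" for j
  proof -
    have "of_rat ((A\<^sup>T *\<^sub>v y) $ j) * e j > 0" using \<delta>(2)[of j] that By1 by (simp add: e_def)
    moreover have "of_rat ((A\<^sup>T *\<^sub>v y) $ j) * U $ j > 0" by (rule sgn(2)[OF that])
    ultimately show ?thesis by (auto simp: zero_less_mult_iff zero_less_divide_iff)
  qed
  have spos: "s j > 0" if "j < n" for j using \<delta>(1) eJ that by (auto simp: s_def)
  have es: "e j * s j = U $ j" if "j < n" for j
    using eK eJ[OF that] \<delta>(1) by (auto simp: s_def)
  define C where "C = scale_cols B s"
  have C: "C \<in> carrier_mat c n" unfolding C_def by (rule scale_cols_carrier[OF B])
  have "plucker_coord C I' > 0" if I': "I' \<in> plucker_indices c n" for I'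
    unfolding C_def plucker_scale_cols[OF B I']
    using Bpos[OF I'] spos I' by (intro mult_pos_pos prod_pos) (auto simp: plucker_indices_def)
  then have "vec_space.row_space n C \<in> positive_grassmannian c n"
    unfolding positive_grassmannian_def using C by blast
  moreover have "C\<^sup>T *\<^sub>v y' = U"
  proof (rule eq_vecI)
    fix j assume "j < dim_vec U"
    then have j: "j < n" using U by simp
    show "(C\<^sup>T *\<^sub>v y') $ j = U $ j"
      unfolding C_def scale_cols_row_comb[OF B y' j] ey'[OF j] by (rule es[OF j])
  qed (use U C in auto)
  then have "U \<in> vec_space.row_space n C" unfolding row_space_char[OF C] using y' by blast
  ultimately show ?thesis by blast
qed

section \<open>Edges excluded by positive hyperbolicity\<close>

context valued_limits
begin

text \<open>Here \<open>Q\<close> and \<open>\<phi>\<close> describe the Chow form on the torus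
  orbit of \<open>A\<close>, \<open>E\<close> is the set of exponents on the edge through
  \<open>a\<close> and \<open>b\<close>, \<open>kk\<close> counts steps of \<open>v\<close> from
  \<open>a\<close>, and \<open>w2\<close> is normal to the edge. The zeros supplied by
  \<open>edge_limit_point\<close> lead to a point of \<open>X\<close> whose imaginary part lies in a
  positive subspace.\<close>

lemma no_edge:
  fixes v :: "nat \<Rightarrow> int" and \<phi> :: "(nat \<Rightarrow>\<^sub>0 nat) \<Rightarrow> 'k" and A :: "rat mat"
  assumes X: "homogeneous_variety n X" "positively_hyperbolic im n c X" and F: "is_chow_form n c X F"
    and c: "c > 0" and A: "A \<in> carrier_mat c n" "\<And>I. I \<in> plucker_indices c n \<Longrightarrow> plucker_coord A I > 0"
    and F_eval: "\<And>z. poly_eval (plucker_coord (scale_cols (map_mat of_rat A) z)) F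
      = (\<Sum>\<alpha>\<in>Q. \<phi> \<alpha> * (\<Prod>i<n. z i ^ lookup \<alpha> i))"
    and Q: "finite Q" "\<And>\<alpha>. \<alpha> \<in> Q \<Longrightarrow> \<phi> \<alpha> \<noteq> 0" "\<And>\<alpha>. \<alpha> \<in> Q \<Longrightarrow> keys \<alpha> \<subseteq> {..<n}"
    and v: "(\<Sum>i<n. v i) = 0" "(\<Sum>i<n. \<bar>v i\<bar>) > 2"
    and E: "E \<subseteq> Q" "a \<in> E" "b \<in> E" "b \<noteq> a"
    and kk: "\<And>\<alpha> i. \<alpha> \<in> E \<Longrightarrow> i < n \<Longrightarrow> int (lookup \<alpha> i) = int (lookup a i) + int (kk \<alpha>) * v i"
    and w2: "dot n w2 (\<lambda>i. of_int (v i)) = 0"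
      "\<And>\<alpha>. \<alpha> \<in> Q - E \<Longrightarrow> dot n w2 (\<lambda>i. exponent \<alpha> i - exponent a i) > 0"
  shows False
proof -
  have cn: "c < n" and equi: "equidimensional n (n - c) X"
    and hyp: "\<And>x L. x \<in> X \<Longrightarrow> L \<in> positive_grassmannian c n \<Longrightarrow> map_vec im x \<notin> L - {0\<^sub>v n}"
    using X(2) by (auto simp: positively_hyperbolic_def)
  \<comment> \<open>\<open>X\<close> has dimension n - c, so any n - c + 1 coordinates are
    algebraically dependent on it.\<close>
  define JJ where "JJ = {J. J \<subseteq> {..<n} \<and> card J = Suc (n - c)}"
  have finJ: "finite JJ" by (rule finite_subset[of _ "Pow {..<n}"]) (auto simp: JJ_def)
  have "\<exists>g\<in>polys_in J. g \<noteq> 0 \<and> (\<forall>x\<in>X. poly_eval (vec_index x) g = 0)" if "J \<in> JJ" for J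
    using coordinates_dependent[OF uncountable_field equi] that by (auto simp: JJ_def)
  then obtain g where g: "\<And>J. J \<in> JJ \<Longrightarrow> g J \<in> polys_in J" "\<And>J. J \<in> JJ \<Longrightarrow> g J \<noteq> 0"
    "\<And>J x. J \<in> JJ \<Longrightarrow> x \<in> X \<Longrightarrow> poly_eval (vec_index x) (g J) = 0" by metis
  obtain L w Z z where L: "L \<le> sequentially" "L \<noteq> bot" and Z: "\<And>i. i < n \<Longrightarrow> tends L (Z i) (z i)"
    and z: "\<And>i. i < n \<Longrightarrow> Im (z i) > 0"
    and zero: "eventually (\<lambda>m. (\<Sum>\<alpha>\<in>Q. \<phi> \<alpha> * (\<Prod>i<n. (T (w i) m * Z i m) ^ lookup \<alpha> i)) = 0) L"
    and par: "\<And>h \<beta> \<beta>' k l. h \<in> g ` JJ \<Longrightarrow> \<beta> \<in> keys h \<Longrightarrow> \<beta>' \<in> keys h \<Longrightarrow>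
      val (lookup h \<beta>) + dot n w (exponent \<beta>) = val (lookup h \<beta>') + dot n w (exponent \<beta>') \<Longrightarrow> k < n \<Longrightarrow> l < n \<Longrightarrow>
      of_int (v k) * (exponent \<beta> l - exponent \<beta>' l) = of_int (v l) * (exponent \<beta> k - exponent \<beta>' k)"
    by (rule edge_limit_point[OF Q v E kk w2 finite_imageI[OF finJ]]) (assumption | rule that)+
  have znz: "z i \<noteq> 0" if "i < n" for i using z[OF that] by auto
  define AK where "AK = (map_mat of_rat A :: 'k mat)"
  have AK: "AK \<in> carrier_mat c n" using A(1) by (simp add: AK_def)
  define zn where "zn m i = T (w i) m * Z i m" for m i
  define B where "B m = scale_cols AK (zn m)" for m
  have B: "B m \<in> carrier_mat c n" for m unfolding B_def by (rule scale_cols_carrier[OF AK])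
  \<comment> \<open>At such \<open>m\<close> the scaled matrix keeps full rank and is a zero of the
    Chow form.\<close>
  define good where "good m \<longleftrightarrow> (\<forall>i<n. Z i m \<noteq> 0) \<and>
    (\<Sum>\<alpha>\<in>Q. \<phi> \<alpha> * (\<Prod>i<n. (T (w i) m * Z i m) ^ lookup \<alpha> i)) = 0" for m
  have good: "eventually good L"
  proof -
    have "eventually (\<lambda>m. \<forall>i\<in>{..<n}. Z i m \<noteq> 0) L"
      by (intro eventually_ball_finite ballI tends_nonzero[OF Z znz]) auto
    then have "eventually (\<lambda>m. (\<forall>i\<in>{..<n}. Z i m \<noteq> 0) \<and>
        (\<Sum>\<alpha>\<in>Q. \<phi> \<alpha> * (\<Prod>i<n. (T (w i) m * Z i m) ^ lookup \<alpha> i)) = 0) L"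
      using zero by (rule eventually_conj)
    then show ?thesis by (rule eventually_mono) (simp add: good_def)
  qed
  define I1 where "I1 = {..<c}"
  have I1: "I1 \<in> plucker_indices c n" using cn by (auto simp: I1_def plucker_indices_def)
  have "\<exists>y. y \<in> carrier_vec c \<and> y \<noteq> 0\<^sub>v c \<and> (good m \<longrightarrow> (B m)\<^sup>T *\<^sub>v y \<in> X)" for m
  proof (cases "good m")
    case True
    have "(\<Prod>i\<in>I1. zn m i) \<noteq> 0"
      using True cn by (auto simp: I1_def zn_def prod_zero_iff good_def)
    then have "plucker_coord (B m) I1 \<noteq> 0"
      unfolding B_def plucker_scale_cols[OF AK I1]
      unfolding AK_def plucker_of_rat[OF A(1) I1]
      using A(2)[OF I1] by simp
    moreover have "poly_eval (plucker_coord (B m)) F = 0"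
      using True unfolding B_def AK_def F_eval by (simp add: good_def zn_def)
    ultimately obtain y where y: "y \<in> carrier_vec c" "(B m)\<^sup>T *\<^sub>v y \<noteq> 0\<^sub>v n" "(B m)\<^sup>T *\<^sub>v y \<in> X"
      using chow_form_zero_imp_meets[OF uncountable_field X(1) F B I1] by blast
    then have "y \<noteq> 0\<^sub>v c" using B[of m] by (auto simp: carrier_vecD)
    then show ?thesis using y by blast
  next
    case False
    \<comment> \<open>A default value for the other \<open>m\<close>, since compactness is applied
      to vectors that are nonzero at every index.\<close>
    have "vec c (\<lambda>_. 1 :: 'k) $ 0 \<noteq> 0\<^sub>v c $ 0" using c by simp
    then have "vec c (\<lambda>_. 1 :: 'k) \<noteq> 0\<^sub>v c" by metis
    then show ?thesis using False by (intro exI[of _ "vec c (\<lambda>_. 1)"]) auto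
  qed
  then obtain y where y: "\<And>m. y m \<in> carrier_vec c" "\<And>m. y m \<noteq> 0\<^sub>v c"
    "\<And>m. good m \<Longrightarrow> (B m)\<^sup>T *\<^sub>v y m \<in> X" by metis
  have "\<exists>j<c. y m $ j \<noteq> 0" for m
    using y(1,2)[of m] by (metis carrier_vecD eq_vecI index_zero_vec(1) index_zero_vec(2))
  from compactness[of L c "\<lambda>m j. y m $ j", OF L(2) this]
  obtain L' s l where L': "L' \<le> L" "L' \<noteq> bot" and s: "\<forall>m. s m \<noteq> 0"
    and l: "\<forall>j<c. tends L' (\<lambda>m. s m * y m $ j) (l j)" "\<exists>j<c. l j \<noteq> 0"
    by (elim exE conjE) (rule that, assumption+, blast)
  define AC where "AC = (map_mat of_rat A :: complex mat)"
  have AC: "AC \<in> carrier_mat c n" using A(1) by (simp add: AC_def)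
  define lv where "lv = vec c l"
  obtain j1 where j1: "j1 < c" "l j1 \<noteq> 0" using l(2) by blast
  then have "lv $ j1 \<noteq> 0\<^sub>v c $ j1" by (simp add: lv_def)
  then have lv: "lv \<in> carrier_vec c" "lv \<noteq> 0\<^sub>v c" by (auto simp: lv_def)
  \<comment> \<open>The limit of the normalized row combinations, before the columns are
    scaled.\<close>
  define b' where "b' j = (AC\<^sup>T *\<^sub>v lv) $ j" for j
  define Y where "Y j m = s m * (AK\<^sup>T *\<^sub>v y m) $ j" for j m
  have Y: "tends L' (Y j) (b' j)" if j: "j < n" for j
  proof -
    have "tends L' (\<lambda>m. \<Sum>r<c. of_rat (A $$ (r, j)) * (s m * y m $ r)) (\<Sum>r<c. of_rat (A $$ (r, j)) * l r)"
      using l(1) by (intro tends_sum tends_mult tends_of_rat) auto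
    moreover have "Y j = (\<lambda>m. \<Sum>r<c. of_rat (A $$ (r, j)) * (s m * y m $ r))"
    proof (rule ext)
      fix m show "Y j m = (\<Sum>r<c. of_rat (A $$ (r, j)) * (s m * y m $ r))"
      unfolding Y_def row_comb_index[OF AK y(1) j] sum_distrib_left
      by (rule sum.cong) (use A(1) j in \<open>auto simp: AK_def\<close>)
    qed
    moreover have "b' j = (\<Sum>r<c. of_rat (A $$ (r, j)) * l r)"
      unfolding b'_def row_comb_index[OF AC lv(1) j]
      by (rule sum.cong) (use A(1) j in \<open>auto simp: AC_def lv_def\<close>)
    ultimately show ?thesis by (simp only:)
  qed
  have Z': "tends L' (Z j) (z j)" if "j < n" for j using tends_mono[OF L'(1) Z[OF that]] .
  define xs where "xs m = s m \<cdot>\<^sub>v ((B m)\<^sup>T *\<^sub>v y m)" for m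
  have xs: "xs m \<in> carrier_vec n" "\<And>j. j < n \<Longrightarrow> xs m $ j = T (w j) m * (Y j m * Z j m)" for m
  proof -
    have *: "(B m)\<^sup>T *\<^sub>v y m \<in> carrier_vec n"
      using B[of m] y(1)[of m] by (intro mult_mat_vec_carrier[of _ n c]) auto
    then show "xs m \<in> carrier_vec n" by (simp add: xs_def)
    fix j assume j: "j < n"
    have "xs m $ j = s m * ((B m)\<^sup>T *\<^sub>v y m) $ j"
      unfolding xs_def by (rule index_smult_vec(1)) (simp only: carrier_vecD[OF *] j)
    then show "xs m $ j = T (w j) m * (Y j m * Z j m)"
      unfolding B_def scale_cols_row_comb[OF AK y(1) j] by (simp add: Y_def zn_def ac_simps)
  qed
  have good': "eventually good L'" using good L'(1) by (rule filter_leD[rotated])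
  have xsX: "xs m \<in> X" if "good m" for m
    unfolding xs_def by (rule homogeneous_variety_scale[OF X(1) y(3)[OF that]])
  have ACn: "plucker_coord AC I \<noteq> 0" if "I \<in> plucker_indices c n" for I
    unfolding AC_def plucker_of_rat[OF A(1) that] using A(2)[OF that] by simp
  define N where "N = {j. j < n \<and> b' j = 0}"
  define J where "J = {j. j < n \<and> b' j \<noteq> 0}"
  have NJ: "card N + card J = n" "finite N" "finite J" "N = {..<n} - J"
  proof -
    have "card (N \<union> J) = card N + card J" by (rule card_Un_disjoint) (auto simp: N_def J_def)
    moreover have "N \<union> J = {..<n}" by (auto simp: N_def J_def)
    ultimately show "card N + card J = n" by simp
  qed (auto simp: N_def J_def)
  \<comment> \<open>A row combination that vanishes at \<open>c\<close> columns is zero, since all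
    maximal minors are nonzero.\<close>
  have cardN: "card N < c"
  proof (rule ccontr)
    assume "\<not> ?thesis"
    then obtain I where I: "I \<subseteq> N" "card I = c" by (meson not_less obtain_subset_with_card_n)
    then have pI: "I \<in> plucker_indices c n" by (auto simp: plucker_indices_def N_def)
    have "lv = 0\<^sub>v c"
      by (rule plucker_solve(2)[OF AC pI ACn[OF pI] lv(1)]) (use I(1) in \<open>auto simp: N_def b'_def\<close>)
    then show False using lv(2) by simp
  qed
  \<comment> \<open>If \<open>J'\<close> missed a coordinate in the support of \<open>v\<close>, all
    exponents of \<open>g J'\<close> would be 0 there, and two of them could differ by a multiple of
    \<open>v\<close> only if equal. The lowest term would then be unique and have a nonzero limit,
    although \<open>g J'\<close> vanishes at the points of \<open>X\<close>.\<close>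
  have supp: "i \<in> J'" if J': "J' \<in> JJ" "J' \<subseteq> J" and i: "i < n" "v i \<noteq> 0" for J' i
  proof (rule ccontr)
    assume iJ: "i \<notin> J'"
    let ?g = "g J'"
    define ord where "ord \<beta> = val (lookup ?g \<beta>) + dot n w (exponent \<beta>)" for \<beta>
    have ne: "finite (ord ` keys ?g)" "ord ` keys ?g \<noteq> {}" using g(2)[OF J'(1)] by auto
    define m0 where "m0 = Min (ord ` keys ?g)"
    obtain \<beta>0 where \<beta>0: "\<beta>0 \<in> keys ?g" "ord \<beta>0 = m0" using Min_in[OF ne] by (auto simp: m0_def)
    have kJ: "keys \<beta> \<subseteq> J'" if "\<beta> \<in> keys ?g" for \<beta> using g(1)[OF J'(1)] that by (auto simp: polys_in_def)
    have Jn: "J' \<subseteq> {..<n}" using J'(1) by (simp add: JJ_def)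
    have uniq: "\<beta> = \<beta>0" if \<beta>: "\<beta> \<in> keys ?g" "ord \<beta> = m0" for \<beta>
    proof (rule poly_mapping_eqI)
      fix k
      show "lookup \<beta> k = lookup \<beta>0 k"
      proof (cases "k < n")
        case True
        have "of_int (v i) * (exponent \<beta> k - exponent \<beta>0 k) = of_int (v k) * (exponent \<beta> i - exponent \<beta>0 i)"
          by (rule par[of ?g]) (use J'(1) \<beta> \<beta>0 i(1) True in \<open>auto simp: ord_def\<close>)
        moreover have "lookup \<beta> i = 0" "lookup \<beta>0 i = 0"
          using kJ[OF \<beta>(1)] kJ[OF \<beta>0(1)] iJ by (auto simp: in_keys_iff)
        ultimately show ?thesis using i(2) by simp
      next
        case False
        then have "k \<notin> keys \<beta>" "k \<notin> keys \<beta>0" using kJ[OF \<beta>(1)] kJ[OF \<beta>0(1)] Jn by auto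
        then show ?thesis by (simp add: in_keys_iff)
      qed
    qed
    have lim0: "tends L' (\<lambda>m. T (- m0) m * (\<Sum>\<beta>\<in>keys ?g. lookup ?g \<beta> * (\<Prod>i<n. (T (w i) m * (Y i m * Z i m)) ^ lookup \<beta> i)))
      (\<Sum>\<beta> | \<beta> \<in> keys ?g \<and> val (lookup ?g \<beta>) + (\<Sum>i<n. of_nat (lookup \<beta> i) * w i) = m0.
        lead (lookup ?g \<beta>) * (\<Prod>i<n. (b' i * z i) ^ lookup \<beta> i))"
    proof (rule tropical_limit)
      show "L' \<le> sequentially" using L'(1) L(1) by (rule order_trans)
      show "tends L' (\<lambda>m. lookup ?g \<beta> * T (- val (lookup ?g \<beta>)) m) (lead (lookup ?g \<beta>))" if "\<beta> \<in> keys ?g" for \<beta>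
        using that by (intro tends_mono[OF \<open>L' \<le> sequentially\<close>] val_lead(2)) (simp add: in_keys_iff)
      show "tends L' (\<lambda>m. Y i m * Z i m) (b' i * z i)" if "i \<in> {..<n}" for i
        using that by (intro tends_mult Y Z') auto
      show "m0 \<le> val (lookup ?g \<beta>) + (\<Sum>i<n. of_nat (lookup \<beta> i) * w i)" if "\<beta> \<in> keys ?g" for \<beta>
        unfolding dot_exponent m0_def using ne that by (intro Min_le) (auto simp: ord_def)
    qed auto
    have "{\<beta>. \<beta> \<in> keys ?g \<and> ord \<beta> = m0} = {\<beta>0}" using uniq \<beta>0 by blast
    then have "{\<beta>. \<beta> \<in> keys ?g \<and> val (lookup ?g \<beta>) + (\<Sum>i<n. of_nat (lookup \<beta> i) * w i) = m0} = {\<beta>0}"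
      unfolding ord_def dot_exponent .
    note lim0 = lim0[unfolded this]
    then have lim: "tends L' (\<lambda>m. T (- m0) m * (\<Sum>\<beta>\<in>keys ?g. lookup ?g \<beta> * (\<Prod>i<n. (T (w i) m * (Y i m * Z i m)) ^ lookup \<beta> i)))
      (lead (lookup ?g \<beta>0) * (\<Prod>i<n. (b' i * z i) ^ lookup \<beta>0 i))" by simp
    have ev: "(\<Sum>\<beta>\<in>keys ?g. lookup ?g \<beta> * (\<Prod>i<n. (T (w i) m * (Y i m * Z i m)) ^ lookup \<beta> i)) = 0" if "good m" for m
    proof -
      have "monom_eval (vec_index (xs m)) \<beta> = (\<Prod>i<n. (T (w i) m * (Y i m * Z i m)) ^ lookup \<beta> i)"
        if "\<beta> \<in> keys ?g" for \<beta>
      proof -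
        have "monom_eval (vec_index (xs m)) \<beta> = (\<Prod>i<n. xs m $ i ^ lookup \<beta> i)"
          using kJ[OF that] Jn by (intro monom_eval_superset) auto
        then show ?thesis using xs(2) by simp
      qed
      then show ?thesis using g(3)[OF J'(1) xsX[OF that]] unfolding poly_eval_alt by simp
    qed
    have "tends L' (\<lambda>_. 0) (lead (lookup ?g \<beta>0) * (\<Prod>i<n. (b' i * z i) ^ lookup \<beta>0 i))"
      by (rule tends_cong[OF _ lim]) (rule eventually_mono[OF good'], simp add: ev)
    then have "lead (lookup ?g \<beta>0) * (\<Prod>i<n. (b' i * z i) ^ lookup \<beta>0 i) = 0"
      using tends_unique[OF L'(2) _ tends_0] by blast
    moreover have "lead (lookup ?g \<beta>0) \<noteq> 0" using \<beta>0(1) by (intro val_lead(1)) (simp add: in_keys_iff)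
    moreover have "(b' i * z i) ^ lookup \<beta>0 i \<noteq> 0" if "i < n" for i
    proof (cases "i \<in> keys \<beta>0")
      case True
      then have "i \<in> J" using kJ[OF \<beta>0(1)] J'(2) by blast
      then show ?thesis using znz[OF that] by (simp add: J_def)
    qed (simp add: in_keys_iff)
    ultimately show False
      unfolding mult_eq_0_iff prod_zero_iff[OF finite_lessThan] by (metis lessThan_iff)
  qed
  obtain i1 where i1: "i1 < n" "v i1 \<noteq> 0"
    using v(2) by (metis abs_zero lessThan_iff not_numeral_less_zero sum.neutral)
  \<comment> \<open>From a larger \<open>J\<close> a subset of n - c + 1 elements that avoids
    \<open>i1\<close> could be chosen.\<close>
  have cardJ: "card J = Suc (n - c)"
  proof (rule ccontr)
    assume "card J \<noteq> Suc (n - c)"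
    then have "Suc (n - c) < card J" using NJ(1) cardN cn by linarith
    then have "Suc (n - c) \<le> card (J - {i1})" using card_Diff1_le[of J i1] card_Suc_Diff1[OF NJ(3), of i1]
      by (cases "i1 \<in> J") auto
    then obtain J' where J': "J' \<subseteq> J - {i1}" "card J' = Suc (n - c)" by (meson obtain_subset_with_card_n)
    then have "J' \<in> JJ" by (auto simp: JJ_def J_def)
    then show False using supp[of J' i1] J'(1) i1 by blast
  qed
  then have cardN': "Suc (card N) = c" using NJ(1) cn by simp
  obtain j0 where j0: "j0 \<in> J" using cardJ by (metis card.empty ex_in_conv nat.distinct(1))
  define I where "I = insert j0 N"
  have j0n: "j0 < n" "j0 \<notin> N" "b' j0 \<noteq> 0" using j0 by (auto simp: J_def N_def)
  have I: "I \<in> plucker_indices c n" using j0n cardN' NJ(2) by (auto simp: I_def plucker_indices_def N_def)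
  \<comment> \<open>The rational counterpart of the limit: the combination that vanishes on
    \<open>N\<close> and is 1 at \<open>j0\<close>. As a combination is determined by its entries on
    the \<open>c\<close> columns \<open>I\<close>, the limit is \<open>b' j0\<close> times this
    one.\<close>
  obtain yq where yq: "yq \<in> carrier_vec c" "\<And>i. i \<in> I \<Longrightarrow> (A\<^sup>T *\<^sub>v yq) $ i = (if i = j0 then 1 else 0)"
    using plucker_solve(1)[OF A(1) I, of "\<lambda>i. if i = j0 then 1 else 0"] A(2)[OF I] by auto
  define bq where "bq j = (A\<^sup>T *\<^sub>v yq) $ j" for j
  define yC where "yC = (map_vec of_rat yq :: complex vec)"
  have yC: "yC \<in> carrier_vec c" using yq(1) by (simp add: yC_def)
  have bC: "(AC\<^sup>T *\<^sub>v yC) $ j = of_rat (bq j)" if "j < n" for j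
    unfolding AC_def yC_def bq_def by (rule row_comb_of_rat[OF A(1) yq(1) that])
  have lin: "(AC\<^sup>T *\<^sub>v (lv - b' j0 \<cdot>\<^sub>v yC)) $ j = b' j - b' j0 * of_rat (bq j)" if j: "j < n" for j
  proof -
    have d: "lv - b' j0 \<cdot>\<^sub>v yC \<in> carrier_vec c" using lv(1) yC by simp
    show ?thesis
      unfolding bC[OF j, symmetric] b'_def[of j] row_comb_index[OF AC d j] row_comb_index[OF AC lv(1) j] row_comb_index[OF AC yC j]
        sum_distrib_left sum_subtractf[symmetric]
      by (rule sum.cong) (use lv(1) yC in \<open>auto simp: algebra_simps\<close>)
  qed
  have "lv - b' j0 \<cdot>\<^sub>v yC = 0\<^sub>v c"
  proof (rule plucker_solve(2)[OF AC I ACn[OF I]])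
    show "lv - b' j0 \<cdot>\<^sub>v yC \<in> carrier_vec c" using lv(1) yC by simp
    fix i assume i: "i \<in> I"
    then have "i < n" using I by (auto simp: plucker_indices_def)
    moreover have "bq i = (if i = j0 then 1 else 0)" using yq(2)[OF i] by (simp add: bq_def)
    moreover have "b' i = 0" if "i \<noteq> j0" using i that by (auto simp: I_def N_def)
    ultimately show "(AC\<^sup>T *\<^sub>v (lv - b' j0 \<cdot>\<^sub>v yC)) $ i = 0" by (auto simp: lin)
  qed
  then have bb: "b' j = b' j0 * of_rat (bq j)" if "j < n" for j
    using lin[OF that] AC that by simp
  \<comment> \<open>Multiplication by \<open>u\<close> makes the limits of the coefficients real, so
    that the signs of the imaginary parts become those of \<open>bq\<close>.\<close>
  obtain u where u: "\<And>F. tends F (\<lambda>_. u) (inverse (b' j0))" using tends_const by blast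
  have lim: "tends L' (\<lambda>m. u * (Y j m * Z j m)) (of_rat (bq j) * z j)" if j: "j < n" for j
  proof -
    have "tends L' (\<lambda>m. u * (Y j m * Z j m)) (inverse (b' j0) * (b' j * z j))"
      using j by (intro tends_mult u Y Z') auto
    also have "inverse (b' j0) * (b' j * z j) = of_rat (bq j) * z j"
      using j0n(3) by (simp add: bb[OF j])
    finally show ?thesis .
  qed
  have Imq: "Im (of_rat q * x) = of_rat q * Im x" for q x
  proof -
    have "(of_rat q :: complex) = of_real (of_rat q)"
      by (cases q) (simp add: Fract_of_int_quotient of_rat_divide)
    then show ?thesis by simp
  qed
  have L's: "L' \<le> sequentially" using L'(1) L(1) by (rule order_trans)
  have ev: "eventually (\<lambda>m. of_rat (bq j) * im (T (w j) m * (u * (Y j m * Z j m))) > 0) L'" if j: "j \<in> J" for j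
  proof -
    have jn: "j < n" and bj: "bq j \<noteq> 0" using j bb[of j] by (auto simp: J_def)
    show ?thesis
    proof (cases "bq j > 0")
      case True
      then have "Im (of_rat (bq j) * z j) > 0" unfolding Imq using z[OF jn] True by simp
      from im_pos[OF L's lim[OF jn] this] show ?thesis
        by (rule eventually_mono) (use True in \<open>auto intro: mult_pos_pos\<close>)
    next
      case False
      then have neg: "bq j < 0" using bj by simp
      then have "Im (- (of_rat (bq j) * z j)) > 0"
        unfolding uminus_complex.sel Imq using z[OF jn] neg by (simp add: mult_neg_pos)
      from im_pos[OF L's tends_uminus[OF lim[OF jn]] this] show ?thesis
        by (rule eventually_mono) (use neg in \<open>auto simp: im_uminus intro: mult_neg_neg\<close>)
    qed
  qed
  have "eventually (\<lambda>m. good m \<and> (\<forall>j\<in>J. of_rat (bq j) * im (T (w j) m * (u * (Y j m * Z j m))) > 0)) L'"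
    using good' NJ(3) ev by (intro eventually_conj eventually_ball_finite) auto
  from eventually_happens'[OF L'(2) this] obtain m where m: "good m"
    "\<forall>j\<in>J. of_rat (bq j) * im (T (w j) m * (u * (Y j m * Z j m))) > 0" by blast
  define x where "x = u \<cdot>\<^sub>v xs m"
  have xX: "x \<in> X" unfolding x_def by (rule homogeneous_variety_scale[OF X(1) xsX[OF m(1)]])
  have xc: "x \<in> carrier_vec n" using xs(1) by (simp add: x_def)
  have xj: "x $ j = T (w j) m * (u * (Y j m * Z j m))" if "j < n" for j
    using xs(1)[of m] xs(2)[OF that, of m] that by (simp add: x_def ac_simps)
  have sgn: "of_rat (bq j) * map_vec im x $ j > 0" if "j \<in> J" for j
    using m(2) that xc by (auto simp: J_def xj)
  have "\<exists>L\<in>positive_grassmannian c n. map_vec im x \<in> L"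
  proof (rule sign_pattern_in_positive_subspace[OF A I _ yq(1)])
    show "N \<subseteq> I" by (auto simp: I_def)
    show "(A\<^sup>T *\<^sub>v yq) $ k = 0" if "k \<in> N" for k using yq(2)[of k] that j0n by (auto simp: I_def)
    show "map_vec im x \<in> carrier_vec n" using xc by simp
    fix j assume "j < n" "j \<notin> N"
    then have "j \<in> J" by (simp add: J_def N_def)
    then show "of_rat ((A\<^sup>T *\<^sub>v yq) $ j) * map_vec im x $ j > 0" using sgn by (simp add: bq_def)
    show "(A\<^sup>T *\<^sub>v yq) $ j \<noteq> 0" using bb[OF \<open>j < n\<close>] \<open>j \<in> J\<close> by (auto simp: bq_def J_def)
  qed
  then obtain M where M: "M \<in> positive_grassmannian c n" "map_vec im x \<in> M" by blast
  have "map_vec im x $ j0 \<noteq> 0\<^sub>v n $ j0" using sgn[OF j0] j0n(1) by auto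
  then have "map_vec im x \<noteq> 0\<^sub>v n" by metis
  then show False using hyp[OF xX M(1)] M(2) by blast
qed

end

section \<open>Vandermonde matrices and positivity at rational points\<close>

lemma poly_eq_lead_times_linear:
  fixes p :: "'a::field poly"
  assumes deg: "degree p \<le> m" and inj: "inj_on x {..<m}" and roots: "\<And>i. i < m \<Longrightarrow> poly p (x i) = 0"
  shows "p = Polynomial.smult (coeff p m) (\<Prod>i<m. [:- x i, 1:])"
proof -
  let ?q = "\<Prod>i<m. [:- x i, 1:]"
  have dq: "degree ?q = m" by (subst degree_prod_eq_sum_degree) auto
  have lq: "coeff ?q m = 1" using lead_coeff_prod[of "\<lambda>i. [:- x i, 1:]" "{..<m}"] dq by simp
  define r where "r = p - Polynomial.smult (coeff p m) ?q"
  have "coeff r k = 0" if "k \<ge> m" for k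
  proof (cases "k = m")
    case True
    then show ?thesis using lq by (simp add: r_def)
  next
    case False
    then show ?thesis using that deg dq by (simp add: r_def coeff_eq_0)
  qed
  then have dr: "r = 0 \<or> degree r < m" by (metis degree_lessI)
  have rr: "poly r (x i) = 0" if "i < m" for i
    using roots[OF that] that by (auto simp: r_def poly_prod prod_zero_iff)
  have "r = 0"
  proof (rule ccontr)
    assume nz: "r \<noteq> 0"
    have "m = card (x ` {..<m})" using inj by (simp add: card_image)
    also have "\<dots> \<le> card {t. poly r t = 0}"
      using rr by (intro card_mono poly_roots_finite[OF nz]) auto
    also have "\<dots> \<le> degree r" by (rule card_poly_roots_bound[OF nz])
    finally show False using dr nz by simp
  qed
  then show ?thesis by (simp add: r_def)
qed

text \<open>As a function of the last node the determinant is a polynomial of degree at most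
  \<open>c\<close> that vanishes at the other nodes; its coefficient at degree \<open>c\<close> is
  the smaller determinant.\<close>

lemma vandermonde_det_pos:
  fixes x :: "nat \<Rightarrow> 'a::linordered_field"
  assumes "\<And>i j. i < j \<Longrightarrow> j < c \<Longrightarrow> x i < x j"
  shows "Determinant.det (mat c c (\<lambda>(r, k). x k ^ r)) > 0"
  using assms
proof (induction c)
  case 0
  then show ?case by simp
next
  case (Suc c)
  let ?M = "\<lambda>t. mat (Suc c) (Suc c) (\<lambda>(r, k). (if k = c then t else x k) ^ r)"
  let ?C = "\<lambda>r. cofactor (?M 0) r c"
  have cof: "cofactor (?M t) r c = ?C r" if "r < Suc c" for t r
  proof -
    have "mat_delete (?M t) r c = mat_delete (?M 0) r c"
      by (rule eq_matI) (auto simp: mat_delete_def)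
    then show ?thesis by (simp add: cofactor_def)
  qed
  define p where "p = (\<Sum>r<Suc c. Polynomial.monom (?C r) r)"
  have p: "poly p t = Determinant.det (?M t)" for t
  proof -
    have "Determinant.det (?M t) = (\<Sum>r<Suc c. ?M t $$ (r, c) * cofactor (?M t) r c)"
      by (rule laplace_expansion_column) auto
    also have "\<dots> = (\<Sum>r<Suc c. t ^ r * ?C r)"
    proof (rule sum.cong)
      fix r assume r: "r \<in> {..<Suc c}"
      then have "?M t $$ (r, c) = t ^ r" by simp
      then show "?M t $$ (r, c) * cofactor (?M t) r c = t ^ r * ?C r" using cof[of r t] r by simp
    qed simp
    finally show ?thesis by (simp add: p_def poly_sum poly_monom mult.commute)
  qed
  have deg: "degree p \<le> c"
    unfolding p_def by (rule degree_sum_le) (auto intro: order_trans[OF degree_monom_le])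
  have "coeff p c = ?C c" by (simp add: p_def coeff_sum)
  also have "\<dots> = Determinant.det (mat c c (\<lambda>(r, k). x k ^ r))"
  proof -
    have "mat_delete (?M 0) c c = mat c c (\<lambda>(r, k). x k ^ r)"
      by (rule eq_matI) (auto simp: mat_delete_def)
    then show ?thesis by (simp add: cofactor_def)
  qed
  finally have lead: "coeff p c > 0" using Suc.IH Suc.prems by simp
  have "inj_on x {..<c}"
  proof (rule inj_onI)
    fix i j assume "i \<in> {..<c}" "j \<in> {..<c}" "x i = x j"
    then show "i = j" using Suc.prems[of i j] Suc.prems[of j i] by (cases i j rule: linorder_cases) auto
  qed
  moreover have "poly p (x i) = 0" if i: "i < c" for i
    unfolding p by (rule det_identical_columns[of _ "Suc c" i c]) (use i in \<open>auto intro!: eq_vecI\<close>)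
  ultimately have "p = Polynomial.smult (coeff p c) (\<Prod>i<c. [:- x i, 1:])"
    by (intro poly_eq_lead_times_linear deg) auto
  then have "poly p (x c) = poly (Polynomial.smult (coeff p c) (\<Prod>i<c. [:- x i, 1:])) (x c)" by simp
  also have "\<dots> = coeff p c * (\<Prod>i<c. x c - x i)" by (simp add: poly_prod)
  also have "\<dots> > 0" using lead Suc.prems by (intro mult_pos_pos prod_pos) auto
  also have "poly p (x c) = Determinant.det (mat (Suc c) (Suc c) (\<lambda>(r, k). x k ^ r))"
    unfolding p by (intro arg_cong[of _ _ Determinant.det] eq_matI) auto
  finally show ?case .
qed

text \<open>Continuity of polynomials by Horner's scheme, in terms of the order alone.\<close>

lemma poly_lipschitz:
  fixes q :: "'a::linordered_field poly"
  shows "\<exists>C\<ge>0. \<forall>h. \<bar>h\<bar> \<le> 1 \<longrightarrow> \<bar>poly q (t + h) - poly q t\<bar> \<le> C * \<bar>h\<bar>"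
proof (induction q)
  case 0
  then show ?case by (intro exI[of _ 0]) simp
next
  case (pCons a q)
  then obtain C where C: "C \<ge> 0" "\<And>h. \<bar>h\<bar> \<le> 1 \<Longrightarrow> \<bar>poly q (t + h) - poly q t\<bar> \<le> C * \<bar>h\<bar>" by blast
  show ?case
  proof (intro exI[of _ "(\<bar>t\<bar> + 1) * C + \<bar>poly q t\<bar>"] conjI allI impI)
    show "0 \<le> (\<bar>t\<bar> + 1) * C + \<bar>poly q t\<bar>" using C(1) by simp
    fix h :: 'a assume h: "\<bar>h\<bar> \<le> 1"
    have "poly (pCons a q) (t + h) - poly (pCons a q) t
        = (t + h) * (poly q (t + h) - poly q t) + h * poly q t" by (simp add: algebra_simps)
    also have "\<bar>\<dots>\<bar> \<le> \<bar>t + h\<bar> * \<bar>poly q (t + h) - poly q t\<bar> + \<bar>h\<bar> * \<bar>poly q t\<bar>"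
      using abs_triangle_ineq[of "(t + h) * (poly q (t + h) - poly q t)" "h * poly q t"]
      by (simp add: abs_mult)
    also have "\<dots> \<le> (\<bar>t\<bar> + 1) * (C * \<bar>h\<bar>) + \<bar>h\<bar> * \<bar>poly q t\<bar>"
      using C(2)[OF h] abs_triangle_ineq[of t h] h by (intro add_mono mult_mono) auto
    finally show "\<bar>poly (pCons a q) (t + h) - poly (pCons a q) t\<bar> \<le> ((\<bar>t\<bar> + 1) * C + \<bar>poly q t\<bar>) * \<bar>h\<bar>"
      by (simp add: algebra_simps)
  qed
qed

lemma poly_pos_near:
  fixes q :: "'a::linordered_field poly"
  assumes "poly q t > 0"
  shows "\<exists>\<epsilon>>0. \<forall>h. \<bar>h\<bar> < \<epsilon> \<longrightarrow> poly q (t + h) > 0"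
proof -
  obtain C where C: "C \<ge> 0" "\<And>h. \<bar>h\<bar> \<le> 1 \<Longrightarrow> \<bar>poly q (t + h) - poly q t\<bar> \<le> C * \<bar>h\<bar>"
    using poly_lipschitz[of q t] by blast
  show ?thesis
  proof (intro exI[of _ "min 1 (poly q t / (C + 1))"] conjI allI impI)
    show "0 < min 1 (poly q t / (C + 1))" using assms C(1) by simp
    fix h assume h: "\<bar>h\<bar> < min 1 (poly q t / (C + 1))"
    then have "\<bar>h\<bar> * (C + 1) < poly q t" using C(1) by (simp add: pos_less_divide_eq)
    moreover have "C * \<bar>h\<bar> \<le> \<bar>h\<bar> * (C + 1)" by (simp add: algebra_simps)
    ultimately have "\<bar>poly q (t + h) - poly q t\<bar> < poly q t" using C(2)[of h] h by linarith
    then show "poly q (t + h) > 0" by linarith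
  qed
qed

lemma poly_pos_near_family:
  fixes q :: "'i \<Rightarrow> 'a::linordered_field poly"
  assumes "finite I" "\<And>i. i \<in> I \<Longrightarrow> poly (q i) t > 0"
  shows "\<exists>\<epsilon>>0. \<forall>h. \<bar>h\<bar> < \<epsilon> \<longrightarrow> (\<forall>i\<in>I. poly (q i) (t + h) > 0)"
  using assms
proof (induction I rule: finite_induct)
  case empty
  then show ?case by (intro exI[of _ 1]) auto
next
  case (insert i I)
  then obtain e where e: "e > 0" "\<forall>h. \<bar>h\<bar> < e \<longrightarrow> (\<forall>i\<in>I. poly (q i) (t + h) > 0)" by auto
  obtain d where d: "d > 0" "\<forall>h. \<bar>h\<bar> < d \<longrightarrow> poly (q i) (t + h) > 0"
    using poly_pos_near insert.prems by blast
  show ?case by (intro exI[of _ "min e d"]) (use e d in auto)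
qed

lemma line_polynomial_coordinate:
  assumes "line_polynomial f"
  obtains p where "\<And>t. f (x(i := t)) = poly p t"
proof -
  obtain p where p: "\<And>t. f (\<lambda>j. (x(i := 0)) j + t * (if j = i then 1 else 0)) = poly p t"
    using assms unfolding line_polynomial_def by meson
  have "(\<lambda>j. (x(i := 0)) j + t * (if j = i then 1 else 0)) = x(i := t)" for t by auto
  then show thesis using that p by metis
qed

text \<open>
  A polynomial that does not vanish identically has a nonzero value at a rational point of any
  nonempty open set: the coordinates are changed to rational ones, one at a time.
\<close>

lemma rational_nonzero_point:
  fixes h :: "('i \<Rightarrow> 'k::field_char_0) \<Rightarrow> 'k" and m :: "'l \<Rightarrow> ('i \<Rightarrow> rat) \<Rightarrow> rat"
  assumes h: "line_polynomial h" "h f0 \<noteq> 0" and fin: "finite S" "finite L"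
    and m: "\<And>l. l \<in> L \<Longrightarrow> line_polynomial (m l)" "\<And>l. l \<in> L \<Longrightarrow> m l g0 > 0"
  shows "\<exists>g. (\<forall>l\<in>L. m l g > 0) \<and> h (\<lambda>p. if p \<in> S then of_rat (g p) else f0 p) \<noteq> 0"
  using fin(1)
proof (induction S rule: finite_induct)
  case empty
  then show ?case using h(2) m(2) by (intro exI[of _ g0]) auto
next
  case (insert p S)
  then obtain g where g: "\<forall>l\<in>L. m l g > 0" "h (\<lambda>p. if p \<in> S then of_rat (g p) else f0 p) \<noteq> 0" by blast
  define f where "f = (\<lambda>p. if p \<in> S then of_rat (g p) else f0 p)"
  obtain P where P: "\<And>t. h (f(p := t)) = poly P t" using line_polynomial_coordinate[OF h(1)] by metis
  have "h f \<noteq> 0" using g(2) unfolding f_def .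
  then have "poly P (f p) \<noteq> 0" using P[of "f p"] by simp
  then have "P \<noteq> 0" by auto
  then have finP: "finite {t. poly P t = 0}" by (rule poly_roots_finite)
  have "\<forall>l\<in>L. \<exists>q. \<forall>t. m l (g(p := t)) = poly q t"
    using line_polynomial_coordinate[OF m(1)] by metis
  then obtain q where q: "\<And>l t. l \<in> L \<Longrightarrow> m l (g(p := t)) = poly (q l) t" by metis
  have "poly (q l) (g p) > 0" if "l \<in> L" for l using q[OF that, of "g p"] g(1) that by (metis fun_upd_triv)
  then obtain \<epsilon> where \<epsilon>: "\<epsilon> > 0" "\<forall>h. \<bar>h\<bar> < \<epsilon> \<longrightarrow> (\<forall>l\<in>L. poly (q l) (g p + h) > 0)"
    using poly_pos_near_family[OF fin(2), of q "g p"] by blast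
  have inj: "inj (of_rat :: rat \<Rightarrow> 'k)" by (rule injI) simp
  \<comment> \<open>Small shifts keep all \<open>m l\<close> positive, and only finitely many of
    them lead to roots of \<open>P\<close>.\<close>
  have "infinite {0<..<\<epsilon>}" using \<epsilon>(1) by (rule infinite_Ioo)
  moreover have "finite ((\<lambda>h. of_rat (g p + h)) -` {t :: 'k. poly P t = 0})"
  proof (rule finite_vimageI[OF finP])
    show "inj (\<lambda>h. of_rat (g p + h) :: 'k)" by (rule injI) simp
  qed
  ultimately have "infinite ({0<..<\<epsilon>} - (\<lambda>h. of_rat (g p + h)) -` {t :: 'k. poly P t = 0})" by (rule Diff_infinite_finite[rotated])
  then have "{0<..<\<epsilon>} - (\<lambda>h. of_rat (g p + h)) -` {t :: 'k. poly P t = 0} \<noteq> {}" by (metis finite.emptyI)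
  then have "\<exists>d. 0 < d \<and> d < \<epsilon> \<and> poly P (of_rat (g p + d)) \<noteq> 0"
    by (simp only: ex_in_conv[symmetric] Diff_iff vimage_eq mem_Collect_eq greaterThanLessThan_iff conj_assoc)
  then obtain d where d: "0 < d" "d < \<epsilon>" "poly P (of_rat (g p + d)) \<noteq> 0" by blast
  let ?g = "g(p := g p + d)"
  have "\<forall>l\<in>L. m l ?g > 0" using q \<epsilon>(2) d by simp
  moreover have "(\<lambda>p'. if p' \<in> insert p S then of_rat (?g p') else f0 p') = f(p := of_rat (g p + d))"
    using insert.hyps(2) by (auto simp: f_def)
  then have "h (\<lambda>p'. if p' \<in> insert p S then of_rat (?g p') else f0 p') \<noteq> 0" using P d(3) by simp
  ultimately show ?case by blast
qed

lemma line_polynomial_plucker: "line_polynomial (\<lambda>f. plucker_coord (mat c n f) I)"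
proof (cases "card {j. j < n \<and> j \<in> I} = c")
  case True
  have sub: "submatrix (mat c n f) UNIV I = mat c c (\<lambda>(i, j). f (i, pick I j))" for f :: "nat \<times> nat \<Rightarrow> 'a"
    using True pick_le[of _ n I] by (intro eq_matI) (auto simp: submatrix_def pick_UNIV)
  have "plucker_coord (mat c n f) I = (\<Sum>p | p permutes {0..<c}. signof p * (\<Prod>i = 0..<c. f (i, pick I (p i))))"
    for f :: "nat \<times> nat \<Rightarrow> 'a"
    unfolding plucker_coord_def sub
  proof (subst det_def'[of _ c])
    show "(\<Sum>p | p permutes {0..<c}. signof p * (\<Prod>i = 0..<c. mat c c (\<lambda>(i, j). f (i, pick I j)) $$ (i, p i)))
      = (\<Sum>p | p permutes {0..<c}. signof p * (\<Prod>i = 0..<c. f (i, pick I (p i))))"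
    proof (intro sum.cong refl arg_cong2[of _ _ _ _ "(*)"] prod.cong)
      fix p i assume "p \<in> {p. p permutes {0..<c}}" "i \<in> {0..<c}"
      then show "mat c c (\<lambda>(i, j). f (i, pick I j)) $$ (i, p i) = f (i, pick I (p i))"
        using permutes_in_image[of p "{0..<c}" i] by auto
    qed
  qed auto
  then show ?thesis
    by (simp only:) (intro line_polynomial_sum line_polynomial_mult line_polynomial_const
        line_polynomial_prod line_polynomial_coord)
next
  case False
  \<comment> \<open>A submatrix that is not square has determinant 0 by definition.\<close>
  have "plucker_coord (mat c n f) I = 0" for f :: "nat \<times> nat \<Rightarrow> 'a"
    unfolding plucker_coord_def Determinant.det_def using False by (auto simp: submatrix_def)
  then show ?thesis by (simp only: line_polynomial_const)
qed

text \<open>The rational matrices with positive maximal minors form an open set that contains a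
  Vandermonde matrix. By the witnesses \<open>B\<close> and \<open>C\<close> neither
  \<open>G\<close> nor \<open>H\<close> vanishes at all matrices, hence neither does their
  product.\<close>

lemma ex_positive_generic_matrix:
  fixes G H :: "(nat set, 'k::field_char_0) mpoly"
  assumes B: "B \<in> carrier_mat c n" "poly_eval (plucker_coord B) G \<noteq> 0"
    and C: "C \<in> carrier_mat c n" "poly_eval (plucker_coord C) H \<noteq> 0"
  obtains A :: "rat mat" where "A \<in> carrier_mat c n" "\<And>I. I \<in> plucker_indices c n \<Longrightarrow> plucker_coord A I > 0"
    "poly_eval (plucker_coord (map_mat of_rat A)) G \<noteq> 0" "poly_eval (plucker_coord (map_mat of_rat A)) H \<noteq> 0"
proof -
  define ev where "ev F f = poly_eval (plucker_coord (mat c n f)) F" for F :: "(nat set, 'k) mpoly" and f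
  have lp: "line_polynomial (ev F)" for F
    unfolding ev_def by (intro line_polynomial_poly_eval line_polynomial_plucker)
  have ex: "mat c n (\<lambda>p. D $$ p) = D" if "D \<in> carrier_mat c n" for D :: "'k mat"
    using that by (intro eq_matI) auto
  obtain f0 where f0: "ev G f0 \<noteq> 0" "ev H f0 \<noteq> 0"
    using line_polynomial_common_nonzero[of "ev G" "ev H" "\<lambda>p. B $$ p" "\<lambda>p. C $$ p", OF lp lp]
      B C by (auto simp: ev_def ex)
  define V where "V = (\<lambda>(r, j). rat_of_nat j ^ r)"
  have Vpos: "plucker_coord (mat c n V) I > 0" if I: "I \<in> plucker_indices c n" for I
  proof -
    have "mat c c (\<lambda>(r, k). mat c n V $$ (r, pick I k)) = mat c c (\<lambda>(r, k). rat_of_nat (pick I k) ^ r)"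
      using plucker_indices_pick(2)[OF I] by (intro eq_matI) (auto simp: V_def)
    then have "plucker_coord (mat c n V) I = Determinant.det (mat c c (\<lambda>(r, k). rat_of_nat (pick I k) ^ r))"
      by (simp add: plucker_coord_eq_col_det[OF _ I] col_det_def)
    also have "\<dots> > 0"
    proof (rule vandermonde_det_pos)
      fix i j assume "i < j" "j < c"
      then show "rat_of_nat (pick I i) < rat_of_nat (pick I j)"
        using pick_mono_le[of j I i] I by (simp add: plucker_indices_def)
    qed
    finally show ?thesis .
  qed
  have fin: "finite (plucker_indices c n)"
    by (rule finite_subset[of _ "Pow {..<n}"]) (auto simp: plucker_indices_def)
  have "\<exists>g. (\<forall>I\<in>plucker_indices c n. plucker_coord (mat c n g) I > 0) \<and>
     ev G (\<lambda>p. if p \<in> {..<c} \<times> {..<n} then of_rat (g p) else f0 p) *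
     ev H (\<lambda>p. if p \<in> {..<c} \<times> {..<n} then of_rat (g p) else f0 p) \<noteq> 0"
  proof (rule rational_nonzero_point[where m = "\<lambda>I g. plucker_coord (mat c n g) I" and ?g0.0 = V
        and ?f0.0 = f0 and h = "\<lambda>f. ev G f * ev H f"])
    show "line_polynomial (\<lambda>f. ev G f * ev H f)" by (intro line_polynomial_mult lp)
    show "ev G f0 * ev H f0 \<noteq> 0" using f0 by simp
  qed (use fin Vpos line_polynomial_plucker in auto)
  then obtain g where g: "\<forall>I\<in>plucker_indices c n. plucker_coord (mat c n g) I > 0"
    "ev G (\<lambda>p. if p \<in> {..<c} \<times> {..<n} then of_rat (g p) else f0 p) *
     ev H (\<lambda>p. if p \<in> {..<c} \<times> {..<n} then of_rat (g p) else f0 p) \<noteq> 0" by blast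
  have "mat c n (\<lambda>p. if p \<in> {..<c} \<times> {..<n} then of_rat (g p) else f0 p) = map_mat of_rat (mat c n g)"
    by (rule eq_matI) auto
  then show thesis
    using that[of "mat c n g"] g by (auto simp: ev_def)
qed

section \<open>Weights and edges of the Chow polytope\<close>

lemma lookup_real_exponent [simp]: "lookup (real_exponent \<alpha>) i = real (lookup \<alpha> i)"
  by (simp add: real_exponent_def Poly_Mapping.map.rep_eq when_def)

lemma keys_real_exponent [simp]: "keys (real_exponent \<alpha>) = keys \<alpha>"
  by (auto simp: in_keys_iff)

lemma real_exponent_inject [simp]: "real_exponent \<alpha> = real_exponent \<beta> \<longleftrightarrow> \<alpha> = \<beta>"
proof
  assume "real_exponent \<alpha> = real_exponent \<beta>"
  then have "lookup (real_exponent \<alpha>) i = lookup (real_exponent \<beta>) i" for i by simp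
  then show "\<alpha> = \<beta>" by (intro poly_mapping_eqI) simp
qed simp

lemma lookup_scaleR [simp]: "lookup (r *\<^sub>R x) i = r *\<^sub>R lookup x i"
proof -
  have "finite {i. r *\<^sub>R lookup x i \<noteq> 0}"
    by (rule finite_subset[OF _ finite_lookup[of x]]) auto
  then show ?thesis by (simp add: scaleR_poly_mapping_def Abs_poly_mapping_inverse)
qed

lemma weight_map_superset:
  assumes "finite A" "keys x \<subseteq> A"
  shows "weight_map x = (\<Sum>I\<in>A. lookup x I *\<^sub>R (\<Sum>i\<in>I. single i 1))"
  unfolding weight_map_def using assms by (intro sum.mono_neutral_left) (auto simp: in_keys_iff)

lemma linear_weight_map: "linear weight_map"
proof (rule linearI)
  fix x y :: "nat set \<Rightarrow>\<^sub>0 real" and r :: real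
  let ?A = "keys x \<union> keys y"
  have k: "keys (x + y) \<subseteq> ?A" "keys x \<subseteq> ?A" "keys y \<subseteq> ?A" "keys (r *\<^sub>R x) \<subseteq> ?A"
    by (auto simp: in_keys_iff lookup_add)
  have fin: "finite ?A" by simp
  show "weight_map (x + y) = weight_map x + weight_map y"
    unfolding k[THEN weight_map_superset[OF fin]] by (simp add: lookup_add scaleR_add_left sum.distrib)
  show "weight_map (r *\<^sub>R x) = r *\<^sub>R weight_map x"
    unfolding k[THEN weight_map_superset[OF fin]] by (simp add: scaleR_sum_right)
qed

text \<open>The multidegree of a Pluecker monomial under scaling of the columns; the integral form
  of \<open>weight_map\<close> on exponents.\<close>

definition weight :: "(nat set \<Rightarrow>\<^sub>0 nat) \<Rightarrow> (nat \<Rightarrow>\<^sub>0 nat)" where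
  "weight \<alpha> = (\<Sum>I\<in>keys \<alpha>. \<Sum>i\<in>I. single i (lookup \<alpha> I))"

lemma weight_map_real_exponent: "weight_map (real_exponent \<alpha>) = real_exponent (weight \<alpha>)"
proof (rule poly_mapping_eqI)
  fix i
  show "lookup (weight_map (real_exponent \<alpha>)) i = lookup (real_exponent (weight \<alpha>)) i"
    unfolding weight_map_def weight_def lookup_real_exponent lookup_sum keys_real_exponent of_nat_sum
      lookup_scaleR real_scaleR_def sum_distrib_left
    by (intro sum.cong refl) (simp add: lookup_single when_def)
qed

context
  fixes n c :: nat and \<alpha> :: "nat set \<Rightarrow>\<^sub>0 nat"
  assumes k: "keys \<alpha> \<subseteq> plucker_indices c n"
begin

lemma lookup_weight: "lookup (weight \<alpha>) i = (\<Sum>I\<in>keys \<alpha>. if i \<in> I then lookup \<alpha> I else 0)"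
  unfolding weight_def lookup_sum
proof (rule sum.cong[OF refl])
  fix I assume "I \<in> keys \<alpha>"
  then have "finite I" using k by (auto simp: plucker_indices_def intro: finite_subset)
  then show "(\<Sum>j\<in>I. lookup (single j (lookup \<alpha> I)) i) = (if i \<in> I then lookup \<alpha> I else 0)"
    by (simp add: lookup_single when_def)
qed

lemma keys_weight: "keys (weight \<alpha>) \<subseteq> {..<n}"
proof
  fix i assume "i \<in> keys (weight \<alpha>)"
  then have "(\<Sum>I\<in>keys \<alpha>. if i \<in> I then lookup \<alpha> I else 0) \<noteq> 0"
    unfolding in_keys_iff lookup_weight .
  then obtain I where "I \<in> keys \<alpha>" "i \<in> I" by (metis (mono_tags, lifting) sum.neutral)
  then show "i \<in> {..<n}" using k by (auto simp: plucker_indices_def)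
qed

text \<open>Each Pluecker coordinate involves \<open>c\<close> columns. So the weights of a
  homogeneous form lie in one hyperplane, which makes edge directions have sum 0.\<close>

lemma sum_lookup_weight: "(\<Sum>i<n. lookup (weight \<alpha>) i) = c * (\<Sum>I\<in>keys \<alpha>. lookup \<alpha> I)"
proof -
  have "(\<Sum>i<n. if i \<in> I then lookup \<alpha> I else 0) = c * lookup \<alpha> I" if "I \<in> keys \<alpha>" for I
  proof -
    have I: "I \<subseteq> {..<n}" "card I = c" using that k by (auto simp: plucker_indices_def)
    then have "(\<Sum>i<n. if i \<in> I then lookup \<alpha> I else 0) = (\<Sum>i\<in>I. lookup \<alpha> I)"
      by (intro sum.mono_neutral_cong_right) auto
    then show ?thesis using I by simp
  qed
  then show ?thesis
    unfolding lookup_weight sum_distrib_left by (subst sum.swap) (rule sum.cong, auto)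
qed

lemma monom_eval_scale_cols:
  assumes A: "A \<in> carrier_mat c n"
  shows "monom_eval (plucker_coord (scale_cols A z)) \<alpha> =
    monom_eval (plucker_coord A) \<alpha> * (\<Prod>i<n. z i ^ lookup (weight \<alpha>) i)"
proof -
  have "(\<Prod>i<n. z i ^ (if i \<in> I then lookup \<alpha> I else 0)) = (\<Prod>i\<in>I. z i) ^ lookup \<alpha> I"
    if "I \<in> keys \<alpha>" for I
  proof -
    have I: "I \<subseteq> {..<n}" using that k by (auto simp: plucker_indices_def)
    then have "(\<Prod>i<n. z i ^ (if i \<in> I then lookup \<alpha> I else 0)) = (\<Prod>i\<in>I. z i ^ lookup \<alpha> I)"
      by (intro prod.mono_neutral_cong_right) auto
    then show ?thesis by (simp only: prod_power_distrib)
  qed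
  then have "(\<Prod>i<n. z i ^ lookup (weight \<alpha>) i) = (\<Prod>I\<in>keys \<alpha>. (\<Prod>i\<in>I. z i) ^ lookup \<alpha> I)"
    unfolding lookup_weight power_sum by (subst prod.swap) (rule prod.cong, auto)
  moreover have "plucker_coord (scale_cols A z) I = plucker_coord A I * (\<Prod>i\<in>I. z i)" if "I \<in> keys \<alpha>" for I
    using plucker_scale_cols[OF A] k that by blast
  ultimately show ?thesis
    unfolding monom_eval_def by (simp add: power_mult_distrib prod.distrib)
qed

end

lemma poly_eval_weight_component:
  "poly_eval v (weight_component (real_exponent \<beta>) F) =
    (\<Sum>\<alpha> | \<alpha> \<in> keys F \<and> weight \<alpha> = \<beta>. lookup F \<alpha> * monom_eval v \<alpha>)"
  unfolding weight_component_def weight_map_real_exponent real_exponent_inject poly_eval_sum poly_eval_single ..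

lemma weight_component_nonzero:
  assumes "\<alpha> \<in> keys F"
  shows "weight_component (real_exponent (weight \<alpha>)) F \<noteq> 0"
proof
  assume "weight_component (real_exponent (weight \<alpha>)) F = 0"
  moreover have "lookup (weight_component (real_exponent (weight \<alpha>)) F) \<alpha> =
      (\<Sum>\<gamma> | \<gamma> \<in> keys F \<and> weight \<gamma> = weight \<alpha>. if \<gamma> = \<alpha> then lookup F \<gamma> else 0)"
    unfolding weight_component_def weight_map_real_exponent real_exponent_inject lookup_sum
    by (simp add: lookup_single when_def)
  moreover have "\<dots> = lookup F \<alpha>" using assms by simp
  ultimately show False using assms by (simp add: in_keys_iff)
qed

text \<open>Unless the weight of \<open>x i\<close> is 1, the sum lies between \<open>x i\<close>
  and the weighted mean \<open>y\<close> of the other points, and a face containing an inner point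
  of a segment contains its ends.\<close>

lemma face_of_convex_sum:
  assumes S: "convex S" and T: "T face_of S" and fin: "finite I"
    and u: "\<And>i. i \<in> I \<Longrightarrow> u i \<ge> 0" "sum u I = 1" and x: "\<And>i. i \<in> I \<Longrightarrow> x i \<in> S"
    and sum: "(\<Sum>i\<in>I. u i *\<^sub>R x i) \<in> T" and i: "i \<in> I" "u i > 0"
  shows "x i \<in> T"
proof -
  have split: "sum u I = u i + sum u (I - {i})" "(\<Sum>i\<in>I. u i *\<^sub>R x i) = u i *\<^sub>R x i + (\<Sum>i\<in>I - {i}. u i *\<^sub>R x i)"
    using fin i(1) by (simp_all add: sum.remove)
  show ?thesis
  proof (cases "u i = 1")
    case True
    then have "sum u (I - {i}) = 0" using split u by simp
    then have "u j = 0" if "j \<in> I - {i}" for j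
      using sum_nonneg_eq_0_iff[of "I - {i}" u] u(1) fin that by auto
    then have "(\<Sum>i\<in>I - {i}. u i *\<^sub>R x i) = 0" by (intro sum.neutral) auto
    then show ?thesis using split sum True by simp
  next
    case False
    define r where "r = 1 - u i"
    have "sum u (I - {i}) \<ge> 0" using u(1) by (intro sum_nonneg) auto
    then have r: "r > 0" "sum u (I - {i}) = r" using False split u(2) by (auto simp: r_def)
    define y where "y = (\<Sum>j\<in>I - {i}. (u j / r) *\<^sub>R x j)"
    have y: "y \<in> S" unfolding y_def
      by (rule convex_sum[OF _ S]) (use fin r u(1) x in \<open>auto simp: sum_divide_distrib[symmetric]\<close>)
    have ry: "r *\<^sub>R y = (\<Sum>i\<in>I - {i}. u i *\<^sub>R x i)"
      using r(1) by (simp add: y_def scaleR_sum_right)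
    have c: "(1 - r) *\<^sub>R x i + r *\<^sub>R y \<in> T" using sum split ry by (simp add: r_def)
    show ?thesis
    proof (cases "x i = y")
      case True
      have "(1 - r) *\<^sub>R y + r *\<^sub>R y = y" by (simp add: scaleR_add_left[symmetric])
      then show ?thesis using c True by simp
    next
      case False
      then have "(1 - r) *\<^sub>R x i + r *\<^sub>R y \<in> open_segment (x i) y"
        unfolding in_segment(2) using r(1) i(2) by (intro conjI exI[of _ r]) (auto simp: r_def)
      then show ?thesis using face_ofD[OF T _ x[OF i(1)] y c] by blast
    qed
  qed
qed

text \<open>If \<open>x\<close> lay beyond an end of the segment, that end would be an inner point
  of the segment from \<open>x\<close> to the other end, so \<open>x\<close> would belong to the
  face.\<close>

lemma face_of_segment_line:
  assumes T: "closed_segment a b face_of S" and ab: "a \<noteq> b"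
    and x: "x \<in> S" "x = a + \<mu> *\<^sub>R (b - a)"
  shows "x \<in> closed_segment a b"
proof -
  have S: "a \<in> S" "b \<in> S" using face_of_imp_subset[OF T] by auto
  consider "\<mu> < 0" | "0 \<le> \<mu>" "\<mu> \<le> 1" | "\<mu> > 1" by linarith
  then show ?thesis
  proof cases
    case 1
    have "1 / (1 - \<mu>) * \<mu> = 1 / (1 - \<mu>) - 1" using 1 by (simp add: field_simps)
    then have "(1 / (1 - \<mu>)) *\<^sub>R x = (1 / (1 - \<mu>)) *\<^sub>R a + (1 / (1 - \<mu>) - 1) *\<^sub>R (b - a)"
      unfolding x(2) scaleR_add_right scaleR_scaleR by (simp only:)
    then have "a = (1 - 1 / (1 - \<mu>)) *\<^sub>R b + (1 / (1 - \<mu>)) *\<^sub>R x"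
      by (simp add: algebra_simps)
    moreover have "b \<noteq> x"
    proof
      assume "b = x"
      then have "(1 - \<mu>) *\<^sub>R (b - a) = 0" using x(2) by (simp add: algebra_simps)
      then show False using 1 ab by simp
    qed
    ultimately have "a \<in> open_segment b x"
      unfolding in_segment(2) using 1 by (intro conjI exI[of _ "1 / (1 - \<mu>)"]) auto
    then show ?thesis using face_ofD[OF T _ S(2) x(1)] by auto
  next
    case 2
    then show ?thesis unfolding in_segment(1) x(2) by (intro exI[of _ \<mu>]) (simp add: algebra_simps)
  next
    case 3
    have "b = (1 - 1 / \<mu>) *\<^sub>R a + (1 / \<mu>) *\<^sub>R x"
    proof -
      have "\<mu> *\<^sub>R b = \<mu> *\<^sub>R ((1 - 1 / \<mu>) *\<^sub>R a + (1 / \<mu>) *\<^sub>R x)"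
        using 3 by (simp add: x(2) algebra_simps)
      then show ?thesis using 3 by simp
    qed
    moreover have "a \<noteq> x" using x(2) 3 ab by auto
    ultimately have "b \<in> open_segment a x"
      unfolding in_segment(2) using 3 by (intro conjI exI[of _ "1 / \<mu>"]) auto
    then show ?thesis using face_ofD[OF T _ S(1) x(1)] by auto
  qed
qed

lemma extreme_point_of_closed_segment: "a extreme_point_of closed_segment a b"
proof (cases "a = b")
  case False
  show ?thesis unfolding extreme_point_of_def
  proof (intro conjI ballI notI)
    fix x y assume "x \<in> closed_segment a b" "y \<in> closed_segment a b" and o: "a \<in> open_segment x y"
    then obtain p q where p: "x = (1 - p) *\<^sub>R a + p *\<^sub>R b" "0 \<le> p" and q: "y = (1 - q) *\<^sub>R a + q *\<^sub>R b" "0 \<le> q"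
      by (auto simp: in_segment(1))
    obtain t where t: "x \<noteq> y" "0 < t" "t < 1" "a = (1 - t) *\<^sub>R x + t *\<^sub>R y" using o by (auto simp: in_segment(2))
    have "((1 - t) * p + t * q) *\<^sub>R (b - a) = 0" using t(4) unfolding p q by (simp add: algebra_simps)
    then have "(1 - t) * p + t * q = 0" using False by simp
    then have "p = 0" "q = 0" using t p(2) q(2) by (auto simp: add_nonneg_eq_0_iff)
    then show False using p q t(1) by simp
  qed simp
qed simp

text \<open>Among the integer vectors that are positive multiples of \<open>d\<close>,
  \<open>v\<close> has the least sum of absolute values. If \<open>\<nu>\<close> were not an
  integer, subtracting \<open>\<lfloor>\<nu>\<rfloor>\<close> times \<open>v\<close> would leave a
  shorter one.\<close>

lemma ex_primitive_direction:
  fixes d :: "nat \<Rightarrow> int"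
  assumes "i < n" "d i \<noteq> 0"
  obtains v :: "nat \<Rightarrow> int" and \<mu> :: real where "\<mu> > 0" "\<And>i. i < n \<Longrightarrow> of_int (d i) = \<mu> * of_int (v i)"
    "\<And>u \<nu>. \<nu> \<ge> 0 \<Longrightarrow> \<forall>i<n. of_int (u i) = \<nu> * real_of_int (v i) \<Longrightarrow> \<exists>k. \<nu> = real k"
proof -
  define norm where "norm u = nat (\<Sum>i<n. \<bar>u i\<bar>)" for u :: "nat \<Rightarrow> int"
  define D where "D u \<longleftrightarrow> (\<exists>\<mu>>0. \<forall>i<n. of_int (u i) = \<mu> * real_of_int (d i))" for u
  have "D d" by (auto simp: D_def intro: exI[of _ 1])
  then obtain v where v: "D v" "\<And>u. D u \<Longrightarrow> norm v \<le> norm u"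
    using ex_has_least_nat[of D d norm] by blast
  then obtain \<mu> where \<mu>: "\<mu> > 0" "\<forall>i<n. of_int (v i) = \<mu> * real_of_int (d i)" by (auto simp: D_def)
  show thesis
  proof (rule that[of "1 / \<mu>" v])
    fix u :: "nat \<Rightarrow> int" and \<nu> :: real assume \<nu>: "\<nu> \<ge> 0" and u: "\<forall>i<n. of_int (u i) = \<nu> * real_of_int (v i)"
    define f where "f = \<nu> - of_int \<lfloor>\<nu>\<rfloor>"
    have f: "0 \<le> f" "f < 1" by (auto simp: f_def) linarith
    have w: "of_int (u i - \<lfloor>\<nu>\<rfloor> * v i) = f * real_of_int (v i)" if "i < n" for i
      using u that by (simp add: f_def algebra_simps)
    have "f = 0"
    proof (rule ccontr)
      assume "f \<noteq> 0"
      then have f0: "f > 0" using f by simp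
      have "D (\<lambda>i. u i - \<lfloor>\<nu>\<rfloor> * v i)"
        unfolding D_def using f0 \<mu> w by (intro exI[of _ "f * \<mu>"]) auto
      then have "norm v \<le> norm (\<lambda>i. u i - \<lfloor>\<nu>\<rfloor> * v i)" by (rule v(2))
      then have "(\<Sum>i<n. \<bar>v i\<bar>) \<le> (\<Sum>i<n. \<bar>u i - \<lfloor>\<nu>\<rfloor> * v i\<bar>)"
        by (simp add: norm_def nat_le_eq_zle sum_nonneg)
      then have "real_of_int (\<Sum>i<n. \<bar>v i\<bar>) \<le> real_of_int (\<Sum>i<n. \<bar>u i - \<lfloor>\<nu>\<rfloor> * v i\<bar>)"
        by (simp only: of_int_le_iff)
      also have "\<dots> = (\<Sum>i<n. \<bar>real_of_int (u i - \<lfloor>\<nu>\<rfloor> * v i)\<bar>)" by simp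
      also have "\<dots> = (\<Sum>i<n. f * \<bar>of_int (v i)\<bar>)"
        by (rule sum.cong) (simp_all only: w lessThan_iff abs_mult abs_of_pos[OF f0])
      also have "\<dots> = f * of_int (\<Sum>i<n. \<bar>v i\<bar>)" by (simp add: sum_distrib_left)
      finally have "(1 - f) * real_of_int (\<Sum>i<n. \<bar>v i\<bar>) \<le> 0" by (simp add: algebra_simps)
      moreover have "(\<Sum>i<n. \<bar>v i\<bar>) > 0"
      proof -
        have "real_of_int (v i) \<noteq> 0" using \<mu> assms by simp
        then show ?thesis using assms(1) by (intro sum_pos2[of _ i]) auto
      qed
      then have "(1 - f) * real_of_int (\<Sum>i<n. \<bar>v i\<bar>) > 0"
        using f by (intro mult_pos_pos) (auto simp del: of_int_sum)
      ultimately show False by linarith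
    qed
    then show "\<exists>k. \<nu> = real k" using \<nu> by (intro exI[of _ "nat \<lfloor>\<nu>\<rfloor>"]) (simp add: f_def)
  qed (use \<mu> in \<open>auto simp: field_simps\<close>)
qed

text \<open>Sum 0 forces a positive and a negative entry, and the bound 2 leaves room only for 1 and
  -1.\<close>

lemma root_direction:
  fixes v :: "nat \<Rightarrow> int"
  assumes sum: "(\<Sum>i<n. v i) = 0" and abs: "(\<Sum>i<n. \<bar>v i\<bar>) \<le> 2" and nz: "l < n" "v l \<noteq> 0"
  obtains i j where "i < n" "j < n" "\<And>k. k < n \<Longrightarrow> v k = (if k = i then 1 else 0) - (if k = j then 1 else 0)"
proof -
  have "\<exists>i<n. v i > 0"
  proof (rule ccontr)
    assume "\<not> ?thesis"
    then have "\<And>i. i < n \<Longrightarrow> - v i \<ge> 0" by auto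
    moreover have "(\<Sum>i<n. - v i) = 0" using sum by (simp add: sum_negf)
    ultimately have "\<forall>i\<in>{..<n}. - v i = 0" by (subst (asm) sum_nonneg_eq_0_iff) auto
    then show False using nz by auto
  qed
  then obtain i where i: "i < n" "v i > 0" by blast
  have "\<exists>j<n. v j < 0"
  proof (rule ccontr)
    assume "\<not> ?thesis"
    then have "\<And>i. i < n \<Longrightarrow> v i \<ge> 0" by force
    then have "\<forall>i\<in>{..<n}. v i = 0" using sum by (subst (asm) sum_nonneg_eq_0_iff) auto
    then show False using nz by auto
  qed
  then obtain j where j: "j < n" "v j < 0" by blast
  have ij: "i \<noteq> j" using i j by auto
  have "(\<Sum>i<n. \<bar>v i\<bar>) = \<bar>v i\<bar> + (\<bar>v j\<bar> + (\<Sum>k\<in>{..<n} - {i} - {j}. \<bar>v k\<bar>))"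
    using i j ij by (subst sum.remove[of _ i], simp, simp, subst sum.remove[of _ j]) auto
  moreover have "(\<Sum>k\<in>{..<n} - {i} - {j}. \<bar>v k\<bar>) \<ge> 0" by (rule sum_nonneg) simp
  ultimately have v: "v i = 1" "v j = -1" "(\<Sum>k\<in>{..<n} - {i} - {j}. \<bar>v k\<bar>) = 0"
    using abs i j by linarith+
  then have "\<forall>k\<in>{..<n} - {i} - {j}. \<bar>v k\<bar> = 0" by (subst (asm) sum_nonneg_eq_0_iff) auto
  then show thesis using v ij i j by (intro that[of i j]) auto
qed

text \<open>Gordan's theorem is applied to the exponents off the edge, modulo the edge direction.
  Its other alternative would be a convex combination of exponents off the edge that lies on the
  line of the edge, impossible for a face. The functional is rational because it will supply
  exponents of \<open>T\<close>.\<close>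

lemma edge_functional:
  fixes W :: "(nat \<Rightarrow>\<^sub>0 nat) set"
  assumes fin: "finite W" and W: "\<And>\<alpha>. \<alpha> \<in> W \<Longrightarrow> keys \<alpha> \<subseteq> {..<n}"
    and face: "closed_segment (real_exponent a) (real_exponent b) face_of convex hull (real_exponent ` W)"
    and ab: "a \<in> W" "b \<in> W" "a \<noteq> b"
  obtains w where "dot n w (\<lambda>i. of_nat (lookup b i) - of_nat (lookup a i)) = 0"
    "\<And>\<alpha>. \<alpha> \<in> W \<Longrightarrow> real_exponent \<alpha> \<notin> closed_segment (real_exponent a) (real_exponent b) \<Longrightarrow>
      dot n w (\<lambda>i. of_nat (lookup \<alpha> i) - of_nat (lookup a i)) > (0 :: rat)"
proof -
  let ?seg = "closed_segment (real_exponent a) (real_exponent b)"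
  define D :: "(nat \<Rightarrow>\<^sub>0 nat) \<Rightarrow> nat \<Rightarrow> rat" where "D \<alpha> i = of_nat (lookup \<alpha> i) - of_nat (lookup a i)" for \<alpha> i
  have zero: "lookup \<alpha> i = 0" if "\<alpha> \<in> W" "\<not> i < n" for \<alpha> i
    using W[OF that(1)] that(2) by (meson in_keys_iff lessThan_iff subsetD)
  obtain i0 where "lookup a i0 \<noteq> lookup b i0" using ab(3) by (metis poly_mapping_eqI)
  then have i0: "i0 < n" "D b i0 \<noteq> 0" using zero ab by (metis, simp add: D_def)
  \<comment> \<open>Subtracting this multiple of the edge vector clears the coordinate
    \<open>i0\<close> and gives a representative modulo the edge direction.\<close>
  define \<kappa> where "\<kappa> \<alpha> = D \<alpha> i0 / D b i0" for \<alpha>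
  define Off where "Off = {\<alpha> \<in> W. real_exponent \<alpha> \<notin> ?seg}"
  have "finite Off" using fin by (simp add: Off_def)
  from gordan[OF this, of n "\<lambda>\<alpha> i. D \<alpha> i - \<kappa> \<alpha> * D b i"]
  consider (functional) w where "\<forall>\<alpha>\<in>Off. dot n w (\<lambda>i. D \<alpha> i - \<kappa> \<alpha> * D b i) > 0"
    | (dependency) l where "\<forall>\<alpha>\<in>Off. l \<alpha> \<ge> 0" "\<exists>\<alpha>\<in>Off. l \<alpha> > 0"
      "\<forall>i<n. (\<Sum>\<alpha>\<in>Off. l \<alpha> * (D \<alpha> i - \<kappa> \<alpha> * D b i)) = 0" by blast
  then show thesis
  proof cases
    case functional
    \<comment> \<open>The correction in the coordinate \<open>i0\<close> makes the functional vanish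
      on the edge direction; on the representatives, which are 0 there, it changes nothing.\<close>
    define w' where "w' i = w i - (if i = i0 then dot n w (D b) / D b i0 else 0)" for i
    have w': "dot n w' y = dot n w y - dot n w (D b) / D b i0 * y i0" for y
    proof -
      have "dot n w' y = (\<Sum>i<n. w i * y i - (if i = i0 then dot n w (D b) / D b i0 * y i0 else 0))"
        unfolding dot_def[of n w'] w'_def by (rule sum.cong) (auto simp: left_diff_distrib)
      then show ?thesis using i0(1) by (simp add: sum_subtractf dot_def[of n w y])
    qed
    show thesis
    proof (rule that[of w'])
      show "dot n w' (\<lambda>i. of_nat (lookup b i) - of_nat (lookup a i)) = 0"
        unfolding D_def[symmetric] w' using i0 by simp
      fix \<alpha> assume "\<alpha> \<in> W" "real_exponent \<alpha> \<notin> ?seg"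
      then have "dot n w (\<lambda>i. D \<alpha> i - \<kappa> \<alpha> * D b i) > 0" using functional by (simp add: Off_def)
      then show "dot n w' (\<lambda>i. of_nat (lookup \<alpha> i) - of_nat (lookup a i)) > 0"
        unfolding D_def[symmetric] w' dot_diff dot_scale \<kappa>_def by (simp add: mult.commute)
    qed
  next
    case dependency
    have finOff: "finite Off" by fact
    define S where "S = sum l Off"
    have S: "S > 0" using dependency(1,2) finOff unfolding S_def by (metis sum_pos2)
    define u where "u \<alpha> = l \<alpha> / S" for \<alpha>
    have u: "\<alpha> \<in> Off \<Longrightarrow> u \<alpha> \<ge> 0" "sum u Off = 1" for \<alpha>
      using dependency(1) S by (auto simp: u_def S_def sum_divide_distrib[symmetric])
    \<comment> \<open>The normalized dependency is a convex combination of exponents off the edge;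
      it is the point with parameter \<open>\<mu>\<close> on the line from \<open>a\<close> to
      \<open>b\<close>.\<close>
    define \<mu> where "\<mu> = (\<Sum>\<alpha>\<in>Off. u \<alpha> * \<kappa> \<alpha>)"
    have eq: "(\<Sum>\<alpha>\<in>Off. u \<alpha> * of_nat (lookup \<alpha> i)) = of_nat (lookup a i) + \<mu> * D b i" if "i < n" for i
    proof -
      have "(\<Sum>\<alpha>\<in>Off. u \<alpha> * (D \<alpha> i - \<kappa> \<alpha> * D b i)) = (\<Sum>\<alpha>\<in>Off. l \<alpha> * (D \<alpha> i - \<kappa> \<alpha> * D b i)) / S"
        unfolding sum_divide_distrib by (rule sum.cong) (auto simp: u_def)
      also have "\<dots> = 0" using dependency(3) that by simp
      finally have "(\<Sum>\<alpha>\<in>Off. u \<alpha> * of_nat (lookup \<alpha> i) - u \<alpha> * of_nat (lookup a i) - u \<alpha> * \<kappa> \<alpha> * D b i) = 0"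
        by (simp add: D_def[of _ i] right_diff_distrib mult.assoc)
      then show ?thesis
        unfolding sum_subtractf sum_distrib_right[symmetric] u(2) \<mu>_def by simp
    qed
    define x where "x = (\<Sum>\<alpha>\<in>Off. real_of_rat (u \<alpha>) *\<^sub>R real_exponent \<alpha>)"
    have ru: "sum (\<lambda>\<alpha>. real_of_rat (u \<alpha>)) Off = 1"
      using arg_cong[OF u(2), of real_of_rat] by (simp add: of_rat_sum)
    have sub: "\<alpha> \<in> Off \<Longrightarrow> real_exponent \<alpha> \<in> convex hull (real_exponent ` W)" for \<alpha>
      by (intro hull_inc) (auto simp: Off_def)
    have "x \<in> convex hull (real_exponent ` W)" unfolding x_def
      by (rule convex_sum[OF finOff convex_convex_hull ru]) (use u(1) sub in auto)
    moreover have "x = real_exponent a + real_of_rat \<mu> *\<^sub>R (real_exponent b - real_exponent a)"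
    proof (rule poly_mapping_eqI)
      fix i
      have x: "lookup x i = real_of_rat (\<Sum>\<alpha>\<in>Off. u \<alpha> * of_nat (lookup \<alpha> i))"
        by (simp add: x_def lookup_sum of_rat_sum of_rat_mult)
      show "lookup x i = lookup (real_exponent a + real_of_rat \<mu> *\<^sub>R (real_exponent b - real_exponent a)) i"
      proof (cases "i < n")
        case True
        then show ?thesis unfolding x eq[OF True] D_def
          by (simp add: lookup_add lookup_minus of_rat_add of_rat_mult of_rat_diff)
      next
        case False
        then have "(\<Sum>\<alpha>\<in>Off. u \<alpha> * of_nat (lookup \<alpha> i)) = 0"
          by (intro sum.neutral) (auto simp: zero Off_def)
        then show ?thesis unfolding x using zero[OF ab(1) False] zero[OF ab(2) False]
          by (simp add: lookup_add lookup_minus)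
      qed
    qed
    ultimately have "x \<in> ?seg" using ab(3) by (intro face_of_segment_line[OF face]) auto
    obtain \<alpha> where \<alpha>: "\<alpha> \<in> Off" "l \<alpha> > 0" using dependency(2) by blast
    have "real_exponent \<alpha> \<in> ?seg"
      by (rule face_of_convex_sum[OF convex_convex_hull face finOff _ ru sub])
        (use \<open>x \<in> ?seg\<close> \<alpha> u(1) S in \<open>auto simp: x_def u_def[of \<alpha>]\<close>)
    then show thesis using \<alpha>(1) by (simp add: Off_def)
  qed
qed

section \<open>Edge directions of the Chow polytope\<close>

context valued_limits
begin

text \<open>The Chow polytope is the convex hull of the weights of the Chow form. On the torus orbit
  of a positive matrix \<open>A\<close> the form becomes a polynomial with such weights as
  exponents, and \<open>weight_reduced\<close> permits a choice of \<open>A\<close> for which the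
  coefficients at both ends of a given edge are nonzero.\<close>

lemma generalized_permutohedron_chow_polytope:
  assumes X: "homogeneous_variety n X" "positively_hyperbolic im n c X" and P: "is_chow_polytope n c X P"
  shows "generalized_permutohedron n P"
proof -
  obtain F where F: "is_chow_form n c X F" and red: "weight_reduced n c F"
    and P: "P = weight_map ` newton_polytope F"
    using P by (auto simp: is_chow_polytope_def)
  have kF: "keys \<alpha> \<subseteq> plucker_indices c n" if "\<alpha> \<in> keys F" for \<alpha>
    using F that by (auto simp: is_chow_form_def polys_in_def)
  obtain h where h: "\<And>\<alpha>. \<alpha> \<in> keys F \<Longrightarrow> (\<Sum>I\<in>keys \<alpha>. lookup \<alpha> I) = h"
    using F by (auto simp: is_chow_form_def homogeneous_poly_def)
  define W where "W = weight ` keys F"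
  have finW: "finite W" by (simp add: W_def)
  have kW: "keys \<beta> \<subseteq> {..<n}" if "\<beta> \<in> W" for \<beta>
    using that keys_weight[OF kF] by (auto simp: W_def)
  have sW: "(\<Sum>i<n. lookup \<beta> i) = c * h" if "\<beta> \<in> W" for \<beta>
    using that sum_lookup_weight[OF kF] h by (auto simp: W_def)
  have PW: "P = convex hull (real_exponent ` W)"
    unfolding P newton_polytope_def convex_hull_linear_image[OF linear_weight_map] W_def
      image_image weight_map_real_exponent ..
  show ?thesis unfolding generalized_permutohedron_def
  proof (intro conjI ballI allI impI)
    show "polytope P" unfolding polytope_def PW using finW by blast
    fix x assume x: "x \<in> P"
    have "convex {x :: nat \<Rightarrow>\<^sub>0 real. keys x \<subseteq> {..<n}}"
    proof (rule convexI)
      fix x y :: "nat \<Rightarrow>\<^sub>0 real" and u v :: real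
      assume "x \<in> {x. keys x \<subseteq> {..<n}}" "y \<in> {x. keys x \<subseteq> {..<n}}"
      moreover have "keys (u *\<^sub>R x + v *\<^sub>R y) \<subseteq> keys x \<union> keys y" by (auto simp: in_keys_iff lookup_add)
      ultimately show "u *\<^sub>R x + v *\<^sub>R y \<in> {x. keys x \<subseteq> {..<n}}" by auto
    qed
    moreover have "real_exponent ` W \<subseteq> {x. keys x \<subseteq> {..<n}}" using kW by fastforce
    ultimately have "P \<subseteq> {x. keys x \<subseteq> {..<n}}" unfolding PW by (intro hull_minimal)
    then show "keys x \<subseteq> {..<n}" using x by blast
  next
    fix a' b' assume e: "a' \<noteq> b' \<and> closed_segment a' b' face_of P"
    then have "a' \<in> real_exponent ` W" "b' \<in> real_exponent ` W"
      using extreme_point_of_closed_segment[of a' b'] extreme_point_of_closed_segment[of b' a']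
      unfolding PW closed_segment_commute[of b' a']
      by (meson extreme_point_of_convex_hull extreme_point_of_face)+
    then obtain a b where ab: "a \<in> W" "b \<in> W" and a': "a' = real_exponent a" and b': "b' = real_exponent b" by blast
    have ne: "a \<noteq> b" and face: "closed_segment (real_exponent a) (real_exponent b) face_of convex hull (real_exponent ` W)"
      using e unfolding a' b' PW by auto
    let ?seg = "closed_segment (real_exponent a) (real_exponent b)"
    have zero: "lookup \<alpha> i = 0" if "\<alpha> \<in> W" "\<not> i < n" for \<alpha> i
      using kW[OF that(1)] that(2) by (meson in_keys_iff lessThan_iff subsetD)
    obtain i0 where i0: "lookup a i0 \<noteq> lookup b i0" using ne by (metis poly_mapping_eqI)
    then have i0n: "i0 < n" using zero ab by metis
    \<comment> \<open>For c = 0 all weights are zero, so there is no edge.\<close>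
    have c: "c > 0"
    proof (rule ccontr)
      assume "\<not> c > 0"
      then have "(\<Sum>i<n. lookup a i) = 0" "(\<Sum>i<n. lookup b i) = 0" using sW ab by auto
      then show False using i0 i0n by simp
    qed
    define d where "d i = int (lookup b i) - int (lookup a i)" for i
    have "d i0 \<noteq> 0" using i0 by (simp add: d_def)
    \<comment> \<open>Primitivity of \<open>v\<close> will place the exponents on the edge at
      natural multiples of \<open>v\<close> from \<open>a\<close>.\<close>
    obtain v \<mu> where \<mu>: "\<mu> > 0" and v: "\<And>i. i < n \<Longrightarrow> of_int (d i) = \<mu> * real_of_int (v i)"
      and prim: "\<And>u \<nu>. \<nu> \<ge> 0 \<Longrightarrow> \<forall>i<n. of_int (u i) = \<nu> * real_of_int (v i) \<Longrightarrow> \<exists>k. \<nu> = real k"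
      by (rule ex_primitive_direction[where d = d, OF i0n \<open>d i0 \<noteq> 0\<close>]) (rule that)
    have "(\<Sum>i<n. d i) = 0"
    proof -
      have "(\<Sum>i<n. d i) = int (\<Sum>i<n. lookup b i) - int (\<Sum>i<n. lookup a i)"
        by (simp add: d_def sum_subtractf)
      then show ?thesis using sW ab by simp
    qed
    then have "\<mu> * of_int (\<Sum>i<n. v i) = 0"
      using v by (metis (no_types, lifting) lessThan_iff of_int_0 of_int_sum sum.cong sum_distrib_left)
    then have sv: "(\<Sum>i<n. v i) = 0" using \<mu> by (metis less_irrefl mult_eq_0_iff of_int_eq_0_iff)
    have vi0: "v i0 \<noteq> 0" using v[OF i0n] \<open>d i0 \<noteq> 0\<close> by auto
    show "\<exists>i<n. \<exists>j<n. \<exists>t. b' - a' = t *\<^sub>R (single i 1 - single j 1)"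
    proof (cases "(\<Sum>i<n. \<bar>v i\<bar>) \<le> 2")
      case True
      obtain i j where ij: "i < n" "j < n"
        "\<And>k. k < n \<Longrightarrow> v k = (if k = i then 1 else 0) - (if k = j then 1 else 0)"
        by (rule root_direction[OF sv True i0n vi0]) (rule that)
      have "b' - a' = \<mu> *\<^sub>R (single i 1 - single j 1)"
      proof (rule poly_mapping_eqI)
        fix k
        show "lookup (b' - a') k = lookup (\<mu> *\<^sub>R (single i 1 - single j 1)) k"
        proof (cases "k < n")
          case True
          have "lookup (b' - a') k = of_int (d k)" by (simp add: a' b' lookup_minus d_def)
          then show ?thesis using v[OF True] ij(3)[OF True] by (simp add: lookup_minus lookup_single when_def)
        next
          case False
          then show ?thesis using ij(1,2) zero[OF ab(1) False] zero[OF ab(2) False]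
            by (simp add: a' b' lookup_minus lookup_single when_def)
        qed
      qed
      then show ?thesis using ij by blast
    next
      case False
      have ex: "\<exists>C\<in>carrier_mat c n. poly_eval (plucker_coord C) (weight_component (real_exponent \<beta>) F) \<noteq> 0"
        if "\<beta> \<in> W" for \<beta>
      proof -
        have "\<not> vanishes_on n c (grassmannian c n) (weight_component (real_exponent \<beta>) F)"
          using red that weight_component_nonzero by (auto simp: W_def weight_reduced_def)
        then show ?thesis by (auto simp: vanishes_on_def full_rank_mats_def)
      qed
      obtain B C where "B \<in> carrier_mat c n" "poly_eval (plucker_coord B) (weight_component (real_exponent a) F) \<noteq> 0"
        "C \<in> carrier_mat c n" "poly_eval (plucker_coord C) (weight_component (real_exponent b) F) \<noteq> 0"
        using ex ab by blast
      then obtain A :: "rat mat" where A: "A \<in> carrier_mat c n" "\<And>I. I \<in> plucker_indices c n \<Longrightarrow> plucker_coord A I > 0"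
        "poly_eval (plucker_coord (map_mat of_rat A)) (weight_component (real_exponent a) F) \<noteq> 0"
        "poly_eval (plucker_coord (map_mat of_rat A)) (weight_component (real_exponent b) F) \<noteq> 0"
        by (rule ex_positive_generic_matrix) (rule that)
      define \<phi> where "\<phi> \<beta> = poly_eval (plucker_coord (map_mat of_rat A)) (weight_component (real_exponent \<beta>) F)" for \<beta>
      \<comment> \<open>Weights whose component vanishes at \<open>A\<close> drop out; the two ends
        of the edge remain.\<close>
      define Q where "Q = {\<beta> \<in> W. \<phi> \<beta> \<noteq> 0}"
      define E where "E = {\<beta> \<in> Q. real_exponent \<beta> \<in> ?seg}"
      have AK: "map_mat of_rat A \<in> carrier_mat c n" using A(1) by simp
      have F_eval: "poly_eval (plucker_coord (scale_cols (map_mat of_rat A) z)) F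
          = (\<Sum>\<beta>\<in>Q. \<phi> \<beta> * (\<Prod>i<n. z i ^ lookup \<beta> i))" for z
      proof -
        let ?p = "plucker_coord (map_mat of_rat A)"
        have "poly_eval (plucker_coord (scale_cols (map_mat of_rat A) z)) F
            = (\<Sum>\<alpha>\<in>keys F. lookup F \<alpha> * monom_eval ?p \<alpha> * (\<Prod>i<n. z i ^ lookup (weight \<alpha>) i))"
          unfolding poly_eval_alt
          by (rule sum.cong) (simp_all only: monom_eval_scale_cols[OF kF AK] mult.assoc)
        also have "\<dots> = (\<Sum>\<beta>\<in>W. \<Sum>\<alpha> | \<alpha> \<in> keys F \<and> weight \<alpha> = \<beta>.
            lookup F \<alpha> * monom_eval ?p \<alpha> * (\<Prod>i<n. z i ^ lookup (weight \<alpha>) i))"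
          unfolding W_def by (rule sum.image_gen) simp
        also have "\<dots> = (\<Sum>\<beta>\<in>W. \<phi> \<beta> * (\<Prod>i<n. z i ^ lookup \<beta> i))"
          unfolding \<phi>_def poly_eval_weight_component sum_distrib_right by (intro sum.cong) auto
        also have "\<dots> = (\<Sum>\<beta>\<in>Q. \<phi> \<beta> * (\<Prod>i<n. z i ^ lookup \<beta> i))"
          using finW by (intro sum.mono_neutral_right) (auto simp: Q_def)
        finally show ?thesis .
      qed
      have "\<exists>k. \<forall>i<n. int (lookup \<alpha> i) = int (lookup a i) + int k * v i" if "\<alpha> \<in> E" for \<alpha>
      proof -
        have "real_exponent \<alpha> \<in> ?seg" using that by (simp add: E_def)
        then obtain u where u: "0 \<le> u" "real_exponent \<alpha> = (1 - u) *\<^sub>R real_exponent a + u *\<^sub>R real_exponent b"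
          by (auto simp: in_segment(1))
        have "real (lookup \<alpha> i) = (1 - u) * real (lookup a i) + u * real (lookup b i)" for i
          using arg_cong[OF u(2), of "\<lambda>x. lookup x i"] by (simp add: lookup_add)
        then have "real_of_int (int (lookup \<alpha> i) - int (lookup a i)) = u * of_int (d i)" for i
          by (simp add: d_def algebra_simps)
        then have *: "real_of_int (int (lookup \<alpha> i) - int (lookup a i)) = (u * \<mu>) * of_int (v i)" if "i < n" for i
          using v[OF that] by simp
        then obtain k where "u * \<mu> = real k"
          using prim[of "u * \<mu>" "\<lambda>i. int (lookup \<alpha> i) - int (lookup a i)"] u(1) \<mu> by auto
        then have "real_of_int (int (lookup \<alpha> i) - int (lookup a i)) = real_of_int (int k * v i)" if "i < n" for i
          using *[OF that] by simp
        then have "int (lookup \<alpha> i) - int (lookup a i) = int k * v i" if "i < n" for i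
          using that by (simp only: of_int_eq_iff)
        then show ?thesis by (intro exI[of _ k]) force
      qed
      then obtain kk where kk: "\<And>\<alpha> i. \<alpha> \<in> E \<Longrightarrow> i < n \<Longrightarrow> int (lookup \<alpha> i) = int (lookup a i) + int (kk \<alpha>) * v i"
        by metis
      obtain w where w: "dot n w (\<lambda>i. of_nat (lookup b i) - of_nat (lookup a i)) = 0"
        "\<And>\<alpha>. \<alpha> \<in> W \<Longrightarrow> real_exponent \<alpha> \<notin> ?seg \<Longrightarrow> dot n w (\<lambda>i. of_nat (lookup \<alpha> i) - of_nat (lookup a i)) > (0 :: rat)"
        by (rule edge_functional[OF finW kW face ab ne]) (assumption, rule that)
      have E: "a \<in> E" "b \<in> E" using ab A(3,4) by (auto simp: E_def Q_def \<phi>_def)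
      have db: "d i = int (kk b) * v i" if "i < n" for i using kk[OF E(2) that] by (simp add: d_def)
      then have kb: "kk b \<noteq> 0" using i0n \<open>d i0 \<noteq> 0\<close> by auto
      have "dot n w (\<lambda>i. of_nat (lookup b i) - of_nat (lookup a i)) = dot n w (\<lambda>i. of_nat (kk b) * of_int (v i))"
        unfolding dot_def
      proof (rule sum.cong[OF refl], rule arg_cong2[of _ _ _ _ "(*)", OF refl])
        fix i assume "i \<in> {..<n}"
        then have "rat_of_int (d i) = of_int (int (kk b) * v i)" using db by simp
        then show "of_nat (lookup b i) - of_nat (lookup a i) = of_nat (kk b) * rat_of_int (v i)" by (simp add: d_def)
      qed
      then have wv: "dot n w (\<lambda>i. of_int (v i)) = 0" using w(1) kb by (simp add: dot_scale)
      have False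
      proof (rule no_edge[OF X F c A(1,2) F_eval])
        show "finite Q" "E \<subseteq> Q" using finW by (auto simp: Q_def E_def)
        show "\<phi> \<alpha> \<noteq> 0" "keys \<alpha> \<subseteq> {..<n}" if "\<alpha> \<in> Q" for \<alpha>
          using that kW[of \<alpha>] by (simp_all add: Q_def)
        show "dot n w (\<lambda>i. exponent \<alpha> i - exponent a i) > 0" if "\<alpha> \<in> Q - E" for \<alpha>
          using that by (intro w(2)) (auto simp: Q_def E_def)
        show "2 < (\<Sum>i<n. \<bar>v i\<bar>)" using False by simp
        show "b \<noteq> a" using ne by simp
      qed (assumption | fact E sv wv kk)+
      then show ?thesis ..
    qed
  qed
qed

end

theorem theorem4p12:
  shows "(\<forall>n c (X :: complex vec set) P.
            homogeneous_variety n X \<and> positively_hyperbolic Im n c X \<and> is_chow_polytope n c X P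
            \<longrightarrow> generalized_permutohedron n P) \<and>
         (\<forall>n c (X :: complex puiseux vec set) P.
            homogeneous_variety n X \<and> positively_hyperbolic puiseux_Im n c X \<and> is_chow_polytope n c X P
            \<longrightarrow> generalized_permutohedron n P)"
  using complex_limits.generalized_permutohedron_chow_polytope
    puiseux_limits.generalized_permutohedron_chow_polytope
  by blast

end
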